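(* Let $k$ be a commutative ring with unit and let $\mathcal{C}$ be a category formed by an amalgam of groups $G_1,\dots,G_N$ and a finite poset with $N$ elements. For the category algebra $k[\mathcal{C}]$ there is an isomorphism of $k$-modules $$HH^*(k[\mathcal{C}];\,k[\mathcal{C}])\;\simeq\;H^*(B\mathcal{C})\oplus\Big(\sum_{i=1}^N HH^*(k[G_i];\,k[G_i])/H^*(BG_i)\Big),$$ where $H^*(BG_i)$ is identified with $H^*(AP(k[G_i]^{\otimes *}))$. Moreover, $H^*(B\mathcal{C})$ is a subalgebra of $HH^*(k[\mathcal{C}];\,k[\mathcal{C}])$, realized by the $E_\infty$-subalgebra of autopoietic Hochschild cochains.
   Context: All (singular/simplicial) cohomology has coefficients in $k$, and the sum over $i$ is a direct sum. Amalgam of groups and a poset: let $P$ be a finite poset (no cycles) of cardinality $N$ with partial order $\preccurlyeq$, and for each $i\in P$ let $G_i$ be a discrete group (trivial, finite or infinite) with identity $e_{ii}$. The category $\mathcal{C}$ has object set $P$; for $i\ne j$, $\mathrm{Mor}(i,j)=\{e_{ij}\}$ if $i\preccurlyeq j$ and $\emptyset$ if $i\not\preccurlyeq j$; and $\mathrm{Mor}(i,i)=G_i$. Composition, written left to right, is the group law in each $G_i$, $e_{ij}e_{jl}=e_{il}$, and $ge_{ij}=e_{ij}$ for $g\in G_i$, $e_{ij}h=e_{ij}$ for $h\in G_j$ ($i\ne j$). The category algebra $k[\mathcal{C}]$ is the free $k$-module on the morphisms of $\mathcal{C}$ with product given by composition, or $0$ for non-composable morphisms. $B\mathcal{C}$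 is the classifying space (geometric realization of the nerve $B_*(\mathcal{C})$), and $BG_i$ that of $G_i$. Hochschild cohomology: for a unital $k$-algebra $A$, $HH^*(A;A)$ is the cohomology of $(\mathrm{Hom}_k(A^{\otimes *},A),\delta)$, where $$(\delta f)(a_1\otimes\cdots\otimes a_{n+1})=a_1f(a_2\otimes\cdots\otimes a_{n+1})+\sum_{j=1}^n(-1)^jf(a_1\otimes\cdots\otimes a_ja_{j+1}\otimes\cdots\otimes a_{n+1})+(-1)^{n+1}f(a_1\otimes\cdots\otimes a_n)a_{n+1}$$ and $(\delta f)(a_1)=a_1f(1)-f(1)a_1$ for $n=0$. Its product is the Gerstenhaber product $(f\underset{G}{\cdot}g)(a_1\otimes\cdots\otimes a_{p+q})=f(a_1\otimes\cdots\otimes a_p)g(a_{p+1}\otimes\cdots\otimes a_{p+q})$. With $E=\langle e_{11},\dots,e_{NN}\rangle\subseteq k[\mathcal{C}]$ the (separable) subalgebra spanned by the identities, $HH^*(k[\mathcal{C}];k[\mathcal{C}])$ is also the cohomology of the complex $C^*$ with $C^0=\sum_{i=1}^N\mathrm{Hom}_k(k_i,k[G_i])$, where $k_i=k[e_{ii}]$, and for $n\ge1$, $C^n$ the module of $k$-linear $f:k[\mathcal{C}]^{\otimes_E n}\to k[\mathcal{C}]$ sending $\alpha_{i_1i_2}\otimes\cdots\otimes\alpha_{i_ni_{n+1}}$ (with $\alpha_{ij}\in\mathrm{Mor}(i,j)$, $i_1\preccurlyeq\cdots\preccurlyeq i_{n+1}$) into $k[\mathrm{Mor}(i_1,i_{n+1})]$;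 the differential is given by the same formula as $\delta$ above for $n\ge 1$, and by $(\delta f)(\alpha_{ij})=\alpha_{ij}f(e_{jj})-f(e_{ii})\alpha_{ij}$ for $n=0$. Autopoietic cochains for $\mathcal{C}$: for $n\ge1$, $f\in C^n$ is autopoietic if for all composable morphisms $f(\alpha_1\otimes\cdots\otimes\alpha_n)=\lambda_{\alpha_1,\dots,\alpha_n}(\alpha_1\cdots\alpha_n)$ with $\lambda_{\alpha_1,\dots,\alpha_n}\in k$; for $n=0$, $f$ must send each $e_{ii}$ to a $k$-multiple of $e_{ii}$. With $B^n=\mathrm{Hom}_k(k[B_n(\mathcal{C})],k)$ the simplicial cochains, the cochain map $\Psi:B^*\to C^*$, $\Psi(\gamma)(\alpha_1\otimes\cdots\otimes\alpha_n)=\gamma(\alpha_1,\dots,\alpha_n)(\alpha_1\cdots\alpha_n)$ for $n\geq 1$ and $\Psi(\gamma)(e_{ii})=\gamma(i)e_{ii}$ for $n=0$, has as image exactly the autopoietic cochains; their $E_\infty$-structure is the one given by Steenrod's simplicial cup-$i$ products on $B^*$ transported along $\Psi$. Autopoietic cochains for $G_i$: $AP(k[G_i]^{\otimes *})\subseteq\mathrm{Hom}_k(k[G_i]^{\otimes *},k[G_i])$ is the subcomplex of strictly autopoietic cochains: for $n\ge1$, $f(g_1\otimes\cdots\otimes g_n)=\lambda_{g_1,\dots,g_n}(g_1\cdots g_n)$ with $\lambda_{g_1,\dots,g_n}\in k$, and for $n=0$, $f(1)\in k\,e_{ii}$. Its cohomology is isomorphic to $H^*(BG_i;k)$ and injects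 as a direct summand in $HH^*(k[G_i];k[G_i])$. *)

theory Defs
  imports "HOL-Algebra.Module" "HOL-Algebra.AbelCoset" "HOL-Library.Poly_Mapping" "HOL-Library.FuncSet"
begin

text \<open>
  The coefficient ring is the type \<open>'k\<close> of sort \<open>{comm_ring, comm_monoid_mult}\<close>: a commutative ring
  with unit in which, unlike in class \<open>comm_ring_1\<close>, \<open>0 = 1\<close> is allowed.  The modules over \<open>'k\<close> are
  records of type \<open>('k, 'a) module\<close>; where only the module structure matters, the fields for
  multiplication and unit are left undefined.
\<close>

section \<open>Modules\<close>

definition module_hom ::
    "('k, 'a, 'c) module_scheme \<Rightarrow> ('k, 'b, 'd) module_scheme \<Rightarrow> ('a \<Rightarrow> 'b) set" where
  "module_hom M N = {h \<in> hom (add_monoid M) (add_monoid N).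
     \<forall>c. \<forall>x\<in>carrier M. h (c \<odot>\<^bsub>M\<^esub> x) = c \<odot>\<^bsub>N\<^esub> h x}"

definition module_iso ::
    "('k, 'a, 'c) module_scheme \<Rightarrow> ('k, 'b, 'd) module_scheme \<Rightarrow> ('a \<Rightarrow> 'b) set" where
  "module_iso M N = {h \<in> module_hom M N. bij_betw h (carrier M) (carrier N)}"

definition quot_module :: "('k, 'a) module \<Rightarrow> 'a set \<Rightarrow> ('k, 'a set) module" where
  "quot_module M N =
     \<lparr>carrier = a_rcosets\<^bsub>M\<^esub> N, monoid.mult = undefined, one = undefined,
      zero = N, add = (<+>\<^bsub>M\<^esub>), smult = (\<lambda>c X. \<Union>x\<in>X. N +>\<^bsub>M\<^esub> (c \<odot>\<^bsub>M\<^esub> x))\<rparr>"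

definition prod_module :: "('k, 'a) module \<Rightarrow> ('k, 'b) module \<Rightarrow> ('k, 'a \<times> 'b) module" where
  "prod_module M N =
     \<lparr>carrier = carrier M \<times> carrier N, monoid.mult = undefined, one = undefined,
      zero = (\<zero>\<^bsub>M\<^esub>, \<zero>\<^bsub>N\<^esub>),
      add = (\<lambda>(x, y) (x', y'). (x \<oplus>\<^bsub>M\<^esub> x', y \<oplus>\<^bsub>N\<^esub> y')),
      smult = (\<lambda>c (x, y). (c \<odot>\<^bsub>M\<^esub> x, c \<odot>\<^bsub>N\<^esub> y))\<rparr>"

definition direct_sum :: "'i set \<Rightarrow> ('i \<Rightarrow> ('k, 'a) module) \<Rightarrow> ('k, 'i \<Rightarrow> 'a) module" where
  "direct_sum I M =
     \<lparr>carrier = {x \<in> \<Pi>\<^sub>E i\<in>I. carrier (M i). finite {i \<in> I. x i \<noteq> \<zero>\<^bsub>M i\<^esub>}},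
      monoid.mult = undefined, one = undefined,
      zero = (\<lambda>i\<in>I. \<zero>\<^bsub>M i\<^esub>),
      add = (\<lambda>x y. \<lambda>i\<in>I. x i \<oplus>\<^bsub>M i\<^esub> y i),
      smult = (\<lambda>c x. \<lambda>i\<in>I. c \<odot>\<^bsub>M i\<^esub> x i)\<rparr>"

section \<open>Cochain complexes and their cohomology\<close>

text \<open>A cochain complex is given by its modules \<open>K n\<close> and its differentials \<open>d n : K n \<rightarrow> K (n + 1)\<close>.\<close>

definition cocycles :: "(nat \<Rightarrow> ('k, 'a) module) \<Rightarrow> (nat \<Rightarrow> 'a \<Rightarrow> 'a) \<Rightarrow> nat \<Rightarrow> 'a set" where
  "cocycles K d n = {x \<in> carrier (K n). d n x = \<zero>\<^bsub>K (Suc n)\<^esub>}"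

definition coboundaries :: "(nat \<Rightarrow> ('k, 'a) module) \<Rightarrow> (nat \<Rightarrow> 'a \<Rightarrow> 'a) \<Rightarrow> nat \<Rightarrow> 'a set" where
  "coboundaries K d n = (case n of 0 \<Rightarrow> {\<zero>\<^bsub>K 0\<^esub>} | Suc m \<Rightarrow> d m ` carrier (K m))"

definition cohomology ::
    "(nat \<Rightarrow> ('k, 'a) module) \<Rightarrow> (nat \<Rightarrow> 'a \<Rightarrow> 'a) \<Rightarrow> nat \<Rightarrow> ('k, 'a set) module" where
  "cohomology K d n = quot_module (K n\<lparr>carrier := cocycles K d n\<rparr>) (coboundaries K d n)"

definition coh_class ::
    "(nat \<Rightarrow> ('k, 'a) module) \<Rightarrow> (nat \<Rightarrow> 'a \<Rightarrow> 'a) \<Rightarrow> nat \<Rightarrow> 'a \<Rightarrow> 'a set" where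
  "coh_class K d n x = coboundaries K d n +>\<^bsub>K n\<^esub> x"

text \<open>The map induced on degree \<open>n\<close> cohomology by the degree \<open>n\<close> part \<open>\<phi>\<close> of a cochain map into \<open>(K, d)\<close>.\<close>

definition coh_map ::
    "(nat \<Rightarrow> ('k, 'b) module) \<Rightarrow> (nat \<Rightarrow> 'b \<Rightarrow> 'b) \<Rightarrow> nat \<Rightarrow> ('a \<Rightarrow> 'b) \<Rightarrow> 'a set \<Rightarrow> 'b set" where
  "coh_map K d n \<phi> X = (\<Union>x\<in>X. coh_class K d n (\<phi> x))"

text \<open>The product of two cohomology classes, with values in degree \<open>n\<close>, induced by a cochain product.\<close>

definition coh_prod ::
    "(nat \<Rightarrow> ('k, 'a) module) \<Rightarrow> (nat \<Rightarrow> 'a \<Rightarrow> 'a) \<Rightarrow> nat \<Rightarrow> ('a \<Rightarrow> 'a \<Rightarrow> 'a) \<Rightarrow> 'a set \<Rightarrow> 'a set \<Rightarrow> 'a set"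
  where
  "coh_prod K d n m X Y = (\<Union>x\<in>X. \<Union>y\<in>Y. coh_class K d n (m x y))"

section \<open>Hochschild cohomology of a unital algebra\<close>

definition tuples :: "('k, 'a) module \<Rightarrow> nat \<Rightarrow> 'a list set" where
  "tuples A n = {xs. set xs \<subseteq> carrier A \<and> length xs = n}"

text \<open>
  A linear map on the \<open>n\<close>-fold tensor power of \<open>A\<close> is given by the corresponding \<open>n\<close>-linear map, a
  function of lists of length \<open>n\<close>.  For \<open>n = 0\<close> the value \<open>f(1)\<close> is \<open>f []\<close>.
\<close>

definition hoch :: "('k, 'a) module \<Rightarrow> nat \<Rightarrow> ('k, 'a list \<Rightarrow> 'a) module" where
  "hoch A n =
     \<lparr>carrier = {f \<in> tuples A n \<rightarrow>\<^sub>E carrier A.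
        \<forall>xs ys. set xs \<subseteq> carrier A \<and> set ys \<subseteq> carrier A \<and> length xs + length ys + 1 = n \<longrightarrow>
          (\<forall>x\<in>carrier A. \<forall>y\<in>carrier A.
             f (xs @ (x \<oplus>\<^bsub>A\<^esub> y) # ys) = f (xs @ x # ys) \<oplus>\<^bsub>A\<^esub> f (xs @ y # ys)) \<and>
          (\<forall>c. \<forall>x\<in>carrier A. f (xs @ (c \<odot>\<^bsub>A\<^esub> x) # ys) = c \<odot>\<^bsub>A\<^esub> f (xs @ x # ys))},
      monoid.mult = undefined, one = undefined,
      zero = (\<lambda>xs\<in>tuples A n. \<zero>\<^bsub>A\<^esub>),
      add = (\<lambda>f g. \<lambda>xs\<in>tuples A n. f xs \<oplus>\<^bsub>A\<^esub> g xs),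
      smult = (\<lambda>c f. \<lambda>xs\<in>tuples A n. c \<odot>\<^bsub>A\<^esub> f xs)\<rparr>"

text \<open>
  The list \<open>xs\<close> is \<open>[a\<^sub>1, \<dots>, a\<^sub>n\<^sub>+\<^sub>1]\<close> with \<open>a\<^sub>j = xs ! (j - 1)\<close>.
\<close>

definition hoch_d ::
    "('k::{comm_ring,comm_monoid_mult}, 'a) module \<Rightarrow> nat \<Rightarrow> ('a list \<Rightarrow> 'a) \<Rightarrow> 'a list \<Rightarrow> 'a" where
  "hoch_d A n f = (\<lambda>xs\<in>tuples A (Suc n).
     (hd xs \<otimes>\<^bsub>A\<^esub> f (tl xs))
     \<oplus>\<^bsub>A\<^esub> (\<Oplus>\<^bsub>A\<^esub>j\<in>{1..n}. (- 1) ^ j \<odot>\<^bsub>A\<^esub>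
            f (take (j - 1) xs @ (xs ! (j - 1) \<otimes>\<^bsub>A\<^esub> xs ! j) # drop (j + 1) xs))
     \<oplus>\<^bsub>A\<^esub> ((- 1) ^ (n + 1) \<odot>\<^bsub>A\<^esub> (f (butlast xs) \<otimes>\<^bsub>A\<^esub> last xs)))"

abbreviation HH :: "('k::{comm_ring,comm_monoid_mult}, 'a) module \<Rightarrow> nat \<Rightarrow> ('k, ('a list \<Rightarrow> 'a) set) module"
  where "HH A n \<equiv> cohomology (hoch A) (hoch_d A) n"

definition gerst ::
    "('k, 'a) module \<Rightarrow> nat \<Rightarrow> nat \<Rightarrow> ('a list \<Rightarrow> 'a) \<Rightarrow> ('a list \<Rightarrow> 'a) \<Rightarrow> 'a list \<Rightarrow> 'a" where
  "gerst A p q f g = (\<lambda>xs\<in>tuples A (p + q). f (take p xs) \<otimes>\<^bsub>A\<^esub> g (drop p xs))"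

section \<open>Category algebras and group algebras\<close>

text \<open>
  The free module on a set \<open>S\<close> with a partially defined product, extended bilinearly and by \<open>0\<close> where
  the product of two basis elements is undefined; \<open>u\<close> is its unit.
\<close>

definition free_algebra ::
    "'m set \<Rightarrow> ('m \<Rightarrow> 'm \<Rightarrow> 'm option) \<Rightarrow> ('m \<Rightarrow>\<^sub>0 'k::{comm_ring,comm_monoid_mult})
      \<Rightarrow> ('k, 'm \<Rightarrow>\<^sub>0 'k) module" where
  "free_algebra S m u =
     \<lparr>carrier = {x. Poly_Mapping.keys x \<subseteq> S},
      monoid.mult = (\<lambda>x y. \<Sum>a\<in>Poly_Mapping.keys x. \<Sum>b\<in>Poly_Mapping.keys y.
        (case m a b of None \<Rightarrow> 0
         | Some c \<Rightarrow> Poly_Mapping.single c (Poly_Mapping.lookup x a * Poly_Mapping.lookup y b))),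
      one = u, zero = 0, add = (+), smult = (\<lambda>c. Poly_Mapping.map ((*) c))\<rparr>"

text \<open>Composition is written from left to right; \<open>Comp C a b\<close> matters only if \<open>tgt C a = src C b\<close>.\<close>

record ('o, 'm) cat =
  Ob :: "'o set"
  Arr :: "'m set"
  src :: "'m \<Rightarrow> 'o"
  tgt :: "'m \<Rightarrow> 'o"
  Id :: "'o \<Rightarrow> 'm"
  Comp :: "'m \<Rightarrow> 'm \<Rightarrow> 'm"

definition Mor :: "('o, 'm) cat \<Rightarrow> 'o \<Rightarrow> 'o \<Rightarrow> 'm set" where
  "Mor C i j = {a \<in> Arr C. src C a = i \<and> tgt C a = j}"

definition cat_algebra :: "('o, 'm) cat \<Rightarrow> ('k::{comm_ring,comm_monoid_mult}, 'm \<Rightarrow>\<^sub>0 'k) module" where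
  "cat_algebra C = free_algebra (Arr C) (\<lambda>a b. if tgt C a = src C b then Some (Comp C a b) else None)
     (\<Sum>i\<in>Ob C. Poly_Mapping.single (Id C i) 1)"

definition group_algebra :: "'g monoid \<Rightarrow> ('k::{comm_ring,comm_monoid_mult}, 'g \<Rightarrow>\<^sub>0 'k) module" where
  "group_algebra G = free_algebra (carrier G) (\<lambda>a b. Some (a \<otimes>\<^bsub>G\<^esub> b)) (Poly_Mapping.single \<one>\<^bsub>G\<^esub> 1)"

section \<open>The amalgam of groups and a poset\<close>

text \<open>\<open>Loop i g\<close> is the element \<open>g\<close> of \<open>G i\<close>, and \<open>Edge i j\<close> is \<open>e\<^sub>i\<^sub>j\<close> for \<open>i \<noteq> j\<close>.\<close>

datatype ('i, 'g) amalgam_mor = Loop 'i 'g | Edge 'i 'i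

fun amalgam_src :: "('i, 'g) amalgam_mor \<Rightarrow> 'i" where
  "amalgam_src (Loop i g) = i"
| "amalgam_src (Edge i j) = i"

fun amalgam_tgt :: "('i, 'g) amalgam_mor \<Rightarrow> 'i" where
  "amalgam_tgt (Loop i g) = i"
| "amalgam_tgt (Edge i j) = j"

fun amalgam_comp ::
    "('i \<Rightarrow> 'g monoid) \<Rightarrow> ('i, 'g) amalgam_mor \<Rightarrow> ('i, 'g) amalgam_mor \<Rightarrow> ('i, 'g) amalgam_mor" where
  "amalgam_comp G (Loop i g) (Loop j h) = Loop i (g \<otimes>\<^bsub>G i\<^esub> h)"
| "amalgam_comp G (Loop i g) (Edge j l) = Edge j l"
| "amalgam_comp G (Edge i j) (Loop l h) = Edge i j"
| "amalgam_comp G (Edge i j) (Edge l m) = Edge i m"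

definition amalgam ::
    "'i set \<Rightarrow> ('i \<times> 'i) set \<Rightarrow> ('i \<Rightarrow> 'g monoid) \<Rightarrow> ('i, ('i, 'g) amalgam_mor) cat" where
  "amalgam P r G =
     \<lparr>Ob = P,
      Arr = {Loop i g | i g. i \<in> P \<and> g \<in> carrier (G i)}
          \<union> {Edge i j | i j. i \<in> P \<and> j \<in> P \<and> i \<noteq> j \<and> (i, j) \<in> r},
      src = amalgam_src, tgt = amalgam_tgt,
      Id = (\<lambda>i. Loop i \<one>\<^bsub>G i\<^esub>), Comp = amalgam_comp G\<rparr>"

section \<open>The nerve and its simplicial cochains\<close>

fun is_path :: "('o, 'm) cat \<Rightarrow> 'o \<Rightarrow> 'm list \<Rightarrow> bool" where
  "is_path C i [] \<longleftrightarrow> i \<in> Ob C"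
| "is_path C i (a # as) \<longleftrightarrow> i \<in> Ob C \<and> a \<in> Arr C \<and> src C a = i \<and> is_path C (tgt C a) as"

fun composite :: "('o, 'm) cat \<Rightarrow> 'o \<Rightarrow> 'm list \<Rightarrow> 'm" where
  "composite C i [] = Id C i"
| "composite C i (a # as) = Comp C a (composite C (tgt C a) as)"

text \<open>
  An \<open>n\<close>-simplex of the nerve is a list of \<open>n\<close> composable morphisms, recorded together with the object
  at which it starts, so that the \<open>0\<close>-simplices \<open>(i, [])\<close> are the objects \<open>i\<close>.
\<close>

type_synonym ('o, 'm) simplex = "'o \<times> 'm list"

definition nerve :: "('o, 'm) cat \<Rightarrow> nat \<Rightarrow> ('o, 'm) simplex set" where
  "nerve C n = {(i, as). length as = n \<and> is_path C i as}"

definition vertex :: "('o, 'm) cat \<Rightarrow> ('o, 'm) simplex \<Rightarrow> nat \<Rightarrow> 'o" where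
  "vertex C \<sigma> s = (if s = 0 then fst \<sigma> else tgt C (snd \<sigma> ! (s - 1)))"

text \<open>The face of \<open>\<sigma>\<close> spanned by the vertices with the strictly increasing numbers in the nonempty list \<open>ss\<close>.\<close>

definition face :: "('o, 'm) cat \<Rightarrow> ('o, 'm) simplex \<Rightarrow> nat list \<Rightarrow> ('o, 'm) simplex" where
  "face C \<sigma> ss = (vertex C \<sigma> (hd ss),
     map (\<lambda>(s, t). composite C (vertex C \<sigma> s) (take (t - s) (drop s (snd \<sigma>)))) (zip ss (tl ss)))"

definition scochains :: "('o, 'm) cat \<Rightarrow> nat \<Rightarrow> ('k::{comm_ring,comm_monoid_mult}, ('o, 'm) simplex \<Rightarrow> 'k) module"
  where
  "scochains C n =
     \<lparr>carrier = extensional (nerve C n), monoid.mult = undefined, one = undefined,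
      zero = (\<lambda>\<sigma>\<in>nerve C n. 0),
      add = (\<lambda>u v. \<lambda>\<sigma>\<in>nerve C n. u \<sigma> + v \<sigma>),
      smult = (\<lambda>c u. \<lambda>\<sigma>\<in>nerve C n. c * u \<sigma>)\<rparr>"

definition scochain_d ::
    "('o, 'm) cat \<Rightarrow> nat \<Rightarrow> (('o, 'm) simplex \<Rightarrow> 'k::{comm_ring,comm_monoid_mult}) \<Rightarrow> ('o, 'm) simplex \<Rightarrow> 'k"
  where
  "scochain_d C n u = (\<lambda>\<sigma>\<in>nerve C (Suc n). \<Sum>j\<le>n + 1. (- 1) ^ j * u (face C \<sigma> (remove1 j [0..<n + 2])))"

text \<open>The cohomology of the classifying space of \<open>C\<close>, as the simplicial cohomology of the nerve.\<close>

abbreviation HB ::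
    "('o, 'm) cat \<Rightarrow> nat \<Rightarrow> ('k::{comm_ring,comm_monoid_mult}, (('o, 'm) simplex \<Rightarrow> 'k) set) module" where
  "HB C n \<equiv> cohomology (scochains C) (scochain_d C) n"

text \<open>
  Steenrod's cup-\<open>i\<close> product of cochains of degrees \<open>p\<close> and \<open>q\<close>, of degree \<open>m = p + q - i\<close>.  The vertices
  \<open>j\<^sub>0 < \<dots> < j\<^sub>i\<close> in \<open>J\<close> cut \<open>[0..m]\<close> into the intervals \<open>[0..j\<^sub>0], [j\<^sub>0..j\<^sub>1], \<dots>, [j\<^sub>i..m]\<close>, which go
  alternately to the first and to the second factor, so that the two factors share exactly the
  vertices in \<open>J\<close>.  The sign is that of the permutation which lists the vertices of the first factor
  before the remaining vertices of the second.
\<close>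

definition cut_fst :: "nat \<Rightarrow> nat set \<Rightarrow> nat set" where
  "cut_fst m J = {s. s \<le> m \<and> (s \<in> J \<or> even (card {j \<in> J. j < s}))}"

definition cut_snd :: "nat \<Rightarrow> nat set \<Rightarrow> nat set" where
  "cut_snd m J = {s. s \<le> m \<and> (s \<in> J \<or> odd (card {j \<in> J. j < s}))}"

definition cut_inversions :: "nat \<Rightarrow> nat set \<Rightarrow> nat" where
  "cut_inversions m J = card {(s, t). s \<in> cut_fst m J \<and> t \<in> cut_snd m J - J \<and> t < s}"

definition cup ::
    "('o, 'm) cat \<Rightarrow> nat \<Rightarrow> nat \<Rightarrow> nat \<Rightarrow> (('o, 'm) simplex \<Rightarrow> 'k::{comm_ring,comm_monoid_mult})
      \<Rightarrow> (('o, 'm) simplex \<Rightarrow> 'k) \<Rightarrow> ('o, 'm) simplex \<Rightarrow> 'k" where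
  "cup C i p q u v = (\<lambda>\<sigma>\<in>nerve C (p + q - i).
     \<Sum>J | J \<subseteq> {..p + q - i} \<and> card J = i + 1 \<and>
           card (cut_fst (p + q - i) J) = p + 1 \<and> card (cut_snd (p + q - i) J) = q + 1.
       (- 1) ^ cut_inversions (p + q - i) J
       * u (face C \<sigma> (sorted_list_of_set (cut_fst (p + q - i) J)))
       * v (face C \<sigma> (sorted_list_of_set (cut_snd (p + q - i) J))))"

text \<open>
  A cochain complex with operations \<open>mu i p q\<close> of degree \<open>-i\<close> on cochains of degrees \<open>p\<close> and \<open>q\<close> that
  satisfy Steenrod's relations: \<open>mu 0\<close> is an associative product with unit \<open>e\<close>, and \<open>mu (i + 1)\<close> is a
  homotopy for the commutativity of \<open>mu i\<close>, with the signs of the coboundary formula in Steenrod's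
  \<^emph>\<open>Products of cocycles and extensions of mappings\<close>.
\<close>

definition cup_i_algebra ::
    "(nat \<Rightarrow> ('k::{comm_ring,comm_monoid_mult}, 'a) module) \<Rightarrow> (nat \<Rightarrow> 'a \<Rightarrow> 'a)
      \<Rightarrow> (nat \<Rightarrow> nat \<Rightarrow> nat \<Rightarrow> 'a \<Rightarrow> 'a \<Rightarrow> 'a) \<Rightarrow> 'a \<Rightarrow> bool" where
  "cup_i_algebra K d mu e \<longleftrightarrow>
     (\<forall>n. d n \<in> module_hom (K n) (K (Suc n))) \<and>
     (\<forall>n. \<forall>u\<in>carrier (K n). d (Suc n) (d n u) = \<zero>\<^bsub>K (Suc (Suc n))\<^esub>) \<and>
     (\<forall>i p q. i \<le> p + q \<longrightarrow>
        (\<forall>u\<in>carrier (K p). mu i p q u \<in> module_hom (K q) (K (p + q - i))) \<and>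
        (\<forall>v\<in>carrier (K q). (\<lambda>u. mu i p q u v) \<in> module_hom (K p) (K (p + q - i)))) \<and>
     e \<in> carrier (K 0) \<and>
     (\<forall>p. \<forall>u\<in>carrier (K p). mu 0 0 p e u = u \<and> mu 0 p 0 u e = u) \<and>
     (\<forall>p q s. \<forall>u\<in>carrier (K p). \<forall>v\<in>carrier (K q). \<forall>w\<in>carrier (K s).
        mu 0 (p + q) s (mu 0 p q u v) w = mu 0 p (q + s) u (mu 0 q s v w)) \<and>
     (\<forall>i p q. i \<le> p + q \<longrightarrow> (\<forall>u\<in>carrier (K p). \<forall>v\<in>carrier (K q).
        let N = K (Suc (p + q - i)) in
        d (p + q - i) (mu i p q u v) =
          (if i = 0 then \<zero>\<^bsub>N\<^esub>
           else ((- 1) ^ (p + q - i) \<odot>\<^bsub>N\<^esub> mu (i - 1) p q u v)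
                \<oplus>\<^bsub>N\<^esub> ((- 1) ^ (p * q + p + q) \<odot>\<^bsub>N\<^esub> mu (i - 1) q p v u))
          \<oplus>\<^bsub>N\<^esub> mu i (Suc p) q (d p u) v
          \<oplus>\<^bsub>N\<^esub> ((- 1) ^ p \<odot>\<^bsub>N\<^esub> mu i p (Suc q) u (d q v))))"

section \<open>Autopoietic cochains of a category algebra\<close>

abbreviation basis :: "'m \<Rightarrow> ('m \<Rightarrow>\<^sub>0 'k::{comm_ring,comm_monoid_mult})" where
  "basis a \<equiv> Poly_Mapping.single a 1"

text \<open>
  The complex \<open>C\<^sup>*\<close> relative to the span \<open>E\<close> of the identities, as a subcomplex of the Hochschild complex.
  A linear map on the \<open>n\<close>-fold tensor power over \<open>E\<close> is an \<open>E\<close>-balanced \<open>n\<close>-linear map.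
  In degree \<open>0\<close>, a family \<open>f\<close> of linear maps \<open>k\<^sub>i \<rightarrow> k[Mor(i, i)]\<close> is identified with the Hochschild
  cochain \<open>[] \<mapsto> \<Sum>i. f(e\<^sub>i\<^sub>i)\<close>; thus \<open>f(e\<^sub>i\<^sub>i)\<close> is the component of \<open>f []\<close> in \<open>k[Mor(i, i)]\<close>, and the two
  formulas for the differential of a \<open>0\<close>-cochain agree on morphisms.
\<close>

definition rel_cochains :: "('o, 'm) cat \<Rightarrow> nat \<Rightarrow>
    (('m \<Rightarrow>\<^sub>0 'k::{comm_ring,comm_monoid_mult}) list \<Rightarrow> ('m \<Rightarrow>\<^sub>0 'k)) set" where
  "rel_cochains C n =
     (let A = (cat_algebra C :: ('k, 'm \<Rightarrow>\<^sub>0 'k) module) in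
      {f \<in> carrier (hoch A n).
        (\<forall>xs ys. \<forall>x\<in>carrier A. \<forall>y\<in>carrier A. \<forall>e. Poly_Mapping.keys e \<subseteq> Id C ` Ob C \<and>
           set xs \<subseteq> carrier A \<and> set ys \<subseteq> carrier A \<and> length xs + length ys + 2 = n \<longrightarrow>
           f (xs @ (x \<otimes>\<^bsub>A\<^esub> e) # y # ys) = f (xs @ x # (e \<otimes>\<^bsub>A\<^esub> y) # ys)) \<and>
        (if n = 0 then Poly_Mapping.keys (f []) \<subseteq> (\<Union>i\<in>Ob C. Mor C i i)
         else \<forall>(i, as)\<in>nerve C n.
           Poly_Mapping.keys (f (map basis as)) \<subseteq> Mor C i (vertex C (i, as) n))})"

definition autopoietic :: "('o, 'm) cat \<Rightarrow> nat \<Rightarrow>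
    (('m \<Rightarrow>\<^sub>0 'k::{comm_ring,comm_monoid_mult}) list \<Rightarrow> ('m \<Rightarrow>\<^sub>0 'k)) set" where
  "autopoietic C n = {f \<in> rel_cochains C n.
     if n = 0 then \<forall>i\<in>Ob C. \<exists>c. basis (Id C i) \<otimes>\<^bsub>cat_algebra C\<^esub> f [] \<otimes>\<^bsub>cat_algebra C\<^esub> basis (Id C i)
                               = Poly_Mapping.single (Id C i) c
     else \<forall>(i, as)\<in>nerve C n. \<exists>c. f (map basis as) = Poly_Mapping.single (composite C i as) c}"

definition ap_cochains :: "('o, 'm) cat \<Rightarrow> nat \<Rightarrow>
    ('k::{comm_ring,comm_monoid_mult}, ('m \<Rightarrow>\<^sub>0 'k) list \<Rightarrow> ('m \<Rightarrow>\<^sub>0 'k)) module" where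
  "ap_cochains C n = hoch (cat_algebra C) n\<lparr>carrier := autopoietic C n\<rparr>"

text \<open>
  The multilinear extension of \<open>\<alpha>\<^sub>1, \<dots>, \<alpha>\<^sub>n \<mapsto> \<gamma>(\<alpha>\<^sub>1, \<dots>, \<alpha>\<^sub>n) (\<alpha>\<^sub>1\<cdots>\<alpha>\<^sub>n)\<close>, which is \<open>0\<close> on tuples that are not
  composable.  For \<open>n = 0\<close> its value at \<open>[]\<close> is \<open>\<Sum>i. \<gamma>(i) e\<^sub>i\<^sub>i\<close>.
\<close>

definition Psi :: "('o, 'm) cat \<Rightarrow> nat \<Rightarrow> (('o, 'm) simplex \<Rightarrow> 'k::{comm_ring,comm_monoid_mult})
    \<Rightarrow> ('m \<Rightarrow>\<^sub>0 'k) list \<Rightarrow> ('m \<Rightarrow>\<^sub>0 'k)" where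
  "Psi C n \<gamma> = (\<lambda>xs\<in>tuples (cat_algebra C) n.
     \<Sum>(i, as) | (i, as) \<in> nerve C n \<and> (\<forall>j<n. as ! j \<in> Poly_Mapping.keys (xs ! j)).
       Poly_Mapping.single (composite C i as) (\<gamma> (i, as) * (\<Prod>j<n. Poly_Mapping.lookup (xs ! j) (as ! j))))"

text \<open>The cup-\<open>i\<close> products transported along \<open>Psi\<close>.\<close>

definition ap_cup :: "('o, 'm) cat \<Rightarrow> nat \<Rightarrow> nat \<Rightarrow> nat
    \<Rightarrow> (('m \<Rightarrow>\<^sub>0 'k::{comm_ring,comm_monoid_mult}) list \<Rightarrow> ('m \<Rightarrow>\<^sub>0 'k))
    \<Rightarrow> (('m \<Rightarrow>\<^sub>0 'k) list \<Rightarrow> ('m \<Rightarrow>\<^sub>0 'k)) \<Rightarrow> ('m \<Rightarrow>\<^sub>0 'k) list \<Rightarrow> ('m \<Rightarrow>\<^sub>0 'k)" where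
  "ap_cup C i p q f g = Psi C (p + q - i)
     (cup C i p q (inv_into (carrier (scochains C p)) (Psi C p) f)
                  (inv_into (carrier (scochains C q)) (Psi C q) g))"

section \<open>Strictly autopoietic cochains of a group algebra\<close>

text \<open>For \<open>n = 0\<close> the condition says that \<open>f []\<close> is a multiple of the unit, the empty product.\<close>

definition group_ap_cochains :: "'g monoid \<Rightarrow> nat \<Rightarrow>
    ('k::{comm_ring,comm_monoid_mult}, ('g \<Rightarrow>\<^sub>0 'k) list \<Rightarrow> ('g \<Rightarrow>\<^sub>0 'k)) module" where
  "group_ap_cochains G n = hoch (group_algebra G) n\<lparr>carrier :=
     {f \<in> carrier (hoch (group_algebra G) n).
        \<forall>gs. set gs \<subseteq> carrier G \<and> length gs = n \<longrightarrow>
          (\<exists>c. f (map basis gs) = Poly_Mapping.single (foldr (\<otimes>\<^bsub>G\<^esub>) gs \<one>\<^bsub>G\<^esub>) c)}\<rparr>"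

text \<open>
  The quotient of the Hochschild cohomology of \<open>k[G]\<close> by the cohomology of \<open>BG\<close>, the latter being the
  image of the cohomology of the strictly autopoietic cochains under the inclusion.
\<close>

definition HH_mod_HB :: "'g monoid \<Rightarrow> nat \<Rightarrow>
    ('k::{comm_ring,comm_monoid_mult}, (('g \<Rightarrow>\<^sub>0 'k) list \<Rightarrow> ('g \<Rightarrow>\<^sub>0 'k)) set set) module" where
  "HH_mod_HB G n = (let A = (group_algebra G :: ('k, 'g \<Rightarrow>\<^sub>0 'k) module) in
     quot_module (HH A n)
       (coh_map (hoch A) (hoch_d A) n (\<lambda>f. f) ` carrier (cohomology (group_ap_cochains G) (hoch_d A) n)))"

end

theory Submission
  imports Defs
begin

text \<open>
  A Hochschild cochain of a category algebra is determined by its values on lists of morphisms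
  (\<open>hoch_eq_mext\<close>), and all maps are given there.

  The autopoietic part splits off as a cochain complex.  The map \<open>\<Psi>\<close> has a left inverse \<open>retr\<close>, which
  sends the value of a cochain on a path from \<open>i\<close> to \<open>j\<close> to the sum of its coefficients at the morphisms
  from \<open>i\<close> to \<open>j\<close>.  Composition with a morphism does not change such a sum, so that \<open>retr\<close> is a cochain map
  (\<open>baug_bdiff\<close>).  Values with coefficient sum zero remain.  If \<open>i \<noteq> j\<close>, they vanish, since there is at most
  one morphism from \<open>i\<close> to \<open>j\<close>.  If \<open>i = j\<close>, the path is a list of elements of \<open>G\<^sub>i\<close>, since the poset has no
  cycles (\<open>path_order\<close>).  So what remains lives on the groups, and there are no conditions that relate it to
  the rest of the category: the product of an element of \<open>k[G\<^sub>i]\<close> of coefficient sum zero with \<open>e\<^sub>i\<^sub>j\<close> is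
  zero, so a cochain with such values can be extended by zero from \<open>G\<^sub>i\<close> to the category
  (\<open>bdiff_ext_loops\<close>).  The same splitting for the group \<open>G\<^sub>i\<close> shows that these cochains compute
  \<open>HH\<^sup>*(k[G\<^sub>i]) / H\<^sup>*(BG\<^sub>i)\<close>.

  This accounts for the values on paths, between the identities of their end points.  A cocycle for which
  these are zero is a coboundary (\<open>cocycle_coboundary\<close>).  In its two-sided form the differential is an
  alternating sum over the products of neighbours, and to insert an identity at the first place where a list
  is not composable is a homotopy from the identity to zero on such lists (\<open>ins_id_homotopy\<close>).  Hence a
  cocycle is cohomologous to the sum of its parts (\<open>sum_of_parts\<close>), and the decomposition follows from the
  general \<open>cohomology_splitting\<close>.

  A balanced cochain vanishes on lists that are not composable, and hence the autopoietic cochains are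
  the image of \<open>\<Psi>\<close> (\<open>autopoietic_image\<close>).  The map \<open>\<Psi>\<close> sends the cup product to the Gerstenhaber product
  (\<open>Psi_cup_0\<close>), so the relations for the cup-\<open>i\<close> products have to be shown only for simplicial cochains.
  Steenrod's coboundary formula (\<open>scochain_d_cup\<close>) is obtained by reading the vertices of a simplex one
  after the other: the sum over all ways to cut the simplex becomes a recursion (\<open>cuts_sum\<close>), for which the
  formula is a short induction (\<open>dl_cuts\<close>).
\<close>

section \<open>Quotients of abelian groups with operators\<close>

text \<open>
  An abelian group on which the scalars act by endomorphisms.  This is all that quotients and
  cohomology need of a module.
\<close>

locale opgroup = abelian_group M for M :: "('k, 'a) module" (structure) +
  assumes smult_closed [simp, intro]: "x \<in> carrier M \<Longrightarrow> c \<odot> x \<in> carrier M"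
    and smult_add: "\<lbrakk>x \<in> carrier M; y \<in> carrier M\<rbrakk> \<Longrightarrow> c \<odot> (x \<oplus> y) = c \<odot> x \<oplus> c \<odot> y"
begin

lemma smult_zero [simp]: "c \<odot> \<zero> = \<zero>"
  by (metis add.r_cancel_one smult_add smult_closed zero_closed r_zero)

lemma smult_minus:
  assumes "x \<in> carrier M" "y \<in> carrier M"
  shows "c \<odot> (x \<ominus> y) = c \<odot> x \<ominus> c \<odot> y"
proof -
  have "c \<odot> x = c \<odot> (x \<ominus> y) \<oplus> c \<odot> y"
    using assms by (simp flip: smult_add add: minus_eq a_assoc l_neg)
  then show ?thesis
    using assms by (simp add: minus_eq a_assoc r_neg)
qed

end

text \<open>Additive subgroups that are closed under the action of the scalars.\<close>

definition opsub :: "('k, 'a) module \<Rightarrow> 'a set \<Rightarrow> bool" where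
  "opsub M B \<longleftrightarrow> additive_subgroup B M \<and> (\<forall>c. \<forall>x\<in>B. c \<odot>\<^bsub>M\<^esub> x \<in> B)"

lemma (in opgroup) opsubI:
  assumes "B \<subseteq> carrier M" "\<zero> \<in> B" "\<And>x y. x \<in> B \<Longrightarrow> y \<in> B \<Longrightarrow> x \<ominus> y \<in> B"
    and "\<And>c x. x \<in> B \<Longrightarrow> c \<odot> x \<in> B"
  shows "opsub M B"
proof -
  have neg: "\<ominus> x \<in> B" if "x \<in> B" for x
    using assms(3)[OF assms(2) that] assms(1) that by (auto simp: minus_eq subset_iff)
  have add: "x \<oplus> y \<in> B" if "x \<in> B" "y \<in> B" for x y
    using assms(3)[OF that(1) neg[OF that(2)]] assms(1) that by (auto simp: minus_eq subset_iff)
  have "additive_subgroup B M"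
    unfolding additive_subgroup_def
    by (rule add.subgroupI) (use assms neg add in \<open>auto simp flip: a_inv_def\<close>)
  then show ?thesis using assms by (simp add: opsub_def)
qed

lemma (in opgroup) opsub_carrier: "opsub M (carrier M)"
  by (rule opsubI) auto

lemma module_homI:
  assumes "\<And>x. x \<in> carrier M \<Longrightarrow> h x \<in> carrier N"
    and "\<And>x y. x \<in> carrier M \<Longrightarrow> y \<in> carrier M \<Longrightarrow> h (x \<oplus>\<^bsub>M\<^esub> y) = h x \<oplus>\<^bsub>N\<^esub> h y"
    and "\<And>c x. x \<in> carrier M \<Longrightarrow> h (c \<odot>\<^bsub>M\<^esub> x) = c \<odot>\<^bsub>N\<^esub> h x"
  shows "h \<in> module_hom M N"
  using assms by (auto simp: module_hom_def hom_def)

lemma module_homD: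
  assumes "h \<in> module_hom M N"
  shows "x \<in> carrier M \<Longrightarrow> h x \<in> carrier N"
    and "x \<in> carrier M \<Longrightarrow> y \<in> carrier M \<Longrightarrow> h (x \<oplus>\<^bsub>M\<^esub> y) = h x \<oplus>\<^bsub>N\<^esub> h y"
    and "x \<in> carrier M \<Longrightarrow> h (c \<odot>\<^bsub>M\<^esub> x) = c \<odot>\<^bsub>N\<^esub> h x"
  using assms by (auto simp: module_hom_def hom_def)

lemma module_hom_zero:
  assumes "opgroup M" "opgroup N" "h \<in> module_hom M N"
  shows "h \<zero>\<^bsub>M\<^esub> = \<zero>\<^bsub>N\<^esub>"
proof -
  interpret M: opgroup M by fact
  interpret N: opgroup N by fact
  have "h \<zero>\<^bsub>M\<^esub> \<oplus>\<^bsub>N\<^esub> h \<zero>\<^bsub>M\<^esub> = h \<zero>\<^bsub>M\<^esub>"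
    using module_homD(2)[OF assms(3), of "\<zero>\<^bsub>M\<^esub>" "\<zero>\<^bsub>M\<^esub>"] by simp
  then show ?thesis
    using N.add.r_cancel_one module_homD(1)[OF assms(3)] by blast
qed

lemma module_hom_minus:
  assumes "opgroup M" "opgroup N" "h \<in> module_hom M N" "x \<in> carrier M" "y \<in> carrier M"
  shows "h (x \<ominus>\<^bsub>M\<^esub> y) = h x \<ominus>\<^bsub>N\<^esub> h y"
proof -
  interpret M: opgroup M by fact
  interpret N: opgroup N by fact
  note h = module_homD[OF assms(3)]
  have "h x = h (x \<ominus>\<^bsub>M\<^esub> y) \<oplus>\<^bsub>N\<^esub> h y"
    using assms h(2)[of "x \<ominus>\<^bsub>M\<^esub> y" y] by (simp add: M.minus_eq M.a_assoc M.l_neg)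
  then show ?thesis
    using assms h(1) by (simp add: N.minus_eq N.a_assoc N.r_neg)
qed

lemma (in opgroup) opsub_props:
  assumes "opsub M B"
  shows "B \<subseteq> carrier M" "\<zero> \<in> B" "x \<in> B \<Longrightarrow> y \<in> B \<Longrightarrow> x \<oplus> y \<in> B"
    "x \<in> B \<Longrightarrow> y \<in> B \<Longrightarrow> x \<ominus> y \<in> B" "x \<in> B \<Longrightarrow> c \<odot> x \<in> B"
    "abelian_subgroup B M"
proof -
  interpret additive_subgroup B M using assms by (simp add: opsub_def)
  show "B \<subseteq> carrier M" by (rule a_subset)
  show "\<zero> \<in> B" by simp
  show "x \<in> B \<Longrightarrow> y \<in> B \<Longrightarrow> x \<oplus> y \<in> B" by simp
  show "x \<in> B \<Longrightarrow> y \<in> B \<Longrightarrow> x \<ominus> y \<in> B" by (simp add: minus_eq)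
  show "x \<in> B \<Longrightarrow> c \<odot> x \<in> B" using assms by (simp add: opsub_def)
  show "abelian_subgroup B M" by (rule abelian_subgroupI3) unfold_locales
qed

lemma (in opgroup) mem_coset:
  assumes "opsub M B" "x \<in> carrier M"
  shows "y \<in> B +> x \<longleftrightarrow> y \<in> carrier M \<and> y \<ominus> x \<in> B"
proof -
  interpret abelian_subgroup B M by (rule opsub_props(6)[OF assms(1)])
  show ?thesis
    using a_rcos_module[OF assms(2)] a_elemrcos_carrier[OF assms(2)] by (auto simp: minus_eq)
qed

lemma (in opgroup) coset_eq_iff:
  assumes "opsub M B" "x \<in> carrier M" "y \<in> carrier M"
  shows "B +> x = B +> y \<longleftrightarrow> x \<ominus> y \<in> B"
proof -
  interpret abelian_subgroup B M by (rule opsub_props(6)[OF assms(1)])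
  have "B +> x = B +> y \<longleftrightarrow> x \<in> B +> y"
    using a_repr_independence'[of x y] a_rcos_self[of x] assms by metis
  then show ?thesis using mem_coset[OF assms(1,3)] assms(2) by simp
qed

text \<open>The quotient \<open>Z / B\<close> of two submodules of \<open>M\<close>.\<close>

locale subquotient = opgroup M for M :: "('k, 'a) module" (structure) +
  fixes Z B assumes Z: "opsub M Z" and B: "opsub M B" and BZ: "B \<subseteq> Z"
begin

abbreviation Q where "Q \<equiv> quot_module (M\<lparr>carrier := Z\<rparr>) B"

lemma ZM: "x \<in> Z \<Longrightarrow> x \<in> carrier M"
  using opsub_props(1)[OF Z] by blast

lemma coset_Z [simp]: "B +>\<^bsub>M\<lparr>carrier := Z\<rparr>\<^esub> x = B +> x"
  by (simp add: a_r_coset_def r_coset_def)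

lemma quot_carrier: "carrier Q = (\<lambda>x. B +> x) ` Z"
  by (auto simp: quot_module_def A_RCOSETS_def' a_r_coset_def r_coset_def)

lemma quot_add: "x \<in> Z \<Longrightarrow> y \<in> Z \<Longrightarrow> (B +> x) \<oplus>\<^bsub>Q\<^esub> (B +> y) = B +> (x \<oplus> y)"
proof -
  assume xy: "x \<in> Z" "y \<in> Z"
  interpret abelian_subgroup B M by (rule opsub_props(6)[OF B])
  have "(B +> x) \<oplus>\<^bsub>Q\<^esub> (B +> y) = (B +> x) <+> (B +> y)"
    by (simp add: quot_module_def set_add_def set_mult_def)
  then show ?thesis using a_rcos_sum xy ZM by simp
qed

lemma quot_zero: "\<zero>\<^bsub>Q\<^esub> = B +> \<zero>"
  using opsub_props(1)[OF B] by (simp add: quot_module_def)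

lemma quot_smult: "x \<in> Z \<Longrightarrow> c \<odot>\<^bsub>Q\<^esub> (B +> x) = B +> (c \<odot> x)"
proof -
  assume x: "x \<in> Z"
  have eq: "B +> (c \<odot> y) = B +> (c \<odot> x)" if "y \<in> B +> x" for y
  proof -
    have y: "y \<in> carrier M" "y \<ominus> x \<in> B" using that mem_coset[OF B ZM[OF x]] by auto
    have "c \<odot> y \<ominus> c \<odot> x \<in> B"
      using opsub_props(5)[OF B y(2), of c] smult_minus[OF y(1) ZM[OF x]] by simp
    then show ?thesis using coset_eq_iff[OF B] y(1) ZM[OF x] by simp
  qed
  have "x \<ominus> x = \<zero>" using ZM[OF x] by (simp add: minus_eq r_neg)
  then have "x \<in> B +> x" using mem_coset[OF B ZM[OF x]] ZM[OF x] opsub_props(2)[OF B] by simp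
  then have "(\<Union>y\<in>B +> x. B +> (c \<odot> y)) = B +> (c \<odot> x)" using eq by blast
  then show ?thesis by (simp add: quot_module_def)
qed

lemma quot_hom: "(\<lambda>x. B +> x) \<in> module_hom (M\<lparr>carrier := Z\<rparr>) Q"
  by (rule module_homI) (auto simp: quot_carrier quot_add quot_smult)

lemma quot_opgroup: "opgroup Q"
proof -
  note Zp = opsub_props[OF Z]
  have "abelian_group Q"
  proof (rule abelian_groupI)
    fix X assume "X \<in> carrier Q"
    then obtain x where x: "x \<in> Z" "X = B +> x" by (auto simp: quot_carrier)
    have "\<ominus> x \<in> Z" using Zp(4)[OF Zp(2) x(1)] x ZM by (simp add: minus_eq)
    moreover have "(B +> \<ominus> x) \<oplus>\<^bsub>Q\<^esub> X = \<zero>\<^bsub>Q\<^esub>"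
      using x ZM calculation by (simp add: quot_add quot_zero l_neg)
    ultimately show "\<exists>Y\<in>carrier Q. Y \<oplus>\<^bsub>Q\<^esub> X = \<zero>\<^bsub>Q\<^esub>" by (auto simp: quot_carrier)
  qed (use Zp(2,3) ZM in \<open>auto simp: quot_carrier quot_add quot_zero a_ac\<close>)
  then show ?thesis
    by (intro opgroup.intro opgroup_axioms.intro)
      (use Zp(3,5) ZM in \<open>auto simp: quot_carrier quot_add quot_smult smult_add\<close>)
qed

end

lemma (in opgroup) opgroup_sub:
  assumes "opsub M Z" shows "opgroup (M\<lparr>carrier := Z\<rparr>)"
proof -
  note Zp = opsub_props[OF assms]
  have ZM: "x \<in> Z \<Longrightarrow> x \<in> carrier M" for x using Zp(1) by blast
  have "abelian_group (M\<lparr>carrier := Z\<rparr>)"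
  proof (rule abelian_groupI)
    fix x assume "x \<in> carrier (M\<lparr>carrier := Z\<rparr>)"
    then have x: "x \<in> Z" by simp
    have "\<ominus> x \<in> Z" using Zp(4)[OF Zp(2) x] x ZM by (simp add: minus_eq)
    then show "\<exists>y\<in>carrier (M\<lparr>carrier := Z\<rparr>). y \<oplus>\<^bsub>M\<lparr>carrier := Z\<rparr>\<^esub> x = \<zero>\<^bsub>M\<lparr>carrier := Z\<rparr>\<^esub>"
      using x ZM by (auto simp: l_neg intro!: bexI[of _ "\<ominus> x"])
  qed (use Zp(2,3) ZM in \<open>auto simp: a_ac\<close>)
  then show ?thesis
    by (intro opgroup.intro opgroup_axioms.intro) (use Zp(3,5) ZM in \<open>auto simp: smult_add\<close>)
qed

text \<open>Two quotients of \<open>Z\<close> are isomorphic if their projections have the same fibres.\<close>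

lemma iso_of_presentations:
  assumes \<kappa>: "\<kappa> \<in> module_hom Z Q" "\<kappa> ` carrier Z = carrier Q"
    and \<theta>: "\<theta> \<in> module_hom Z Q'" "\<theta> ` carrier Z = carrier Q'"
    and closed: "\<And>x y. x \<in> carrier Z \<Longrightarrow> y \<in> carrier Z \<Longrightarrow> x \<oplus>\<^bsub>Z\<^esub> y \<in> carrier Z"
      "\<And>c x. x \<in> carrier Z \<Longrightarrow> c \<odot>\<^bsub>Z\<^esub> x \<in> carrier Z"
    and same: "\<And>x y. x \<in> carrier Z \<Longrightarrow> y \<in> carrier Z \<Longrightarrow> \<kappa> x = \<kappa> y \<longleftrightarrow> \<theta> x = \<theta> y"
  shows "\<exists>\<Phi>\<in>module_iso Q Q'. \<forall>x\<in>carrier Z. \<Phi> (\<kappa> x) = \<theta> x"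
proof -
  define \<Phi> where "\<Phi> X = \<theta> (SOME x. x \<in> carrier Z \<and> \<kappa> x = X)" for X
  have \<Phi>: "\<Phi> (\<kappa> x) = \<theta> x" if "x \<in> carrier Z" for x
  proof -
    have "(SOME y. y \<in> carrier Z \<and> \<kappa> y = \<kappa> x) \<in> carrier Z \<and>
          \<kappa> (SOME y. y \<in> carrier Z \<and> \<kappa> y = \<kappa> x) = \<kappa> x"
      by (rule someI_ex) (use that in auto)
    then show ?thesis unfolding \<Phi>_def using same that by blast
  qed
  note \<kappa>D = module_homD[OF \<kappa>(1)] and \<theta>D = module_homD[OF \<theta>(1)]
  have "\<Phi> \<in> module_hom Q Q'"
  proof (rule module_homI)
    fix X Y c assume "X \<in> carrier Q" "Y \<in> carrier Q"
    then obtain x y where xy: "x \<in> carrier Z" "y \<in> carrier Z" "X = \<kappa> x" "Y = \<kappa> y"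
      using \<kappa>(2) by blast
    show "\<Phi> (X \<oplus>\<^bsub>Q\<^esub> Y) = \<Phi> X \<oplus>\<^bsub>Q'\<^esub> \<Phi> Y"
      using xy \<Phi>[OF closed(1)[OF xy(1,2)]] by (simp add: \<Phi> \<theta>D \<kappa>D)
  next
    fix X c assume "X \<in> carrier Q"
    then obtain x where x: "x \<in> carrier Z" "X = \<kappa> x" using \<kappa>(2) by blast
    show "\<Phi> X \<in> carrier Q'" using x by (simp add: \<Phi> \<theta>D)
    show "\<Phi> (c \<odot>\<^bsub>Q\<^esub> X) = c \<odot>\<^bsub>Q'\<^esub> \<Phi> X"
      using x \<Phi>[OF closed(2)[OF x(1)]] by (simp add: \<Phi> \<theta>D \<kappa>D)
  qed
  moreover have "bij_betw \<Phi> (carrier Q) (carrier Q')"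
  proof -
    have "inj_on \<Phi> (carrier Q)"
      unfolding \<kappa>(2)[symmetric] by (auto simp: inj_on_def \<Phi> same)
    moreover have "\<Phi> ` carrier Q = carrier Q'"
      unfolding \<kappa>(2)[symmetric] \<theta>(2)[symmetric] image_image using \<Phi> by (auto cong: image_cong)
    ultimately show ?thesis by (simp add: bij_betw_def)
  qed
  ultimately show ?thesis using \<Phi> by (auto simp: module_iso_def)
qed

section \<open>Cochain complexes\<close>

locale cochain_complex =
  fixes K :: "nat \<Rightarrow> ('k, 'a) module" and d :: "nat \<Rightarrow> 'a \<Rightarrow> 'a"
  assumes opgroup_K: "\<And>n. opgroup (K n)"
    and d_hom: "\<And>n. d n \<in> module_hom (K n) (K (Suc n))"
    and d_d: "\<And>n x. x \<in> carrier (K n) \<Longrightarrow> d (Suc n) (d n x) = \<zero>\<^bsub>K (Suc (Suc n))\<^esub>"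
begin

lemma cocycles_opsub: "opsub (K n) (cocycles K d n)"
proof -
  interpret opgroup "K n" by (rule opgroup_K)
  interpret N: opgroup "K (Suc n)" by (rule opgroup_K)
  show ?thesis
    by (rule opsubI)
      (auto simp: cocycles_def module_homD[OF d_hom] module_hom_zero[OF opgroup_K opgroup_K d_hom]
        module_hom_minus[OF opgroup_K opgroup_K d_hom] N.minus_eq)
qed

lemma coboundaries_opsub: "opsub (K n) (coboundaries K d n)"
proof -
  interpret opgroup "K n" by (rule opgroup_K)
  show ?thesis
  proof (cases n)
    case 0
    interpret O: opgroup "K 0" by (rule opgroup_K)
    show ?thesis unfolding 0 by (intro O.opsubI) (auto simp: coboundaries_def O.minus_eq O.r_neg)
  next
    case (Suc m)
    interpret M: opgroup "K m" by (rule opgroup_K)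
    note h = module_homD[OF d_hom[of m]] module_hom_zero[OF opgroup_K opgroup_K d_hom[of m]]
      module_hom_minus[OF opgroup_K opgroup_K d_hom[of m]]
    show ?thesis
    proof (rule opsubI)
      show "\<zero>\<^bsub>K n\<^esub> \<in> coboundaries K d n"
        using h(4) by (auto simp: coboundaries_def Suc intro: rev_image_eqI)
      fix c x y assume "x \<in> coboundaries K d n"
      then obtain u where u: "u \<in> carrier (K m)" "x = d m u" by (auto simp: coboundaries_def Suc)
      show "c \<odot>\<^bsub>K n\<^esub> x \<in> coboundaries K d n"
        using u h(3)[OF u(1), of c]
        by (auto simp: coboundaries_def Suc intro!: rev_image_eqI[of "c \<odot>\<^bsub>K m\<^esub> u"])
      assume "y \<in> coboundaries K d n"
      then obtain v where v: "v \<in> carrier (K m)" "y = d m v" by (auto simp: coboundaries_def Suc)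
      show "x \<ominus>\<^bsub>K n\<^esub> y \<in> coboundaries K d n"
        using u v h(5)[OF u(1) v(1)]
        by (auto simp: coboundaries_def Suc intro!: rev_image_eqI[of "u \<ominus>\<^bsub>K m\<^esub> v"])
    qed (auto simp: coboundaries_def Suc h(1))
  qed
qed

lemma coboundaries_cocycles: "coboundaries K d n \<subseteq> cocycles K d n"
proof -
  interpret O: opgroup "K 0" by (rule opgroup_K)
  show ?thesis
    using module_homD(1)[OF d_hom] module_hom_zero[OF opgroup_K opgroup_K d_hom]
    by (cases n) (auto simp: coboundaries_def cocycles_def d_d)
qed

sublocale deg: subquotient "K n" "cocycles K d n" "coboundaries K d n" for n
  by (intro subquotient.intro subquotient_axioms.intro opgroup_K cocycles_opsub
      coboundaries_opsub coboundaries_cocycles)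

abbreviation "H \<equiv> cohomology K d"
abbreviation "cl \<equiv> coh_class K d"

lemma H_carrier: "carrier (H n) = cl n ` cocycles K d n"
  unfolding cohomology_def deg.quot_carrier by (simp add: coh_class_def)

lemma H_opgroup: "opgroup (H n)"
  unfolding cohomology_def by (rule deg.quot_opgroup)

lemma cl_hom: "cl n \<in> module_hom (K n\<lparr>carrier := cocycles K d n\<rparr>) (H n)"
  using deg.quot_hom[of n] unfolding cohomology_def coh_class_def .

lemma cl_eq_iff:
  assumes "x \<in> carrier (K n)" "y \<in> carrier (K n)"
  shows "cl n x = cl n y \<longleftrightarrow> x \<ominus>\<^bsub>K n\<^esub> y \<in> coboundaries K d n"
  unfolding coh_class_def by (rule deg.coset_eq_iff[OF coboundaries_opsub assms])

lemma mem_cl: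
  assumes "x \<in> carrier (K n)"
  shows "y \<in> cl n x \<longleftrightarrow> y \<in> carrier (K n) \<and> y \<ominus>\<^bsub>K n\<^esub> x \<in> coboundaries K d n"
  unfolding coh_class_def by (rule deg.mem_coset[OF coboundaries_opsub assms])

lemma cl_self: "x \<in> carrier (K n) \<Longrightarrow> x \<in> cl n x"
  using mem_cl deg.opsub_props(2)[OF coboundaries_opsub] by (simp add: deg.minus_eq deg.r_neg)

lemma cl_zero: "cl n \<zero>\<^bsub>K n\<^esub> = \<zero>\<^bsub>H n\<^esub>"
  unfolding cohomology_def deg.quot_zero coh_class_def ..

lemma cocyclesD: "x \<in> cocycles K d n \<Longrightarrow> x \<in> carrier (K n)"
  by (simp add: cocycles_def)

end

text \<open>
  Linear maps in each degree that commute with the differentials.  The locale \<open>cochain_map\<close> adds that the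
  source and the target are cochain complexes.
\<close>

definition chain_map ::
    "(nat \<Rightarrow> ('k, 'a) module) \<Rightarrow> (nat \<Rightarrow> 'a \<Rightarrow> 'a) \<Rightarrow> (nat \<Rightarrow> ('k, 'b) module) \<Rightarrow> (nat \<Rightarrow> 'b \<Rightarrow> 'b)
      \<Rightarrow> (nat \<Rightarrow> 'a \<Rightarrow> 'b) \<Rightarrow> bool" where
  "chain_map K d K' d' \<phi> \<longleftrightarrow> (\<forall>n. \<phi> n \<in> module_hom (K n) (K' n)) \<and>
     (\<forall>n. \<forall>x\<in>carrier (K n). \<phi> (Suc n) (d n x) = d' n (\<phi> n x))"

locale cochain_map = src: cochain_complex K d + tgt: cochain_complex K' d'
  for K :: "nat \<Rightarrow> ('k, 'a) module" and d and K' :: "nat \<Rightarrow> ('k, 'b) module" and d' +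
  fixes \<phi> assumes \<phi>: "chain_map K d K' d' \<phi>"
begin

lemma hom: "\<phi> n \<in> module_hom (K n) (K' n)"
  and comm: "x \<in> carrier (K n) \<Longrightarrow> \<phi> (Suc n) (d n x) = d' n (\<phi> n x)"
  using \<phi> by (auto simp: chain_map_def)

lemmas homD = module_homD[OF hom]
lemmas hom_zero = module_hom_zero[OF src.opgroup_K tgt.opgroup_K hom]
lemmas hom_minus = module_hom_minus[OF src.opgroup_K tgt.opgroup_K hom]

lemma cocycle: "x \<in> cocycles K d n \<Longrightarrow> \<phi> n x \<in> cocycles K' d' n"
  by (auto simp: cocycles_def homD hom_zero simp flip: comm)

lemma coboundary: "x \<in> coboundaries K d n \<Longrightarrow> \<phi> n x \<in> coboundaries K' d' n"
  by (cases n) (auto simp: coboundaries_def homD hom_zero comm)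

lemma coh_map_cl:
  assumes "x \<in> carrier (K n)"
  shows "coh_map K' d' n (\<phi> n) (coh_class K d n x) = coh_class K' d' n (\<phi> n x)"
proof -
  have "coh_class K' d' n (\<phi> n y) = coh_class K' d' n (\<phi> n x)" if "y \<in> coh_class K d n x" for y
    using that assms src.mem_cl tgt.cl_eq_iff coboundary by (simp add: homD flip: hom_minus)
  then show ?thesis using src.cl_self[OF assms] unfolding coh_map_def by blast
qed

lemma coh_map_hom: "coh_map K' d' n (\<phi> n) \<in> module_hom (src.H n) (tgt.H n)"
proof -
  note s = module_homD[OF src.cl_hom] and t = module_homD[OF tgt.cl_hom]
  note c = src.cocyclesD
  have add: "x \<oplus>\<^bsub>K n\<^esub> y \<in> cocycles K d n" "b \<odot>\<^bsub>K n\<^esub> x \<in> cocycles K d n"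
    if "x \<in> cocycles K d n" "y \<in> cocycles K d n" for b x y
    using src.deg.opsub_props(3,5)[OF src.cocycles_opsub] that by auto
  show ?thesis
    by (rule module_homI)
      (use s t c in \<open>auto simp: src.H_carrier tgt.H_carrier coh_map_cl cocycle add homD
         simp flip: s(2,3) t(2,3)\<close>)
qed

end

lemma finsum_additive:
  assumes "opgroup M" "opgroup N" "finite P" "y \<in> P \<rightarrow> carrier M"
    and h: "\<And>x. x \<in> carrier M \<Longrightarrow> h x \<in> carrier N"
      "\<And>x y. x \<in> carrier M \<Longrightarrow> y \<in> carrier M \<Longrightarrow> h (x \<oplus>\<^bsub>M\<^esub> y) = h x \<oplus>\<^bsub>N\<^esub> h y"
  shows "h (\<Oplus>\<^bsub>M\<^esub>i\<in>P. y i) = (\<Oplus>\<^bsub>N\<^esub>i\<in>P. h (y i))"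
proof -
  interpret M: opgroup M by fact
  interpret N: opgroup N by fact
  have "h \<zero>\<^bsub>M\<^esub> \<oplus>\<^bsub>N\<^esub> h \<zero>\<^bsub>M\<^esub> = h \<zero>\<^bsub>M\<^esub>" using h(2)[of "\<zero>\<^bsub>M\<^esub>" "\<zero>\<^bsub>M\<^esub>"] by simp
  then have "h \<zero>\<^bsub>M\<^esub> = \<zero>\<^bsub>N\<^esub>" using N.add.r_cancel_one h(1) by blast
  with assms(3,4) show ?thesis
    by (induction P) (auto simp: M.finsum_insert N.finsum_insert Pi_iff h)
qed

lemma (in opgroup) opsub_finsum:
  assumes "opsub M B" "finite P" "\<And>i. i \<in> P \<Longrightarrow> y i \<in> B"
  shows "(\<Oplus>i\<in>P. y i) \<in> B"
  using assms(2,3)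
proof (induction P)
  case (insert a P)
  have "y \<in> P \<rightarrow> carrier M" "y a \<in> carrier M" using insert opsub_props(1)[OF assms(1)] by auto
  then show ?case using insert opsub_props(3)[OF assms(1)] by (simp add: finsum_insert)
qed (simp add: opsub_props(2)[OF assms(1)])

text \<open>
  The image in cohomology of a graded submodule \<open>AP\<close>, no matter whether it is a subcomplex: only the
  cocycles that lie in \<open>AP\<close> count.
\<close>

lemma (in cochain_complex) sub_cohomology_image:
  assumes AP: "\<And>n. opsub (K n) (AP n)"
  shows "coh_map K d n (\<lambda>f. f) ` carrier (cohomology (\<lambda>n. K n\<lparr>carrier := AP n\<rparr>) d n)
     = cl n ` (AP n \<inter> cocycles K d n)"
proof -
  let ?K = "\<lambda>n. K n\<lparr>carrier := AP n\<rparr>"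
  have sub: "AP m \<subseteq> carrier (K m)" for m using deg.opsub_props(1)[OF AP] .
  have Z: "cocycles ?K d n = AP n \<inter> cocycles K d n"
    using sub by (auto simp: cocycles_def)
  have B: "coboundaries ?K d n \<subseteq> coboundaries K d n"
    using sub by (cases n) (auto simp: coboundaries_def)
  have "d m \<zero>\<^bsub>K m\<^esub> = \<zero>\<^bsub>K (Suc m)\<^esub>" for m by (rule module_hom_zero[OF opgroup_K opgroup_K d_hom])
  then have B0: "\<zero>\<^bsub>K n\<^esub> \<in> coboundaries ?K d n"
    using deg.opsub_props(2)[OF AP]
    by (cases n) (auto simp: coboundaries_def intro!: rev_image_eqI[of "\<zero>\<^bsub>K _\<^esub>"])
  have "coh_map K d n (\<lambda>f. f) (coboundaries ?K d n +>\<^bsub>K n\<^esub> x) = cl n x" if "x \<in> AP n" for x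
  proof -
    have x: "x \<in> carrier (K n)" using that sub by auto
    have "cl n y = cl n x" if y: "y \<in> coboundaries ?K d n +>\<^bsub>K n\<^esub> x" for y
    proof -
      obtain b where b: "b \<in> coboundaries K d n" "y = b \<oplus>\<^bsub>K n\<^esub> x"
        using y B by (auto simp: a_r_coset_def r_coset_def)
      then have "b \<in> carrier (K n)" using coboundaries_cocycles cocyclesD by blast
      then show ?thesis
        using b x cl_eq_iff[of y n x] by (simp add: deg.minus_eq deg.a_assoc deg.r_neg)
    qed
    moreover have "x \<in> coboundaries ?K d n +>\<^bsub>K n\<^esub> x"
      using B0 x by (force simp: a_r_coset_def r_coset_def)
    ultimately show ?thesis unfolding coh_map_def by blast
  qed
  then have eq: "\<And>x. x \<in> AP n \<inter> cocycles K d n \<Longrightarrow>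
      coh_map K d n (\<lambda>f. f) (coboundaries ?K d n +>\<^bsub>K n\<^esub> x) = cl n x" by blast
  have "carrier (cohomology ?K d n) = (\<lambda>x. coboundaries ?K d n +>\<^bsub>K n\<^esub> x) ` (AP n \<inter> cocycles K d n)"
    by (auto simp: cohomology_def quot_module_def A_RCOSETS_def' Z[symmetric] a_r_coset_def r_coset_def)
  then show ?thesis using eq by (simp add: image_image cong: image_cong_simp)
qed

section \<open>Splitting a complex up to coboundaries\<close>

text \<open>
  In degree \<open>n\<close> the complex \<open>S\<close> is a direct summand of \<open>K\<close>, embedded by \<open>\<psi>\<close> with left inverse \<open>p\<close>.  The other summands come
  from complexes \<open>L i\<close> by maps \<open>t i\<close> that kill \<open>AP i\<close>, with left inverses \<open>q i\<close> modulo \<open>AP i\<close>.  The summands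
  need to exhaust \<open>K\<close> only on cocycles and up to coboundaries.
\<close>

lemma cohomology_splitting:
  fixes K :: "nat \<Rightarrow> ('k, 'a) module" and S :: "nat \<Rightarrow> ('k, 's) module"
    and L :: "'i \<Rightarrow> nat \<Rightarrow> ('k, 'b) module"
  assumes fin: "finite P"
    and \<psi>: "cochain_map S dS K dK \<psi>" and p: "cochain_map K dK S dS p"
    and t: "\<And>i. i \<in> P \<Longrightarrow> cochain_map (L i) (dL i) K dK (t i)"
    and q: "\<And>i. i \<in> P \<Longrightarrow> cochain_map K dK (L i) (dL i) (q i)"
    and AP: "\<And>i n. i \<in> P \<Longrightarrow> opsub (L i n) (AP i n)"
    and p\<psi>: "\<And>x. x \<in> carrier (S n) \<Longrightarrow> p n (\<psi> n x) = x"
    and pt: "\<And>i y. i \<in> P \<Longrightarrow> y \<in> carrier (L i n) \<Longrightarrow> p n (t i n y) = \<zero>\<^bsub>S n\<^esub>"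
    and q\<psi>: "\<And>i x. i \<in> P \<Longrightarrow> x \<in> carrier (S n) \<Longrightarrow> q i n (\<psi> n x) \<in> AP i n"
    and qt: "\<And>i y. i \<in> P \<Longrightarrow> y \<in> carrier (L i n) \<Longrightarrow> y \<ominus>\<^bsub>L i n\<^esub> q i n (t i n y) \<in> AP i n"
    and qt0: "\<And>i j y. i \<in> P \<Longrightarrow> j \<in> P \<Longrightarrow> i \<noteq> j \<Longrightarrow> y \<in> carrier (L i n) \<Longrightarrow>
      q j n (t i n y) = \<zero>\<^bsub>L j n\<^esub>"
    and tAP: "\<And>i y. i \<in> P \<Longrightarrow> y \<in> AP i n \<Longrightarrow> t i n y = \<zero>\<^bsub>K n\<^esub>"
    and retract: "\<And>z. z \<in> cocycles K dK n \<Longrightarrow>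
      (\<psi> n (p n z) \<oplus>\<^bsub>K n\<^esub> (\<Oplus>\<^bsub>K n\<^esub>i\<in>P. t i n (q i n z))) \<ominus>\<^bsub>K n\<^esub> z \<in> coboundaries K dK n"
  defines "Y \<equiv> \<lambda>i. quot_module (cohomology (L i) (dL i) n)
      (coh_map (L i) (dL i) n (\<lambda>f. f) `
        carrier (cohomology (\<lambda>n. L i n\<lparr>carrier := AP i n\<rparr>) (dL i) n))"
  shows "\<exists>\<Phi>\<in>module_iso (prod_module (cohomology S dS n) (direct_sum P Y)) (cohomology K dK n).
    \<forall>X\<in>carrier (cohomology S dS n).
      \<Phi> (X, \<zero>\<^bsub>direct_sum P Y\<^esub>) = coh_map K dK n (\<psi> n) X"
proof -
  interpret K: opgroup "K n"
    by (rule cochain_complex.opgroup_K[OF cochain_map.axioms(2)[OF \<psi>]])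
  interpret S: opgroup "S n"
    by (rule cochain_complex.opgroup_K[OF cochain_map.axioms(1)[OF \<psi>]])
  interpret \<psi>: cochain_map S dS K dK \<psi> by fact
  interpret p: cochain_map K dK S dS p by fact
  have Lc: "cochain_complex (L i) (dL i)" if "i \<in> P" for i
    using t[OF that] by (simp add: cochain_map_def)
  have Lo: "opgroup (L i n)" if "i \<in> P" for i
    using cochain_complex.opgroup_K[OF Lc[OF that]] .
  let ?Z = "\<lambda>i. cocycles (L i) (dL i) n" and ?B = "\<lambda>i. coboundaries (L i) (dL i) n"
  note ZS = S.opsub_props[OF \<psi>.src.cocycles_opsub]
  note BK = K.opsub_props[OF \<psi>.tgt.coboundaries_opsub]
  note ZL = opgroup.opsub_props[OF Lo cochain_complex.cocycles_opsub[OF Lc]]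
  note APs = opgroup.opsub_props[OF Lo AP]
  define cL where "cL i = coh_class (L i) (dL i) n" for i
  define I where "I i = cL i ` (AP i n \<inter> ?Z i)" for i
  define \<kappa>1 where "\<kappa>1 i y = I i +>\<^bsub>cohomology (L i) (dL i) n\<^esub> cL i y" for i y
  have Y: "Y i = quot_module (cohomology (L i) (dL i) n) (I i)" if "i \<in> P" for i
    unfolding Y_def I_def cL_def
    using cochain_complex.sub_cohomology_image[OF Lc[OF that], of "AP i" n] AP[OF that] by simp
  have cLh: "cL i \<in> module_hom (L i n\<lparr>carrier := ?Z i\<rparr>) (cohomology (L i) (dL i) n)" if "i \<in> P" for i
    unfolding cL_def by (rule cochain_complex.cl_hom[OF Lc[OF that]])
  have cLc: "carrier (cohomology (L i) (dL i) n) = cL i ` ?Z i" if "i \<in> P" for i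
    unfolding cL_def by (rule cochain_complex.H_carrier[OF Lc[OF that]])
  have ZLo: "opgroup (L i n\<lparr>carrier := ?Z i\<rparr>)" if "i \<in> P" for i
    by (rule opgroup.opgroup_sub[OF Lo[OF that] cochain_complex.cocycles_opsub[OF Lc[OF that]]])
  have ZLmin: "y \<ominus>\<^bsub>L i n\<lparr>carrier := ?Z i\<rparr>\<^esub> y' = y \<ominus>\<^bsub>L i n\<^esub> y'" if "i \<in> P" "y \<in> ?Z i" "y' \<in> ?Z i" for i y y'
  proof -
    interpret L: opgroup "L i n" by (rule Lo[OF that(1)])
    interpret ZL: opgroup "L i n\<lparr>carrier := ?Z i\<rparr>" by (rule ZLo[OF that(1)])
    have y: "y \<in> carrier (L i n)" "y' \<in> carrier (L i n)" using that ZL(1)[OF that(1) that(1)] by auto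
    have z: "y \<ominus>\<^bsub>L i n\<^esub> y' \<in> ?Z i" using that ZL(4)[OF that(1) that(1)] by auto
    have "(y \<ominus>\<^bsub>L i n\<lparr>carrier := ?Z i\<rparr>\<^esub> y') \<oplus>\<^bsub>L i n\<^esub> y' = y"
      using ZL.a_assoc[of y "\<ominus>\<^bsub>L i n\<lparr>carrier := ?Z i\<rparr>\<^esub> y'" y'] that ZL.l_neg[of y'] ZL.r_zero
        ZL.a_inv_closed[of y']
      by (simp add: ZL.minus_eq)
    moreover have "y \<ominus>\<^bsub>L i n\<lparr>carrier := ?Z i\<rparr>\<^esub> y' \<in> carrier (L i n)"
      using ZL.minus_closed[of y y'] that ZL(1)[OF that(1) that(1)] by auto
    ultimately show ?thesis
      using y by (metis L.minus_eq L.a_assoc L.r_neg L.r_zero L.a_inv_closed)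
  qed
  have I: "opsub (cohomology (L i) (dL i) n) (I i)" if i: "i \<in> P" for i
  proof -
    interpret H: opgroup "cohomology (L i) (dL i) n" by (rule cochain_complex.H_opgroup[OF Lc[OF i]])
    note h = module_homD[OF cLh[OF i]] module_hom_zero[OF ZLo[OF i] H.opgroup_axioms cLh[OF i]]
      module_hom_minus[OF ZLo[OF i] H.opgroup_axioms cLh[OF i]]
    show ?thesis
    proof (rule H.opsubI)
      show "I i \<subseteq> carrier (cohomology (L i) (dL i) n)" by (auto simp: I_def cLc[OF i])
      show "\<zero>\<^bsub>cohomology (L i) (dL i) n\<^esub> \<in> I i"
        using h(4) APs(2)[OF i i] ZL(2)[OF i i] i
        by (auto simp: I_def intro!: image_eqI[of _ _ "\<zero>\<^bsub>L i n\<^esub>"])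
      fix c X X' assume "X \<in> I i"
      then obtain y where y: "y \<in> AP i n" "y \<in> ?Z i" "X = cL i y" by (auto simp: I_def)
      show "c \<odot>\<^bsub>cohomology (L i) (dL i) n\<^esub> X \<in> I i"
        using h(3)[of y c] y APs(5)[OF i i y(1), of c] ZL(5)[OF i i y(2), of c]
        by (auto simp: I_def intro!: image_eqI[of _ _ "c \<odot>\<^bsub>L i n\<^esub> y"])
      assume "X' \<in> I i"
      then obtain y' where y': "y' \<in> AP i n" "y' \<in> ?Z i" "X' = cL i y'" by (auto simp: I_def)
      show "X \<ominus>\<^bsub>cohomology (L i) (dL i) n\<^esub> X' \<in> I i"
        using h(5)[of y y'] y y' APs(4)[OF i i y(1) y'(1)] ZL(4)[OF i i y(2) y'(2)] ZLmin[OF i y(2) y'(2)]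
        by (auto simp: I_def intro!: image_eqI[of _ _ "y \<ominus>\<^bsub>L i n\<^esub> y'"])
    qed
  qed
  have sq: "subquotient (cohomology (L i) (dL i) n) (carrier (cohomology (L i) (dL i) n)) (I i)" if i: "i \<in> P" for i
  proof -
    interpret H: opgroup "cohomology (L i) (dL i) n" by (rule cochain_complex.H_opgroup[OF Lc[OF i]])
    show ?thesis
      by unfold_locales (use H.opsub_carrier I[OF i] H.opsub_props(1)[OF I[OF i]] in auto)
  qed
  have self: "M\<lparr>carrier := carrier M\<rparr> = M" for M :: "('k, 'b set) module" by simp
  note quot = subquotient.quot_carrier[OF sq, unfolded self] subquotient.quot_add[OF sq, unfolded self]
    subquotient.quot_smult[OF sq, unfolded self] subquotient.quot_zero[OF sq, unfolded self]
  have \<kappa>1_mem: "\<kappa>1 i y \<in> carrier (Y i)" if "i \<in> P" "y \<in> ?Z i" for i y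
    using quot(1)[OF that(1)] that by (auto simp: Y \<kappa>1_def cLc)
  have \<kappa>1_add: "\<kappa>1 i (y \<oplus>\<^bsub>L i n\<^esub> y') = \<kappa>1 i y \<oplus>\<^bsub>Y i\<^esub> \<kappa>1 i y'"
    if "i \<in> P" "y \<in> ?Z i" "y' \<in> ?Z i" for i y y'
    using quot(2)[OF that(1), of "cL i y" "cL i y'"] that
      module_homD(2)[OF cLh[OF that(1)], of y y']
    by (simp add: Y \<kappa>1_def cLc)
  have \<kappa>1_smult: "\<kappa>1 i (c \<odot>\<^bsub>L i n\<^esub> y) = c \<odot>\<^bsub>Y i\<^esub> \<kappa>1 i y" if "i \<in> P" "y \<in> ?Z i" for i y c
    using quot(3)[OF that(1), of "cL i y" c] that
      module_homD(3)[OF cLh[OF that(1)], of y c]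
    by (simp add: Y \<kappa>1_def cLc)
  have \<kappa>1_zero: "\<kappa>1 i \<zero>\<^bsub>L i n\<^esub> = \<zero>\<^bsub>Y i\<^esub>" if i: "i \<in> P" for i
    using quot(4)[OF i] cochain_complex.cl_zero[OF Lc[OF i], of n]
    by (simp add: Y i \<kappa>1_def cL_def)
  have \<kappa>1_eq: "\<kappa>1 i y = \<kappa>1 i y' \<longleftrightarrow> (\<exists>a\<in>AP i n \<inter> ?Z i. (y \<ominus>\<^bsub>L i n\<^esub> y') \<ominus>\<^bsub>L i n\<^esub> a \<in> ?B i)"
    if i: "i \<in> P" and y: "y \<in> ?Z i" "y' \<in> ?Z i" for i y y'
  proof -
    interpret H: opgroup "cohomology (L i) (dL i) n" by (rule cochain_complex.H_opgroup[OF Lc[OF i]])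
    have m: "y \<ominus>\<^bsub>L i n\<^esub> y' \<in> ?Z i" using ZL(4)[OF i i y] .
    have "\<kappa>1 i y = \<kappa>1 i y' \<longleftrightarrow> cL i y \<ominus>\<^bsub>cohomology (L i) (dL i) n\<^esub> cL i y' \<in> I i"
      unfolding \<kappa>1_def using y by (intro H.coset_eq_iff I i) (auto simp: cLc i)
    also have "cL i y \<ominus>\<^bsub>cohomology (L i) (dL i) n\<^esub> cL i y' = cL i (y \<ominus>\<^bsub>L i n\<^esub> y')"
      using module_hom_minus[OF ZLo[OF i] H.opgroup_axioms cLh[OF i], of y y'] y ZLmin[OF i y] by simp
    also have "\<dots> \<in> I i \<longleftrightarrow> (\<exists>a\<in>AP i n \<inter> ?Z i. cL i (y \<ominus>\<^bsub>L i n\<^esub> y') = cL i a)"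
      by (auto simp: I_def)
    also have "\<dots> \<longleftrightarrow> (\<exists>a\<in>AP i n \<inter> ?Z i. (y \<ominus>\<^bsub>L i n\<^esub> y') \<ominus>\<^bsub>L i n\<^esub> a \<in> ?B i)"
      unfolding cL_def using cochain_complex.cl_eq_iff[OF Lc[OF i]] m ZL(1)[OF i i] by blast
    finally show ?thesis .
  qed
  \<comment> \<open>Pairs of cocycles \<open>ZM\<close> map onto both sides: by \<open>\<kappa>\<close> onto the direct sum, by \<open>\<theta>\<close> onto the cohomology of \<open>K\<close>.
    The maps \<open>\<kappa>\<close> and \<open>\<theta>\<close> turn out to have the same fibres.\<close>
  define T where "T y = (\<Oplus>\<^bsub>K n\<^esub>i\<in>P. t i n (y i))" for y
  define F where "F = (\<lambda>(x, y). \<psi> n x \<oplus>\<^bsub>K n\<^esub> T y)"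
  define ZM where "ZM = prod_module (S n\<lparr>carrier := cocycles S dS n\<rparr>) (direct_sum P (\<lambda>i. L i n\<lparr>carrier := ?Z i\<rparr>))"
  define \<kappa> where "\<kappa> = (\<lambda>(x, y). (coh_class S dS n x, \<lambda>i\<in>P. \<kappa>1 i (y i)))"
  define \<theta> where "\<theta> z = coh_class K dK n (F z)" for z
  have ZMc: "carrier ZM = cocycles S dS n \<times> (\<Pi>\<^sub>E i\<in>P. ?Z i)"
    using fin by (auto simp: ZM_def prod_module_def direct_sum_def)
  note th = module_homD[OF cochain_map.hom[OF t]]
  have tK: "(\<lambda>i. t i n (y i)) \<in> P \<rightarrow> carrier (K n)" if "\<And>i. i \<in> P \<Longrightarrow> y i \<in> ?Z i" for y
    using that th(1) ZL(1) by blast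
  have TZ: "T y \<in> cocycles K dK n" if "\<And>i. i \<in> P \<Longrightarrow> y i \<in> ?Z i" for y
    unfolding T_def using that cochain_map.cocycle[OF t]
    by (intro K.opsub_finsum \<psi>.tgt.cocycles_opsub fin) auto
  have FZ: "F z \<in> cocycles K dK n" if "z \<in> carrier ZM" for z
    using that \<psi>.cocycle TZ K.opsub_props(3)[OF \<psi>.tgt.cocycles_opsub]
    by (auto simp: ZMc F_def PiE_iff)
  have Tadd: "T (\<lambda>i\<in>P. y i \<oplus>\<^bsub>L i n\<^esub> y' i) = T y \<oplus>\<^bsub>K n\<^esub> T y'"
    if "\<And>i. i \<in> P \<Longrightarrow> y i \<in> ?Z i" "\<And>i. i \<in> P \<Longrightarrow> y' i \<in> ?Z i" for y y'
  proof -
    have "T (\<lambda>i\<in>P. y i \<oplus>\<^bsub>L i n\<^esub> y' i) = (\<Oplus>\<^bsub>K n\<^esub>i\<in>P. t i n (y i) \<oplus>\<^bsub>K n\<^esub> t i n (y' i))"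
      unfolding T_def using that th ZL(1) by (intro K.finsum_cong') (auto simp: subset_iff)
    also have "\<dots> = T y \<oplus>\<^bsub>K n\<^esub> T y'"
      unfolding T_def by (rule K.finsum_addf) (use tK that in blast)+
    finally show ?thesis .
  qed
  have Tsmult: "T (\<lambda>i\<in>P. c \<odot>\<^bsub>L i n\<^esub> y i) = c \<odot>\<^bsub>K n\<^esub> T y"
    if "\<And>i. i \<in> P \<Longrightarrow> y i \<in> ?Z i" for c y
  proof -
    have "T (\<lambda>i\<in>P. c \<odot>\<^bsub>L i n\<^esub> y i) = (\<Oplus>\<^bsub>K n\<^esub>i\<in>P. c \<odot>\<^bsub>K n\<^esub> t i n (y i))"
      unfolding T_def using that th ZL(1) by (intro K.finsum_cong') (auto simp: subset_iff)
    also have "\<dots> = c \<odot>\<^bsub>K n\<^esub> T y"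
      unfolding T_def using tK[OF that]
      by (intro finsum_additive[symmetric] K.opgroup_axioms fin) (auto simp: K.smult_add)
    finally show ?thesis .
  qed
  have Fhom: "F z \<oplus>\<^bsub>K n\<^esub> F z' = F (z \<oplus>\<^bsub>ZM\<^esub> z')" "c \<odot>\<^bsub>K n\<^esub> F z = F (c \<odot>\<^bsub>ZM\<^esub> z)"
    if "z \<in> carrier ZM" "z' \<in> carrier ZM" for z z' c
  proof -
    obtain x y x' y' where z: "z = (x, y)" "z' = (x', y')" by fastforce
    have mem: "x \<in> carrier (S n)" "x' \<in> carrier (S n)" "T y \<in> carrier (K n)" "T y' \<in> carrier (K n)"
      using that TZ \<psi>.tgt.cocyclesD \<psi>.src.cocyclesD by (auto simp: z ZMc PiE_iff)
    have yZ: "\<And>i. i \<in> P \<Longrightarrow> y i \<in> ?Z i" "\<And>i. i \<in> P \<Longrightarrow> y' i \<in> ?Z i"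
      using that by (auto simp: z ZMc PiE_iff)
    show "F z \<oplus>\<^bsub>K n\<^esub> F z' = F (z \<oplus>\<^bsub>ZM\<^esub> z')"
      using mem Tadd[OF yZ] \<psi>.homD
      by (simp add: z F_def ZM_def prod_module_def direct_sum_def K.a_ac)
    show "c \<odot>\<^bsub>K n\<^esub> F z = F (c \<odot>\<^bsub>ZM\<^esub> z)"
      using mem Tsmult[OF yZ(1), of c] \<psi>.homD
      by (simp add: z F_def ZM_def prod_module_def direct_sum_def K.smult_add)
  qed
  have ZMo: "z \<oplus>\<^bsub>ZM\<^esub> z' \<in> carrier ZM" "c \<odot>\<^bsub>ZM\<^esub> z \<in> carrier ZM"
    if "z \<in> carrier ZM" "z' \<in> carrier ZM" for z z' c
    using that ZS(3,5) ZL(3,5) unfolding ZMc by (auto simp: ZM_def prod_module_def direct_sum_def PiE_iff)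
  have \<theta>hom: "\<theta> \<in> module_hom ZM (cohomology K dK n)"
    by (rule module_homI)
      (use FZ module_homD[OF \<psi>.tgt.cl_hom[of n]] in
        \<open>auto simp: \<theta>_def \<psi>.tgt.H_carrier simp flip: Fhom\<close>)
  have \<kappa>hom: "\<kappa> \<in> module_hom ZM (prod_module (cohomology S dS n) (direct_sum P Y))"
    using fin \<kappa>1_mem \<kappa>1_add \<kappa>1_smult module_homD[OF \<psi>.src.cl_hom[of n]]
    by (intro module_homI)
      (auto simp: ZMc \<kappa>_def prod_module_def direct_sum_def ZM_def \<psi>.src.H_carrier restrict_def PiE_iff fun_eq_iff extensional_def)
  have kernel: "F (x, y) \<in> coboundaries K dK n \<longleftrightarrow> x \<in> coboundaries S dS n \<and>
      (\<forall>i\<in>P. \<exists>a\<in>AP i n \<inter> ?Z i. y i \<ominus>\<^bsub>L i n\<^esub> a \<in> ?B i)" (is "?l \<longleftrightarrow> ?r")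
    if x: "x \<in> cocycles S dS n" and y: "\<And>i. i \<in> P \<Longrightarrow> y i \<in> ?Z i" for x y
  proof
    have xS: "x \<in> carrier (S n)" and TK: "T y \<in> carrier (K n)"
      using x \<psi>.src.cocyclesD TZ[OF y] \<psi>.tgt.cocyclesD by auto
    assume l: ?l
    have "p n (T y) = (\<Oplus>\<^bsub>S n\<^esub>i\<in>P. p n (t i n (y i)))"
      unfolding T_def using tK[OF y] p.homD
      by (intro finsum_additive K.opgroup_axioms S.opgroup_axioms fin) auto
    also have "\<dots> = (\<Oplus>\<^bsub>S n\<^esub>i\<in>P. \<zero>\<^bsub>S n\<^esub>)"
      using y ZL(1) by (intro S.finsum_cong') (auto simp: pt subset_iff)
    finally have "p n (F (x, y)) = x"
      using xS TK \<psi>.homD(1) by (simp add: F_def p.homD p\<psi>)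
    moreover have "\<exists>a\<in>AP i n \<inter> ?Z i. y i \<ominus>\<^bsub>L i n\<^esub> a \<in> ?B i" if i: "i \<in> P" for i
    proof -
      interpret L: opgroup "L i n" by (rule Lo[OF i])
      interpret q: cochain_map K dK "L i" "dL i" "q i" by (rule q[OF i])
      interpret t: cochain_map "L i" "dL i" K dK "t i" by (rule t[OF i])
      have yi: "y i \<in> carrier (L i n)" using y[OF i] ZL(1)[OF i i] by auto
      have "q i n (T y) = (\<Oplus>\<^bsub>L i n\<^esub>j\<in>P. q i n (t j n (y j)))"
        unfolding T_def using tK[OF y] q.homD
        by (intro finsum_additive K.opgroup_axioms L.opgroup_axioms fin) auto
      also have "\<dots> = (\<Oplus>\<^bsub>L i n\<^esub>j\<in>P. if i = j then q i n (t j n (y j)) else \<zero>\<^bsub>L i n\<^esub>)"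
        using y ZL(1) q.homD(1) i th(1) by (intro L.finsum_cong') (auto simp: qt0 subset_iff)
      also have "\<dots> = q i n (t i n (y i))"
        using i fin y ZL(1) q.homD(1) th(1)
        by (intro L.add.finprod_singleton[simplified finsum_def[symmetric]]) (auto simp: subset_iff)
      finally have qF: "q i n (F (x, y)) = q i n (\<psi> n x) \<oplus>\<^bsub>L i n\<^esub> q i n (t i n (y i))"
        using xS TK \<psi>.homD(1) by (simp add: F_def q.homD)
      \<comment> \<open>chosen so that \<open>y i\<close> minus \<open>a\<close> is the coboundary \<open>q i n (F (x, y))\<close>\<close>
      define a where "a = (y i \<ominus>\<^bsub>L i n\<^esub> q i n (t i n (y i))) \<ominus>\<^bsub>L i n\<^esub> q i n (\<psi> n x)"
      have "a \<in> AP i n" unfolding a_def using APs(4)[OF i i] qt[OF i yi] q\<psi>[OF i xS] by blast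
      moreover have "a \<in> ?Z i"
        unfolding a_def using ZL(4)[OF i i] y[OF i] q.cocycle t.cocycle \<psi>.cocycle[OF x] by blast
      moreover have "y i \<ominus>\<^bsub>L i n\<^esub> a = q i n (F (x, y))"
      proof -
        have mem: "q i n (t i n (y i)) \<in> carrier (L i n)" "q i n (\<psi> n x) \<in> carrier (L i n)"
          using yi xS q.homD t.homD \<psi>.homD by auto
        show ?thesis unfolding qF a_def using mem yi
          by (simp add: L.minus_eq L.minus_add L.a_ac L.r_neg2 L.r_neg)
      qed
      ultimately show ?thesis using q.coboundary[OF l] by (intro bexI[of _ a]) simp_all
    qed
    ultimately show ?r using p.coboundary[OF l] by auto
  next
    assume r: ?r
    have "t i n (y i) \<in> coboundaries K dK n" if i: "i \<in> P" for i
    proof -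
      interpret t: cochain_map "L i" "dL i" K dK "t i" by (rule t[OF i])
      obtain a where a: "a \<in> AP i n" "a \<in> ?Z i" "y i \<ominus>\<^bsub>L i n\<^esub> a \<in> ?B i" using r i by blast
      have "t i n (y i \<ominus>\<^bsub>L i n\<^esub> a) = t i n (y i)"
        using t.hom_minus[of "y i" n a] y[OF i] a ZL(1)[OF i i] t.homD(1) tAP[OF i a(1)]
        by (auto simp: subset_iff K.minus_eq)
      then show ?thesis using t.coboundary[OF a(3)] by simp
    qed
    then have "T y \<in> coboundaries K dK n"
      unfolding T_def by (intro K.opsub_finsum \<psi>.tgt.coboundaries_opsub fin)
    then show ?l using r \<psi>.coboundary BK(3) by (simp add: F_def)
  qed
  have same: "\<kappa> z = \<kappa> z' \<longleftrightarrow> \<theta> z = \<theta> z'" if z: "z \<in> carrier ZM" "z' \<in> carrier ZM" for z z'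
  proof -
    obtain x y x' y' where e: "z = (x, y)" "z' = (x', y')" by fastforce
    have x: "x \<in> cocycles S dS n" "x' \<in> cocycles S dS n"
      and y: "\<And>i. i \<in> P \<Longrightarrow> y i \<in> ?Z i" "\<And>i. i \<in> P \<Longrightarrow> y' i \<in> ?Z i"
      using z by (auto simp: e ZMc PiE_iff)
    have xS: "x \<in> carrier (S n)" "x' \<in> carrier (S n)" using x \<psi>.src.cocyclesD by auto
    define y'' where "y'' = (\<lambda>i\<in>P. y i \<ominus>\<^bsub>L i n\<^esub> y' i)"
    have y'': "\<And>i. i \<in> P \<Longrightarrow> y'' i \<in> ?Z i" using y ZL(4) by (auto simp: y''_def)
    have "T y = T (\<lambda>i\<in>P. y'' i \<oplus>\<^bsub>L i n\<^esub> y' i)"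
    proof -
      have "y'' i \<oplus>\<^bsub>L i n\<^esub> y' i = y i" if i: "i \<in> P" for i
      proof -
        interpret L: opgroup "L i n" by (rule Lo[OF i])
        have "y i \<in> carrier (L i n)" "y' i \<in> carrier (L i n)" using y[OF i] ZL(1)[OF i i] by auto
        then show ?thesis using i by (simp add: y''_def L.minus_eq L.a_assoc L.l_neg)
      qed
      then show ?thesis unfolding T_def
        using tK[OF y(1)] by (intro K.finsum_cong') auto
    qed
    then have Ty: "T y = T y'' \<oplus>\<^bsub>K n\<^esub> T y'" using Tadd[OF y'' y(2)] by simp
    have TK: "T y'' \<in> carrier (K n)" "T y' \<in> carrier (K n)"
      using TZ[OF y''] TZ[OF y(2)] \<psi>.tgt.cocyclesD by auto
    have cancel: "c \<oplus>\<^bsub>K n\<^esub> (a \<oplus>\<^bsub>K n\<^esub> (\<ominus>\<^bsub>K n\<^esub> c \<oplus>\<^bsub>K n\<^esub> b)) = a \<oplus>\<^bsub>K n\<^esub> b"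
      if "a \<in> carrier (K n)" "b \<in> carrier (K n)" "c \<in> carrier (K n)" for a b c
      using that K.a_lcomm[of c a "\<ominus>\<^bsub>K n\<^esub> c \<oplus>\<^bsub>K n\<^esub> b"] by (simp add: K.r_neg2)
    have diff: "F z \<ominus>\<^bsub>K n\<^esub> F z' = F (x \<ominus>\<^bsub>S n\<^esub> x', y'')"
      using xS TK \<psi>.homD(1)
      by (simp add: cancel e F_def Ty \<psi>.hom_minus K.minus_eq K.minus_add K.a_ac K.r_neg K.r_neg1)
    have "\<theta> z = \<theta> z' \<longleftrightarrow> F (x \<ominus>\<^bsub>S n\<^esub> x', y'') \<in> coboundaries K dK n"
      unfolding \<theta>_def using FZ[OF z(1)] FZ[OF z(2)] \<psi>.tgt.cocyclesD
      by (simp add: \<psi>.tgt.cl_eq_iff diff)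
    also have "\<dots> \<longleftrightarrow> x \<ominus>\<^bsub>S n\<^esub> x' \<in> coboundaries S dS n \<and>
      (\<forall>i\<in>P. \<exists>a\<in>AP i n \<inter> ?Z i. y'' i \<ominus>\<^bsub>L i n\<^esub> a \<in> ?B i)"
      by (rule kernel) (use ZS(4) x y'' in auto)
    also have "\<dots> \<longleftrightarrow> coh_class S dS n x = coh_class S dS n x' \<and> (\<forall>i\<in>P. \<kappa>1 i (y i) = \<kappa>1 i (y' i))"
      using xS y by (simp add: \<psi>.src.cl_eq_iff \<kappa>1_eq y''_def)
    also have "\<dots> \<longleftrightarrow> \<kappa> z = \<kappa> z'"
      by (auto simp: \<kappa>_def e restrict_def fun_eq_iff)
    finally show ?thesis by simp
  qed
  have \<kappa>surj: "\<kappa> ` carrier ZM = carrier (prod_module (cohomology S dS n) (direct_sum P Y))"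
  proof
    show "\<kappa> ` carrier ZM \<subseteq> carrier (prod_module (cohomology S dS n) (direct_sum P Y))"
      using module_homD(1)[OF \<kappa>hom] by blast
    show "carrier (prod_module (cohomology S dS n) (direct_sum P Y)) \<subseteq> \<kappa> ` carrier ZM"
    proof
      fix W assume "W \<in> carrier (prod_module (cohomology S dS n) (direct_sum P Y))"
      then obtain X V where W: "W = (X, V)" "X \<in> carrier (cohomology S dS n)" "V \<in> (\<Pi>\<^sub>E i\<in>P. carrier (Y i))"
        by (auto simp: prod_module_def direct_sum_def)
      obtain x where x: "x \<in> cocycles S dS n" "X = coh_class S dS n x"
        using W(2) by (auto simp: \<psi>.src.H_carrier)
      have "\<exists>y. y \<in> ?Z i \<and> V i = \<kappa>1 i y" if i: "i \<in> P" for i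
      proof -
        have "V i \<in> carrier (Y i)" using W(3) i by auto
        then show ?thesis unfolding Y[OF i] quot(1)[OF i] cLc[OF i] \<kappa>1_def by auto
      qed
      then obtain y where y: "\<And>i. i \<in> P \<Longrightarrow> y i \<in> ?Z i \<and> V i = \<kappa>1 i (y i)" by metis
      have "W = \<kappa> (x, \<lambda>i\<in>P. y i)"
        using W(1,3) x y by (auto simp: \<kappa>_def PiE_iff extensional_def fun_eq_iff)
      moreover have "(x, \<lambda>i\<in>P. y i) \<in> carrier ZM" using x y by (auto simp: ZMc)
      ultimately show "W \<in> \<kappa> ` carrier ZM" by blast
    qed
  qed
  have \<theta>surj: "\<theta> ` carrier ZM = carrier (cohomology K dK n)"
  proof
    show "\<theta> ` carrier ZM \<subseteq> carrier (cohomology K dK n)" using module_homD(1)[OF \<theta>hom] by blast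
    show "carrier (cohomology K dK n) \<subseteq> \<theta> ` carrier ZM"
    proof
      fix W assume "W \<in> carrier (cohomology K dK n)"
      then obtain z where z: "z \<in> cocycles K dK n" "W = coh_class K dK n z"
        by (auto simp: \<psi>.tgt.H_carrier)
      define w where "w = (p n z, \<lambda>i\<in>P. q i n z)"
      have w: "w \<in> carrier ZM" using z p.cocycle cochain_map.cocycle[OF q] by (auto simp: w_def ZMc)
      have "T (\<lambda>i\<in>P. q i n z) = (\<Oplus>\<^bsub>K n\<^esub>i\<in>P. t i n (q i n z))"
        unfolding T_def using tK[of "\<lambda>i. q i n z"] z cochain_map.cocycle[OF q]
        by (intro K.finsum_cong') auto
      then have "F w \<ominus>\<^bsub>K n\<^esub> z \<in> coboundaries K dK n"
        using retract[OF z(1)] by (simp add: w_def F_def)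
      then have "\<theta> w = W"
        using FZ[OF w] z \<psi>.tgt.cocyclesD by (simp add: \<theta>_def \<psi>.tgt.cl_eq_iff)
      then show "W \<in> \<theta> ` carrier ZM" using w by blast
    qed
  qed
  obtain \<Phi> where \<Phi>: "\<Phi> \<in> module_iso (prod_module (cohomology S dS n) (direct_sum P Y)) (cohomology K dK n)"
    "\<And>z. z \<in> carrier ZM \<Longrightarrow> \<Phi> (\<kappa> z) = \<theta> z"
  proof -
    have "\<exists>\<Phi>\<in>module_iso (prod_module (cohomology S dS n) (direct_sum P Y)) (cohomology K dK n).
        \<forall>z\<in>carrier ZM. \<Phi> (\<kappa> z) = \<theta> z"
      by (rule iso_of_presentations[OF \<kappa>hom \<kappa>surj \<theta>hom \<theta>surj]) (use ZMo same in blast)+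
    then show thesis using that by blast
  qed
  have "\<Phi> (X, \<zero>\<^bsub>direct_sum P Y\<^esub>) = coh_map K dK n (\<psi> n) X" if X: "X \<in> carrier (cohomology S dS n)" for X
  proof -
    obtain x where x: "x \<in> cocycles S dS n" "X = coh_class S dS n x"
      using X by (auto simp: \<psi>.src.H_carrier)
    define z where "z = (x, \<lambda>i\<in>P. \<zero>\<^bsub>L i n\<^esub>)"
    have z: "z \<in> carrier ZM" using x ZL(2) by (auto simp: z_def ZMc)
    have "T (\<lambda>i\<in>P. \<zero>\<^bsub>L i n\<^esub>) = (\<Oplus>\<^bsub>K n\<^esub>i\<in>P. \<zero>\<^bsub>K n\<^esub>)"
      unfolding T_def using cochain_map.hom_zero[OF t] by (intro K.finsum_cong') auto
    then have "F z = \<psi> n x"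
      using x \<psi>.homD(1) \<psi>.src.cocyclesD by (simp add: z_def F_def)
    then have "\<theta> z = coh_map K dK n (\<psi> n) X"
      using \<psi>.coh_map_cl x \<psi>.src.cocyclesD by (simp add: \<theta>_def)
    moreover have "\<kappa> z = (X, \<zero>\<^bsub>direct_sum P Y\<^esub>)"
      by (auto simp: z_def \<kappa>_def x direct_sum_def \<kappa>1_zero restrict_def fun_eq_iff)
    ultimately show ?thesis using \<Phi>(2)[OF z] by simp
  qed
  then show ?thesis using \<Phi>(1) by blast
qed

section \<open>Linear and multilinear extension over free modules\<close>

definition scale :: "'k \<Rightarrow> ('m \<Rightarrow>\<^sub>0 'k::{comm_ring,comm_monoid_mult}) \<Rightarrow> ('m \<Rightarrow>\<^sub>0 'k)" where
  "scale c = Poly_Mapping.map ((*) c)"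

lemma lookup_scale [simp]: "Poly_Mapping.lookup (scale c x) a = c * Poly_Mapping.lookup x a"
  by (simp add: scale_def Poly_Mapping.map.rep_eq when_def)

lemma scale_simps [simp]:
  "scale c 0 = 0" "scale 0 x = 0" "scale 1 x = x" "scale c (- x) = - scale c x"
  "scale (- c) x = - scale c x"
  "scale c (Poly_Mapping.single a b) = Poly_Mapping.single a (c * b)"
  "scale b (scale c x) = scale (b * c) x"
  by (rule poly_mapping_eqI; simp add: lookup_single when_def mult.assoc)+

lemma scale_add: "scale c (x + y) = scale c x + scale c y"
  and scale_add_left: "scale (b + c) x = scale b x + scale c x"
  and scale_diff: "scale c (x - y) = scale c x - scale c y"
  by (rule poly_mapping_eqI; simp add: lookup_add lookup_minus algebra_simps)+

lemma scale_sum: "scale c (\<Sum>i\<in>I. x i) = (\<Sum>i\<in>I. scale c (x i))"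
  by (induction I rule: infinite_finite_induct) (auto simp: scale_add)

lemma keys_scale: "Poly_Mapping.keys (scale c x) \<subseteq> Poly_Mapping.keys x"
  by (auto simp: in_keys_iff)

lemma keys_add_subset: "Poly_Mapping.keys x \<subseteq> S \<Longrightarrow> Poly_Mapping.keys y \<subseteq> S \<Longrightarrow>
    Poly_Mapping.keys (x + y :: 'm \<Rightarrow>\<^sub>0 'k::ab_group_add) \<subseteq> S"
  by (rule order_trans[OF Poly_Mapping.keys_add]) simp

lemma keys_diff_subset: "Poly_Mapping.keys x \<subseteq> S \<Longrightarrow> Poly_Mapping.keys y \<subseteq> S \<Longrightarrow>
    Poly_Mapping.keys (x - y :: 'm \<Rightarrow>\<^sub>0 'k::ab_group_add) \<subseteq> S"
  using keys_add_subset[of x S "- y"] by simp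

lemma keys_sum_subset: "(\<And>i. i \<in> I \<Longrightarrow> Poly_Mapping.keys (x i) \<subseteq> S) \<Longrightarrow>
    Poly_Mapping.keys (\<Sum>i\<in>I. x i :: 'm \<Rightarrow>\<^sub>0 'k::ab_group_add) \<subseteq> S"
  by (induction I rule: infinite_finite_induct) (simp_all add: keys_add_subset)

lemma keys_scale_subset: "Poly_Mapping.keys x \<subseteq> S \<Longrightarrow> Poly_Mapping.keys (scale c x) \<subseteq> S"
  by (rule order_trans[OF keys_scale])

lemma keys_single_subset: "a \<in> S \<Longrightarrow> Poly_Mapping.keys (Poly_Mapping.single a b) \<subseteq> S"
  by auto

lemmas keys_subset = keys_add_subset keys_diff_subset keys_sum_subset keys_scale_subset keys_single_subset

text \<open>The linear extension of a function on the basis.\<close>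

definition lext :: "('a \<Rightarrow> ('b \<Rightarrow>\<^sub>0 'k)) \<Rightarrow> ('a \<Rightarrow>\<^sub>0 'k) \<Rightarrow> ('b \<Rightarrow>\<^sub>0 'k::{comm_ring,comm_monoid_mult})" where
  "lext g x = (\<Sum>a\<in>Poly_Mapping.keys x. scale (Poly_Mapping.lookup x a) (g a))"

lemma lext_superset:
  assumes "finite T" "Poly_Mapping.keys x \<subseteq> T"
  shows "lext g x = (\<Sum>a\<in>T. scale (Poly_Mapping.lookup x a) (g a))"
  unfolding lext_def using assms by (intro sum.mono_neutral_left) (auto simp: in_keys_iff)

lemma lext_add: "lext g (x + y) = lext g x + lext g y"
proof -
  let ?T = "Poly_Mapping.keys x \<union> Poly_Mapping.keys y"
  have "Poly_Mapping.keys (x + y) \<subseteq> ?T" by (rule Poly_Mapping.keys_add)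
  then show ?thesis
    by (simp add: lext_superset[of ?T] lookup_add scale_add_left sum.distrib)
qed

lemma lext_scale: "lext g (scale c x) = scale c (lext g x)"
  using keys_scale[of c x]
  by (simp add: lext_superset[of "Poly_Mapping.keys x"] scale_sum)

lemma lext_single [simp]: "lext g (Poly_Mapping.single a c) = scale c (g a)"
  by (subst lext_superset[of "{a}"]) auto

lemma lext_zero [simp]: "lext g 0 = 0"
  by (simp add: lext_def)

lemma lext_uminus: "lext g (- x) = - lext g x"
  using lext_scale[of g "-1" x] by simp

lemma lext_diff: "lext g (x - y) = lext g x - lext g y"
  using lext_add[of g x "-y"] by (simp add: lext_uminus)

lemma lext_sum: "lext g (\<Sum>i\<in>I. x i) = (\<Sum>i\<in>I. lext g (x i))"
  by (induction I rule: infinite_finite_induct) (auto simp: lext_add)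

lemma lext_fun_add: "lext (\<lambda>a. g a + h a) x = lext g x + lext h x"
  by (simp add: lext_def scale_add sum.distrib)

lemma lext_fun_scale: "lext (\<lambda>a. scale c (g a)) x = scale c (lext g x)"
  by (simp add: lext_def scale_sum mult.commute)

lemma lext_fun_zero [simp]: "lext (\<lambda>a. 0) x = 0"
  by (simp add: lext_def)

lemma lext_fun_sum: "lext (\<lambda>a. \<Sum>i\<in>I. g i a) x = (\<Sum>i\<in>I. lext (g i) x)"
  by (induction I rule: infinite_finite_induct) (auto simp: lext_fun_add)

lemma lext_cong: "(\<And>a. a \<in> Poly_Mapping.keys x \<Longrightarrow> g a = h a) \<Longrightarrow> lext g x = lext h x"
  by (simp add: lext_def)

lemma lext_lext: "lext f (lext g x) = lext (\<lambda>a. lext f (g a)) x"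
  by (subst lext_def[of g]) (simp add: lext_sum lext_scale lext_def[of "\<lambda>a. lext f (g a)"])

lemma lext_basis: "lext basis x = x"
proof (rule poly_mapping_eqI)
  fix b
  have "Poly_Mapping.lookup (lext basis x) b =
      (\<Sum>a\<in>Poly_Mapping.keys x. if a = b then Poly_Mapping.lookup x a else 0)"
    by (simp add: lext_def lookup_sum lookup_single when_def)
  then show "Poly_Mapping.lookup (lext basis x) b = Poly_Mapping.lookup x b"
    by (auto simp: in_keys_iff)
qed

lemma keys_lext:
  assumes "\<And>a. a \<in> Poly_Mapping.keys x \<Longrightarrow> Poly_Mapping.keys (g a) \<subseteq> S"
  shows "Poly_Mapping.keys (lext g x) \<subseteq> S"
  unfolding lext_def by (intro keys_subset assms)

lemma linear_eq_lext:
  fixes f :: "('a \<Rightarrow>\<^sub>0 'k) \<Rightarrow> ('b \<Rightarrow>\<^sub>0 'k::{comm_ring,comm_monoid_mult})"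
  assumes add: "\<And>x y. Poly_Mapping.keys x \<subseteq> S \<Longrightarrow> Poly_Mapping.keys y \<subseteq> S \<Longrightarrow> f (x + y) = f x + f y"
    and scale: "\<And>c x. Poly_Mapping.keys x \<subseteq> S \<Longrightarrow> f (scale c x) = scale c (f x)"
    and x: "Poly_Mapping.keys x \<subseteq> S"
  shows "f x = lext (\<lambda>a. f (basis a)) x"
proof -
  have sum: "f (\<Sum>a\<in>T. scale (c a) (basis a)) = (\<Sum>a\<in>T. scale (c a) (f (basis a)))"
    if "finite T" "T \<subseteq> S" for T c
    using that
  proof (induction T)
    case empty
    show ?case using scale[of 0 0] by simp
  next
    case (insert a T)
    have "Poly_Mapping.keys (basis a :: 'a \<Rightarrow>\<^sub>0 'k) \<subseteq> S" using insert by auto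
    moreover have "Poly_Mapping.keys (\<Sum>a\<in>T. scale (c a) (basis a)) \<subseteq> S"
      using insert by (intro keys_subset) auto
    ultimately show ?case using insert by (simp del: scale_simps add: add scale keys_subset)
  qed
  have "x = (\<Sum>a\<in>Poly_Mapping.keys x. scale (Poly_Mapping.lookup x a) (basis a))"
    using lext_basis[of x] unfolding lext_def by simp
  then have "f x = f (\<Sum>a\<in>Poly_Mapping.keys x. scale (Poly_Mapping.lookup x a) (basis a))" by simp
  also have "\<dots> = lext (\<lambda>a. f (basis a)) x" unfolding lext_def using x by (intro sum) auto
  finally show ?thesis .
qed

text \<open>The multilinear extension of a function of lists of basis elements.\<close>

fun ml :: "('a list \<Rightarrow> ('b \<Rightarrow>\<^sub>0 'k)) \<Rightarrow> ('a \<Rightarrow>\<^sub>0 'k) list \<Rightarrow> ('b \<Rightarrow>\<^sub>0 'k::{comm_ring,comm_monoid_mult})" where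
  "ml F [] = F []"
| "ml F (x # xs) = lext (\<lambda>a. ml (\<lambda>as. F (a # as)) xs) x"

lemma ml_cong:
  assumes "\<And>as. list_all2 (\<lambda>a x. a \<in> Poly_Mapping.keys x) as xs \<Longrightarrow> F as = G as"
  shows "ml F xs = ml G xs"
  using assms
proof (induction xs arbitrary: F G)
  case (Cons x xs)
  show ?case
    unfolding ml.simps by (intro lext_cong Cons.IH Cons.prems) simp
qed simp

lemma ml_cong_length: "(\<And>as. length as = length xs \<Longrightarrow> F as = G as) \<Longrightarrow> ml F xs = ml G xs"
  by (rule ml_cong) (simp add: list_all2_lengthD)

lemma ml_add: "ml (\<lambda>as. F as + G as) xs = ml F xs + ml G xs"
  by (induction xs arbitrary: F G) (auto simp: lext_fun_add)

lemma ml_scale: "ml (\<lambda>as. scale c (F as)) xs = scale c (ml F xs)"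
  by (induction xs arbitrary: F) (auto simp: lext_fun_scale)

lemma ml_zero [simp]: "ml (\<lambda>as. 0) xs = 0"
  by (induction xs) auto

lemma ml_sum: "ml (\<lambda>as. \<Sum>i\<in>I. F i as) xs = (\<Sum>i\<in>I. ml (F i) xs)"
  by (induction I rule: infinite_finite_induct) (auto simp: ml_add)

lemma ml_basis [simp]: "ml F (map basis as) = F as"
  by (induction as arbitrary: F) auto

lemma ml_arg_add: "ml F (xs @ (x + y) # ys) = ml F (xs @ x # ys) + ml F (xs @ y # ys)"
  by (induction xs arbitrary: F) (auto simp: lext_add lext_fun_add)

lemma ml_arg_scale: "ml F (xs @ scale c x # ys) = scale c (ml F (xs @ x # ys))"
  by (induction xs arbitrary: F) (auto simp: lext_scale lext_fun_scale)

lemma list_all2_keys_subset: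
  assumes "list_all2 (\<lambda>a x. a \<in> Poly_Mapping.keys x) as xs" "\<forall>x\<in>set xs. Poly_Mapping.keys x \<subseteq> S"
  shows "set as \<subseteq> S"
  using assms by (induction as xs rule: list_all2_induct) auto

text \<open>The lists of \<open>n\<close> vectors over the free module on \<open>S\<close>.\<close>

definition vtuples :: "'m set \<Rightarrow> nat \<Rightarrow> ('m \<Rightarrow>\<^sub>0 'k::{comm_ring,comm_monoid_mult}) list set" where
  "vtuples S n = {xs. (\<forall>x\<in>set xs. Poly_Mapping.keys x \<subseteq> S) \<and> length xs = n}"

lemma vtuples_keys:
  assumes "xs \<in> vtuples S n" "list_all2 (\<lambda>a x. a \<in> Poly_Mapping.keys x) as xs"
  shows "set as \<subseteq> S" "length as = n"
  using list_all2_keys_subset[OF assms(2)] list_all2_lengthD[OF assms(2)] assms(1)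
  by (auto simp: vtuples_def)

lemma keys_ml:
  assumes "\<And>as. list_all2 (\<lambda>a x. a \<in> Poly_Mapping.keys x) as xs \<Longrightarrow> Poly_Mapping.keys (F as) \<subseteq> S"
  shows "Poly_Mapping.keys (ml F xs) \<subseteq> S"
  using assms
proof (induction xs arbitrary: F)
  case (Cons x xs)
  show ?case unfolding ml.simps by (intro keys_lext Cons.IH Cons.prems) simp
qed simp

section \<open>Free modules with a partial product of basis elements\<close>

text \<open>The bilinear product, which is \<open>0\<close> on basis elements without a product.\<close>

definition pmult :: "('m \<Rightarrow> 'm \<Rightarrow> 'm option) \<Rightarrow> ('m \<Rightarrow>\<^sub>0 'k) \<Rightarrow> ('m \<Rightarrow>\<^sub>0 'k)
    \<Rightarrow> ('m \<Rightarrow>\<^sub>0 'k::{comm_ring,comm_monoid_mult})" where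
  "pmult m x y = lext (\<lambda>a. lext (\<lambda>b. case m a b of None \<Rightarrow> 0 | Some c \<Rightarrow> basis c) y) x"

lemma free_algebra_simps [simp]:
  "carrier (free_algebra S m u) = {x. Poly_Mapping.keys x \<subseteq> S}"
  "x \<oplus>\<^bsub>free_algebra S m u\<^esub> y = x + y"
  "\<zero>\<^bsub>free_algebra S m u\<^esub> = 0"
  "\<one>\<^bsub>free_algebra S m u\<^esub> = u"
  "c \<odot>\<^bsub>free_algebra S m u\<^esub> x = scale c x"
  by (simp_all add: free_algebra_def scale_def)

lemma free_algebra_mult [simp]: "x \<otimes>\<^bsub>free_algebra S m u\<^esub> y = pmult m x y"
proof -
  have "scale (Poly_Mapping.lookup x a) (scale (Poly_Mapping.lookup y b)
        (case m a b of None \<Rightarrow> 0 | Some c \<Rightarrow> basis c)) =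
      (case m a b of None \<Rightarrow> 0
         | Some c \<Rightarrow> Poly_Mapping.single c (Poly_Mapping.lookup x a * Poly_Mapping.lookup y b))" for a b
    by (auto split: option.split)
  then show ?thesis by (simp add: free_algebra_def pmult_def lext_def scale_sum)
qed

lemma tuples_free_algebra [simp]: "tuples (free_algebra S m u) n = vtuples S n"
  by (auto simp: tuples_def vtuples_def)

lemma opgroup_free_algebra: "opgroup (free_algebra S m u :: ('k::{comm_ring,comm_monoid_mult}, 'm \<Rightarrow>\<^sub>0 'k) module)"
proof -
  have "abelian_group (free_algebra S m u :: ('k, 'm \<Rightarrow>\<^sub>0 'k) module)"
  proof (rule abelian_groupI)
    fix x :: "'m \<Rightarrow>\<^sub>0 'k" assume "x \<in> carrier (free_algebra S m u)"
    then show "\<exists>y\<in>carrier (free_algebra S m u). y \<oplus>\<^bsub>free_algebra S m u\<^esub> x = \<zero>\<^bsub>free_algebra S m u\<^esub>"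
      by (intro bexI[of _ "- x"]) auto
  qed (simp_all add: keys_add_subset add_ac)
  then show ?thesis
    by (intro opgroup.intro opgroup_axioms.intro) (simp_all add: keys_scale_subset scale_add)
qed

lemma finsum_free_algebra:
  assumes "finite I" "\<And>i. i \<in> I \<Longrightarrow> Poly_Mapping.keys (f i) \<subseteq> S"
  shows "(\<Oplus>\<^bsub>free_algebra S m u\<^esub>i\<in>I. f i) = (\<Sum>i\<in>I. f i)"
proof -
  interpret opgroup "free_algebra S m u" by (rule opgroup_free_algebra)
  show ?thesis using assms by (induction I) (auto simp: finsum_insert)
qed

lemma pmult_add: "pmult m (x + y) z = pmult m x z + pmult m y z"
  "pmult m z (x + y) = pmult m z x + pmult m z y"
  by (simp_all add: pmult_def lext_add lext_fun_add)

lemma pmult_scale: "pmult m (scale c x) z = scale c (pmult m x z)"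
  "pmult m z (scale c x) = scale c (pmult m z x)"
  by (simp_all add: pmult_def lext_scale lext_fun_scale)

lemma pmult_zero [simp]: "pmult m 0 z = 0" "pmult m z 0 = 0"
  by (simp_all add: pmult_def)

lemma pmult_sum: "pmult m (\<Sum>i\<in>I. f i) z = (\<Sum>i\<in>I. pmult m (f i) z)"
  "pmult m z (\<Sum>i\<in>I. f i) = (\<Sum>i\<in>I. pmult m z (f i))"
  by (induction I rule: infinite_finite_induct) (auto simp: pmult_add)

lemma pmult_lext: "pmult m (lext g x) z = lext (\<lambda>a. pmult m (g a) z) x"
  "pmult m z (lext g x) = lext (\<lambda>a. pmult m z (g a)) x"
  by (simp_all add: lext_def pmult_sum pmult_scale)

lemma pmult_uminus: "pmult m (- x) z = - pmult m x z" "pmult m z (- x) = - pmult m z x"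
  using pmult_scale[where c = "-1"] by (metis scale_simps(3,5))+

lemma pmult_diff: "pmult m (x - y) z = pmult m x z - pmult m y z"
  "pmult m z (x - y) = pmult m z x - pmult m z y"
  using pmult_add[of m x "-y" z] pmult_add(2)[of m z x "-y"] by (simp_all add: pmult_uminus)

lemma pmult_basis: "pmult m (basis a) (basis b) = (case m a b of None \<Rightarrow> 0 | Some c \<Rightarrow> basis c)"
  by (simp add: pmult_def)

lemma pmult_basis_left: "pmult m (basis a) y = lext (\<lambda>b. case m a b of None \<Rightarrow> 0 | Some c \<Rightarrow> basis c) y"
  and pmult_basis_right: "pmult m x (basis b) = lext (\<lambda>a. case m a b of None \<Rightarrow> 0 | Some c \<Rightarrow> basis c) x"
  by (simp_all add: pmult_def)

lemma ml_pmult: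
  "pmult m (ml F xs) (ml G ys) = ml (\<lambda>as. pmult m (F (take (length xs) as)) (G (drop (length xs) as))) (xs @ ys)"
proof (induction xs arbitrary: F)
  case Nil
  have "pmult m (F []) (ml G ys) = ml (\<lambda>as. pmult m (F []) (G as)) ys"
    by (induction ys arbitrary: G) (auto simp: pmult_lext)
  then show ?case by simp
next
  case (Cons x xs)
  then show ?case by (simp add: pmult_lext)
qed

text \<open>The product of the entries number \<open>k\<close> and \<open>k + 1\<close>, on lists of basis elements and of vectors.\<close>

fun bmerge :: "('m \<Rightarrow> 'm \<Rightarrow> 'm option) \<Rightarrow> nat \<Rightarrow> 'm list \<Rightarrow> 'm list option" where
  "bmerge m 0 (a # b # as) = map_option (\<lambda>c. c # as) (m a b)"
| "bmerge m (Suc k) (a # as) = map_option ((#) a) (bmerge m k as)"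
| "bmerge m _ _ = None"

fun vmerge :: "('m \<Rightarrow> 'm \<Rightarrow> 'm option) \<Rightarrow> nat \<Rightarrow> ('m \<Rightarrow>\<^sub>0 'k) list \<Rightarrow> ('m \<Rightarrow>\<^sub>0 'k::{comm_ring,comm_monoid_mult}) list" where
  "vmerge m 0 (x # y # xs) = pmult m x y # xs"
| "vmerge m (Suc k) (x # xs) = x # vmerge m k xs"
| "vmerge m _ _ = []"

text \<open>The value \<open>0\<close> at an undefined argument.\<close>

definition on_opt :: "('a \<Rightarrow> 'b) \<Rightarrow> 'a option \<Rightarrow> 'b::zero" where
  "on_opt F p = (case p of None \<Rightarrow> 0 | Some x \<Rightarrow> F x)"

lemma on_opt_simps [simp]: "on_opt F None = 0" "on_opt F (Some x) = F x"
  by (simp_all add: on_opt_def)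

lemma bmerge_length: "bmerge m k as = Some bs \<Longrightarrow> length as = Suc (length bs) \<and> Suc k < length as"
  by (induction m k as arbitrary: bs rule: bmerge.induct) fastforce+

lemma vmerge_conv: "Suc k < length xs \<Longrightarrow>
    take k xs @ pmult m (xs ! k) (xs ! Suc k) # drop (Suc (Suc k)) xs = vmerge m k xs"
proof (induction m k xs rule: vmerge.induct)
  case ("3_2" m v)
  then show ?case by simp
qed auto

lemma ml_vmerge:
  "Suc k < length xs \<Longrightarrow> ml F (vmerge m k xs) = ml (\<lambda>as. on_opt F (bmerge m k as)) xs"
proof (induction m k xs arbitrary: F rule: vmerge.induct)
  case (1 m x y xs)
  have "lext (\<lambda>c. ml (\<lambda>as. F (c # as)) xs) (case m a b of None \<Rightarrow> 0 | Some c \<Rightarrow> basis c) =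
      ml (\<lambda>as. on_opt F (map_option (\<lambda>c. c # as) (m a b))) xs" for a b
    by (cases "m a b") auto
  then show ?case by (simp add: pmult_def lext_lext)
next
  case (2 m k x xs)
  have "on_opt F (map_option ((#) a) p) = on_opt (\<lambda>as. F (a # as)) p" for a p
    by (cases p) auto
  then show ?case using 2 by simp
qed auto

lemma bmerge_append1: "Suc k < length xs \<Longrightarrow> bmerge m k (xs @ ys) = map_option (\<lambda>z. z @ ys) (bmerge m k xs)"
  by (induction m k xs rule: bmerge.induct) (auto simp: option.map_comp comp_def)

lemma bmerge_append2: "bmerge m (length xs + k) (xs @ ys) = map_option ((@) xs) (bmerge m k ys)"
  by (induction xs) (auto simp: option.map_comp comp_def option.map_ident)

lemma bmerge_set:
  assumes "bmerge m k as = Some bs" "set as \<subseteq> S" "\<And>a b c. a \<in> S \<Longrightarrow> b \<in> S \<Longrightarrow> m a b = Some c \<Longrightarrow> c \<in> S"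
  shows "set bs \<subseteq> S"
  using assms(1,2)
proof (induction k arbitrary: as bs)
  case 0
  then obtain a b cs c where "as = a # b # cs" "m a b = Some c" "bs = c # cs"
    by (cases "(m, 0::nat, as)" rule: bmerge.cases) auto
  then show ?case using 0 assms(3)[of a b c] by auto
next
  case (Suc k)
  then obtain a cs ds where "as = a # cs" "bmerge m k cs = Some ds" "bs = a # ds"
    by (cases as) auto
  then show ?case using Suc by auto
qed

section \<open>The Hochschild complex of a free algebra in terms of basis elements\<close>

text \<open>
  A cochain of degree \<open>n\<close> of the free algebra on \<open>S\<close>, given on lists of basis elements.  Only the values on
  lists of length \<open>n\<close> over \<open>S\<close> matter, and they have to lie in the free module on \<open>S\<close>.
\<close>

definition bcochain :: "'m set \<Rightarrow> nat \<Rightarrow> ('m list \<Rightarrow> ('m \<Rightarrow>\<^sub>0 'k::{comm_ring,comm_monoid_mult})) \<Rightarrow> bool" where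
  "bcochain S n F \<longleftrightarrow> (\<forall>as. set as \<subseteq> S \<and> length as = n \<longrightarrow> Poly_Mapping.keys (F as) \<subseteq> S)"

text \<open>The Hochschild cochain with given values on lists of basis elements.\<close>

definition mext :: "'m set \<Rightarrow> nat \<Rightarrow> ('m list \<Rightarrow> ('m \<Rightarrow>\<^sub>0 'k)) \<Rightarrow> ('m \<Rightarrow>\<^sub>0 'k) list
    \<Rightarrow> ('m \<Rightarrow>\<^sub>0 'k::{comm_ring,comm_monoid_mult})" where
  "mext S n F = (\<lambda>xs\<in>vtuples S n. ml F xs)"

lemma mext_cong:
  assumes "\<And>as. set as \<subseteq> S \<Longrightarrow> length as = n \<Longrightarrow> F as = G as"
  shows "mext S n F = mext S n G"
  unfolding mext_def
proof (rule restrict_ext)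
  fix xs :: "('a \<Rightarrow>\<^sub>0 'b) list" assume xs: "xs \<in> vtuples S n"
  show "ml F xs = ml G xs"
    by (rule ml_cong) (use vtuples_keys[OF xs] assms in blast)
qed

lemma map_basis_vtuples: "set as \<subseteq> S \<Longrightarrow> length as = n \<Longrightarrow> map basis as \<in> vtuples S n"
  by (auto simp: vtuples_def)

lemma mext_basis [simp]: "set as \<subseteq> S \<Longrightarrow> length as = n \<Longrightarrow> mext S n F (map basis as) = F as"
  by (simp add: mext_def map_basis_vtuples)

lemma keys_mext:
  assumes "bcochain S n F" "xs \<in> vtuples S n"
  shows "Poly_Mapping.keys (ml F xs) \<subseteq> S"
proof (rule keys_ml)
  fix as assume "list_all2 (\<lambda>a x. a \<in> Poly_Mapping.keys x) as xs"
  then show "Poly_Mapping.keys (F as) \<subseteq> S"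
    using vtuples_keys[OF assms(2)] assms(1) by (simp add: bcochain_def)
qed

lemma hoch_mext:
  assumes "bcochain S n F"
  shows "mext S n F \<in> carrier (hoch (free_algebra S m u) n)"
proof -
  have "xs @ z # ys \<in> vtuples S n"
    if "set xs \<subseteq> {x. Poly_Mapping.keys x \<subseteq> S}" "set ys \<subseteq> {x. Poly_Mapping.keys x \<subseteq> S}"
      "length xs + length ys + 1 = n" "Poly_Mapping.keys z \<subseteq> S"
    for xs ys and z :: "'a \<Rightarrow>\<^sub>0 'b"
    using that by (auto simp: vtuples_def)
  then show ?thesis
    using keys_mext[OF assms]
    by (auto simp: hoch_def mext_def ml_arg_add ml_arg_scale keys_subset)
qed

lemma hoch_arg:
  assumes "f \<in> carrier (hoch (free_algebra S m u) n)" "xs @ z # ys \<in> vtuples S n"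
    and "Poly_Mapping.keys x \<subseteq> S" "Poly_Mapping.keys y \<subseteq> S"
  shows "f (xs @ (x + y) # ys) = f (xs @ x # ys) + f (xs @ y # ys)"
    "f (xs @ scale c x # ys) = scale c (f (xs @ x # ys))"
proof -
  have l: "set xs \<subseteq> {x. Poly_Mapping.keys x \<subseteq> S} \<and> set ys \<subseteq> {x. Poly_Mapping.keys x \<subseteq> S} \<and>
      length xs + length ys + 1 = n"
    using assms(2) by (auto simp: vtuples_def)
  show "f (xs @ (x + y) # ys) = f (xs @ x # ys) + f (xs @ y # ys)"
    "f (xs @ scale c x # ys) = scale c (f (xs @ x # ys))"
    using assms(1,3,4) l unfolding hoch_def by simp_all
qed

lemma hoch_eq_mext:
  assumes f: "f \<in> carrier (hoch (free_algebra S m u) n)"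
  shows "f = mext S n (\<lambda>as. f (map basis as))"
proof
  fix xs
  have ext: "f \<in> extensional (vtuples S n)" using f by (auto simp: hoch_def PiE_iff)
  have "f (map basis bs @ ys) = ml (\<lambda>as. f (map basis bs @ map basis as)) ys"
    if "set bs \<subseteq> S" "\<forall>x\<in>set ys. Poly_Mapping.keys x \<subseteq> S" "length bs + length ys = n" for bs ys
    using that
  proof (induction ys arbitrary: bs)
    case (Cons y ys)
    have "f (map basis bs @ y # ys) = lext (\<lambda>a. f (map basis bs @ basis a # ys)) y"
    proof (rule linear_eq_lext[where S = S])
      show "Poly_Mapping.keys y \<subseteq> S" using Cons by auto
      have "map basis bs @ y # ys \<in> vtuples S n" using Cons.prems by (auto simp: vtuples_def split: if_splits)
      note arg = hoch_arg[OF f this]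
      show "f (map basis bs @ (x + z) # ys) = f (map basis bs @ x # ys) + f (map basis bs @ z # ys)"
        if "Poly_Mapping.keys x \<subseteq> S" "Poly_Mapping.keys z \<subseteq> S" for x z
        by (rule arg[OF that])
      show "f (map basis bs @ scale c x # ys) = scale c (f (map basis bs @ x # ys))"
        if "Poly_Mapping.keys x \<subseteq> S" for c x
        by (rule arg(2)[OF that that])
    qed
    also have "\<dots> = lext (\<lambda>a. ml (\<lambda>as. f (map basis bs @ map basis (a # as))) ys) y"
    proof (rule lext_cong)
      fix a assume "a \<in> Poly_Mapping.keys y"
      then show "f (map basis bs @ basis a # ys) = ml (\<lambda>as. f (map basis bs @ map basis (a # as))) ys"
        using Cons.IH[of "bs @ [a]"] Cons.prems by auto
    qed
    finally show ?case by simp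
  qed simp
  from this[of "[]" xs] show "f xs = mext S n (\<lambda>as. f (map basis as)) xs"
    using ext by (auto simp: mext_def vtuples_def extensional_def)
qed

lemma hoch_bcochain:
  assumes "f \<in> carrier (hoch (free_algebra S m u) n)"
  shows "bcochain S n (\<lambda>as. f (map basis as))"
  using assms map_basis_vtuples[of _ S n] by (auto simp: hoch_def bcochain_def PiE_iff)

lemma hoch_eqI:
  assumes "f \<in> carrier (hoch (free_algebra S m u) n)" "g \<in> carrier (hoch (free_algebra S m u) n)"
    and "\<And>as. set as \<subseteq> S \<Longrightarrow> length as = n \<Longrightarrow> f (map basis as) = g (map basis as)"
  shows "f = g"
  using hoch_eq_mext[OF assms(1)] hoch_eq_mext[OF assms(2)] mext_cong[OF assms(3)] by simp

lemma hoch_add_mext: "mext S n F \<oplus>\<^bsub>hoch (free_algebra S m u) n\<^esub> mext S n G = mext S n (\<lambda>as. F as + G as)"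
  and hoch_smult_mext: "c \<odot>\<^bsub>hoch (free_algebra S m u) n\<^esub> mext S n F = mext S n (\<lambda>as. scale c (F as))"
  and hoch_zero_mext: "\<zero>\<^bsub>hoch (free_algebra S m u) n\<^esub> = mext S n (\<lambda>as. 0)"
  by (auto simp: hoch_def mext_def ml_add ml_scale restrict_def fun_eq_iff)

lemma hoch_basis:
  assumes "set as \<subseteq> S" "length as = n"
  shows "(f \<oplus>\<^bsub>hoch (free_algebra S m u) n\<^esub> g) (map basis as) = f (map basis as) + g (map basis as)"
    "(c \<odot>\<^bsub>hoch (free_algebra S m u) n\<^esub> f) (map basis as) = scale c (f (map basis as))"
    "\<zero>\<^bsub>hoch (free_algebra S m u) n\<^esub> (map basis as) = 0"
  using map_basis_vtuples[OF assms] by (auto simp: hoch_def)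

lemma opgroup_hoch:
  "opgroup (hoch (free_algebra S m u :: ('k::{comm_ring,comm_monoid_mult}, 'm \<Rightarrow>\<^sub>0 'k) module) n)" (is "opgroup ?H")
proof -
  note eqI = hoch_eqI[of _ S m u n]
  have closed: "f \<oplus>\<^bsub>?H\<^esub> g \<in> carrier ?H" "c \<odot>\<^bsub>?H\<^esub> f \<in> carrier ?H"
    if "f \<in> carrier ?H" "g \<in> carrier ?H" for f g c
  proof -
    note b = hoch_bcochain[OF that(1)] hoch_bcochain[OF that(2)]
    show "f \<oplus>\<^bsub>?H\<^esub> g \<in> carrier ?H"
      by (subst hoch_eq_mext[OF that(1)], subst hoch_eq_mext[OF that(2)], subst hoch_add_mext)
        (use b in \<open>simp add: hoch_mext bcochain_def keys_add_subset keys_scale_subset\<close>)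
    show "c \<odot>\<^bsub>?H\<^esub> f \<in> carrier ?H"
      by (subst hoch_eq_mext[OF that(1)], subst hoch_smult_mext)
        (use b in \<open>simp add: hoch_mext bcochain_def keys_add_subset keys_scale_subset\<close>)
  qed
  have zero: "\<zero>\<^bsub>?H\<^esub> \<in> carrier ?H"
    unfolding hoch_zero_mext by (rule hoch_mext) (simp add: bcochain_def)
  have "abelian_group ?H"
  proof (rule abelian_groupI)
    fix f assume f: "f \<in> carrier ?H"
    have "(- 1) \<odot>\<^bsub>?H\<^esub> f \<oplus>\<^bsub>?H\<^esub> f = \<zero>\<^bsub>?H\<^esub>"
      by (rule eqI) (use f closed zero in \<open>auto simp: hoch_basis\<close>)
    then show "\<exists>g\<in>carrier ?H. g \<oplus>\<^bsub>?H\<^esub> f = \<zero>\<^bsub>?H\<^esub>" using closed f by blast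
  next
    fix f g h assume "f \<in> carrier ?H" "g \<in> carrier ?H" "h \<in> carrier ?H"
    then show "(f \<oplus>\<^bsub>?H\<^esub> g) \<oplus>\<^bsub>?H\<^esub> h = f \<oplus>\<^bsub>?H\<^esub> (g \<oplus>\<^bsub>?H\<^esub> h)"
      by (intro eqI) (auto simp: hoch_basis closed add_ac)
  next
    fix f g assume "f \<in> carrier ?H" "g \<in> carrier ?H"
    then show "f \<oplus>\<^bsub>?H\<^esub> g = g \<oplus>\<^bsub>?H\<^esub> f"
      by (intro eqI) (auto simp: hoch_basis closed add_ac)
  next
    fix f assume "f \<in> carrier ?H"
    then show "\<zero>\<^bsub>?H\<^esub> \<oplus>\<^bsub>?H\<^esub> f = f"
      by (intro eqI) (auto simp: hoch_basis closed zero)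
  qed (use closed zero in auto)
  then show ?thesis
  proof (intro opgroup.intro opgroup_axioms.intro)
    fix f g c assume "f \<in> carrier ?H" "g \<in> carrier ?H"
    then show "c \<odot>\<^bsub>?H\<^esub> (f \<oplus>\<^bsub>?H\<^esub> g) = c \<odot>\<^bsub>?H\<^esub> f \<oplus>\<^bsub>?H\<^esub> c \<odot>\<^bsub>?H\<^esub> g"
      by (intro eqI) (auto simp: hoch_basis closed scale_add)
  qed (use closed in auto)
qed

lemma hoch_minus_basis:
  assumes "f \<in> carrier (hoch (free_algebra S m u) n)" "g \<in> carrier (hoch (free_algebra S m u) n)"
    "set as \<subseteq> S" "length as = n"
  shows "(f \<ominus>\<^bsub>hoch (free_algebra S m u) n\<^esub> g) (map basis as) = f (map basis as) - g (map basis as)"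
proof -
  interpret opgroup "hoch (free_algebra S m u) n" by (rule opgroup_hoch)
  have "f = (f \<ominus>\<^bsub>hoch (free_algebra S m u) n\<^esub> g) \<oplus>\<^bsub>hoch (free_algebra S m u) n\<^esub> g"
    using assms by (simp add: minus_eq a_assoc l_neg)
  then have "f (map basis as) = (f \<ominus>\<^bsub>hoch (free_algebra S m u) n\<^esub> g) (map basis as) + g (map basis as)"
    using hoch_basis(1)[OF assms(3,4)] by metis
  then show ?thesis by simp
qed

text \<open>The Hochschild differential on lists of basis elements.\<close>

definition bdiff :: "('m \<Rightarrow> 'm \<Rightarrow> 'm option) \<Rightarrow> nat \<Rightarrow> ('m list \<Rightarrow> ('m \<Rightarrow>\<^sub>0 'k)) \<Rightarrow> 'm list
    \<Rightarrow> ('m \<Rightarrow>\<^sub>0 'k::{comm_ring,comm_monoid_mult})" where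
  "bdiff m n F as = pmult m (basis (hd as)) (F (tl as))
     + (\<Sum>k<n. scale ((- 1) ^ Suc k) (on_opt F (bmerge m k as)))
     + scale ((- 1) ^ Suc n) (pmult m (F (butlast as)) (basis (last as)))"

lemma keys_pmult:
  assumes "Poly_Mapping.keys x \<subseteq> S" "Poly_Mapping.keys y \<subseteq> S"
    and "\<And>a b c. a \<in> S \<Longrightarrow> b \<in> S \<Longrightarrow> m a b = Some c \<Longrightarrow> c \<in> S"
  shows "Poly_Mapping.keys (pmult m x y) \<subseteq> S"
  unfolding pmult_def
proof (intro keys_lext)
  fix a b assume "a \<in> Poly_Mapping.keys x" "b \<in> Poly_Mapping.keys y"
  then have ab: "a \<in> S" "b \<in> S" using assms(1,2) by auto
  show "Poly_Mapping.keys (case m a b of None \<Rightarrow> 0 | Some c \<Rightarrow> basis c) \<subseteq> S"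
  proof (cases "m a b")
    case (Some c)
    have "c \<in> S" by (rule assms(3)[OF ab Some])
    then show ?thesis by (simp add: Some)
  qed simp
qed

lemma bdiff_cong:
  assumes FG: "\<And>as. set as \<subseteq> S \<Longrightarrow> length as = n \<Longrightarrow> F as = G as"
    and as: "set as \<subseteq> S" "length as = Suc n"
    and closed: "\<And>a b c. a \<in> S \<Longrightarrow> b \<in> S \<Longrightarrow> m a b = Some c \<Longrightarrow> c \<in> S"
  shows "bdiff m n F as = bdiff m n G as"
proof -
  have "on_opt F (bmerge m k as) = on_opt G (bmerge m k as)" for k
  proof (cases "bmerge m k as")
    case (Some bs)
    have "set bs \<subseteq> S" using closed by (rule bmerge_set[OF Some as(1)])
    moreover have "length bs = n" using bmerge_length[OF Some] as(2) by simp
    ultimately show ?thesis using FG Some by simp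
  qed simp
  moreover have "set (tl as) \<subseteq> S" "set (butlast as) \<subseteq> S"
    using as(1) by (cases as; auto dest: in_set_butlastD)+
  then have "F (tl as) = G (tl as)" "F (butlast as) = G (butlast as)"
    using as(2) by (simp_all add: FG)
  ultimately show ?thesis by (simp add: bdiff_def)
qed

text \<open>
  A partial product on a basis that is associative, also as far as definedness is concerned, with a unit \<open>u\<close>
  for its linear extension.
\<close>

locale partial_algebra =
  fixes S :: "'m set" and m :: "'m \<Rightarrow> 'm \<Rightarrow> 'm option" and u :: "'m \<Rightarrow>\<^sub>0 'k::{comm_ring,comm_monoid_mult}"
  assumes closed: "a \<in> S \<Longrightarrow> b \<in> S \<Longrightarrow> m a b = Some c \<Longrightarrow> c \<in> S"
    and assoc: "a \<in> S \<Longrightarrow> b \<in> S \<Longrightarrow> c \<in> S \<Longrightarrow>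
      Option.bind (m a b) (\<lambda>x. m x c) = Option.bind (m b c) (m a)"
    and unit_closed: "Poly_Mapping.keys u \<subseteq> S"
    and unit_left: "a \<in> S \<Longrightarrow> pmult m u (basis a) = basis a"
    and unit_right: "a \<in> S \<Longrightarrow> pmult m (basis a) u = basis a"
begin

abbreviation A where "A \<equiv> free_algebra S m u"

abbreviation pm (infixl \<open>\<bullet>\<close> 70) where "x \<bullet> y \<equiv> pmult m x y"

lemma pmult_assoc:
  assumes "Poly_Mapping.keys x \<subseteq> S" "Poly_Mapping.keys y \<subseteq> S" "Poly_Mapping.keys z \<subseteq> S"
  shows "(x \<bullet> y) \<bullet> z = x \<bullet> (y \<bullet> (z :: 'm \<Rightarrow>\<^sub>0 'k))"
proof -
  have "(basis a \<bullet> basis b) \<bullet> basis c = basis a \<bullet> (basis b \<bullet> (basis c :: 'm \<Rightarrow>\<^sub>0 'k))"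
    if "a \<in> S" "b \<in> S" "c \<in> S" for a b c
    using assoc[OF that] by (cases "m a b"; cases "m b c") (auto simp: pmult_basis split: option.split)
  then have "(basis a \<bullet> basis b) \<bullet> z = basis a \<bullet> (basis b \<bullet> z)" if "a \<in> S" "b \<in> S" for a b
    using that assms(3) pmult_lext(2)[of m _ basis z] unfolding lext_basis
    by (auto simp: pmult_lext intro!: lext_cong)
  then have "(basis a \<bullet> y) \<bullet> z = basis a \<bullet> (y \<bullet> z)" if "a \<in> S" for a
  proof -
    have "(basis a \<bullet> lext basis y) \<bullet> z = basis a \<bullet> (lext basis y \<bullet> z)"
      unfolding pmult_lext using that assms(2) \<open>\<And>b a. \<lbrakk>a \<in> S; b \<in> S\<rbrakk> \<Longrightarrow> _\<close> by (intro lext_cong) auto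
    then show ?thesis by (simp add: lext_basis)
  qed
  then have "(lext basis x \<bullet> y) \<bullet> z = lext basis x \<bullet> (y \<bullet> z)"
    unfolding pmult_lext using assms(1) by (intro lext_cong) auto
  then show ?thesis by (simp add: lext_basis)
qed

lemma pmult_unit:
  assumes "Poly_Mapping.keys x \<subseteq> S"
  shows "u \<bullet> x = x" "x \<bullet> u = x"
proof -
  have "u \<bullet> lext basis x = lext basis x" "lext basis x \<bullet> u = lext basis x"
    unfolding pmult_lext using assms unit_left unit_right by (intro lext_cong; auto)+
  then show "u \<bullet> x = x" "x \<bullet> u = x" by (simp_all add: lext_basis)
qed

lemma pmult_closed:
  assumes "Poly_Mapping.keys x \<subseteq> S" "Poly_Mapping.keys y \<subseteq> S"
  shows "Poly_Mapping.keys (x \<bullet> y) \<subseteq> S"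
  using closed by (rule keys_pmult[OF assms])

lemma on_opt_bmerge_keys:
  assumes "bcochain S n F" "set as \<subseteq> S" "length as = Suc n"
  shows "Poly_Mapping.keys (on_opt F (bmerge m k as)) \<subseteq> S"
proof (cases "bmerge m k as")
  case (Some bs)
  have "set bs \<subseteq> S" using closed by (rule bmerge_set[OF Some assms(2)])
  moreover have "length bs = n" using bmerge_length[OF Some] assms(3) by simp
  ultimately show ?thesis using Some assms(1) by (simp add: bcochain_def)
qed simp

lemma bcochain_bdiff: "bcochain S n F \<Longrightarrow> bcochain S (Suc n) (bdiff m n F)"
  unfolding bcochain_def[of _ "Suc n"] bdiff_def
proof (intro allI impI keys_subset pmult_closed)
  fix as assume F: "bcochain S n F" and as: "set as \<subseteq> S \<and> length as = Suc n"
  then show "Poly_Mapping.keys (on_opt F (bmerge m k as)) \<subseteq> S" for k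
    by (intro on_opt_bmerge_keys) auto
  show "Poly_Mapping.keys (F (tl as)) \<subseteq> S" "Poly_Mapping.keys (F (butlast as)) \<subseteq> S"
  proof -
    have "set (tl as) \<subseteq> S" "set (butlast as) \<subseteq> S"
      using as by (cases as; auto dest: in_set_butlastD)+
    then show "Poly_Mapping.keys (F (tl as)) \<subseteq> S" "Poly_Mapping.keys (F (butlast as)) \<subseteq> S"
      using F as by (simp_all add: bcochain_def)
  qed
  have "as \<noteq> []" using as by auto
  then show "hd as \<in> S" "last as \<in> S" using as by auto
qed

lemma hoch_d_mext:
  assumes F: "bcochain S n F"
  shows "hoch_d A n (mext S n F) = mext S (Suc n) (bdiff m n F)"
proof
  fix xs
  show "hoch_d A n (mext S n F) xs = mext S (Suc n) (bdiff m n F) xs"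
  proof (cases "xs \<in> vtuples S (Suc n)")
    case True
    then have xs: "\<forall>x\<in>set xs. Poly_Mapping.keys x \<subseteq> S" "length xs = Suc n" by (auto simp: vtuples_def)
    then have ne: "xs \<noteq> []" by auto
    have tl: "tl xs \<in> vtuples S n" and bl: "butlast xs \<in> vtuples S n"
      using xs ne by (auto simp: vtuples_def list.set_sel(2) dest: in_set_butlastD)
    have mid: "mext S n F (take k xs @ (xs ! k \<bullet> xs ! Suc k) # drop (Suc (Suc k)) xs) =
        ml (\<lambda>as. on_opt F (bmerge m k as)) xs" if k: "k < n" for k
    proof -
      have "take k xs @ (xs ! k \<bullet> xs ! Suc k) # drop (Suc (Suc k)) xs \<in> vtuples S n"
        using xs k by (auto simp: vtuples_def pmult_closed dest: in_set_takeD in_set_dropD)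
      then show ?thesis
        using k xs by (simp add: mext_def vmerge_conv ml_vmerge)
    qed
    have keys: "Poly_Mapping.keys (ml (\<lambda>as. on_opt F (bmerge m k as)) xs) \<subseteq> S" for k
      using xs list_all2_keys_subset[OF _ xs(1)]
      by (intro keys_ml on_opt_bmerge_keys[OF F]) (auto dest: list_all2_lengthD)
    have "(\<Oplus>\<^bsub>A\<^esub>j\<in>{1..n}. (- 1) ^ j \<odot>\<^bsub>A\<^esub>
            mext S n F (take (j - 1) xs @ (xs ! (j - 1) \<otimes>\<^bsub>A\<^esub> xs ! j) # drop (j + 1) xs)) =
          (\<Oplus>\<^bsub>A\<^esub>j\<in>{1..n}. scale ((- 1) ^ j) (ml (\<lambda>as. on_opt F (bmerge m (j - 1) as)) xs))"
    proof -
      interpret opgroup A by (rule opgroup_free_algebra)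
      show ?thesis
      proof (rule finsum_cong')
        fix j assume j: "j \<in> {1..n}"
        then obtain k where k: "j = Suc k" "k < n" by (cases j) auto
        then show "(- 1) ^ j \<odot>\<^bsub>A\<^esub>
            mext S n F (take (j - 1) xs @ (xs ! (j - 1) \<otimes>\<^bsub>A\<^esub> xs ! j) # drop (j + 1) xs) =
            scale ((- 1) ^ j) (ml (\<lambda>as. on_opt F (bmerge m (j - 1) as)) xs)"
          using mid[OF k(2)] by simp
      qed (use keys in \<open>auto intro!: keys_subset\<close>)
    qed
    also have "\<dots> = (\<Sum>j=1..n. scale ((- 1) ^ j) (ml (\<lambda>as. on_opt F (bmerge m (j - 1) as)) xs))"
      using keys by (intro finsum_free_algebra keys_subset) auto
    also have "\<dots> = (\<Sum>k<n. scale ((- 1) ^ Suc k) (ml (\<lambda>as. on_opt F (bmerge m k as)) xs))"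
      by (rule sum.reindex_bij_witness[of _ Suc "\<lambda>j. j - 1"]) auto
    finally have sum: "(\<Oplus>\<^bsub>A\<^esub>j\<in>{1..n}. (- 1) ^ j \<odot>\<^bsub>A\<^esub>
            mext S n F (take (j - 1) xs @ (xs ! (j - 1) \<otimes>\<^bsub>A\<^esub> xs ! j) # drop (j + 1) xs)) =
        (\<Sum>k<n. scale ((- 1) ^ Suc k) (ml (\<lambda>as. on_opt F (bmerge m k as)) xs))" .
    have one: "x = ml (\<lambda>as. basis (hd as)) [x]" for x :: "'m \<Rightarrow>\<^sub>0 'k" by (simp add: lext_basis)
    have "hd xs \<bullet> ml F (tl xs) = ml (\<lambda>as. basis (hd as)) [hd xs] \<bullet> ml F (tl xs)"
      by (subst one[of "hd xs"]) simp
    also have "\<dots> = ml (\<lambda>as. basis (hd as) \<bullet> F (tl as)) xs"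
    proof -
      have "[hd xs] @ tl xs = xs" using ne by simp
      moreover have "ml (\<lambda>as. basis (hd (take (length [hd xs]) as)) \<bullet> F (drop (length [hd xs]) as)) xs =
          ml (\<lambda>as. basis (hd as) \<bullet> F (tl as)) xs"
        by (intro ml_cong_length) (simp add: drop_Suc)
      ultimately show ?thesis unfolding ml_pmult by simp
    qed
    finally have first: "hd xs \<bullet> ml F (tl xs) = ml (\<lambda>as. basis (hd as) \<bullet> F (tl as)) xs" .
    have "ml F (butlast xs) \<bullet> last xs = ml F (butlast xs) \<bullet> ml (\<lambda>as. basis (hd as)) [last xs]"
      by (subst one[of "last xs"]) simp
    also have "\<dots> = ml (\<lambda>as. F (butlast as) \<bullet> basis (last as)) xs"
    proof -
      have "butlast xs @ [last xs] = xs" using ne by simp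
      moreover have "ml (\<lambda>as. F (take (length (butlast xs)) as) \<bullet> basis (hd (drop (length (butlast xs)) as))) xs =
          ml (\<lambda>as. F (butlast as) \<bullet> basis (last as)) xs"
      proof (rule ml_cong_length)
        fix as :: "'m list" assume "length as = length xs"
        then have "as \<noteq> []" "length (butlast xs) = length as - 1" using ne by auto
        then show "F (take (length (butlast xs)) as) \<bullet> basis (hd (drop (length (butlast xs)) as)) =
            F (butlast as) \<bullet> basis (last as)"
          by (simp add: butlast_conv_take hd_drop_conv_nth last_conv_nth)
      qed
      ultimately show ?thesis unfolding ml_pmult by simp
    qed
    finally have last: "ml F (butlast xs) \<bullet> last xs = ml (\<lambda>as. F (butlast as) \<bullet> basis (last as)) xs" .
    have "hoch_d A n (mext S n F) xs = hd xs \<bullet> ml F (tl xs)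
        + (\<Sum>k<n. scale ((- 1) ^ Suc k) (ml (\<lambda>as. on_opt F (bmerge m k as)) xs))
        + scale ((- 1) ^ Suc n) (ml F (butlast xs) \<bullet> last xs)"
      unfolding hoch_d_def tuples_free_algebra restrict_apply'[OF True] sum
      using tl bl by (simp add: mext_def)
    also have "\<dots> = ml (bdiff m n F) xs"
      unfolding bdiff_def[abs_def] ml_add ml_sum ml_scale first last ..
    finally show ?thesis using True by (simp add: mext_def)
  qed (simp add: hoch_d_def mext_def)
qed

end

section \<open>The two-sided form of the Hochschild differential\<close>

lemma double_sum_cancel:
  fixes y :: "nat \<Rightarrow> nat \<Rightarrow> 'a::ab_group_add"
  assumes "\<And>k l. k \<le> l \<Longrightarrow> l < N \<Longrightarrow> y k l = - y (Suc l) k"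
  shows "(\<Sum>k<Suc N. \<Sum>l<N. y k l) = 0"
proof -
  let ?U = "{(k, l). k \<le> l \<and> l < N}" and ?L = "{(k, l). l < k \<and> k \<le> N}"
  have fin: "finite ?U" "finite ?L"
    by (rule finite_subset[of _ "{..N} \<times> {..N}"]; auto)+
  have "(\<Sum>k<Suc N. \<Sum>l<N. y k l) = (\<Sum>(k, l)\<in>{..<Suc N} \<times> {..<N}. y k l)"
    by (simp add: sum.cartesian_product)
  also have "{..<Suc N} \<times> {..<N} = ?U \<union> ?L" by auto
  also have "(\<Sum>(k, l)\<in>?U \<union> ?L. y k l) = (\<Sum>(k, l)\<in>?U. y k l) + (\<Sum>(k, l)\<in>?L. y k l)"
    using fin by (intro sum.union_disjoint) auto
  also have "(\<Sum>(k, l)\<in>?L. y k l) = (\<Sum>(k, l)\<in>?U. y (Suc l) k)"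
    by (rule sum.reindex_bij_witness[of _ "\<lambda>(k, l). (Suc l, k)" "\<lambda>(k, l). (l, k - 1)"]) auto
  also have "(\<Sum>(k, l)\<in>?U. y k l) = (\<Sum>(k, l)\<in>?U. - y (Suc l) k)"
    by (rule sum.cong) (auto simp: assms)
  finally show ?thesis by (simp add: sum_negf split_def)
qed

text \<open>
  In the two-sided form \<open>bhat m F\<close> of a cochain \<open>F\<close> the first and the last entry of a list act on the value
  by multiplication.  In this form the differential is the plain alternating sum \<open>bdel\<close> over the products
  of neighbours.
\<close>

definition bdel :: "('m \<Rightarrow> 'm \<Rightarrow> 'm option) \<Rightarrow> ('m list \<Rightarrow> ('m \<Rightarrow>\<^sub>0 'k)) \<Rightarrow> 'm list
    \<Rightarrow> ('m \<Rightarrow>\<^sub>0 'k::{comm_ring,comm_monoid_mult})" where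
  "bdel m \<Phi> as = (\<Sum>k<length as - 1. scale ((- 1) ^ k) (on_opt \<Phi> (bmerge m k as)))"

definition bhat :: "('m \<Rightarrow> 'm \<Rightarrow> 'm option) \<Rightarrow> ('m list \<Rightarrow> ('m \<Rightarrow>\<^sub>0 'k)) \<Rightarrow> 'm list
    \<Rightarrow> ('m \<Rightarrow>\<^sub>0 'k::{comm_ring,comm_monoid_mult})" where
  "bhat m F as = pmult m (pmult m (basis (hd as)) (F (butlast (tl as)))) (basis (last as))"

text \<open>The Gerstenhaber product on lists of basis elements.\<close>

definition bprod :: "('m \<Rightarrow> 'm \<Rightarrow> 'm option) \<Rightarrow> nat \<Rightarrow> ('m list \<Rightarrow> ('m \<Rightarrow>\<^sub>0 'k)) \<Rightarrow> ('m list \<Rightarrow> ('m \<Rightarrow>\<^sub>0 'k))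
    \<Rightarrow> 'm list \<Rightarrow> ('m \<Rightarrow>\<^sub>0 'k::{comm_ring,comm_monoid_mult})" where
  "bprod m p F G as = pmult m (F (take p as)) (G (drop p as))"

context partial_algebra
begin

text \<open>The simplicial identity for the products of neighbours.\<close>

lemma bmerge_bmerge:
  assumes "k \<le> l" "set as \<subseteq> S"
  shows "Option.bind (bmerge m (Suc l) as) (bmerge m k) = Option.bind (bmerge m k as) (bmerge m l)"
  using assms
proof (induction k arbitrary: l as)
  case 0
  show ?case
  proof (cases as)
    case (Cons a bs)
    show ?thesis
    proof (cases bs)
      case bs: (Cons b cs)
      show ?thesis
      proof (cases l)
        case 0
        show ?thesis
        proof (cases cs)
          case (Cons c ds)
          have "Option.bind (m a b) (\<lambda>x. m x c) = Option.bind (m b c) (m a)"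
            using 0 \<open>as = _\<close> bs Cons \<open>set as \<subseteq> S\<close> by (intro assoc) auto
          then show ?thesis using 0 \<open>as = _\<close> bs Cons
            by (cases "m a b"; cases "m b c") auto
        qed (use 0 \<open>as = _\<close> bs in \<open>auto split: bind_split option.split\<close>)
      next
        case (Suc l')
        then show ?thesis using \<open>as = _\<close> bs
          by (cases "m a b"; cases "bmerge m l' cs") auto
      qed
    qed (use Cons in \<open>cases l; auto\<close>)
  qed auto
next
  case (Suc k)
  then obtain l' where l: "l = Suc l'" by (cases l) auto
  show ?case
  proof (cases as)
    case (Cons a bs)
    have *: "Option.bind (map_option ((#) a) p) (bmerge m (Suc j)) = map_option ((#) a) (Option.bind p (bmerge m j))"
      for p j by (cases p) auto
    show ?thesis using Suc.IH[of l' bs] Suc.prems l Cons by (simp add: *)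
  qed auto
qed

lemma bdel_bdel:
  assumes "set as \<subseteq> S"
  shows "bdel m (bdel m \<Phi>) as = (0 :: 'm \<Rightarrow>\<^sub>0 'k)"
proof (cases "length as \<le> 1")
  case False
  then obtain N where N: "length as = Suc (Suc N)"
    by (metis One_nat_def Suc_le_mono le0 not_less_eq_eq old.nat.exhaust)
  let ?y = "\<lambda>k l. scale ((- 1) ^ (k + l)) (on_opt \<Phi> (Option.bind (bmerge m k as) (bmerge m l)))"
  have inner: "scale ((- 1) ^ k) (on_opt (bdel m \<Phi>) (bmerge m k as)) = (\<Sum>l<N. ?y k l)" for k
  proof (cases "bmerge m k as")
    case (Some bs)
    have "length bs = Suc N" using bmerge_length[OF Some] N by simp
    then show ?thesis by (simp add: Some bdel_def scale_sum power_add)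
  qed simp
  have "bdel m (bdel m \<Phi>) as = (\<Sum>k<Suc N. \<Sum>l<N. ?y k l)"
    by (subst bdel_def) (simp add: N inner)
  also have "\<dots> = 0"
    by (rule double_sum_cancel) (simp add: bmerge_bmerge[OF _ assms] add.commute)
  finally show ?thesis .
qed (auto simp: bdel_def)

lemma bhat_bdiff:
  fixes F :: "'m list \<Rightarrow> 'm \<Rightarrow>\<^sub>0 'k"
  assumes F: "bcochain S n F" and as: "set (a # as @ [b]) \<subseteq> S" "length as = Suc n"
  shows "bhat m (bdiff m n F) (a # as @ [b]) = bdel m (bhat m F) (a # as @ [b])"
proof -
  have key: "Poly_Mapping.keys (F bs) \<subseteq> S" if "set bs \<subseteq> S" "length bs = n" for bs
    using F that by (simp add: bcochain_def)
  obtain c cs where c: "as = c # cs" using as(2) by (cases as) auto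
  obtain e es where e: "as = es @ [e]" using as(2) by (cases as rule: rev_cases) auto
  have len: "length cs = n" using as(2) c by simp
  have len': "length es = n" using as(2) e by simp
  note len = len len'
  have S: "a \<in> S" "b \<in> S" "c \<in> S" "set cs \<subseteq> S" using as(1) c by auto
  have "set as \<subseteq> S" using as(1) by auto
  then have "e \<in> S" "set es \<subseteq> S" using e by auto
  note S = S this
  have ks: "Poly_Mapping.keys (basis x) \<subseteq> S" if "x \<in> S" for x using that by auto
  have first: "(basis a \<bullet> (basis c \<bullet> F cs)) \<bullet> basis b = on_opt (bhat m F) (bmerge m 0 (a # as @ [b]))"
  proof -
    have "basis a \<bullet> (basis c \<bullet> F cs) = (basis a \<bullet> basis c) \<bullet> F cs"
      by (rule pmult_assoc[symmetric]) (use S key len ks in blast)+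
    then show ?thesis by (cases "m a c") (auto simp: c bhat_def pmult_basis)
  qed
  have last: "(basis a \<bullet> (F es \<bullet> basis e)) \<bullet> basis b = on_opt (bhat m F) (bmerge m (Suc n) (a # as @ [b]))"
  proof -
    have "(basis a \<bullet> (F es \<bullet> basis e)) \<bullet> basis b = (basis a \<bullet> F es) \<bullet> (basis e \<bullet> basis b)"
      using S key[of es] len ks by (simp add: pmult_assoc pmult_closed)
    moreover have "bmerge m n (es @ [e, b]) = map_option ((@) es) (bmerge m 0 [e, b])"
      using bmerge_append2[of m es 0 "[e, b]"] len by simp
    ultimately show ?thesis by (cases "m e b") (auto simp: e bhat_def pmult_basis)
  qed
  have mid: "(basis a \<bullet> on_opt F (bmerge m k as)) \<bullet> basis b = on_opt (bhat m F) (bmerge m (Suc k) (a # as @ [b]))"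
    if "k < n" for k
    using that as(2) by (cases "bmerge m k as") (auto simp: bmerge_append1 bhat_def)
  have "bdel m (bhat m F) (a # as @ [b]) =
      (\<Sum>k<Suc (Suc n). scale ((- 1) ^ k) (on_opt (bhat m F) (bmerge m k (a # as @ [b]))))"
    using as(2) by (simp add: bdel_def)
  also have "\<dots> = on_opt (bhat m F) (bmerge m 0 (a # as @ [b]))
      + (\<Sum>k<n. scale ((- 1) ^ Suc k) (on_opt (bhat m F) (bmerge m (Suc k) (a # as @ [b]))))
      + scale ((- 1) ^ Suc n) (on_opt (bhat m F) (bmerge m (Suc n) (a # as @ [b])))"
    by (subst sum.lessThan_Suc, subst sum.lessThan_Suc_shift) simp
  also have "(\<Sum>k<n. scale ((- 1) ^ Suc k) (on_opt (bhat m F) (bmerge m (Suc k) (a # as @ [b])))) =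
      (\<Sum>k<n. scale ((- 1) ^ Suc k) ((basis a \<bullet> on_opt F (bmerge m k as)) \<bullet> basis b))"
    by (rule sum.cong) (simp_all add: mid)
  finally have "bdel m (bhat m F) (a # as @ [b]) = (basis a \<bullet> (basis c \<bullet> F cs)) \<bullet> basis b
      + (\<Sum>k<n. scale ((- 1) ^ Suc k) ((basis a \<bullet> on_opt F (bmerge m k as)) \<bullet> basis b))
      + scale ((- 1) ^ Suc n) ((basis a \<bullet> (F es \<bullet> basis e)) \<bullet> basis b)"
    unfolding first last .
  moreover have "hd as = c" "tl as = cs" by (simp_all add: c)
  moreover have "butlast as = es" "last as = e" by (simp_all add: e)
  ultimately show ?thesis
    by (simp add: bhat_def[of m "bdiff m n F"] bdiff_def pmult_add pmult_sum pmult_scale del: power_Suc)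
qed

text \<open>The unit is a linear combination of basis elements, so nothing is lost in the two-sided form.\<close>

lemma eq_zero_by_bhat:
  assumes x: "Poly_Mapping.keys x \<subseteq> S" and *: "\<And>a b. a \<in> S \<Longrightarrow> b \<in> S \<Longrightarrow> (basis a \<bullet> x) \<bullet> basis b = 0"
  shows "x = (0 :: 'm \<Rightarrow>\<^sub>0 'k)"
proof -
  have "x = (u \<bullet> x) \<bullet> u" using x by (simp add: pmult_unit)
  also have "\<dots> = (lext basis u \<bullet> x) \<bullet> lext basis u" by (simp only: lext_basis)
  also have "\<dots> = 0"
    unfolding pmult_lext
    by (subst lext_cong[where h = "\<lambda>a. 0"]) (use unit_closed * in \<open>auto intro!: trans[OF lext_cong lext_fun_zero]\<close>)
  finally show ?thesis .
qed

lemma bdiff_bdiff: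
  fixes F :: "'m list \<Rightarrow> 'm \<Rightarrow>\<^sub>0 'k"
  assumes F: "bcochain S n F" and as: "set as \<subseteq> S" "length as = Suc (Suc n)"
  shows "bdiff m (Suc n) (bdiff m n F) as = 0"
proof (rule eq_zero_by_bhat)
  show "Poly_Mapping.keys (bdiff m (Suc n) (bdiff m n F) as) \<subseteq> S"
    using bcochain_bdiff[OF bcochain_bdiff[OF F]] as by (simp add: bcochain_def)
  fix a b assume ab: "a \<in> S" "b \<in> S"
  let ?l = "a # as @ [b]"
  have l: "set ?l \<subseteq> S" using ab as by auto
  have "(basis a \<bullet> bdiff m (Suc n) (bdiff m n F) as) \<bullet> basis b = bhat m (bdiff m (Suc n) (bdiff m n F)) ?l"
    by (simp add: bhat_def)
  also have "\<dots> = bdel m (bhat m (bdiff m n F)) ?l"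
    by (rule bhat_bdiff[OF bcochain_bdiff[OF F] l]) (use as in simp)
  also have "\<dots> = bdel m (bdel m (bhat m F)) ?l"
  proof -
    have "on_opt (bhat m (bdiff m n F)) (bmerge m k ?l) = on_opt (bdel m (bhat m F)) (bmerge m k ?l)" for k
    proof (cases "bmerge m k ?l")
      case (Some bs)
      have bs: "set bs \<subseteq> S" using closed by (rule bmerge_set[OF Some l])
      have len: "length bs = Suc (Suc (Suc n))" using bmerge_length[OF Some] as by simp
      obtain a' cs where "bs = a' # cs" "length cs = Suc (Suc n)" using len by (cases bs) auto
      moreover obtain ds b' where "cs = ds @ [b']" "length ds = Suc n"
        using \<open>length cs = _\<close> by (cases cs rule: rev_cases) auto
      ultimately show ?thesis using Some bhat_bdiff[OF F, of a' ds b'] bs by simp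
    qed simp
    then show ?thesis by (simp add: bdel_def)
  qed
  also have "\<dots> = 0" by (rule bdel_bdel[OF l])
  finally show "(basis a \<bullet> bdiff m (Suc n) (bdiff m n F) as) \<bullet> basis b = 0" .
qed

lemma hoch_d_eq_mext:
  assumes "f \<in> carrier (hoch A n)"
  shows "hoch_d A n f = mext S (Suc n) (bdiff m n (\<lambda>as. f (map basis as)))"
  using hoch_d_mext[OF hoch_bcochain[OF assms]] hoch_eq_mext[OF assms] by simp

lemma hoch_d_closed: "f \<in> carrier (hoch A n) \<Longrightarrow> hoch_d A n f \<in> carrier (hoch A (Suc n))"
  by (simp add: hoch_d_eq_mext hoch_mext bcochain_bdiff hoch_bcochain)

lemma hoch_d_basis:
  assumes "f \<in> carrier (hoch A n)" "set as \<subseteq> S" "length as = Suc n"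
  shows "hoch_d A n f (map basis as) = bdiff m n (\<lambda>as. f (map basis as)) as"
  using assms by (simp add: hoch_d_eq_mext)

lemma bdiff_add: "bdiff m n (\<lambda>as. F as + G as) as = bdiff m n F as + bdiff m n G as"
  and bdiff_scale: "bdiff m n (\<lambda>as. scale c (F as)) as = scale c (bdiff m n F as)"
proof -
  have "on_opt (\<lambda>as. F as + G as) p = on_opt F p + on_opt G p"
    "on_opt (\<lambda>as. scale c (F as)) p = scale c (on_opt F p)" for p by (cases p; simp)+
  then show "bdiff m n (\<lambda>as. F as + G as) as = bdiff m n F as + bdiff m n G as"
    "bdiff m n (\<lambda>as. scale c (F as)) as = scale c (bdiff m n F as)"
    by (simp_all add: bdiff_def pmult_add pmult_scale scale_add sum.distrib scale_sum
        mult.commute[of c] add_ac del: power_Suc)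
qed

lemma bdiff_cong_S:
  assumes "\<And>as. set as \<subseteq> S \<Longrightarrow> length as = n \<Longrightarrow> F as = G as" "set as \<subseteq> S" "length as = Suc n"
  shows "bdiff m n F as = bdiff m n G as"
  by (rule bdiff_cong[of S]; (rule assms closed; assumption)?)

lemma hoch_d_hom: "hoch_d A n \<in> module_hom (hoch A n) (hoch A (Suc n))"
proof (rule module_homI)
  interpret opgroup "hoch A n" by (rule opgroup_hoch)
  interpret S: opgroup "hoch A (Suc n)" by (rule opgroup_hoch)
  fix f g c assume f: "f \<in> carrier (hoch A n)"
  show "hoch_d A n f \<in> carrier (hoch A (Suc n))" using f by (rule hoch_d_closed)
  show "hoch_d A n (c \<odot>\<^bsub>hoch A n\<^esub> f) = c \<odot>\<^bsub>hoch A (Suc n)\<^esub> hoch_d A n f"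
  proof (rule hoch_eqI[of _ S m u "Suc n"])
    fix as assume as: "set as \<subseteq> S" "length as = Suc n"
    have "hoch_d A n (c \<odot>\<^bsub>hoch A n\<^esub> f) (map basis as) = bdiff m n (\<lambda>as. (c \<odot>\<^bsub>hoch A n\<^esub> f) (map basis as)) as"
      using f as by (intro hoch_d_basis) auto
    also have "\<dots> = bdiff m n (\<lambda>as. scale c (f (map basis as))) as"
      by (rule bdiff_cong_S[OF _ as]) (simp add: hoch_basis)
    finally show "hoch_d A n (c \<odot>\<^bsub>hoch A n\<^esub> f) (map basis as) = (c \<odot>\<^bsub>hoch A (Suc n)\<^esub> hoch_d A n f) (map basis as)"
      using f as by (simp add: bdiff_scale hoch_d_basis hoch_basis)
  qed (use f hoch_d_closed in auto)
  assume g: "g \<in> carrier (hoch A n)"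
  show "hoch_d A n (f \<oplus>\<^bsub>hoch A n\<^esub> g) = hoch_d A n f \<oplus>\<^bsub>hoch A (Suc n)\<^esub> hoch_d A n g"
  proof (rule hoch_eqI[of _ S m u "Suc n"])
    fix as assume as: "set as \<subseteq> S" "length as = Suc n"
    have "hoch_d A n (f \<oplus>\<^bsub>hoch A n\<^esub> g) (map basis as) = bdiff m n (\<lambda>as. (f \<oplus>\<^bsub>hoch A n\<^esub> g) (map basis as)) as"
      using f g as by (intro hoch_d_basis) auto
    also have "\<dots> = bdiff m n (\<lambda>as. f (map basis as) + g (map basis as)) as"
      by (rule bdiff_cong_S[OF _ as]) (simp add: hoch_basis)
    finally show "hoch_d A n (f \<oplus>\<^bsub>hoch A n\<^esub> g) (map basis as) =
        (hoch_d A n f \<oplus>\<^bsub>hoch A (Suc n)\<^esub> hoch_d A n g) (map basis as)"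
      using f g as by (simp add: bdiff_add hoch_d_basis hoch_basis)
  qed (use f g hoch_d_closed in auto)
qed

lemma hoch_d_hoch_d:
  assumes f: "f \<in> carrier (hoch A n)"
  shows "hoch_d A (Suc n) (hoch_d A n f) = \<zero>\<^bsub>hoch A (Suc (Suc n))\<^esub>"
proof -
  interpret S: opgroup "hoch A (Suc (Suc n))" by (rule opgroup_hoch)
  show ?thesis
  proof (rule hoch_eqI[of _ S m u "Suc (Suc n)"])
    fix as assume as: "set as \<subseteq> S" "length as = Suc (Suc n)"
    have "hoch_d A (Suc n) (hoch_d A n f) (map basis as) =
        bdiff m (Suc n) (\<lambda>as. hoch_d A n f (map basis as)) as"
      using f as by (intro hoch_d_basis hoch_d_closed)
    also have "\<dots> = bdiff m (Suc n) (bdiff m n (\<lambda>as. f (map basis as))) as"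
      by (rule bdiff_cong_S[OF _ as]) (simp add: hoch_d_basis f)
    also have "\<dots> = 0" by (rule bdiff_bdiff[OF hoch_bcochain[OF f] as])
    finally show "hoch_d A (Suc n) (hoch_d A n f) (map basis as) = \<zero>\<^bsub>hoch A (Suc (Suc n))\<^esub> (map basis as)"
      using as by (simp add: hoch_basis)
  qed (use f hoch_d_closed in auto)
qed

lemma cochain_complex_hoch: "cochain_complex (hoch A) (hoch_d A)"
  by (rule cochain_complex.intro) (auto intro: opgroup_hoch hoch_d_hom hoch_d_hoch_d)

section \<open>The Gerstenhaber product\<close>

lemma bcochain_bprod:
  assumes "bcochain S p F" "bcochain S q G"
  shows "bcochain S (p + q) (bprod m p F G)"
  unfolding bcochain_def bprod_def
proof (intro allI impI pmult_closed)
  fix as assume as: "set as \<subseteq> S \<and> length as = p + q"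
  then have "set (take p as) \<subseteq> S" "set (drop p as) \<subseteq> S"
    by (auto dest: in_set_takeD in_set_dropD)
  then show "Poly_Mapping.keys (F (take p as)) \<subseteq> S" "Poly_Mapping.keys (G (drop p as)) \<subseteq> S"
    using assms as by (auto simp: bcochain_def)
qed

lemma gerst_mext: "gerst A p q (mext S p F) (mext S q G) = mext S (p + q) (bprod m p F G)"
proof
  fix xs
  show "gerst A p q (mext S p F) (mext S q G) xs = mext S (p + q) (bprod m p F G) xs"
  proof (cases "xs \<in> vtuples S (p + q)")
    case True
    then have "take p xs \<in> vtuples S p" "drop p xs \<in> vtuples S q"
      by (auto simp: vtuples_def dest: in_set_takeD in_set_dropD)
    moreover have "ml F (take p xs) \<bullet> ml G (drop p xs) = ml (bprod m p F G) xs"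
      using True by (simp add: vtuples_def ml_pmult bprod_def[abs_def])
    ultimately show ?thesis using True by (simp add: gerst_def mext_def)
  qed (simp add: gerst_def mext_def)
qed

lemma gerst_eq_mext:
  assumes "f \<in> carrier (hoch A p)" "g \<in> carrier (hoch A q)"
  shows "gerst A p q f g = mext S (p + q) (bprod m p (\<lambda>as. f (map basis as)) (\<lambda>as. g (map basis as)))"
  using gerst_mext hoch_eq_mext[OF assms(1)] hoch_eq_mext[OF assms(2)] by metis

lemma gerst_closed:
  assumes "f \<in> carrier (hoch A p)" "g \<in> carrier (hoch A q)"
  shows "gerst A p q f g \<in> carrier (hoch A (p + q))"
  unfolding gerst_eq_mext[OF assms]
  by (intro hoch_mext bcochain_bprod hoch_bcochain[OF assms(1)] hoch_bcochain[OF assms(2)])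

lemma gerst_basis:
  assumes "f \<in> carrier (hoch A p)" "g \<in> carrier (hoch A q)" "set as \<subseteq> S" "length as = p + q"
  shows "gerst A p q f g (map basis as) = f (map basis (take p as)) \<bullet> g (map basis (drop p as))"
  unfolding gerst_eq_mext[OF assms(1,2)] using assms(3,4) by (simp add: bprod_def)

lemma bdiff_bprod:
  fixes F G :: "'m list \<Rightarrow> 'm \<Rightarrow>\<^sub>0 'k"
  assumes F: "bcochain S p F" and G: "bcochain S q G" and as: "set as \<subseteq> S" "length as = Suc (p + q)"
  shows "bdiff m (p + q) (bprod m p F G) as =
    bprod m (Suc p) (bdiff m p F) G as + scale ((- 1) ^ p) (bprod m p F (bdiff m q G) as)"
proof -
  define bs c ds where "bs = take p as" "c = as ! p" "ds = drop (Suc p) as"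
  have as_eq: "as = bs @ c # ds" and len: "length bs = p" "length ds = q"
    using as(2) by (auto simp: bs_c_ds_def id_take_nth_drop)
  have S: "set bs \<subseteq> S" "c \<in> S" "set ds \<subseteq> S" using as(1) as_eq by auto
  have kF: "Poly_Mapping.keys (F xs) \<subseteq> S" if "set xs \<subseteq> S" "length xs = p" for xs
    using F that by (simp add: bcochain_def)
  have kG: "Poly_Mapping.keys (G xs) \<subseteq> S" if "set xs \<subseteq> S" "length xs = q" for xs
    using G that by (simp add: bcochain_def)
  have ks: "Poly_Mapping.keys (basis x) \<subseteq> S" if "x \<in> S" for x using that by auto
  let ?h = "hd (bs @ [c])" and ?t = "tl (bs @ [c])" and ?b = "butlast (c # ds)" and ?l = "last (c # ds)"
  have S': "?h \<in> S" "set ?t \<subseteq> S" "?l \<in> S" "set ?b \<subseteq> S" "length ?t = p" "length ?b = q"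
    using S len by (cases bs; cases ds rule: rev_cases; auto)+
  note keys = ks[OF S'(1)] ks[OF S(2)] ks[OF S'(3)] kF[OF S'(2,5)] kF[OF S(1) len(1)]
    kG[OF S(3) len(2)] kG[OF S'(4,6)]
  have first: "basis (hd as) \<bullet> bprod m p F G (tl as) = (basis ?h \<bullet> F ?t) \<bullet> G ds"
  proof -
    have "hd as = ?h" "take p (tl as) = ?t" "drop p (tl as) = ds"
      using len by (cases bs; auto simp: as_eq)+
    then show ?thesis using pmult_assoc[OF keys(1,4,6)] by (simp add: bprod_def)
  qed
  have last: "bprod m p F G (butlast as) \<bullet> basis (last as) = F bs \<bullet> (G ?b \<bullet> basis ?l)"
  proof -
    have "last as = ?l" "take p (butlast as) = bs" "drop p (butlast as) = ?b"
      using len by (auto simp: as_eq butlast_append)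
    then show ?thesis using pmult_assoc[OF keys(5,7,3)] by (simp add: bprod_def)
  qed
  have low: "on_opt (bprod m p F G) (bmerge m k as) = on_opt F (bmerge m k (bs @ [c])) \<bullet> G ds" if "k < p" for k
  proof -
    have "bmerge m k as = map_option (\<lambda>z. z @ ds) (bmerge m k (bs @ [c]))"
      using bmerge_append1[of k "bs @ [c]" m ds] that len by (simp add: as_eq)
    then show ?thesis using bmerge_length[of m k "bs @ [c]"] len
      by (cases "bmerge m k (bs @ [c])") (auto simp: bprod_def)
  qed
  have high: "on_opt (bprod m p F G) (bmerge m (p + k) as) = F bs \<bullet> on_opt G (bmerge m k (c # ds))" for k
    using bmerge_append2[of m bs k "c # ds"] len
    by (cases "bmerge m k (c # ds)") (auto simp: as_eq bprod_def)
  have split: "(\<Sum>k<p + q. f k) = (\<Sum>k<p. f k) + (\<Sum>k<q. f (p + k))" for f :: "nat \<Rightarrow> 'm \<Rightarrow>\<^sub>0 'k"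
    by (induction q) (auto simp: add.assoc)
  have E1: "bdiff m (p + q) (bprod m p F G) as = (basis ?h \<bullet> F ?t) \<bullet> G ds
      + ((\<Sum>k<p. scale ((- 1) ^ Suc k) (on_opt F (bmerge m k (bs @ [c])) \<bullet> G ds))
       + (\<Sum>k<q. scale ((- 1) ^ Suc (p + k)) (F bs \<bullet> on_opt G (bmerge m k (c # ds)))))
      + scale ((- 1) ^ Suc (p + q)) (F bs \<bullet> (G ?b \<bullet> basis ?l))"
    unfolding bdiff_def first last split high by (simp add: low)
  have E2: "bprod m (Suc p) (bdiff m p F) G as = bdiff m p F (bs @ [c]) \<bullet> G ds"
    "bprod m p F (bdiff m q G) as = F bs \<bullet> bdiff m q G (c # ds)"
    using len by (simp_all add: bprod_def as_eq)
  have E3: "bdiff m p F (bs @ [c]) \<bullet> G ds = (basis ?h \<bullet> F ?t) \<bullet> G ds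
      + (\<Sum>k<p. scale ((- 1) ^ Suc k) (on_opt F (bmerge m k (bs @ [c])) \<bullet> G ds))
      + scale ((- 1) ^ Suc p) (F bs \<bullet> (basis c \<bullet> G ds))"
    using pmult_assoc[OF keys(5,2,6)]
    by (simp add: bdiff_def pmult_add pmult_sum pmult_scale pmult_uminus pmult_diff del: power_Suc)
  have E4: "F bs \<bullet> bdiff m q G (c # ds) = F bs \<bullet> (basis c \<bullet> G ds)
      + (\<Sum>k<q. scale ((- 1) ^ Suc k) (F bs \<bullet> on_opt G (bmerge m k (c # ds))))
      + scale ((- 1) ^ Suc q) (F bs \<bullet> (G ?b \<bullet> basis ?l))"
    by (simp add: bdiff_def pmult_add pmult_sum pmult_scale pmult_uminus pmult_diff del: power_Suc)
  show ?thesis unfolding E1 E2 E3 E4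
    by (simp add: scale_add scale_diff scale_sum power_add sum_negf algebra_simps)
qed

lemma hoch_d_gerst:
  assumes f: "f \<in> carrier (hoch A p)" and g: "g \<in> carrier (hoch A q)"
  shows "hoch_d A (p + q) (gerst A p q f g) = gerst A (Suc p) q (hoch_d A p f) g
     \<oplus>\<^bsub>hoch A (Suc (p + q))\<^esub> ((- 1) ^ p \<odot>\<^bsub>hoch A (Suc (p + q))\<^esub> gerst A p (Suc q) f (hoch_d A q g))"
proof -
  interpret opgroup "hoch A (Suc (p + q))" by (rule opgroup_hoch)
  let ?f = "\<lambda>as. f (map basis as)" and ?g = "\<lambda>as. g (map basis as)"
  note bc = hoch_bcochain[OF f] hoch_bcochain[OF g]
  show ?thesis
  proof (rule hoch_eqI[of _ S m u "Suc (p + q)"])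
    fix as assume as: "set as \<subseteq> S" "length as = Suc (p + q)"
    have "hoch_d A (p + q) (gerst A p q f g) (map basis as) = bdiff m (p + q) (bprod m p ?f ?g) as"
      unfolding gerst_eq_mext[OF f g] using hoch_d_mext[OF bcochain_bprod[OF bc]] as by simp
    also have "\<dots> = bprod m (Suc p) (bdiff m p ?f) ?g as + scale ((- 1) ^ p) (bprod m p ?f (bdiff m q ?g) as)"
      by (rule bdiff_bprod[OF bc as])
    also have "bprod m (Suc p) (bdiff m p ?f) ?g as = gerst A (Suc p) q (hoch_d A p f) g (map basis as)"
    proof -
      have "set (take (Suc p) as) \<subseteq> S" using as(1) by (auto dest: in_set_takeD)
      then show ?thesis
        using gerst_basis[OF hoch_d_closed[OF f] g as(1)] as hoch_d_basis[OF f]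
        by (simp add: bprod_def del: take_Suc_Cons)
    qed
    also have "bprod m p ?f (bdiff m q ?g) as = gerst A p (Suc q) f (hoch_d A q g) (map basis as)"
    proof -
      have "set (drop p as) \<subseteq> S" using as(1) by (auto dest: in_set_dropD)
      then show ?thesis
        using gerst_basis[OF f hoch_d_closed[OF g] as(1)] as hoch_d_basis[OF g]
        by (simp add: bprod_def)
    qed
    finally show "hoch_d A (p + q) (gerst A p q f g) (map basis as) =
        (gerst A (Suc p) q (hoch_d A p f) g \<oplus>\<^bsub>hoch A (Suc (p + q))\<^esub>
         ((- 1) ^ p \<odot>\<^bsub>hoch A (Suc (p + q))\<^esub> gerst A p (Suc q) f (hoch_d A q g))) (map basis as)"
      using as by (simp add: hoch_basis)
  qed (use gerst_closed[OF hoch_d_closed[OF f] g] gerst_closed[OF f hoch_d_closed[OF g]]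
         hoch_d_closed[OF gerst_closed[OF f g]] in auto)
qed

lemma gerst_bilinear:
  assumes "f \<in> carrier (hoch A p)"
  shows "gerst A p q f \<in> module_hom (hoch A q) (hoch A (p + q))"
    and "(\<lambda>g. gerst A q p g f) \<in> module_hom (hoch A q) (hoch A (q + p))"
proof -
  interpret q: opgroup "hoch A q" by (rule opgroup_hoch)
  interpret pq: opgroup "hoch A (p + q)" by (rule opgroup_hoch)
  interpret qp: opgroup "hoch A (q + p)" by (rule opgroup_hoch)
  have td: "set (take i as) \<subseteq> S" "set (drop i as) \<subseteq> S" if "set as \<subseteq> S" for i as
    using that by (auto dest: in_set_takeD in_set_dropD)
  show "gerst A p q f \<in> module_hom (hoch A q) (hoch A (p + q))"
    using assms
    by (intro module_homI hoch_eqI[of _ S m u "p + q"])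
      (auto simp: gerst_closed gerst_basis hoch_basis td pmult_add pmult_scale)
  show "(\<lambda>g. gerst A q p g f) \<in> module_hom (hoch A q) (hoch A (q + p))"
    using assms
    by (intro module_homI hoch_eqI[of _ S m u "q + p"])
      (auto simp: gerst_closed gerst_basis hoch_basis td pmult_add pmult_scale)
qed

end

text \<open>A product that satisfies the Leibniz rule, with signs \<open>sg p\<close>, is well-defined on cohomology classes.\<close>

lemma (in cochain_complex) coh_prod_cl:
  assumes \<mu>1: "\<And>p q x. x \<in> carrier (K p) \<Longrightarrow> \<mu> p q x \<in> module_hom (K q) (K (p + q))"
    and \<mu>2: "\<And>p q y. y \<in> carrier (K q) \<Longrightarrow> (\<lambda>x. \<mu> p q x y) \<in> module_hom (K p) (K (p + q))"
    and leibniz: "\<And>p q x y. x \<in> carrier (K p) \<Longrightarrow> y \<in> carrier (K q) \<Longrightarrow>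
      d (p + q) (\<mu> p q x y) = \<mu> (Suc p) q (d p x) y
        \<oplus>\<^bsub>K (Suc (p + q))\<^esub> (sg p \<odot>\<^bsub>K (Suc (p + q))\<^esub> \<mu> p (Suc q) x (d q y))"
    and sg: "\<And>p n x. x \<in> carrier (K n) \<Longrightarrow> sg p \<odot>\<^bsub>K n\<^esub> (sg p \<odot>\<^bsub>K n\<^esub> x) = x"
    and x: "x \<in> cocycles K d p" and y: "y \<in> cocycles K d q"
  shows "coh_prod K d (p + q) (\<mu> p q) (cl p x) (cl q y) = cl (p + q) (\<mu> p q x y)"
proof -
  have c1: "\<mu> p q b z \<in> coboundaries K d (p + q)"
    if b: "b \<in> coboundaries K d p" and z: "z \<in> cocycles K d q" for p b z
  proof -
    have zK: "z \<in> carrier (K q)" and dz: "d q z = \<zero>\<^bsub>K (Suc q)\<^esub>" using z by (auto simp: cocycles_def)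
    show ?thesis
    proof (cases p)
      case 0
      then have "\<mu> p q b z = \<zero>\<^bsub>K (p + q)\<^esub>"
        using b module_hom_zero[OF opgroup_K opgroup_K \<mu>2[OF zK, of 0]] by (simp add: coboundaries_def)
      then show ?thesis using deg.opsub_props(2)[OF coboundaries_opsub] by simp
    next
      case (Suc r)
      then obtain a where a: "a \<in> carrier (K r)" "b = d r a" using b by (auto simp: coboundaries_def)
      have "\<mu> r (Suc q) a (d q z) = \<zero>\<^bsub>K (Suc (r + q))\<^esub>"
        using module_hom_zero[OF opgroup_K opgroup_K \<mu>1[OF a(1), of "Suc q"]] by (simp add: dz)
      moreover have "\<mu> (Suc r) q (d r a) z \<in> carrier (K (Suc r + q))"
        by (rule module_homD(1)[OF \<mu>2[OF zK] module_homD(1)[OF d_hom a(1)]])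
      ultimately have "d (r + q) (\<mu> r q a z) = \<mu> p q b z"
        using leibniz[OF a(1) zK] a(2) Suc
          deg.smult_zero deg.r_zero by simp
      then show ?thesis using Suc module_homD(1)[OF \<mu>2[OF zK] a(1)]
        by (auto simp: coboundaries_def intro!: image_eqI[of _ _ "\<mu> r q a z"])
    qed
  qed
  have c2: "\<mu> p q z b \<in> coboundaries K d (p + q)"
    if b: "b \<in> coboundaries K d q" and z: "z \<in> cocycles K d p" for q b z
  proof -
    have zK: "z \<in> carrier (K p)" and dz: "d p z = \<zero>\<^bsub>K (Suc p)\<^esub>" using z by (auto simp: cocycles_def)
    show ?thesis
    proof (cases q)
      case 0
      then have "\<mu> p q z b = \<zero>\<^bsub>K (p + q)\<^esub>"
        using b module_hom_zero[OF opgroup_K opgroup_K \<mu>1[OF zK, of 0]] by (simp add: coboundaries_def)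
      then show ?thesis using deg.opsub_props(2)[OF coboundaries_opsub] by simp
    next
      case (Suc r)
      then obtain a where a: "a \<in> carrier (K r)" "b = d r a" using b by (auto simp: coboundaries_def)
      have ma: "\<mu> p r z a \<in> carrier (K (p + r))" by (rule module_homD(1)[OF \<mu>1[OF zK] a(1)])
      have mb: "\<mu> p q z b \<in> carrier (K (p + q))"
        unfolding a(2) Suc by (rule module_homD(1)[OF \<mu>1[OF zK] module_homD(1)[OF d_hom a(1)]])
      have "\<mu> (Suc p) r (d p z) a = \<zero>\<^bsub>K (Suc (p + r))\<^esub>"
        using module_hom_zero[OF opgroup_K opgroup_K \<mu>2[OF a(1), of "Suc p"]] by (simp add: dz)
      then have "d (p + r) (\<mu> p r z a) = sg p \<odot>\<^bsub>K (p + q)\<^esub> \<mu> p q z b"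
        using leibniz[OF zK a(1)] mb a(2) Suc deg.l_zero deg.smult_closed by simp
      then have "d (p + r) (sg p \<odot>\<^bsub>K (p + r)\<^esub> \<mu> p r z a) = \<mu> p q z b"
        using module_homD(3)[OF d_hom ma, of "sg p"] sg[OF mb, of p] Suc by simp
      moreover have "sg p \<odot>\<^bsub>K (p + r)\<^esub> \<mu> p r z a \<in> carrier (K (p + r))"
        using opgroup.smult_closed[OF opgroup_K ma] .
      ultimately show ?thesis using Suc by (auto simp: coboundaries_def intro!: image_eqI[of _ _ "sg p \<odot>\<^bsub>K (p + r)\<^esub> \<mu> p r z a"])
    qed
  qed
  have xK: "x \<in> carrier (K p)" and yK: "y \<in> carrier (K q)" using x y cocyclesD by auto
  have "cl (p + q) (\<mu> p q x' y') = cl (p + q) (\<mu> p q x y)" if x': "x' \<in> cl p x" and y': "y' \<in> cl q y" for x' y'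
  proof -
    have x'K: "x' \<in> carrier (K p)" "x' \<ominus>\<^bsub>K p\<^esub> x \<in> coboundaries K d p"
      and y'K: "y' \<in> carrier (K q)" "y' \<ominus>\<^bsub>K q\<^esub> y \<in> coboundaries K d q"
      using x' y' mem_cl xK yK by auto
    have y'Z: "y' \<in> cocycles K d q"
    proof -
      have "y' = (y' \<ominus>\<^bsub>K q\<^esub> y) \<oplus>\<^bsub>K q\<^esub> y" using y'K yK by (simp add: deg.minus_eq deg.a_assoc deg.l_neg)
      then show ?thesis
        using deg.opsub_props(3)[OF cocycles_opsub _ y] y'K(2) coboundaries_cocycles by (metis subsetD)
    qed
    have "\<mu> p q x' y' \<ominus>\<^bsub>K (p + q)\<^esub> \<mu> p q x y' \<in> coboundaries K d (p + q)"
      using c1[OF x'K(2) y'Z] module_hom_minus[OF opgroup_K opgroup_K \<mu>2[OF y'K(1)] x'K(1) xK] by simp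
    then have 1: "cl (p + q) (\<mu> p q x' y') = cl (p + q) (\<mu> p q x y')"
      using cl_eq_iff module_homD(1)[OF \<mu>2[OF y'K(1)]] x'K(1) xK by simp
    have "\<mu> p q x y' \<ominus>\<^bsub>K (p + q)\<^esub> \<mu> p q x y \<in> coboundaries K d (p + q)"
      using c2[OF y'K(2) x] module_hom_minus[OF opgroup_K opgroup_K \<mu>1[OF xK] y'K(1) yK] by simp
    then have "cl (p + q) (\<mu> p q x y') = cl (p + q) (\<mu> p q x y)"
      using cl_eq_iff module_homD(1)[OF \<mu>1[OF xK]] y'K(1) yK by simp
    with 1 show ?thesis by simp
  qed
  then show ?thesis using cl_self[OF xK] cl_self[OF yK] unfolding coh_prod_def by blast
qed

section \<open>Steenrod's coboundary formula\<close>

lemma neg_one_mult_self: "(- 1) ^ n * (- 1) ^ n = (1::'k::{comm_ring,comm_monoid_mult})"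
  by (induction n) (simp_all add: mult.assoc mult.left_commute[of "(-1) ^ _"])

lemma neg_one_power: "(- 1) ^ n = (if even n then 1 else - 1 :: 'k::{comm_ring,comm_monoid_mult})"
  by (induction n) auto

lemma neg_one_power_cong:
  assumes "even m \<longleftrightarrow> even n"
  shows "(- 1) ^ m = ((- 1) ^ n :: 'k::{comm_ring,comm_monoid_mult})"
  using assms by (simp add: neg_one_power)

text \<open>
  The simplicial coboundary of a function of lists of vertices, as an alternating sum over the omitted
  vertex, and the change of sign on lists of odd length.
\<close>

fun dl :: "('v list \<Rightarrow> 'k::{comm_ring,comm_monoid_mult}) \<Rightarrow> 'v list \<Rightarrow> 'k" where
  "dl U [] = 0"
| "dl U (v # l) = U l - dl (\<lambda>l. U (v # l)) l"

definition sgnl :: "('v list \<Rightarrow> 'k::{comm_ring,comm_monoid_mult}) \<Rightarrow> 'v list \<Rightarrow> 'k" where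
  "sgnl U l = (- 1) ^ length l * U l"

text \<open>
  The sum over all ways to distribute the vertices of a list to the arguments of \<open>U\<close> and \<open>V\<close> so that
  \<open>r\<close> vertices go to both and the others alternate between them, changing at each of the \<open>r\<close> vertices
  and starting with \<open>U\<close> if \<open>b\<close> holds and with \<open>V\<close> otherwise.  Each vertex of \<open>V\<close> alone changes the
  sign once for each later vertex of \<open>U\<close>.
\<close>

fun cuts :: "nat \<Rightarrow> bool \<Rightarrow> ('v list \<Rightarrow> 'k) \<Rightarrow> ('v list \<Rightarrow> 'k) \<Rightarrow> 'v list
    \<Rightarrow> 'k::{comm_ring,comm_monoid_mult}" where
  "cuts r b U V [] = (if r = 0 then U [] * V [] else 0)"
| "cuts r b U V (v # vs) =
     (if b then cuts r b (\<lambda>l. U (v # l)) V vs else cuts r b (sgnl U) (\<lambda>l. V (v # l)) vs)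
     + (if r = 0 then 0 else cuts (r - 1) (\<not> b) (\<lambda>l. U (v # l)) (\<lambda>l. V (v # l)) vs)"

text \<open>The terms with one common vertex less, which are absent if there is none.\<close>

definition cuts' :: "nat \<Rightarrow> bool \<Rightarrow> ('v list \<Rightarrow> 'k) \<Rightarrow> ('v list \<Rightarrow> 'k) \<Rightarrow> 'v list
    \<Rightarrow> 'k::{comm_ring,comm_monoid_mult}" where
  "cuts' r b U V vs = (if r = 0 then 0 else cuts (r - 1) b U V vs)"

lemma dl_diff: "dl (\<lambda>l. U l - V l) l = dl U l - dl V l"
  by (induction l arbitrary: U V) (auto simp: algebra_simps)

lemma dl_add: "dl (\<lambda>l. U l + V l) l = dl U l + dl V l"
  by (induction l arbitrary: U V) (auto simp: algebra_simps)

lemma dl_scale: "dl (\<lambda>l. c * U l) l = c * dl U l"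
  by (induction l arbitrary: U) (auto simp: algebra_simps)

lemma dl_zero [simp]: "dl (\<lambda>l. 0) l = 0"
  by (induction l) auto

lemma dl_dl: "dl (dl U) l = 0"
proof (induction l arbitrary: U)
  case (Cons v l)
  then show ?case by (simp add: dl_diff)
qed simp

lemma sgnl_Cons: "sgnl U (v # l) = - sgnl (\<lambda>l. U (v # l)) l"
  by (auto simp: sgnl_def)

lemma dl_sgnl: "dl (sgnl U) l = - sgnl (dl U) l"
proof (induction l arbitrary: U)
  case (Cons v l)
  have "dl (\<lambda>l. sgnl U (v # l)) l = sgnl (dl (\<lambda>l. U (v # l))) l"
    using Cons[of "\<lambda>l. U (v # l)"] dl_scale[of "-1" "sgnl (\<lambda>l. U (v # l))" l]
    by (simp add: sgnl_Cons)
  then show ?case by (simp add: sgnl_def algebra_simps)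
qed (simp add: sgnl_def)

lemma sgnl_sgnl [simp]: "sgnl (sgnl U) = U"
  by (rule ext) (simp add: sgnl_def neg_one_mult_self flip: mult.assoc)

lemma cuts_addU: "cuts r b (\<lambda>l. U l + U' l) V vs = cuts r b U V vs + cuts r b U' V vs"
proof (induction vs arbitrary: r b U U' V)
  case (Cons v vs)
  have "sgnl (\<lambda>l. U l + U' l) = (\<lambda>l. sgnl U l + sgnl U' l)"
    by (auto simp: sgnl_def algebra_simps)
  then show ?case by (simp add: Cons)
qed (simp add: algebra_simps)

lemma cuts_addV: "cuts r b U (\<lambda>l. V l + V' l) vs = cuts r b U V vs + cuts r b U V' vs"
  by (induction vs arbitrary: r b U V V') (auto simp: algebra_simps)

lemma cuts_scaleU: "cuts r b (\<lambda>l. c * U l) V vs = c * cuts r b U V vs"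
proof (induction vs arbitrary: r b U V)
  case (Cons v vs)
  have "sgnl (\<lambda>l. c * U l) = (\<lambda>l. c * sgnl U l)"
    by (auto simp: sgnl_def mult.left_commute)
  then show ?case by (simp add: Cons distrib_left)
qed (simp add: mult.assoc)

lemma cuts_scaleV: "cuts r b U (\<lambda>l. c * V l) vs = c * cuts r b U V vs"
  by (induction vs arbitrary: r b U V) (auto simp: algebra_simps)

lemma cuts_uminusU: "cuts r b (\<lambda>l. - U l) V vs = - cuts r b U V vs"
  using cuts_scaleU[of r b "-1" U V vs] by simp

lemma cuts_uminusV: "cuts r b U (\<lambda>l. - V l) vs = - cuts r b U V vs"
  using cuts_scaleV[of r b U "-1" V vs] by simp

lemma cuts_diffU: "cuts r b (\<lambda>l. U l - U' l) V vs = cuts r b U V vs - cuts r b U' V vs"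
  using cuts_addU[of r b U "\<lambda>l. - U' l" V vs] by (simp add: cuts_uminusU)

lemma cuts_diffV: "cuts r b U (\<lambda>l. V l - V' l) vs = cuts r b U V vs - cuts r b U V' vs"
  using cuts_addV[of r b U V "\<lambda>l. - V' l" vs] by (simp add: cuts_uminusV)

text \<open>
  If, in the first two terms on the right, a common vertex is omitted from one factor, then the factors
  change at two adjacent vertices instead.  Every such term occurs twice and cancels, except at the two ends
  of the list, where the first or the last run is lost instead; the last two terms make up for these.
\<close>

theorem dl_cuts:
  fixes U :: "'v list \<Rightarrow> 'k::{comm_ring,comm_monoid_mult}"
  shows
  "dl (cuts r b U V) vs =
     cuts r b (dl U) V vs + (if b then - 1 else 1) * cuts r b (sgnl U) (dl V) vs
     - cuts' r (\<not> b) (sgnl U) V vs + (- 1) ^ length vs * cuts' r b U V vs"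
proof (induction vs arbitrary: r b U V)
  case Nil
  show ?case by (cases "r = 0"; cases "r = 1") (auto simp: cuts'_def sgnl_def)
next
  case (Cons v vs)
  let ?U = "\<lambda>l. U (v # l)" and ?V = "\<lambda>l. V (v # l)"
  have sg: "sgnl (dl W) = (\<lambda>l. - dl (sgnl W) l)" for W :: "'v list \<Rightarrow> 'k"
    by (rule ext) (simp add: dl_sgnl)
  show ?case
    by (cases "r = 0"; cases "r = 1"; cases b)
      (simp_all add: Cons cuts'_def dl_add dl_diff sgnl_Cons sg cuts_addU cuts_addV cuts_diffU cuts_diffV
        cuts_uminusU cuts_uminusV algebra_simps)
qed

section \<open>The category algebra and the comparison with the nerve\<close>

text \<open>The partial product of morphisms, and the unit of the category algebra.\<close>

definition cat_prod :: "('o, 'm) cat \<Rightarrow> 'm \<Rightarrow> 'm \<Rightarrow> 'm option" where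
  "cat_prod C a b = (if tgt C a = src C b then Some (Comp C a b) else None)"

definition cat_unit :: "('o, 'm) cat \<Rightarrow> ('m \<Rightarrow>\<^sub>0 'k::{comm_ring,comm_monoid_mult})" where
  "cat_unit C = (\<Sum>i\<in>Ob C. basis (Id C i))"

lemma cat_algebra_eq: "cat_algebra C = free_algebra (Arr C) (cat_prod C) (cat_unit C)"
  by (simp add: cat_algebra_def cat_prod_def[abs_def] cat_unit_def)

text \<open>The object at which a path that starts at \<open>i\<close> ends.\<close>

fun path_end :: "('o, 'm) cat \<Rightarrow> 'o \<Rightarrow> 'm list \<Rightarrow> 'o" where
  "path_end C i [] = i"
| "path_end C i (a # as) = path_end C (tgt C a) as"

text \<open>The sum of the coefficients at the basis elements in \<open>T\<close>.\<close>

definition aug :: "'m set \<Rightarrow> ('m \<Rightarrow>\<^sub>0 'k) \<Rightarrow> 'k::{comm_ring,comm_monoid_mult}" where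
  "aug T x = Poly_Mapping.lookup (lext (\<lambda>a. if a \<in> T then basis () else 0) x) ()"

lemma aug_simps [simp]:
  "aug T 0 = 0" "aug T (x + y) = aug T x + aug T y" "aug T (scale c x) = c * aug T x"
  "aug T (Poly_Mapping.single a b) = (if a \<in> T then b else 0)" "aug T (- x) = - aug T x"
  "aug T (x - y) = aug T x - aug T y"
  by (simp_all add: aug_def lext_add lext_scale lext_uminus lext_diff lookup_add lookup_minus)

lemma aug_sum: "aug T (\<Sum>i\<in>I. x i) = (\<Sum>i\<in>I. aug T (x i))"
  by (induction I rule: infinite_finite_induct) auto

lemma aug_lext_cong:
  assumes "\<And>a. a \<in> Poly_Mapping.keys x \<Longrightarrow> aug T (g a) = aug T' (h a)"
  shows "aug T (lext g x) = aug T' (lext h x)"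
  using assms by (auto simp: lext_def aug_sum intro!: sum.cong)

lemma single_sum: "Poly_Mapping.single a (\<Sum>i\<in>I. x i) = (\<Sum>i\<in>I. Poly_Mapping.single a (x i :: 'k::ab_group_add))"
  by (induction I rule: infinite_finite_induct) (auto simp: single_add)

text \<open>A category with finitely many objects, with composition written from left to right.\<close>

locale fin_cat =
  fixes C :: "('o, 'm) cat"
  assumes finite_Ob: "finite (Ob C)"
    and src_Ob: "a \<in> Arr C \<Longrightarrow> src C a \<in> Ob C" and tgt_Ob: "a \<in> Arr C \<Longrightarrow> tgt C a \<in> Ob C"
    and Id: "i \<in> Ob C \<Longrightarrow> Id C i \<in> Arr C" "i \<in> Ob C \<Longrightarrow> src C (Id C i) = i" "i \<in> Ob C \<Longrightarrow> tgt C (Id C i) = i"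
    and Comp: "a \<in> Arr C \<Longrightarrow> b \<in> Arr C \<Longrightarrow> tgt C a = src C b \<Longrightarrow> Comp C a b \<in> Arr C"
      "a \<in> Arr C \<Longrightarrow> b \<in> Arr C \<Longrightarrow> tgt C a = src C b \<Longrightarrow> src C (Comp C a b) = src C a"
      "a \<in> Arr C \<Longrightarrow> b \<in> Arr C \<Longrightarrow> tgt C a = src C b \<Longrightarrow> tgt C (Comp C a b) = tgt C b"
    and Comp_assoc: "a \<in> Arr C \<Longrightarrow> b \<in> Arr C \<Longrightarrow> c \<in> Arr C \<Longrightarrow> tgt C a = src C b \<Longrightarrow>
      tgt C b = src C c \<Longrightarrow> Comp C (Comp C a b) c = Comp C a (Comp C b c)"
    and Comp_Id: "a \<in> Arr C \<Longrightarrow> Comp C (Id C (src C a)) a = a" "a \<in> Arr C \<Longrightarrow> Comp C a (Id C (tgt C a)) = a"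
begin

lemma is_path_props:
  "is_path C i as \<Longrightarrow> i \<in> Ob C \<and> path_end C i as \<in> Ob C \<and> set as \<subseteq> Arr C \<and>
    composite C i as \<in> Arr C \<and> src C (composite C i as) = i \<and> tgt C (composite C i as) = path_end C i as"
  by (induction as arbitrary: i) (auto simp: Id Comp)

lemma is_path_start: "is_path C i as \<Longrightarrow> as \<noteq> [] \<Longrightarrow> src C (hd as) = i"
  by (cases as) auto

lemma path_end_append [simp]: "path_end C i (as @ bs) = path_end C (path_end C i as) bs"
  by (induction as arbitrary: i) auto

lemma is_path_append:
  "is_path C i (as @ bs) \<longleftrightarrow> is_path C i as \<and> is_path C (path_end C i as) bs"
proof (induction as arbitrary: i)
  case Nil
  then show ?case by (cases bs) auto
qed auto

lemma composite_append:
  "is_path C i (as @ bs) \<Longrightarrow> composite C i (as @ bs) = Comp C (composite C i as) (composite C (path_end C i as) bs)"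
proof (induction as arbitrary: i)
  case Nil
  then show ?case using is_path_props[of i bs] Comp_Id(1)[of "composite C i bs"] by simp
next
  case (Cons a as)
  then show ?case
    using is_path_props[of "tgt C a" as] is_path_props[of "path_end C (tgt C a) as" bs]
    by (simp add: is_path_append Comp_assoc)
qed

lemma bmerge_path:
  assumes "bmerge (cat_prod C) k as = Some bs" "set as \<subseteq> Arr C"
  shows "is_path C i bs \<longleftrightarrow> is_path C i as"
    and "is_path C i as \<Longrightarrow> composite C i bs = composite C i as \<and> path_end C i bs = path_end C i as"
proof -
  have "(is_path C i bs \<longleftrightarrow> is_path C i as) \<and>
    (is_path C i as \<longrightarrow> composite C i bs = composite C i as \<and> path_end C i bs = path_end C i as)"
    using assms
  proof (induction k arbitrary: as bs i)
    case 0
    then obtain a b cs c where *: "as = a # b # cs" "cat_prod C a b = Some c" "bs = c # cs"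
      by (cases "(cat_prod C, 0::nat, as)" rule: bmerge.cases) auto
    then have c: "tgt C a = src C b" "c = Comp C a b" by (auto simp: cat_prod_def split: if_splits)
    have ab: "a \<in> Arr C" "b \<in> Arr C" using 0 * by auto
    have "is_path C (tgt C b) cs \<Longrightarrow> Comp C (Comp C a b) (composite C (tgt C b) cs) =
        Comp C a (Comp C b (composite C (tgt C b) cs))"
      using is_path_props[of "tgt C b" cs] ab c by (intro Comp_assoc) auto
    then show ?case using * c ab by (auto simp: Comp src_Ob)
  next
    case (Suc k)
    then obtain a cs ds where "as = a # cs" "bmerge (cat_prod C) k cs = Some ds" "bs = a # ds"
      by (cases as) auto
    then show ?case using Suc.IH[of cs ds "tgt C a"] Suc.prems by auto
  qed
  then show "is_path C i bs \<longleftrightarrow> is_path C i as"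
    and "is_path C i as \<Longrightarrow> composite C i bs = composite C i as \<and> path_end C i bs = path_end C i as" by auto
qed

lemma bmerge_path_eq:
  assumes "is_path C i as" "Suc k < length as"
  shows "bmerge (cat_prod C) k as = Some (take k as @ Comp C (as ! k) (as ! Suc k) # drop (Suc (Suc k)) as)"
  using assms
proof (induction k arbitrary: as i)
  case 0
  then obtain a b cs where "as = a # b # cs" by (cases as; cases "tl as") auto
  with 0 show ?case by (auto simp: cat_prod_def)
next
  case (Suc k)
  then obtain a cs where "as = a # cs" by (cases as) auto
  with Suc show ?case by auto
qed

subsection \<open>Faces\<close>

lemma nerve_iff: "(i, as) \<in> nerve C n \<longleftrightarrow> is_path C i as \<and> length as = n"
  by (auto simp: nerve_def)

text \<open>The morphism from vertex number \<open>s\<close> to vertex number \<open>t\<close> of a simplex.\<close>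

definition seg :: "('o, 'm) simplex \<Rightarrow> nat \<Rightarrow> nat \<Rightarrow> 'm" where
  "seg \<sigma> s t = composite C (vertex C \<sigma> s) (take (t - s) (drop s (snd \<sigma>)))"

lemma face_seg: "face C \<sigma> ss = (vertex C \<sigma> (hd ss), map (\<lambda>(s, t). seg \<sigma> s t) (zip ss (tl ss)))"
  by (simp add: face_def seg_def)

lemma vertex_path_end: "s \<le> length as \<Longrightarrow> vertex C (i, as) s = path_end C i (take s as)"
proof (induction as arbitrary: i s)
  case (Cons a as)
  show ?case
  proof (cases s)
    case (Suc r)
    then show ?thesis using Cons.IH[of r "tgt C a"] Cons.prems by (cases r) (auto simp: vertex_def)
  qed (simp add: vertex_def)
qed (simp add: vertex_def)

lemma sub_path:
  assumes "is_path C i as" "s \<le> t" "t \<le> length as"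
  shows "is_path C (vertex C (i, as) s) (take (t - s) (drop s as))"
    "path_end C (vertex C (i, as) s) (take (t - s) (drop s as)) = vertex C (i, as) t"
proof -
  have "as = take s as @ take (t - s) (drop s as) @ drop (t - s) (drop s as)"
    by (metis append_take_drop_id)
  then have "is_path C i (take s as @ take (t - s) (drop s as) @ drop (t - s) (drop s as))"
    using assms(1) by simp
  then show "is_path C (vertex C (i, as) s) (take (t - s) (drop s as))"
    using assms by (simp only: is_path_append vertex_path_end)
  have "take t as = take s as @ take (t - s) (drop s as)"
    using assms(2) by (metis le_add_diff_inverse take_add)
  then show "path_end C (vertex C (i, as) s) (take (t - s) (drop s as)) = vertex C (i, as) t"
    using assms by (simp add: vertex_path_end)
qed

lemma seg_props:
  assumes "is_path C i as" "s \<le> t" "t \<le> length as"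
  shows "seg (i, as) s t \<in> Arr C" "src C (seg (i, as) s t) = vertex C (i, as) s"
    "tgt C (seg (i, as) s t) = vertex C (i, as) t"
  using is_path_props[OF sub_path(1)[OF assms]] sub_path(2)[OF assms] by (auto simp: seg_def)

lemma seg_seg:
  assumes "is_path C i as" "r \<le> s" "s \<le> t" "t \<le> length as"
  shows "Comp C (seg (i, as) r s) (seg (i, as) s t) = seg (i, as) r t"
proof -
  have eq: "take (t - r) (drop r as) = take (s - r) (drop r as) @ take (t - s) (drop s as)"
  proof -
    have "t - r = (s - r) + (t - s)" using assms by simp
    then have "take (t - r) (drop r as) = take (s - r) (drop r as) @ take (t - s) (drop (s - r) (drop r as))"
      by (simp only: take_add)
    then show ?thesis using assms by simp
  qed
  have "is_path C (vertex C (i, as) r) (take (t - r) (drop r as))"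
    using assms by (intro sub_path) auto
  then show ?thesis
    unfolding eq seg_def snd_conv using composite_append sub_path(2)[OF assms(1,2)] assms by simp
qed

lemma seg_Suc:
  assumes "is_path C i as" "s < length as"
  shows "seg (i, as) s (Suc s) = as ! s"
proof -
  have "as ! s \<in> Arr C" using is_path_props[OF assms(1)] nth_mem[OF assms(2)] by blast
  then show ?thesis
    using assms Comp_Id(2)[of "as ! s"]
    by (simp add: seg_def take_Suc_conv_app_nth hd_drop_conv_nth flip: Cons_nth_drop_Suc)
qed

lemma seg_refl: "seg (i, as) s s = Id C (vertex C (i, as) s)"
  by (simp add: seg_def)

lemma length_face: "length (snd (face C \<sigma> ss)) = length ss - 1"
  by (simp add: face_def)

lemma face_nth: "Suc k < length ss \<Longrightarrow> snd (face C \<sigma> ss) ! k = seg \<sigma> (ss ! k) (ss ! Suc k)"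
  by (simp add: face_seg nth_tl)

lemma face_path:
  assumes p: "is_path C i as" and ss: "ss \<noteq> []" "sorted_wrt (<) ss" "\<forall>s\<in>set ss. s \<le> length as"
  shows "is_path C (fst (face C (i, as) ss)) (snd (face C (i, as) ss)) \<and>
    path_end C (fst (face C (i, as) ss)) (snd (face C (i, as) ss)) = vertex C (i, as) (last ss)"
  using ss
proof (induction ss)
  case (Cons s ss)
  show ?case
  proof (cases ss)
    case Nil
    have "s \<le> length as" using Cons.prems by auto
    then have "vertex C (i, as) s \<in> Ob C"
      using is_path_props[OF sub_path(1)[OF p, of s s]] by simp
    then show ?thesis using Nil by (simp add: face_seg)
  next
    case t: (Cons t ts)
    have st: "s \<le> t" "t \<le> length as" using Cons.prems t by auto
    have "s \<le> length as" using Cons.prems by auto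
    then have "vertex C (i, as) s \<in> Ob C"
      using is_path_props[OF sub_path(1)[OF p, of s s]] by simp
    moreover have "is_path C (fst (face C (i, as) ss)) (snd (face C (i, as) ss)) \<and>
      path_end C (fst (face C (i, as) ss)) (snd (face C (i, as) ss)) = vertex C (i, as) (last ss)"
      using Cons t by auto
    ultimately show ?thesis using seg_props[OF p st] t by (simp add: face_seg)
  qed
qed simp

lemma face_nerve:
  assumes "\<sigma> \<in> nerve C n" "ss \<noteq> []" "sorted_wrt (<) ss" "\<forall>s\<in>set ss. s \<le> n"
  shows "face C \<sigma> ss \<in> nerve C (length ss - 1)"
proof -
  obtain i as where s: "\<sigma> = (i, as)" by (cases \<sigma>)
  have "is_path C (fst (face C \<sigma> ss)) (snd (face C \<sigma> ss))"
    using face_path[of i as ss] assms by (simp add: s nerve_iff)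
  then show ?thesis using length_face[of \<sigma> ss] by (simp add: nerve_def split_def)
qed

lemma face_interval:
  assumes p: "is_path C i as" and st: "s \<le> t" "t \<le> length as"
  shows "face C (i, as) [s..<Suc t] = (vertex C (i, as) s, take (t - s) (drop s as))"
proof (rule prod_eqI)
  show "fst (face C (i, as) [s..<Suc t]) = fst (vertex C (i, as) s, take (t - s) (drop s as))"
    using st by (simp add: face_def del: upt_Suc)
  show "snd (face C (i, as) [s..<Suc t]) = snd (vertex C (i, as) s, take (t - s) (drop s as))"
    by (rule nth_equalityI) (use p st in \<open>auto simp: length_face face_nth seg_Suc simp del: upt_Suc\<close>)
qed

lemma remove1_upt: "j < n \<Longrightarrow> remove1 j [0..<n] = [0..<j] @ [Suc j..<n]"
proof -
  assume "j < n"
  then have "[0..<n] = [0..<j] @ j # [Suc j..<n]"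
    using upt_add_eq_append[of 0 j "n - j"] upt_conv_Cons[of j n] by simp
  then show ?thesis by (simp add: remove1_append)
qed

lemma face_remove:
  assumes p: "is_path C i as" and len: "length as = Suc n"
  shows "face C (i, as) (remove1 0 [0..<n + 2]) = (tgt C (hd as), tl as)"
    and "k < n \<Longrightarrow> face C (i, as) (remove1 (Suc k) [0..<n + 2]) = (i, the (bmerge (cat_prod C) k as))"
    and "face C (i, as) (remove1 (Suc n) [0..<n + 2]) = (i, butlast as)"
proof -
  have "remove1 0 [0..<n + 2] = [1..<Suc (Suc n)]" by (simp add: upt_conv_Cons del: upt_Suc)
  moreover have "vertex C (i, as) 1 = tgt C (hd as)" using len by (cases as) (auto simp: vertex_def)
  ultimately show "face C (i, as) (remove1 0 [0..<n + 2]) = (tgt C (hd as), tl as)"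
    using face_interval[OF p, of 1 "Suc n"] len by (simp add: drop_Suc del: upt_Suc)
  have "remove1 (Suc n) [0..<n + 2] = [0..<Suc n]" using remove1_upt[of "Suc n" "n + 2"] by (simp del: upt_Suc)
  then show "face C (i, as) (remove1 (Suc n) [0..<n + 2]) = (i, butlast as)"
    using face_interval[OF p, of 0 n] len by (simp add: vertex_def butlast_conv_take del: upt_Suc)
  assume k: "k < n"
  define ss where "ss = [0..<Suc k] @ [Suc (Suc k)..<n + 2]"
  have rem: "remove1 (Suc k) [0..<n + 2] = ss" using k remove1_upt[of "Suc k" "n + 2"] by (simp add: ss_def)
  have len_ss: "length ss = Suc n" using k by (simp add: ss_def del: upt_Suc)
  have nth_ss: "l < Suc n \<Longrightarrow> ss ! l = (if l \<le> k then l else Suc l)" for l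
    using k by (auto simp: ss_def nth_append simp del: upt_Suc)
  have bm: "bmerge (cat_prod C) k as = Some (take k as @ Comp C (as ! k) (as ! Suc k) # drop (Suc (Suc k)) as)"
    by (rule bmerge_path_eq[OF p]) (use k len in simp)
  have "snd (face C (i, as) ss) = take k as @ Comp C (as ! k) (as ! Suc k) # drop (Suc (Suc k)) as"
  proof (rule nth_equalityI)
    fix l assume "l < length (snd (face C (i, as) ss))"
    then have l: "l < n" by (simp add: length_face len_ss)
    have face: "snd (face C (i, as) ss) ! l = seg (i, as) (ss ! l) (ss ! Suc l)"
      using l by (simp add: face_nth len_ss)
    consider "l < k" | "l = k" | "l > k" by linarith
    then show "snd (face C (i, as) ss) ! l = (take k as @ Comp C (as ! k) (as ! Suc k) # drop (Suc (Suc k)) as) ! l"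
    proof cases
      case 1
      then show ?thesis using l len k by (simp add: face nth_ss seg_Suc[OF p] nth_append)
    next
      case 2
      have "seg (i, as) k (Suc (Suc k)) = Comp C (seg (i, as) k (Suc k)) (seg (i, as) (Suc k) (Suc (Suc k)))"
        by (rule seg_seg[OF p, symmetric]) (use k len in auto)
      then show ?thesis using face 2 l len k by (simp add: nth_ss seg_Suc[OF p] nth_append)
    next
      case 3
      then have "(take k as @ Comp C (as ! k) (as ! Suc k) # drop (Suc (Suc k)) as) ! l = as ! Suc l"
        using l len k by (auto simp: nth_append nth_Cons' not_less)
      then show ?thesis using 3 l len by (simp add: face nth_ss seg_Suc[OF p])
    qed
  qed (use k len in \<open>simp add: length_face len_ss\<close>)
  moreover have "fst (face C (i, as) ss) = i"
    by (simp add: face_def vertex_def ss_def upt_conv_Cons del: upt_Suc)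
  ultimately show "face C (i, as) (remove1 (Suc k) [0..<n + 2]) = (i, the (bmerge (cat_prod C) k as))"
    unfolding rem bm by (simp add: prod_eq_iff)
qed

lemma scochain_d_path:
  assumes p: "is_path C i as" and len: "length as = Suc n"
  shows "scochain_d C n \<gamma> (i, as) = \<gamma> (tgt C (hd as), tl as)
    + (\<Sum>k<n. (- 1) ^ Suc k * \<gamma> (i, the (bmerge (cat_prod C) k as))) + (- 1) ^ Suc n * \<gamma> (i, butlast as)"
proof -
  have "(i, as) \<in> nerve C (Suc n)" using p len by (simp add: nerve_iff)
  then have "scochain_d C n \<gamma> (i, as) =
      (\<Sum>j<Suc (Suc n). (- 1) ^ j * \<gamma> (face C (i, as) (remove1 j [0..<n + 2])))"
    unfolding scochain_d_def by (simp add: lessThan_Suc_atMost)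
  also have "\<dots> = \<gamma> (face C (i, as) (remove1 0 [0..<n + 2]))
      + (\<Sum>k<n. (- 1) ^ Suc k * \<gamma> (face C (i, as) (remove1 (Suc k) [0..<n + 2])))
      + (- 1) ^ Suc n * \<gamma> (face C (i, as) (remove1 (Suc n) [0..<n + 2]))"
    by (subst sum.lessThan_Suc, subst sum.lessThan_Suc_shift) simp
  also have "(\<Sum>k<n. (- 1) ^ Suc k * \<gamma> (face C (i, as) (remove1 (Suc k) [0..<n + 2]))) =
      (\<Sum>k<n. (- 1) ^ Suc k * \<gamma> (i, the (bmerge (cat_prod C) k as)))"
    by (rule sum.cong) (simp_all only: lessThan_iff face_remove(2)[OF p len])
  finally show ?thesis by (simp only: face_remove(1,3)[OF p len])
qed

subsection \<open>The comparison maps\<close>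

text \<open>
  The objects at which a list of morphisms is a path: at most one unless the list is empty, and all of
  them if it is empty.  To sum over them treats degree zero like the others.
\<close>

definition starts :: "'m list \<Rightarrow> 'o set" where
  "starts as = {i. is_path C i as}"

lemma starts_Ob: "starts as \<subseteq> Ob C"
  using is_path_props by (auto simp: starts_def)

lemma finite_starts [simp]: "finite (starts as)"
  using finite_subset[OF starts_Ob finite_Ob] .

text \<open>The cochain \<open>\<Psi>(\<gamma>)\<close> on lists of morphisms.\<close>

definition bPsi :: "(('o, 'm) simplex \<Rightarrow> 'k) \<Rightarrow> 'm list \<Rightarrow> ('m \<Rightarrow>\<^sub>0 'k::{comm_ring,comm_monoid_mult})" where
  "bPsi \<gamma> as = (\<Sum>i\<in>starts as. Poly_Mapping.single (composite C i as) (\<gamma> (i, as)))"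

text \<open>The sums of the coefficients of the values on paths, over the morphisms between the end points.\<close>

definition baug :: "('m list \<Rightarrow> ('m \<Rightarrow>\<^sub>0 'k)) \<Rightarrow> ('o, 'm) simplex \<Rightarrow> 'k::{comm_ring,comm_monoid_mult}" where
  "baug F = (\<lambda>(i, as). aug (Mor C i (path_end C i as)) (F as))"

lemma bcochain_bPsi: "bcochain (Arr C) n (bPsi \<gamma>)"
  unfolding bcochain_def bPsi_def
  using is_path_props by (auto intro!: keys_sum_subset keys_single_subset simp: starts_def)

lemma pmult_single_left:
  "pmult (cat_prod C) (basis a) (Poly_Mapping.single b c) =
     (if tgt C a = src C b then Poly_Mapping.single (Comp C a b) c else 0)"
  and pmult_single_right:
  "pmult (cat_prod C) (Poly_Mapping.single b c) (basis a) =
     (if tgt C b = src C a then Poly_Mapping.single (Comp C b a) c else 0)"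
  by (auto simp: pmult_def cat_prod_def)

lemma pmult_bPsi_left:
  assumes "a \<in> Arr C"
  shows "pmult (cat_prod C) (basis a) (bPsi \<gamma> as) =
    (\<Sum>i\<in>starts (a # as). Poly_Mapping.single (composite C i (a # as)) (\<gamma> (tgt C a, as)))"
proof -
  have "pmult (cat_prod C) (basis a) (bPsi \<gamma> as) =
      (\<Sum>i\<in>starts as. if tgt C a = i
         then Poly_Mapping.single (Comp C a (composite C i as)) (\<gamma> (i, as)) else 0)"
    unfolding bPsi_def pmult_sum
    by (rule sum.cong) (use is_path_props in \<open>auto simp: pmult_single_left starts_def\<close>)
  also have "\<dots> = (if tgt C a \<in> starts as
      then Poly_Mapping.single (Comp C a (composite C (tgt C a) as)) (\<gamma> (tgt C a, as)) else 0)"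
    by (simp add: sum.delta')
  also have "starts (a # as) = (if tgt C a \<in> starts as then {src C a} else {})"
    using assms src_Ob by (auto simp: starts_def)
  ultimately show ?thesis by simp
qed

lemma pmult_bPsi_right:
  assumes "a \<in> Arr C"
  shows "pmult (cat_prod C) (bPsi \<gamma> as) (basis a) =
    (\<Sum>i\<in>starts (as @ [a]). Poly_Mapping.single (composite C i (as @ [a])) (\<gamma> (i, as)))"
proof -
  have s: "starts (as @ [a]) = {i \<in> starts as. path_end C i as = src C a}"
    using assms is_path_props tgt_Ob by (auto simp: starts_def is_path_append)
  have "pmult (cat_prod C) (bPsi \<gamma> as) (basis a) =
      (\<Sum>i\<in>starts as. if path_end C i as = src C a
         then Poly_Mapping.single (composite C i (as @ [a])) (\<gamma> (i, as)) else 0)"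
    unfolding bPsi_def pmult_sum
  proof (rule sum.cong)
    fix i assume "i \<in> starts as"
    then show "pmult (cat_prod C) (Poly_Mapping.single (composite C i as) (\<gamma> (i, as))) (basis a) =
        (if path_end C i as = src C a
         then Poly_Mapping.single (composite C i (as @ [a])) (\<gamma> (i, as)) else 0)"
      using is_path_props[of i as] composite_append[of i as "[a]"] assms tgt_Ob Comp_Id(2)[of a]
      by (auto simp: pmult_single_right starts_def is_path_append)
  qed simp
  then show ?thesis unfolding s by (simp add: sum.inter_filter)
qed

lemma on_opt_bPsi:
  assumes "set as \<subseteq> Arr C" "Suc k < length as"
  shows "on_opt (bPsi \<gamma>) (bmerge (cat_prod C) k as) =
    (\<Sum>i\<in>starts as. Poly_Mapping.single (composite C i as) (\<gamma> (i, the (bmerge (cat_prod C) k as))))"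
proof (cases "bmerge (cat_prod C) k as")
  case None
  then have "starts as = {}" using bmerge_path_eq assms(2) by (fastforce simp: starts_def)
  then show ?thesis using None by simp
next
  case (Some bs)
  then have "starts bs = starts as" "\<And>i. i \<in> starts as \<Longrightarrow> composite C i bs = composite C i as"
    using bmerge_path[OF Some assms(1)] by (auto simp: starts_def)
  then show ?thesis using Some by (simp add: bPsi_def)
qed

theorem bdiff_bPsi:
  assumes as: "set as \<subseteq> Arr C" "length as = Suc n"
  shows "bdiff (cat_prod C) n (bPsi \<gamma>) as = bPsi (scochain_d C n \<gamma>) as"
proof -
  have ne: "as \<noteq> []" using as by auto
  then have hl: "hd as \<in> Arr C" "last as \<in> Arr C" using as by auto
  let ?s = "\<lambda>i. Poly_Mapping.single (composite C i as)"
  have 1: "pmult (cat_prod C) (basis (hd as)) (bPsi \<gamma> (tl as)) = (\<Sum>i\<in>starts as. ?s i (\<gamma> (tgt C (hd as), tl as)))"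
    using pmult_bPsi_left[OF hl(1), of \<gamma> "tl as"] ne by simp
  have 2: "pmult (cat_prod C) (bPsi \<gamma> (butlast as)) (basis (last as)) = (\<Sum>i\<in>starts as. ?s i (\<gamma> (i, butlast as)))"
    using pmult_bPsi_right[OF hl(2), of \<gamma> "butlast as"] ne by simp
  have "bdiff (cat_prod C) n (bPsi \<gamma>) as = (\<Sum>i\<in>starts as. ?s i (\<gamma> (tgt C (hd as), tl as)))
      + (\<Sum>k<n. \<Sum>i\<in>starts as. ?s i ((- 1) ^ Suc k * \<gamma> (i, the (bmerge (cat_prod C) k as))))
      + (\<Sum>i\<in>starts as. ?s i ((- 1) ^ Suc n * \<gamma> (i, butlast as)))"
    unfolding bdiff_def 1 2 using as by (simp add: on_opt_bPsi scale_sum del: power_Suc)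
  also have "\<dots> = bPsi (scochain_d C n \<gamma>) as"
    unfolding bPsi_def
  proof (subst sum.swap, unfold sum.distrib[symmetric], rule sum.cong)
    fix i assume "i \<in> starts as"
    then have "is_path C i as" by (simp add: starts_def)
    then show "?s i (\<gamma> (tgt C (hd as), tl as))
        + (\<Sum>k<n. ?s i ((- 1) ^ Suc k * \<gamma> (i, the (bmerge (cat_prod C) k as))))
        + ?s i ((- 1) ^ Suc n * \<gamma> (i, butlast as)) = ?s i (scochain_d C n \<gamma> (i, as))"
      using as by (simp only: scochain_d_path single_add single_sum)
  qed simp
  finally show ?thesis .
qed

lemma aug_pmult_left:
  fixes x :: "'m \<Rightarrow>\<^sub>0 'k::{comm_ring,comm_monoid_mult}"
  assumes "a \<in> Arr C" "Poly_Mapping.keys x \<subseteq> Arr C"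
  shows "aug (Mor C (src C a) j) (pmult (cat_prod C) (basis a) x) = aug (Mor C (tgt C a) j) x"
proof -
  have "aug (Mor C (src C a) j) (pmult (cat_prod C) (basis a) x) = aug (Mor C (tgt C a) j) (lext basis x)"
    unfolding pmult_basis_left
  proof (rule aug_lext_cong)
    fix b assume "b \<in> Poly_Mapping.keys x"
    then have "b \<in> Arr C" using assms by auto
    then show "aug (Mor C (src C a) j) (case cat_prod C a b of None \<Rightarrow> 0 | Some c \<Rightarrow> basis c) =
        aug (Mor C (tgt C a) j) (basis b :: 'm \<Rightarrow>\<^sub>0 'k)"
      using assms(1) Comp[of a b] by (auto simp: cat_prod_def Mor_def)
  qed
  then show ?thesis by (simp add: lext_basis)
qed

lemma aug_pmult_right:
  fixes x :: "'m \<Rightarrow>\<^sub>0 'k::{comm_ring,comm_monoid_mult}"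
  assumes "a \<in> Arr C" "Poly_Mapping.keys x \<subseteq> Arr C"
  shows "aug (Mor C i (tgt C a)) (pmult (cat_prod C) x (basis a)) = aug (Mor C i (src C a)) x"
proof -
  have "aug (Mor C i (tgt C a)) (pmult (cat_prod C) x (basis a)) = aug (Mor C i (src C a)) (lext basis x)"
    unfolding pmult_basis_right
  proof (rule aug_lext_cong)
    fix b assume "b \<in> Poly_Mapping.keys x"
    then have "b \<in> Arr C" using assms by auto
    then show "aug (Mor C i (tgt C a)) (case cat_prod C b a of None \<Rightarrow> 0 | Some c \<Rightarrow> basis c) =
        aug (Mor C i (src C a)) (basis b :: 'm \<Rightarrow>\<^sub>0 'k)"
      using assms(1) Comp[of b a] by (auto simp: cat_prod_def Mor_def)
  qed
  then show ?thesis by (simp add: lext_basis)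
qed

theorem baug_bdiff:
  assumes F: "bcochain (Arr C) n F" and p: "is_path C i as" and len: "length as = Suc n"
  shows "baug (bdiff (cat_prod C) n F) (i, as) = scochain_d C n (baug F) (i, as)"
proof -
  have ne: "as \<noteq> []" using len by auto
  have as: "set as \<subseteq> Arr C" using is_path_props[OF p] by simp
  have hl: "hd as \<in> Arr C" "last as \<in> Arr C" using as ne by auto
  have sub: "set (tl as) \<subseteq> Arr C" "set (butlast as) \<subseteq> Arr C"
    using as ne by (auto dest: in_set_butlastD list.set_sel(2))
  have kF: "Poly_Mapping.keys (F (tl as)) \<subseteq> Arr C" "Poly_Mapping.keys (F (butlast as)) \<subseteq> Arr C"
    using F sub len by (auto simp: bcochain_def)
  let ?j = "path_end C i as"
  have i: "src C (hd as) = i" using is_path_start[OF p ne] .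
  have e1: "path_end C (tgt C (hd as)) (tl as) = ?j" using ne by (cases as) auto
  have p2: "is_path C i (butlast as @ [last as])" using p ne by simp
  then have e2: "path_end C i (butlast as) = src C (last as)" by (simp add: is_path_append)
  have j: "tgt C (last as) = ?j" using path_end_append[of i "butlast as" "[last as]"] ne by simp
  have 1: "aug (Mor C i ?j) (pmult (cat_prod C) (basis (hd as)) (F (tl as))) = baug F (tgt C (hd as), tl as)"
    using aug_pmult_left[OF hl(1) kF(1), of ?j] by (simp add: baug_def i e1)
  have 2: "aug (Mor C i ?j) (pmult (cat_prod C) (F (butlast as)) (basis (last as))) = baug F (i, butlast as)"
    using aug_pmult_right[OF hl(2) kF(2), of i] by (simp add: baug_def j e2)
  have 3: "aug (Mor C i ?j) (on_opt F (bmerge (cat_prod C) k as)) = baug F (i, the (bmerge (cat_prod C) k as))"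
    if "k < n" for k
    using bmerge_path_eq[OF p, of k] bmerge_path(2)[OF bmerge_path_eq[OF p, of k] as p] that len
    by (simp add: baug_def)
  have "baug (bdiff (cat_prod C) n F) (i, as) = aug (Mor C i ?j) (bdiff (cat_prod C) n F as)"
    by (simp add: baug_def)
  also have "\<dots> = baug F (tgt C (hd as), tl as)
      + (\<Sum>k<n. (- 1) ^ Suc k * aug (Mor C i ?j) (on_opt F (bmerge (cat_prod C) k as)))
      + (- 1) ^ Suc n * baug F (i, butlast as)"
    by (simp only: bdiff_def aug_simps aug_sum 1 2)
  also have "(\<Sum>k<n. (- 1) ^ Suc k * aug (Mor C i ?j) (on_opt F (bmerge (cat_prod C) k as))) =
      (\<Sum>k<n. (- 1) ^ Suc k * baug F (i, the (bmerge (cat_prod C) k as)))"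
    by (rule sum.cong) (simp_all add: 3)
  finally show ?thesis unfolding scochain_d_path[OF p len] .
qed

lemma baug_bPsi:
  assumes p: "is_path C i as"
  shows "baug (bPsi \<gamma>) (i, as) = \<gamma> (i, as)"
proof -
  have "baug (bPsi \<gamma>) (i, as) = (\<Sum>i'\<in>starts as. if i' = i then \<gamma> (i', as) else 0)"
    unfolding baug_def bPsi_def prod.case aug_sum
    by (rule sum.cong) (use is_path_props in \<open>auto simp: Mor_def starts_def\<close>)
  moreover have "i \<in> starts as" using p by (simp add: starts_def)
  ultimately show ?thesis by simp
qed

end

lemma ml_expand:
  "ml F xs = (\<Sum>as | list_all2 (\<lambda>a x. a \<in> Poly_Mapping.keys x) as xs.
     scale (\<Prod>j<length xs. Poly_Mapping.lookup (xs ! j) (as ! j)) (F as))"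
  and finite_list_all2_keys: "finite {as. list_all2 (\<lambda>a x. a \<in> Poly_Mapping.keys x) as xs}"
proof (induction xs arbitrary: F)
  case (Cons x xs)
  let ?T = "{as. list_all2 (\<lambda>a x. a \<in> Poly_Mapping.keys x) as xs}"
  have set: "{as. list_all2 (\<lambda>a x. a \<in> Poly_Mapping.keys x) as (x # xs)} =
      (\<lambda>(a, as). a # as) ` (Poly_Mapping.keys x \<times> ?T)"
    by (auto simp: list_all2_Cons2)
  show "finite {as. list_all2 (\<lambda>a x. a \<in> Poly_Mapping.keys x) as (x # xs)}"
    unfolding set using Cons by auto
  case 1
  have "ml F (x # xs) = (\<Sum>a\<in>Poly_Mapping.keys x. \<Sum>as\<in>?T.
      scale (Poly_Mapping.lookup x a * (\<Prod>j<length xs. Poly_Mapping.lookup (xs ! j) (as ! j))) (F (a # as)))"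
    using Cons(1) by (simp add: lext_def scale_sum)
  also have "\<dots> = (\<Sum>(a, as)\<in>Poly_Mapping.keys x \<times> ?T.
      scale (\<Prod>j<length (x # xs). Poly_Mapping.lookup ((x # xs) ! j) ((a # as) ! j)) (F (a # as)))"
    unfolding list.size(4) add_Suc_right add_0_right prod.lessThan_Suc_shift
    by (simp add: sum.cartesian_product)
  also have "\<dots> = (\<Sum>as | list_all2 (\<lambda>a x. a \<in> Poly_Mapping.keys x) as (x # xs).
     scale (\<Prod>j<length (x # xs). Poly_Mapping.lookup ((x # xs) ! j) (as ! j)) (F as))"
    unfolding set by (subst sum.reindex) (auto simp: inj_on_def split_def)
  finally show ?case .
qed simp_all

lemma (in fin_cat) Psi_eq_mext:
  fixes \<gamma> :: "('o, 'm) simplex \<Rightarrow> 'k::{comm_ring,comm_monoid_mult}"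
  shows "Psi C n \<gamma> = mext (Arr C) n (bPsi \<gamma>)"
proof
  fix xs :: "('m \<Rightarrow>\<^sub>0 'k) list"
  let ?T = "{as. list_all2 (\<lambda>a x. a \<in> Poly_Mapping.keys x) as xs}"
  let ?c = "\<lambda>as. \<Prod>j<n. Poly_Mapping.lookup (xs ! j) (as ! j)"
  show "Psi C n \<gamma> xs = mext (Arr C) n (bPsi \<gamma>) xs"
  proof (cases "xs \<in> vtuples (Arr C) n")
    case True
    then have len: "length xs = n" by (simp add: vtuples_def)
    have "Psi C n \<gamma> xs = (\<Sum>(i, as) | (i, as) \<in> nerve C n \<and> (\<forall>j<n. as ! j \<in> Poly_Mapping.keys (xs ! j)).
        Poly_Mapping.single (composite C i as) (\<gamma> (i, as) * ?c as))"
      using True by (simp add: Psi_def cat_algebra_eq)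
    also have "\<dots> = (\<Sum>(as, i)\<in>Sigma ?T starts. Poly_Mapping.single (composite C i as) (\<gamma> (i, as) * ?c as))"
      by (rule sum.reindex_bij_witness[of _ "\<lambda>(as, i). (i, as)" "\<lambda>(i, as). (as, i)"])
        (auto simp: nerve_iff starts_def list_all2_conv_all_nth len)
    also have "\<dots> = (\<Sum>as\<in>?T. \<Sum>i\<in>starts as. Poly_Mapping.single (composite C i as) (\<gamma> (i, as) * ?c as))"
      by (rule sum.Sigma[symmetric]) (auto intro: finite_list_all2_keys)
    also have "\<dots> = ml (bPsi \<gamma>) xs"
      unfolding ml_expand len by (simp add: bPsi_def scale_sum mult.commute)
    finally show ?thesis using True by (simp add: mext_def)
  qed (simp add: Psi_def mext_def cat_algebra_eq)
qed

text \<open>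
  The category algebra of \<open>C\<close> over \<open>'k\<close>.  Its unit is a parameter because it fixes the type \<open>'k\<close> of the
  coefficients.
\<close>

locale cat_over = fin_cat C for C :: "('o, 'm) cat" +
  fixes u :: "'m \<Rightarrow>\<^sub>0 'k::{comm_ring,comm_monoid_mult}"
  assumes u: "u = cat_unit C"

sublocale cat_over \<subseteq> partial_algebra "Arr C" "cat_prod C" u
proof
  show "Poly_Mapping.keys u \<subseteq> Arr C"
    unfolding u cat_unit_def using Id by (intro keys_sum_subset keys_single_subset) auto
  fix a assume a: "a \<in> Arr C"
  have "pmult (cat_prod C) u (basis a) = (\<Sum>i\<in>Ob C. if i = src C a then basis a else 0)"
    unfolding u cat_unit_def pmult_sum
    by (rule sum.cong) (use a Id Comp_Id in \<open>auto simp: pmult_single_left\<close>)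
  then show "pmult (cat_prod C) u (basis a) = basis a" using a src_Ob finite_Ob by simp
  have "pmult (cat_prod C) (basis a) u = (\<Sum>i\<in>Ob C. if i = tgt C a then basis a else 0)"
    unfolding u cat_unit_def pmult_sum
    by (rule sum.cong) (use a Id Comp_Id in \<open>auto simp: pmult_single_right\<close>)
  then show "pmult (cat_prod C) (basis a) u = basis a" using a tgt_Ob finite_Ob by simp
next
  fix a b c assume "a \<in> Arr C" "b \<in> Arr C" "cat_prod C a b = Some c"
  then show "c \<in> Arr C" using Comp by (auto simp: cat_prod_def split: if_splits)
next
  fix a b c assume "a \<in> Arr C" "b \<in> Arr C" "c \<in> Arr C"
  then show "Option.bind (cat_prod C a b) (\<lambda>x. cat_prod C x c) =
      Option.bind (cat_prod C b c) (cat_prod C a)"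
    using Comp by (auto simp: cat_prod_def Comp_assoc)
qed

lemma (in cat_over) cat_algebra_A: "cat_algebra C = A"
  by (simp add: cat_algebra_eq u)

section \<open>Cocycles that vanish on composable tuples are coboundaries\<close>

text \<open>
  A list of morphisms is evaluated after an identity is inserted at the first place where it is not
  composable, with a sign for each morphism that is passed; composable lists give \<open>0\<close>.
\<close>

fun ins_id :: "('o, 'm) cat \<Rightarrow> ('m list \<Rightarrow> 'v) \<Rightarrow> 'm list \<Rightarrow> 'v::ab_group_add" where
  "ins_id C \<Phi> (a # b # as) =
     (if tgt C a = src C b then - ins_id C (\<lambda>l. \<Phi> (a # l)) (b # as)
      else \<Phi> (a # Id C (tgt C a) # b # as))"
| "ins_id C \<Phi> _ = 0"

text \<open>Lists in which neighbours are composable; for nonempty lists of morphisms these are the paths.\<close>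

fun linked :: "('o, 'm) cat \<Rightarrow> 'm list \<Rightarrow> bool" where
  "linked C (a # b # as) \<longleftrightarrow> tgt C a = src C b \<and> linked C (b # as)"
| "linked C _ \<longleftrightarrow> True"

lemma ins_id_linear:
  assumes "f 0 = 0" "\<And>x. f (- x) = - f x"
  shows "f (ins_id C \<Phi> as) = ins_id C (\<lambda>l. f (\<Phi> l)) as"
  using assms by (induction C \<Phi> as rule: ins_id.induct) auto

lemma ins_id_diff: "ins_id C (\<lambda>l. \<Phi> l - \<Psi> l) as = ins_id C \<Phi> as - ins_id C \<Psi> as"
proof (induction as arbitrary: \<Phi> \<Psi>)
  case (Cons a as)
  then show ?case by (cases as) auto
qed simp

lemma ins_id_zero [simp]: "ins_id C (\<lambda>l. 0) as = 0"
  using ins_id_diff[of C "\<lambda>l. 0" "\<lambda>l. 0" as] by simp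

lemma bdel_Cons:
  "bdel m \<Phi> (a # b # as) =
     (case m a b of None \<Rightarrow> 0 | Some c \<Rightarrow> \<Phi> (c # as)) - bdel m (\<lambda>l. \<Phi> (a # l)) (b # as)"
proof -
  have "on_opt \<Phi> (map_option ((#) a) p) = on_opt (\<lambda>l. \<Phi> (a # l)) p" for p by (cases p) auto
  moreover have "on_opt \<Phi> (map_option (\<lambda>c. c # as) (m a b)) = (case m a b of None \<Rightarrow> 0 | Some c \<Rightarrow> \<Phi> (c # as))"
    by (cases "m a b") auto
  ultimately show ?thesis
    by (simp add: bdel_def sum.lessThan_Suc_shift sum_negf del: sum.lessThan_Suc)
qed

lemma bdel_Nil [simp]: "bdel m \<Phi> [] = 0" "bdel m \<Phi> [a] = 0"
  by (simp_all add: bdel_def)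

lemma bdel_uminus: "bdel m (\<lambda>l. - \<Phi> l) as = - bdel m \<Phi> as"
proof -
  have "on_opt (\<lambda>l. - \<Phi> l) p = - on_opt \<Phi> p" for p by (cases p) auto
  then show ?thesis by (simp add: bdel_def sum_negf)
qed

context fin_cat
begin

lemma ins_id_cong:
  assumes "\<And>l. length l = Suc (length as) \<Longrightarrow> set l \<subseteq> Arr C \<Longrightarrow> hd l = hd as \<Longrightarrow> \<Phi> l = \<Psi> l"
    and "set as \<subseteq> Arr C"
  shows "ins_id C \<Phi> as = ins_id C \<Psi> as"
  using assms
proof (induction as arbitrary: \<Phi> \<Psi>)
  case (Cons a as)
  show ?case
  proof (cases as)
    case as: (Cons b bs)
    show ?thesis
    proof (cases "tgt C a = src C b")
      case True
      have "ins_id C (\<lambda>l. \<Phi> (a # l)) as = ins_id C (\<lambda>l. \<Psi> (a # l)) as"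
        by (rule Cons.IH) (use Cons.prems in auto)
      then show ?thesis using True as by simp
    next
      case False
      have "\<Phi> (a # Id C (tgt C a) # b # bs) = \<Psi> (a # Id C (tgt C a) # b # bs)"
        using Cons.prems as tgt_Ob[of a] Id by (intro Cons.prems(1)) auto
      then show ?thesis using False as by simp
    qed
  qed simp
qed simp

lemma bmerge_hd: "bmerge (cat_prod C) k as = Some bs \<Longrightarrow> set as \<subseteq> Arr C \<Longrightarrow>
    bs \<noteq> [] \<and> src C (hd bs) = src C (hd as)"
proof (cases "(cat_prod C, k, as)" rule: bmerge.cases)
  case (1 m a b cs)
  assume "bmerge (cat_prod C) k as = Some bs" "set as \<subseteq> Arr C"
  then show ?thesis using 1 Comp[of a b] by (auto simp: cat_prod_def split: if_splits)
qed auto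

lemma bdel_cong:
  assumes "\<And>l. l \<noteq> [] \<Longrightarrow> Suc (length l) = length as \<Longrightarrow> set l \<subseteq> Arr C \<Longrightarrow> src C (hd l) = src C (hd as) \<Longrightarrow> \<Phi> l = \<Psi> l"
    and as: "set as \<subseteq> Arr C"
  shows "bdel (cat_prod C) \<Phi> as = bdel (cat_prod C) \<Psi> as"
proof -
  have "on_opt \<Phi> (bmerge (cat_prod C) k as) = on_opt \<Psi> (bmerge (cat_prod C) k as)" for k
  proof (cases "bmerge (cat_prod C) k as")
    case (Some bs)
    have "set bs \<subseteq> Arr C"
      by (rule bmerge_set[OF Some as]) (auto simp: cat_prod_def Comp split: if_splits)
    then have "\<Phi> bs = \<Psi> bs"
      using bmerge_hd[OF Some as] bmerge_length[OF Some] by (intro assms(1)) auto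
    then show ?thesis using Some by simp
  qed simp
  then show ?thesis by (simp add: bdel_def)
qed

text \<open>
  At the first gap, between \<open>a\<close> and \<open>b\<close>, the two faces next to the inserted identity \<open>e\<close> are different: \<open>a e = a\<close>
  gives back the list, while \<open>e b\<close> is not defined.  All other faces cancel.
\<close>

theorem ins_id_homotopy:
  assumes "set as \<subseteq> Arr C"
  shows "bdel (cat_prod C) (ins_id C \<Phi>) as + ins_id C (bdel (cat_prod C) \<Phi>) as =
    (if linked C as then 0 else \<Phi> as)"
  using assms
proof (induction as arbitrary: \<Phi>)
  case (Cons a as)
  show ?case
  proof (cases as)
    case as: (Cons b bs)
    let ?m = "cat_prod C" and ?\<Phi>a = "\<lambda>l. \<Phi> (a # l)"
    have arr: "a \<in> Arr C" "b \<in> Arr C" "set as \<subseteq> Arr C" using Cons.prems as by auto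
    show ?thesis
    proof (cases "tgt C a = src C b")
      case False
      let ?e = "Id C (tgt C a)"
      have e: "?m a ?e = Some a" "?m ?e b = None"
        using arr False Id tgt_Ob[OF arr(1)] Comp_Id by (auto simp: cat_prod_def)
      have "ins_id C (bdel ?m \<Phi>) (a # as) = \<Phi> (a # as) + bdel ?m (\<lambda>l. \<Phi> (a # ?e # l)) as"
        using False by (simp add: as bdel_Cons e)
      moreover have "bdel ?m (ins_id C \<Phi>) (a # as) = - bdel ?m (\<lambda>l. ins_id C \<Phi> (a # l)) as"
        using False by (simp add: as bdel_Cons cat_prod_def)
      moreover have "bdel ?m (\<lambda>l. ins_id C \<Phi> (a # l)) as = bdel ?m (\<lambda>l. \<Phi> (a # ?e # l)) as"
      proof (rule bdel_cong[OF _ arr(3)])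
        fix l assume "l \<noteq> []" "src C (hd l) = src C (hd as)"
        then show "ins_id C \<Phi> (a # l) = \<Phi> (a # ?e # l)" using False as by (cases l) auto
      qed
      ultimately show ?thesis using False as by simp
    next
      case True
      let ?c = "Comp C a b"
      have c: "?m a b = Some ?c" "tgt C ?c = tgt C b" using True arr Comp by (auto simp: cat_prod_def)
      have shift: "ins_id C \<Phi> (?c # bs) = ins_id C (\<lambda>l. \<Phi> (?c # tl l)) as"
        using c(2) as by (cases bs) auto
      have "ins_id C (\<lambda>l. bdel ?m \<Phi> (a # l)) as = ins_id C (\<lambda>l. \<Phi> (?c # tl l) - bdel ?m ?\<Phi>a l) as"
      proof (rule ins_id_cong[OF _ arr(3)])
        fix l assume "length l = Suc (length as)" "hd l = hd as"
        then obtain l' where "l = b # l'" using as by (cases l) auto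
        then show "bdel ?m \<Phi> (a # l) = \<Phi> (?c # tl l) - bdel ?m ?\<Phi>a l" by (simp add: bdel_Cons c)
      qed
      then have "ins_id C (bdel ?m \<Phi>) (a # as) = - ins_id C \<Phi> (?c # bs) + ins_id C (bdel ?m ?\<Phi>a) as"
        using True by (simp add: as ins_id_diff shift[unfolded as])
      moreover have "bdel ?m (ins_id C \<Phi>) (a # as) = ins_id C \<Phi> (?c # bs) - bdel ?m (\<lambda>l. ins_id C \<Phi> (a # l)) as"
        by (simp add: as bdel_Cons c(1))
      moreover have "bdel ?m (\<lambda>l. ins_id C \<Phi> (a # l)) as = bdel ?m (\<lambda>l. - ins_id C ?\<Phi>a l) as"
      proof (rule bdel_cong[OF _ arr(3)])
        fix l assume "l \<noteq> []" "src C (hd l) = src C (hd as)"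
        then show "ins_id C \<Phi> (a # l) = - ins_id C ?\<Phi>a l" using True as by (cases l) auto
      qed
      ultimately show ?thesis
        using Cons.IH[OF arr(3), of ?\<Phi>a] True as by (simp add: bdel_uminus)
    qed
  qed simp
qed simp

end

context cat_over
begin

abbreviation cprod (infixl \<open>\<bullet>\<close> 70) where "x \<bullet> y \<equiv> pmult (cat_prod C) x y"

lemma keys_basis: "x \<in> Arr C \<Longrightarrow> Poly_Mapping.keys (basis x) \<subseteq> Arr C"
  by auto

lemma bhat_closed:
  assumes g: "bcochain (Arr C) n g" and l: "set l \<subseteq> Arr C" "length l = Suc (Suc n)"
  shows "Poly_Mapping.keys (bhat (cat_prod C) g l) \<subseteq> Arr C"
proof -
  obtain a l' where a: "l = a # l'" using l by (cases l) auto
  obtain as b where "l' = as @ [b]" using l a by (cases l' rule: rev_cases) auto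
  with a have "l = a # as @ [b]" by simp
  then show ?thesis
    using g l keys_basis unfolding bhat_def by (intro pmult_closed) (auto simp: bcochain_def)
qed

lemma bhat_left:
  fixes g :: "'m list \<Rightarrow> 'm \<Rightarrow>\<^sub>0 'k"
  assumes g: "bcochain (Arr C) n g" and l: "set l \<subseteq> Arr C" "length l = Suc n" and a: "a \<in> Arr C" "c \<in> Arr C"
  shows "basis a \<bullet> bhat (cat_prod C) g (c # l) = on_opt (\<lambda>x. bhat (cat_prod C) g (x # l)) (cat_prod C a c)"
proof -
  have ne: "l \<noteq> []" using l by auto
  have bl: "set (butlast l) \<subseteq> Arr C" "last l \<in> Arr C"
    using l ne by (auto dest: in_set_butlastD)
  let ?g = "g (butlast l)"
  have k: "Poly_Mapping.keys ?g \<subseteq> Arr C" using g bl l by (simp add: bcochain_def)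
  note ks = keys_basis[OF a(1)] keys_basis[OF a(2)] keys_basis[OF bl(2)]
  have "basis a \<bullet> bhat (cat_prod C) g (c # l) = ((basis a \<bullet> basis c) \<bullet> ?g) \<bullet> basis (last l)"
    using ne pmult_assoc[OF ks(1) pmult_closed[OF ks(2) k] ks(3)] pmult_assoc[OF ks(1,2) k]
    by (simp add: bhat_def)
  then show ?thesis using ne by (cases "cat_prod C a c") (auto simp: pmult_basis bhat_def)
qed

lemma bhat_right:
  fixes g :: "'m list \<Rightarrow> 'm \<Rightarrow>\<^sub>0 'k"
  assumes g: "bcochain (Arr C) n g" and l: "set l \<subseteq> Arr C" "length l = Suc n" and a: "a \<in> Arr C" "c \<in> Arr C"
  shows "bhat (cat_prod C) g (l @ [c]) \<bullet> basis a = on_opt (\<lambda>x. bhat (cat_prod C) g (l @ [x])) (cat_prod C c a)"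
proof -
  have ne: "l \<noteq> []" using l by auto
  have bl: "set (tl l) \<subseteq> Arr C" "hd l \<in> Arr C"
    using l ne by (auto dest: list.set_sel(2))
  let ?g = "g (tl l)"
  have k: "Poly_Mapping.keys ?g \<subseteq> Arr C" using g bl l by (simp add: bcochain_def)
  note ks = keys_basis[OF bl(2)] keys_basis[OF a(2)] keys_basis[OF a(1)]
  have "bhat (cat_prod C) g (l @ [c]) \<bullet> basis a = (basis (hd l) \<bullet> ?g) \<bullet> (basis c \<bullet> basis a)"
    using ne pmult_assoc[OF pmult_closed[OF ks(1) k] ks(2,3)] by (simp add: bhat_def)
  then show ?thesis using ne by (cases "cat_prod C c a") (auto simp: pmult_basis bhat_def)
qed

lemma ins_id_closed:
  assumes "\<And>l. length l = Suc (length as) \<Longrightarrow> set l \<subseteq> Arr C \<Longrightarrow> Poly_Mapping.keys (\<Phi> l) \<subseteq> Arr C"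
    and "set as \<subseteq> Arr C"
  shows "Poly_Mapping.keys (ins_id C \<Phi> as :: 'm \<Rightarrow>\<^sub>0 'k) \<subseteq> Arr C"
  using assms
proof (induction as arbitrary: \<Phi>)
  case (Cons a as)
  show ?case
  proof (cases as)
    case as: (Cons b bs)
    show ?thesis
    proof (cases "tgt C a = src C b")
      case True
      have "Poly_Mapping.keys (ins_id C (\<lambda>l. \<Phi> (a # l)) as) \<subseteq> Arr C"
        by (rule Cons.IH) (use Cons.prems in auto)
      then show ?thesis using True as by simp
    next
      case False
      have "Poly_Mapping.keys (\<Phi> (a # Id C (tgt C a) # b # bs)) \<subseteq> Arr C"
        using Cons.prems as tgt_Ob[of a] Id by (intro Cons.prems(1)) auto
      then show ?thesis using False as by simp
    qed
  qed simp
qed simp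

lemma ins_id_left:
  fixes g :: "'m list \<Rightarrow> 'm \<Rightarrow>\<^sub>0 'k"
  assumes g: "bcochain (Arr C) n g" and l: "set l \<subseteq> Arr C" "length l = n" "l \<noteq> []"
    and a: "a \<in> Arr C" and i: "i \<in> Ob C"
  defines "\<Phi> \<equiv> bhat (cat_prod C) g"
  shows "basis a \<bullet> ins_id C \<Phi> (Id C i # l) = (if i = tgt C a then ins_id C \<Phi> (a # l) else 0)"
proof -
  have left: "basis a \<bullet> \<Phi> (Id C i # l') = (if i = tgt C a then \<Phi> (a # l') else 0)"
    if "set l' \<subseteq> Arr C" "length l' = Suc n" for l'
    unfolding \<Phi>_def bhat_left[OF g that a Id(1)[OF i]]
    using a i Id Comp_Id by (auto simp: cat_prod_def)
  obtain c l' where c: "l = c # l'" using l by (cases l) auto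
  show ?thesis
  proof (cases "i = src C c")
    case False
    have "basis a \<bullet> \<Phi> (Id C i # Id C i # l) = (if i = tgt C a then \<Phi> (a # Id C i # l) else 0)"
      by (rule left) (use l Id i in auto)
    then show ?thesis using False c Id i by auto
  next
    case True
    have "basis a \<bullet> ins_id C \<Phi> (Id C i # l) = - (basis a \<bullet> ins_id C (\<lambda>l. \<Phi> (Id C i # l)) l)"
      using True c Id i by (simp add: pmult_uminus)
    also have "basis a \<bullet> ins_id C (\<lambda>l. \<Phi> (Id C i # l)) l = ins_id C (\<lambda>l. basis a \<bullet> \<Phi> (Id C i # l)) l"
      by (rule ins_id_linear) (simp_all add: pmult_uminus)
    also have "\<dots> = ins_id C (\<lambda>l. if i = tgt C a then \<Phi> (a # l) else 0) l"
      by (rule ins_id_cong[OF _ l(1)]) (simp add: left l)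
    finally show ?thesis using True c by auto
  qed
qed

lemma ins_id_right:
  fixes \<Phi> :: "'m list \<Rightarrow> 'm \<Rightarrow>\<^sub>0 'k"
  assumes "\<And>l. set l \<subseteq> Arr C \<Longrightarrow> length l = Suc (length as) \<Longrightarrow>
      \<Phi> (l @ [Id C j]) \<bullet> basis b = (if j = src C b then \<Phi> (l @ [b]) else 0)"
    and "set as \<subseteq> Arr C" "as \<noteq> []" and j: "j \<in> Ob C"
  shows "ins_id C \<Phi> (as @ [Id C j]) \<bullet> basis b = (if j = src C b then ins_id C \<Phi> (as @ [b]) else 0)"
  using assms(1-3)
proof (induction as arbitrary: \<Phi>)
  case (Cons a as)
  have a: "a \<in> Arr C" using Cons by auto
  show ?case
  proof (cases as)
    case Nil
    have "\<Phi> ([a, Id C (tgt C a)] @ [Id C j]) \<bullet> basis b =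
        (if j = src C b then \<Phi> ([a, Id C (tgt C a)] @ [b]) else 0)"
      by (rule Cons.prems) (use Nil a Id tgt_Ob in auto)
    then show ?thesis using Nil j Id by (auto simp: pmult_uminus)
  next
    case as: (Cons c cs)
    show ?thesis
    proof (cases "tgt C a = src C c")
      case True
      have "ins_id C (\<lambda>l. \<Phi> (a # l)) (as @ [Id C j]) \<bullet> basis b =
          (if j = src C b then ins_id C (\<lambda>l. \<Phi> (a # l)) (as @ [b]) else 0)"
      proof (rule Cons.IH)
        fix l assume "set l \<subseteq> Arr C" "length l = Suc (length as)"
        then show "\<Phi> (a # l @ [Id C j]) \<bullet> basis b = (if j = src C b then \<Phi> (a # l @ [b]) else 0)"
          using Cons.prems(1)[of "a # l"] a by simp
      qed (use Cons.prems as in auto)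
      then show ?thesis using True as by (simp add: pmult_uminus)
    next
      case False
      have "\<Phi> ((a # Id C (tgt C a) # as) @ [Id C j]) \<bullet> basis b =
          (if j = src C b then \<Phi> ((a # Id C (tgt C a) # as) @ [b]) else 0)"
        by (rule Cons.prems) (use Cons.prems a Id tgt_Ob in auto)
      then show ?thesis using False as by simp
    qed
  qed
qed simp

lemma linked_path:
  "linked C (a # as @ [b]) \<Longrightarrow> set (a # as @ [b]) \<subseteq> Arr C \<Longrightarrow>
     is_path C (tgt C a) as \<and> path_end C (tgt C a) as = src C b"
  by (induction as arbitrary: a) (auto simp: tgt_Ob src_Ob)

text \<open>
  In positive degree the primitive of \<open>g\<close> is obtained by inserting an identity into the two-sided form of
  \<open>g\<close>.  The outer entries are taken to be identities, summed over all objects, which makes the primitive a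
  function of the inner entries; it has the right two-sided form.  In degree zero the value of \<open>g\<close>
  commutes with all morphisms, and it is zero.
\<close>

theorem cocycle_coboundary:
  fixes g :: "('m \<Rightarrow>\<^sub>0 'k) list \<Rightarrow> 'm \<Rightarrow>\<^sub>0 'k"
  assumes g: "g \<in> cocycles (hoch A) (hoch_d A) n"
    and vanish: "\<And>i as. is_path C i as \<Longrightarrow> length as = n \<Longrightarrow>
      (basis (Id C i) \<bullet> g (map basis as)) \<bullet> basis (Id C (path_end C i as)) = 0"
  shows "g \<in> coboundaries (hoch A) (hoch_d A) n"
proof -
  let ?g = "\<lambda>as. g (map basis as)" and ?m = "cat_prod C"
  have gc: "g \<in> carrier (hoch A n)" and dg: "hoch_d A n g = \<zero>\<^bsub>hoch A (Suc n)\<^esub>"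
    using g by (auto simp: cocycles_def)
  note bg = hoch_bcochain[OF gc]
  have bdg: "bdiff ?m n ?g as = 0" if "set as \<subseteq> Arr C" "length as = Suc n" for as
    using hoch_d_basis[OF gc that] dg hoch_basis(3)[OF that] by metis
  define \<Phi> where "\<Phi> = bhat ?m ?g"
  have linked0: "\<Phi> (a # as @ [b]) = 0"
    if l: "linked C (a # as @ [b])" and S: "set (a # as @ [b]) \<subseteq> Arr C" and len: "length as = n" for a as b
  proof -
    have p: "is_path C (tgt C a) as" "path_end C (tgt C a) as = src C b" using linked_path[OF l S] by auto
    have ab: "a \<in> Arr C" "b \<in> Arr C" using S by auto
    let ?e = "Id C (tgt C a)" and ?e' = "Id C (src C b)"
    have e: "?e \<in> Arr C" "?e' \<in> Arr C" using ab tgt_Ob src_Ob Id by auto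
    have k: "Poly_Mapping.keys (?g as) \<subseteq> Arr C" using bg S len by (simp add: bcochain_def)
    have 1: "basis a \<bullet> basis ?e = basis a" "basis ?e' \<bullet> basis b = basis b"
      using ab tgt_Ob src_Ob Id Comp_Id by (auto simp: pmult_basis cat_prod_def)
    note ks = keys_basis[OF ab(1)] keys_basis[OF e(1)] keys_basis[OF e(2)] keys_basis[OF ab(2)]
    have "\<Phi> (a # as @ [b]) = ((basis a \<bullet> basis ?e) \<bullet> ?g as) \<bullet> (basis ?e' \<bullet> basis b)"
      by (simp add: \<Phi>_def bhat_def 1)
    also have "\<dots> = (basis a \<bullet> (basis ?e \<bullet> ?g as)) \<bullet> (basis ?e' \<bullet> basis b)"
      by (simp only: pmult_assoc[OF ks(1,2) k])
    also have "\<dots> = ((basis a \<bullet> (basis ?e \<bullet> ?g as)) \<bullet> basis ?e') \<bullet> basis b"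
      by (rule pmult_assoc[symmetric, OF pmult_closed[OF ks(1) pmult_closed[OF ks(2) k]] ks(3,4)])
    also have "(basis a \<bullet> (basis ?e \<bullet> ?g as)) \<bullet> basis ?e' = basis a \<bullet> ((basis ?e \<bullet> ?g as) \<bullet> basis ?e')"
      by (rule pmult_assoc[OF ks(1) pmult_closed[OF ks(2) k] ks(3)])
    finally show ?thesis using vanish[OF p(1) len] p(2) by simp
  qed
  show ?thesis
  proof (cases n)
    case 0
    let ?x = "g []"
    have kx: "Poly_Mapping.keys ?x \<subseteq> Arr C" using bg 0 by (simp add: bcochain_def)
    have comm: "basis a \<bullet> ?x = ?x \<bullet> basis a" if "a \<in> Arr C" for a
      using bdg[of "[a]"] that 0 by (simp add: bdiff_def)
    have "(basis a \<bullet> ?x) \<bullet> basis b = 0" if ab: "a \<in> Arr C" "b \<in> Arr C" for a b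
    proof (cases "tgt C a = src C b")
      case True
      then show ?thesis using linked0[of a "[]" b] ab 0 by (simp add: \<Phi>_def bhat_def)
    next
      case False
      have "(basis a \<bullet> ?x) \<bullet> basis b = ?x \<bullet> (basis a \<bullet> basis b)"
        unfolding comm[OF ab(1)] by (rule pmult_assoc[OF kx keys_basis[OF ab(1)] keys_basis[OF ab(2)]])
      then show ?thesis using False by (simp add: pmult_basis cat_prod_def)
    qed
    then have "?x = 0" by (rule eq_zero_by_bhat[OF kx])
    then have "g = \<zero>\<^bsub>hoch A 0\<^esub>"
      using 0 gc opgroup_hoch[of "Arr C" ?m u 0] hoch_basis(3)[of "[]" "Arr C" 0 ?m u]
      by (intro hoch_eqI[of _ "Arr C" ?m u 0]) (auto simp: hoch_basis abelian_group_def abelian_monoid.zero_closed opgroup_def)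
    then show ?thesis using 0 by (simp add: coboundaries_def)
  next
    case (Suc r)
    have bg': "bcochain (Arr C) (Suc r) ?g" using bg Suc by simp
    define h where "h as = (\<Sum>i\<in>Ob C. \<Sum>j\<in>Ob C. ins_id C \<Phi> (Id C i # as @ [Id C j]))" for as
    have bh: "bcochain (Arr C) r h"
      unfolding bcochain_def h_def
    proof (intro allI impI keys_sum_subset ins_id_closed)
      fix as i j l assume *: "set as \<subseteq> Arr C \<and> length as = r" "i \<in> Ob C" "j \<in> Ob C"
      then show "set (Id C i # as @ [Id C j]) \<subseteq> Arr C" using Id by auto
      assume "length l = Suc (length (Id C i # as @ [Id C j]))" "set l \<subseteq> Arr C"
      then show "Poly_Mapping.keys (\<Phi> l) \<subseteq> Arr C"
        unfolding \<Phi>_def using * by (intro bhat_closed[OF bg']) auto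
    qed
    have hhat: "bhat ?m h (a # as @ [b]) = ins_id C \<Phi> (a # as @ [b])"
      if S: "set (a # as @ [b]) \<subseteq> Arr C" and len: "length as = r" for a as b
    proof -
      have ab: "a \<in> Arr C" "b \<in> Arr C" "set as \<subseteq> Arr C" using S by auto
      have right: "ins_id C \<Phi> ((a # as) @ [Id C j]) \<bullet> basis b =
          (if j = src C b then ins_id C \<Phi> ((a # as) @ [b]) else 0)" if j: "j \<in> Ob C" for j
      proof (rule ins_id_right[OF _ _ _ j])
        fix l assume l: "set l \<subseteq> Arr C" "length l = Suc (length (a # as))"
        then have l': "length l = Suc (Suc r)" using len by simp
        show "\<Phi> (l @ [Id C j]) \<bullet> basis b = (if j = src C b then \<Phi> (l @ [b]) else 0)"
          unfolding \<Phi>_def bhat_right[OF bg' l(1) l' ab(2) Id(1)[OF j]]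
          using ab j Id Comp_Id by (auto simp: cat_prod_def)
      qed (use ab in auto)
      have left: "basis a \<bullet> ins_id C \<Phi> (Id C i # as @ [Id C j]) =
          (if i = tgt C a then ins_id C \<Phi> (a # as @ [Id C j]) else 0)"
        if "i \<in> Ob C" "j \<in> Ob C" for i j
        unfolding \<Phi>_def by (rule ins_id_left[OF bg']) (use that ab len Id in auto)
      have "bhat ?m h (a # as @ [b]) = (\<Sum>i\<in>Ob C. \<Sum>j\<in>Ob C.
          (basis a \<bullet> ins_id C \<Phi> (Id C i # as @ [Id C j])) \<bullet> basis b)"
        by (simp add: bhat_def h_def pmult_sum)
      also have "\<dots> = (\<Sum>i\<in>Ob C. \<Sum>j\<in>Ob C. if i = tgt C a
          then if j = src C b then ins_id C \<Phi> (a # as @ [b]) else 0 else 0)"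
        using left right by (intro sum.cong) (auto simp del: ins_id.simps)
      also have "\<dots> = (\<Sum>i\<in>Ob C. if i = tgt C a then \<Sum>j\<in>Ob C.
          if j = src C b then ins_id C \<Phi> (a # as @ [b]) else 0 else 0)"
        by (intro sum.cong) auto
      also have "\<dots> = ins_id C \<Phi> (a # as @ [b])"
        using ab tgt_Ob src_Ob finite_Ob by (simp del: ins_id.simps)
      finally show ?thesis .
    qed
    have dh: "bhat ?m (bdiff ?m r h) (a # as @ [b]) = bhat ?m ?g (a # as @ [b])"
      if S: "set (a # as @ [b]) \<subseteq> Arr C" and len: "length as = n" for a as b
    proof -
      let ?l = "a # as @ [b]"
      have "bhat ?m (bdiff ?m r h) ?l = bdel ?m (bhat ?m h) ?l"
        by (rule bhat_bdiff[OF bh S]) (use len Suc in simp)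
      also have "\<dots> = bdel ?m (ins_id C \<Phi>) ?l"
      proof (rule bdel_cong[OF _ S])
        fix l assume l: "Suc (length l) = length ?l" "set l \<subseteq> Arr C"
        then obtain a' l' where a': "l = a' # l'" "length l' = Suc r" using len Suc by (cases l) auto
        then obtain as' b' where "l' = as' @ [b']" "length as' = r" by (cases l' rule: rev_cases) auto
        then show "bhat ?m h l = ins_id C \<Phi> l" using hhat[of a' as' b'] l a' by simp
      qed
      also have "\<dots> = bdel ?m (ins_id C \<Phi>) ?l + ins_id C (bdel ?m \<Phi>) ?l"
      proof -
        have "ins_id C (bdel ?m \<Phi>) ?l = ins_id C (\<lambda>l. 0) ?l"
        proof (rule ins_id_cong[OF _ S])
          fix l assume l: "length l = Suc (length ?l)" "set l \<subseteq> Arr C"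
          then obtain a' l' where a': "l = a' # l'" "length l' = Suc (Suc n)" using len by (cases l) auto
          then obtain as' b' where b': "l' = as' @ [b']" "length as' = Suc n" by (cases l' rule: rev_cases) auto
          then have "bdel ?m \<Phi> l = bhat ?m (bdiff ?m n ?g) (a' # as' @ [b'])"
            unfolding \<Phi>_def using bhat_bdiff[OF bg, of a' as' b'] l a' by simp
          also have "\<dots> = 0" using bdg[of as'] l a' b' by (simp add: bhat_def)
          finally show "bdel ?m \<Phi> l = 0" .
        qed
        then show ?thesis by simp
      qed
      also have "\<dots> = (if linked C ?l then 0 else \<Phi> ?l)" by (rule ins_id_homotopy[OF S])
      also have "\<dots> = \<Phi> ?l" using linked0[OF _ S len] by simp
      finally show ?thesis by (simp add: \<Phi>_def)
    qed
    have "bdiff ?m r h as = ?g as" if as: "set as \<subseteq> Arr C" "length as = n" for as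
    proof -
      have "bdiff ?m r h as - ?g as = 0"
      proof (rule eq_zero_by_bhat)
        show "Poly_Mapping.keys (bdiff ?m r h as - ?g as) \<subseteq> Arr C"
          using bcochain_bdiff[OF bh] bg as Suc by (intro keys_diff_subset) (auto simp: bcochain_def)
        fix a b assume "a \<in> Arr C" "b \<in> Arr C"
        then show "(basis a \<bullet> (bdiff ?m r h as - ?g as)) \<bullet> basis b = 0"
          using dh[of a as b] as by (simp add: bhat_def pmult_diff)
      qed
      then show ?thesis by simp
    qed
    then have "hoch_d A r (mext (Arr C) r h) = g"
      unfolding hoch_d_mext[OF bh] using Suc hoch_eq_mext[OF gc] mext_cong[of "Arr C" n "bdiff ?m r h" ?g]
      by simp
    then show ?thesis using hoch_mext[OF bh] Suc by (auto simp: coboundaries_def)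
  qed
qed

end

section \<open>The simplicial cochains and their cup products\<close>

lemma dl_remove1: "distinct l \<Longrightarrow> dl U l = (\<Sum>j<length l. (- 1) ^ j * U (remove1 (l ! j) l))"
proof (induction l arbitrary: U)
  case (Cons v l)
  have "dl U (v # l) = U l - (\<Sum>j<length l. (- 1) ^ j * U (v # remove1 (l ! j) l))"
    using Cons by simp
  also have "\<dots> = U l + (\<Sum>j<length l. (- 1) ^ Suc j * U (remove1 ((v # l) ! Suc j) (v # l)))"
  proof -
    have "(\<Sum>j<length l. (- 1) ^ Suc j * U (remove1 ((v # l) ! Suc j) (v # l))) =
        (\<Sum>j<length l. - ((- 1) ^ j * U (v # remove1 (l ! j) l)))"
      using Cons.prems nth_mem by (intro sum.cong) auto
    then show ?thesis by (simp add: sum_negf)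
  qed
  also have "\<dots> = (\<Sum>j<length (v # l). (- 1) ^ j * U (remove1 ((v # l) ! j) (v # l)))"
    unfolding length_Cons sum.lessThan_Suc_shift by simp
  finally show ?case .
qed simp

lemma dl_cong:
  assumes "\<And>l'. sorted_wrt (<) l' \<Longrightarrow> set l' \<subseteq> set l \<Longrightarrow> Suc (length l') = length l \<Longrightarrow> U l' = V l'"
    and "sorted_wrt (<) (l :: nat list)"
  shows "dl U l = dl V l"
  using assms
proof (induction l arbitrary: U V)
  case (Cons v l)
  have "dl (\<lambda>l. U (v # l)) l = dl (\<lambda>l. V (v # l)) l"
  proof (rule Cons.IH)
    fix l' assume "sorted_wrt (<) l'" "set l' \<subseteq> set l" "Suc (length l') = length l"
    then show "U (v # l') = V (v # l')" using Cons.prems(2) by (intro Cons.prems(1)) auto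
  qed (use Cons.prems in auto)
  moreover have "U l = V l" using Cons.prems(2) by (intro Cons.prems(1)) auto
  ultimately show ?case by simp
qed simp

lemma cuts_cong:
  assumes "\<And>l'. sorted_wrt (<) l' \<Longrightarrow> set l' \<subseteq> set l \<Longrightarrow> U l' = U' l' \<and> V l' = V' l'"
    and "sorted_wrt (<) (l :: nat list)"
  shows "cuts r b U V l = cuts r b U' V' l"
  using assms
proof (induction l arbitrary: r b U V U' V')
  case Nil
  then show ?case using Nil(1)[of "[]"] by simp
next
  case (Cons v l)
  have *: "U l' = U' l'" "V l' = V' l'" "U (v # l') = U' (v # l')" "V (v # l') = V' (v # l')"
    if "sorted_wrt (<) l'" "set l' \<subseteq> set l" for l'
  proof -
    show "U l' = U' l'" "V l' = V' l'" using Cons.prems(1)[of l'] that by auto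
    have "sorted_wrt (<) (v # l')" using that Cons.prems(2) by auto
    then show "U (v # l') = U' (v # l')" "V (v # l') = V' (v # l')"
      using Cons.prems(1)[of "v # l'"] that by auto
  qed
  have s: "sorted_wrt (<) l" using Cons.prems(2) by simp
  have "cuts r b (\<lambda>l. U (v # l)) V l = cuts r b (\<lambda>l. U' (v # l)) V' l"
    "cuts r b (sgnl U) (\<lambda>l. V (v # l)) l = cuts r b (sgnl U') (\<lambda>l. V' (v # l)) l"
    "cuts (r - 1) (\<not> b) (\<lambda>l. U (v # l)) (\<lambda>l. V (v # l)) l =
       cuts (r - 1) (\<not> b) (\<lambda>l. U' (v # l)) (\<lambda>l. V' (v # l)) l"
    by (rule Cons.IH[OF _ s]; simp add: * sgnl_def)+
  then show ?case by (cases "r = 0"; cases b) simp_all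
qed

lemma dl_map: "dl (\<lambda>l. U (map f l)) l = dl U (map f l)"
  by (induction l arbitrary: U) auto

lemma cuts_map: "cuts r b (\<lambda>l. U (map f l)) (\<lambda>l. V (map f l)) l = cuts r b U V (map f l)"
proof (induction l arbitrary: r b U V)
  case (Cons v l)
  have s: "sgnl (\<lambda>l. U (map f l)) = (\<lambda>l. sgnl U (map f l))" by (simp add: sgnl_def fun_eq_iff)
  show ?case
    using Cons[of r b "\<lambda>l. U (f v # l)" V] Cons[of r b "sgnl U" "\<lambda>l. V (f v # l)"]
      Cons[of "r - 1" "\<not> b" "\<lambda>l. U (f v # l)" "\<lambda>l. V (f v # l)"]
    by (cases "r = 0"; cases b) (simp_all add: s)
qed simp

lemma cuts_0: "cuts 0 True U V l = U l * V []" "cuts 0 False U V l = U [] * V l"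
  by (induction l arbitrary: U V) (auto simp: sgnl_def)

lemma cuts_1: "cuts (Suc 0) True U V l = (\<Sum>s<length l. U (take (Suc s) l) * V (drop s l))"
proof (induction l arbitrary: U)
  case (Cons v l)
  show ?case by (simp add: Cons cuts_0 sum.lessThan_Suc_shift add.commute del: sum.lessThan_Suc)
qed simp

lemma cuts_zero [simp]: "cuts r b (\<lambda>l. 0) V l = 0" "cuts r b U (\<lambda>l. 0) l = 0"
  using cuts_scaleU[of r b 0 "\<lambda>l. 0" V l] cuts_scaleV[of r b U 0 "\<lambda>l. 0" l] by simp_all

text \<open>
  To exchange the factors changes all signs alike.  Each of the \<open>a - r\<close> vertices of the first factor alone
  is counted with each of the \<open>b - r\<close> vertices of the second alone, and each of these vertices once for every
  later common vertex.  The latter counts are odd in every other run, hence precisely for the vertices of one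
  factor, which depends on the parity of \<open>r\<close>.  Here \<open>a + r\<close> and \<open>b + r\<close> stand for \<open>a - r\<close> and \<open>b - r\<close>, which have
  the same parity.
\<close>

definition swap_sign :: "nat \<Rightarrow> nat \<Rightarrow> nat \<Rightarrow> nat" where
  "swap_sign a b r = (a + r) * (b + r) + (if even r then a + r else b + r)"

lemma cuts_swap:
  fixes U V :: "'v list \<Rightarrow> 'k::{comm_ring,comm_monoid_mult}"
  assumes "\<And>l. length l \<noteq> a \<Longrightarrow> U l = 0" "\<And>l. length l \<noteq> b \<Longrightarrow> V l = 0"
  shows "cuts r False U V l = (- 1) ^ swap_sign a b r * cuts r True V U l"
  using assms
proof (induction l arbitrary: r a b U V)
  case Nil
  show ?case
  proof (cases "a = 0 \<and> b = 0")
    case False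
    then show ?thesis using Nil(1)[of "[]"] Nil(2)[of "[]"] by auto
  qed (simp add: swap_sign_def mult.commute)
next
  case (Cons v l)
  let ?U = "\<lambda>l. U (v # l)" and ?V = "\<lambda>l. V (v # l)"
  have sU: "sgnl U = (\<lambda>l. (- 1) ^ a * U l)"
  proof
    fix l show "sgnl U l = (- 1) ^ a * U l" using Cons.prems(1)[of l] by (cases "length l = a") (auto simp: sgnl_def)
  qed
  show ?case
  proof (cases b)
    case 0
    then have "?V = (\<lambda>l. 0)" using Cons.prems(2) by auto
    then show ?thesis by simp
  next
    case (Suc b')
    have V: "length l \<noteq> b' \<Longrightarrow> ?V l = 0" for l using Cons.prems(2) Suc by simp
    have 1: "cuts r False (sgnl U) ?V l = (- 1) ^ swap_sign a b r * cuts r True ?V U l"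
    proof -
      have "cuts r False (sgnl U) ?V l = (- 1) ^ (a + swap_sign a b' r) * cuts r True ?V U l"
      proof -
        have "cuts r False U ?V l = (- 1) ^ swap_sign a b' r * cuts r True ?V U l"
          by (rule Cons.IH) (use Cons.prems(1) V in blast)+
        then show ?thesis by (simp add: sU cuts_scaleU power_add mult.assoc)
      qed
      also have "(- 1) ^ (a + swap_sign a b' r) = ((- 1) ^ swap_sign a b r :: 'k)"
        by (rule neg_one_power_cong) (auto simp: swap_sign_def Suc)
      finally show ?thesis .
    qed
    have 2: "cuts (r - 1) True ?U ?V l = (- 1) ^ swap_sign a b r * cuts (r - 1) False ?V ?U l" if r: "r > 0"
    proof (cases a)
      case 0
      then have "?U = (\<lambda>l. 0)" using Cons.prems(1) by auto
      then show ?thesis by simp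
    next
      case a: (Suc a')
      have U: "length l \<noteq> a' \<Longrightarrow> ?U l = 0" for l using Cons.prems(1) a by simp
      have sgn: "(- 1) ^ swap_sign b' a' (r - 1) = ((- 1) ^ swap_sign a b r :: 'k)"
        using r by (intro neg_one_power_cong) (cases r; auto simp: swap_sign_def Suc a)
      have "cuts (r - 1) False ?V ?U l = (- 1) ^ swap_sign a b r * cuts (r - 1) True ?U ?V l"
      proof -
        have "cuts (r - 1) False ?V ?U l = (- 1) ^ swap_sign b' a' (r - 1) * cuts (r - 1) True ?U ?V l"
          by (rule Cons.IH) (use U V in blast)+
        then show ?thesis using sgn by simp
      qed
      then show ?thesis by (simp add: neg_one_mult_self flip: mult.assoc)
    qed
    show ?thesis using 1 2 by (simp add: distrib_left)
  qed
qed

subsection \<open>Steenrod's cuts as a recursion\<close>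

text \<open>
  Those of the vertices \<open>v, \<dots>, n - 1\<close> that go to one factor if they are cut at \<open>J\<close>: to the factor that
  takes the first run if \<open>b\<close> holds, and to the other one otherwise.  The sets \<open>cut_fst\<close> and \<open>cut_snd\<close> are the case \<open>v = 0\<close>;
  \<open>cutinv\<close> and \<open>cutterm\<close> are the corresponding number of inversions and summand of a cup product.
\<close>

definition cutset :: "bool \<Rightarrow> nat \<Rightarrow> nat \<Rightarrow> nat set \<Rightarrow> nat set" where
  "cutset b v n J = {s \<in> {v..<n}. s \<in> J \<or> even (card {j \<in> J. j < s}) = b}"

definition cutinv :: "bool \<Rightarrow> nat \<Rightarrow> nat \<Rightarrow> nat set \<Rightarrow> nat" where
  "cutinv b v n J = card {(s, t). s \<in> cutset b v n J \<and> t \<in> cutset (\<not> b) v n J - J \<and> t < s}"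

definition cutterm :: "bool \<Rightarrow> nat \<Rightarrow> nat \<Rightarrow> (nat list \<Rightarrow> 'k) \<Rightarrow> (nat list \<Rightarrow> 'k) \<Rightarrow> nat set
    \<Rightarrow> 'k::{comm_ring,comm_monoid_mult}" where
  "cutterm b v n U V J = (- 1) ^ cutinv b v n J * U (sorted_list_of_set (cutset b v n J))
     * V (sorted_list_of_set (cutset (\<not> b) v n J))"

lemma finite_cutset [simp]: "finite (cutset b v n J)"
  by (simp add: cutset_def)

lemma sorted_list_of_set_insert_least:
  assumes "finite X" "\<And>x. x \<in> X \<Longrightarrow> (v::nat) < x"
  shows "sorted_list_of_set (insert v X) = v # sorted_list_of_set X"
proof -
  have "v \<notin> X" using assms(2) by blast
  then have "sorted_list_of_set (insert v X) = insort v (sorted_list_of_set X)"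
    using assms(1) by simp
  then show ?thesis using assms by (simp add: insort_is_Cons less_imp_le)
qed

lemma cutset_notin:
  assumes J: "J \<subseteq> {Suc v..<n}" and v: "v < n"
  shows "cutset True v n J = insert v (cutset True (Suc v) n J)"
    "cutset False v n J = cutset False (Suc v) n J"
proof -
  have "{j \<in> J. j < v} = {}" using J by auto
  then have "even (card {j \<in> J. j < v})" by (simp only: card.empty) simp
  moreover have "v \<notin> J" using J by auto
  ultimately show "cutset True v n J = insert v (cutset True (Suc v) n J)"
    "cutset False v n J = cutset False (Suc v) n J"
    using v by (auto simp: cutset_def le_eq_less_or_eq Suc_le_eq)
qed

lemma cutset_insert:
  assumes J: "J \<subseteq> {Suc v..<n}" and v: "v < n"
  shows "cutset b v n (insert v J) = insert v (cutset (\<not> b) (Suc v) n J)"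
    "cutset (\<not> b) (Suc v) n J - J = cutset b v n (insert v J) - insert v J"
proof -
  have fin: "finite J" "v \<notin> J" using J finite_subset by auto
  have "{j \<in> insert v J. j < s} = insert v {j \<in> J. j < s}" if "v < s" for s using that by auto
  then have "card {j \<in> insert v J. j < s} = Suc (card {j \<in> J. j < s})" if "v < s" for s
    using that fin by simp
  then show *: "cutset b v n (insert v J) = insert v (cutset (\<not> b) (Suc v) n J)" for b
    using v by (auto simp: cutset_def le_eq_less_or_eq Suc_le_eq)
  show "cutset (\<not> b) (Suc v) n J - J = cutset b v n (insert v J) - insert v J"
    unfolding * by (auto simp: cutset_def)
qed

lemma cutset_gt: "x \<in> cutset b (Suc v) n J \<Longrightarrow> v < x"
  by (auto simp: cutset_def)

lemma sorted_cutset: "sorted_list_of_set (insert v (cutset b (Suc v) n J)) =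
    v # sorted_list_of_set (cutset b (Suc v) n J)"
  by (rule sorted_list_of_set_insert_least) (auto dest: cutset_gt)

lemma cutterm_notin_True:
  assumes J: "J \<subseteq> {Suc v..<n}" and v: "v < n"
  shows "cutterm True v n U V J = cutterm True (Suc v) n (\<lambda>l. U (v # l)) V J"
proof -
  have "{(s, t). s \<in> cutset True v n J \<and> t \<in> cutset False v n J - J \<and> t < s} =
      {(s, t). s \<in> cutset True (Suc v) n J \<and> t \<in> cutset False (Suc v) n J - J \<and> t < s}"
    unfolding cutset_notin[OF assms] by (auto dest: cutset_gt)
  then show ?thesis
    by (simp add: cutterm_def cutinv_def cutset_notin[OF assms] sorted_cutset
        del: sorted_list_of_set_insert_remove)
qed

lemma cutterm_notin_False:
  assumes J: "J \<subseteq> {Suc v..<n}" and v: "v < n"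
  shows "cutterm False v n U V J = cutterm False (Suc v) n (sgnl U) (\<lambda>l. V (v # l)) J"
proof -
  let ?A = "cutset False (Suc v) n J" and ?B = "cutset True (Suc v) n J"
  let ?I = "{(s, t). s \<in> ?A \<and> t \<in> ?B - J \<and> t < s}"
  have "v \<notin> J" using J by auto
  then have "{(s, t). s \<in> cutset False v n J \<and> t \<in> cutset True v n J - J \<and> t < s} = ?I \<union> (\<lambda>s. (s, v)) ` ?A"
    unfolding cutset_notin[OF assms] by (auto dest: cutset_gt)
  moreover have "card (?I \<union> (\<lambda>s. (s, v)) ` ?A) = card ?I + card ?A"
  proof (subst card_Un_disjoint)
    show "finite ?I" by (rule finite_subset[of _ "?A \<times> ?B"]) auto
    show "?I \<inter> (\<lambda>s. (s, v)) ` ?A = {}" by (auto dest: cutset_gt)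
  qed (auto simp: card_image inj_on_def)
  ultimately show ?thesis
    by (simp add: cutterm_def cutinv_def cutset_notin[OF assms] sorted_cutset sgnl_def power_add mult_ac
        del: sorted_list_of_set_insert_remove)
qed

lemma cutterm_insert:
  assumes J: "J \<subseteq> {Suc v..<n}" and v: "v < n"
  shows "cutterm b v n U V (insert v J) = cutterm (\<not> b) (Suc v) n (\<lambda>l. U (v # l)) (\<lambda>l. V (v # l)) J"
proof -
  have "{(s, t). s \<in> cutset b v n (insert v J) \<and> t \<in> cutset (\<not> b) v n (insert v J) - insert v J \<and> t < s} =
      {(s, t). s \<in> cutset (\<not> b) (Suc v) n J \<and> t \<in> cutset (\<not> \<not> b) (Suc v) n J - J \<and> t < s}"
    unfolding cutset_insert(2)[OF assms, symmetric] cutset_insert(1)[OF assms, of b] by (auto dest: cutset_gt)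
  then show ?thesis
    by (simp add: cutterm_def cutinv_def cutset_insert(1)[OF assms] sorted_cutset
        del: sorted_list_of_set_insert_remove)
qed

text \<open>
  The vertex \<open>v\<close> either belongs to \<open>J\<close> or not; these are the two terms in the recursion of \<open>cuts\<close>.
\<close>

lemma cuts_sum:
  fixes U V :: "nat list \<Rightarrow> 'k::{comm_ring,comm_monoid_mult}"
  shows "v \<le> n \<Longrightarrow> cuts r b U V [v..<n] = (\<Sum>J | J \<subseteq> {v..<n} \<and> card J = r. cutterm b v n U V J)"
proof (induction "n - v" arbitrary: v r b U V)
  case 0
  then have "v = n" by simp
  have "{J. J \<subseteq> {v..<n} \<and> card J = r} = (if r = 0 then {{}} else {})"
    using \<open>v = n\<close> by auto
  then show ?case using \<open>v = n\<close> by (simp only:) (simp add: cutterm_def cutinv_def cutset_def)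
next
  case (Suc k)
  then have v: "v < n" by auto
  have IH: "cuts r b U V [Suc v..<n] = (\<Sum>J | J \<subseteq> {Suc v..<n} \<and> card J = r. cutterm b (Suc v) n U V J)"
    for r b and U V :: "nat list \<Rightarrow> 'k" by (rule Suc.hyps(1)) (use Suc.hyps(2) v in auto)
  let ?N = "\<lambda>r. {J. J \<subseteq> {Suc v..<n} \<and> card J = r}"
  have fin: "finite (?N r)" for r by (rule finite_subset[of _ "Pow {Suc v..<n}"]) auto
  have ivl: "{v..<n} = insert v {Suc v..<n}" using v by auto
  have finJ: "finite J" if "J \<subseteq> {Suc v..<n}" for J using that finite_subset by auto
  have split: "{J. J \<subseteq> {v..<n} \<and> card J = r} = ?N r \<union> (if r = 0 then {} else insert v ` ?N (r - 1))"
  proof (rule Set.set_eqI)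
    fix J
    show "J \<in> {J. J \<subseteq> {v..<n} \<and> card J = r} \<longleftrightarrow> J \<in> ?N r \<union> (if r = 0 then {} else insert v ` ?N (r - 1))"
    proof (cases "v \<in> J")
      case False
      then show ?thesis unfolding ivl by (auto simp: subset_insert)
    next
      case True
      have "J \<in> insert v ` ?N (r - 1) \<and> r \<noteq> 0" if "J \<subseteq> {v..<n}" "card J = r"
      proof -
        have "finite J" using that finite_subset by auto
        then have "r \<noteq> 0" "card (J - {v}) = r - 1" using True that by (auto simp: card_gt_0_iff)
        moreover have "J - {v} \<subseteq> {Suc v..<n}" using that unfolding ivl by auto
        moreover have "J = insert v (J - {v})" using True by auto
        ultimately show ?thesis by blast
      qed
      moreover have "card (insert v J') = Suc (card J')" if "J' \<subseteq> {Suc v..<n}" for J'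
        using that finJ by (subst card_insert_disjoint) auto
      ultimately show ?thesis using True v by (auto simp: ivl)
    qed
  qed
  have inj: "inj_on (insert v) (?N (r - 1))"
    unfolding inj_on_def by (auto simp: insert_ident subset_iff) (metis atLeastLessThan_iff insertE insert_iff not_less_eq_eq order_refl)+
  have "(\<Sum>J | J \<subseteq> {v..<n} \<and> card J = r. cutterm b v n U V J) =
      (\<Sum>J\<in>?N r. cutterm b v n U V J)
      + (if r = 0 then 0 else \<Sum>J\<in>?N (r - 1). cutterm b v n U V (insert v J))"
  proof (cases "r = 0")
    case False
    have "?N r \<inter> insert v ` ?N (r - 1) = {}" by auto
    then show ?thesis unfolding split using False fin inj by (simp add: sum.union_disjoint sum.reindex)
  next
    case True
    then show ?thesis unfolding split by simp
  qed
  also have "(\<Sum>J\<in>?N r. cutterm b v n U V J) =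
      (if b then cuts r b (\<lambda>l. U (v # l)) V [Suc v..<n] else cuts r b (sgnl U) (\<lambda>l. V (v # l)) [Suc v..<n])"
    unfolding IH using v by (auto intro!: sum.cong simp: cutterm_notin_True cutterm_notin_False)
  also have "(\<Sum>J\<in>?N (r - 1). cutterm b v n U V (insert v J)) =
      cuts (r - 1) (\<not> b) (\<lambda>l. U (v # l)) (\<lambda>l. V (v # l)) [Suc v..<n]"
    unfolding IH using v by (auto intro!: sum.cong simp: cutterm_insert)
  also have "[v..<n] = v # [Suc v..<n]" using v by (simp add: upt_conv_Cons)
  ultimately show ?case using v by (simp add: upt_conv_Cons)
qed

lemma cut_fst_cutset: "J \<subseteq> {..m} \<Longrightarrow> cut_fst m J = cutset True 0 (Suc m) J"
  and cut_snd_cutset: "J \<subseteq> {..m} \<Longrightarrow> cut_snd m J = cutset False 0 (Suc m) J"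
  by (auto simp: cut_fst_def cut_snd_def cutset_def)

text \<open>
  A cochain of degree \<open>p\<close> as a function of lists of vertices of the simplex \<open>\<sigma>\<close>, zero in all other lengths.
\<close>

definition on_face :: "('o, 'm) cat \<Rightarrow> nat \<Rightarrow> (('o, 'm) simplex \<Rightarrow> 'k) \<Rightarrow> ('o, 'm) simplex \<Rightarrow> nat list \<Rightarrow> 'k::zero" where
  "on_face C p u \<sigma> l = (if length l = Suc p then u (face C \<sigma> l) else 0)"

lemma scochains_simps [simp]:
  "carrier (scochains C n) = extensional (nerve C n)"
  "u \<oplus>\<^bsub>scochains C n\<^esub> v = (\<lambda>\<sigma>\<in>nerve C n. u \<sigma> + v \<sigma>)"
  "\<zero>\<^bsub>scochains C n\<^esub> = (\<lambda>\<sigma>\<in>nerve C n. 0)"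
  "c \<odot>\<^bsub>scochains C n\<^esub> u = (\<lambda>\<sigma>\<in>nerve C n. c * u \<sigma>)"
  by (simp_all add: scochains_def)

lemma opgroup_scochains:
  "opgroup (scochains C n :: ('k::{comm_ring,comm_monoid_mult}, ('o, 'm) simplex \<Rightarrow> 'k) module)"
proof -
  have "abelian_group (scochains C n :: ('k, ('o, 'm) simplex \<Rightarrow> 'k) module)"
  proof (rule abelian_groupI)
    fix u :: "('o, 'm) simplex \<Rightarrow> 'k" assume "u \<in> carrier (scochains C n)"
    then show "\<exists>v\<in>carrier (scochains C n). v \<oplus>\<^bsub>scochains C n\<^esub> u = \<zero>\<^bsub>scochains C n\<^esub>"
      by (intro bexI[of _ "\<lambda>\<sigma>\<in>nerve C n. - u \<sigma>"]) auto
  qed (auto simp: extensional_def restrict_def fun_eq_iff add_ac)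
  then show ?thesis
    by (intro opgroup.intro opgroup_axioms.intro) (auto simp: restrict_def fun_eq_iff distrib_left extensional_def)
qed

context fin_cat
begin

lemma vertex_face:
  assumes "\<sigma> \<in> nerve C m" "sorted_wrt (<) l" "\<forall>s\<in>set l. s \<le> m" "s < length l"
  shows "vertex C (face C \<sigma> l) s = vertex C \<sigma> (l ! s)"
proof (cases s)
  case 0
  then show ?thesis using assms(4) by (cases l) (auto simp: vertex_def face_def)
next
  case (Suc r)
  obtain i as where s: "\<sigma> = (i, as)" by (cases \<sigma>)
  have p: "is_path C i as" "length as = m" using assms(1) by (auto simp: s nerve_iff)
  have "l ! r \<le> l ! Suc r" "l ! Suc r \<le> length as"
    using assms(2-4) Suc p by (auto simp: sorted_wrt_iff_nth_less less_imp_le)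
  then have "tgt C (seg \<sigma> (l ! r) (l ! Suc r)) = vertex C \<sigma> (l ! Suc r)"
    unfolding s by (rule seg_props(3)[OF p(1)])
  then show ?thesis using face_nth[of r l \<sigma>] assms(4) Suc by (simp add: vertex_def[of C "face C \<sigma> l"])
qed

lemma seg_face:
  assumes \<sigma>: "\<sigma> \<in> nerve C m" and l: "sorted_wrt (<) l" "\<forall>s\<in>set l. s \<le> m" and st: "s \<le> t" "t < length l"
  shows "seg (face C \<sigma> l) s t = seg \<sigma> (l ! s) (l ! t)"
  using st
proof (induction t rule: dec_induct)
  case base
  then show ?case using vertex_face[OF \<sigma> l] by (cases "face C \<sigma> l"; cases \<sigma>) (simp add: seg_refl)
next
  case (step t)
  obtain i as where s: "\<sigma> = (i, as)" by (cases \<sigma>)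
  have p: "is_path C i as" "length as = m" using \<sigma> by (auto simp: s nerve_iff)
  obtain j bs where f: "face C \<sigma> l = (j, bs)" by (cases "face C \<sigma> l")
  have "l \<noteq> []" using step by auto
  then have q: "is_path C j bs" "length bs = length l - 1"
    using face_nerve[OF \<sigma> _ l] by (auto simp: f nerve_iff)
  have le: "l ! s \<le> l ! t" "l ! t \<le> l ! Suc t" "l ! Suc t \<le> length as"
    using l step p by (cases "s = t"; auto simp: sorted_wrt_iff_nth_less less_imp_le)+
  have "seg (j, bs) s (Suc t) = Comp C (seg (j, bs) s t) (seg (j, bs) t (Suc t))"
    by (rule seg_seg[OF q(1), symmetric]) (use step q in auto)
  also have "seg (j, bs) t (Suc t) = bs ! t" by (rule seg_Suc[OF q(1)]) (use step q in simp)
  also have "bs ! t = seg \<sigma> (l ! t) (l ! Suc t)" using face_nth[of t l \<sigma>] step by (simp add: f)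
  also have "seg (j, bs) s t = seg \<sigma> (l ! s) (l ! t)" using step f by simp
  also have "Comp C (seg \<sigma> (l ! s) (l ! t)) (seg \<sigma> (l ! t) (l ! Suc t)) = seg \<sigma> (l ! s) (l ! Suc t)"
    unfolding s by (rule seg_seg[OF p(1) le])
  finally show ?case by (simp add: f)
qed

lemma face_face:
  assumes \<sigma>: "\<sigma> \<in> nerve C m" and l: "sorted_wrt (<) l" "\<forall>s\<in>set l. s \<le> m"
    and l': "sorted_wrt (<) l'" "\<forall>s\<in>set l'. s < length l" "l' \<noteq> []"
  shows "face C (face C \<sigma> l) l' = face C \<sigma> (map ((!) l) l')"
proof (rule prod_eqI)
  show "fst (face C (face C \<sigma> l) l') = fst (face C \<sigma> (map ((!) l) l'))"
    using l' vertex_face[OF \<sigma> l, of "hd l'"] by (simp add: face_def[of C _ l'] face_def[of C _ "map _ _"] hd_map)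
  show "snd (face C (face C \<sigma> l) l') = snd (face C \<sigma> (map ((!) l) l'))"
  proof (rule nth_equalityI)
    fix k assume "k < length (snd (face C (face C \<sigma> l) l'))"
    then have k: "Suc k < length l'" by (simp add: length_face)
    then have "l' ! k \<le> l' ! Suc k" "l' ! Suc k < length l"
      using l' by (auto simp: sorted_wrt_iff_nth_less less_imp_le)
    then show "snd (face C (face C \<sigma> l) l') ! k = snd (face C \<sigma> (map ((!) l) l')) ! k"
      using k by (simp add: face_nth seg_face[OF \<sigma> l])
  qed (simp add: length_face)
qed

lemma upt_sorted: "sorted_wrt (<) [i..<j]"
  by simp

lemma scochain_d_dl:
  assumes "\<sigma> \<in> nerve C (Suc n)"
  shows "scochain_d C n u \<sigma> = dl (\<lambda>l. u (face C \<sigma> l)) [0..<Suc (Suc n)]"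
  using assms dl_remove1[of "[0..<Suc (Suc n)]" "\<lambda>l. u (face C \<sigma> l)"]
  by (simp add: scochain_d_def lessThan_Suc_atMost del: upt_Suc sum.lessThan_Suc)

lemma scochain_d_face:
  assumes \<sigma>: "\<sigma> \<in> nerve C m" and l: "sorted_wrt (<) l" "\<forall>s\<in>set l. s \<le> m" "length l = Suc (Suc n)"
  shows "scochain_d C n u (face C \<sigma> l) = dl (\<lambda>l. u (face C \<sigma> l)) l"
proof -
  have "l \<noteq> []" using l by auto
  then have "face C \<sigma> l \<in> nerve C (Suc n)" using face_nerve[OF \<sigma> _ l(1,2)] l(3) by simp
  then have "scochain_d C n u (face C \<sigma> l) = dl (\<lambda>l'. u (face C (face C \<sigma> l) l')) [0..<Suc (Suc n)]"
    by (rule scochain_d_dl)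
  also have "\<dots> = dl (\<lambda>l'. u (face C \<sigma> (map ((!) l) l'))) [0..<Suc (Suc n)]"
  proof (rule dl_cong[OF _ upt_sorted])
    fix l' assume l': "sorted_wrt (<) l'" "set l' \<subseteq> set [0..<Suc (Suc n)]" "Suc (length l') = length [0..<Suc (Suc n)]"
    then have "l' \<noteq> []" by auto
    then show "u (face C (face C \<sigma> l) l') = u (face C \<sigma> (map ((!) l) l'))"
      using face_face[OF \<sigma> l(1,2) l'(1)] l' l by (simp add: subset_iff del: upt_Suc)
  qed
  also have "\<dots> = dl (\<lambda>l. u (face C \<sigma> l)) (map ((!) l) [0..<Suc (Suc n)])"
    by (rule dl_map)
  also have "map ((!) l) [0..<Suc (Suc n)] = l" using l(3) map_nth[of l] by simp
  finally show ?thesis .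
qed

lemma scochain_d_scochain_d: "scochain_d C (Suc n) (scochain_d C n u) = (\<lambda>\<sigma>\<in>nerve C (Suc (Suc n)). 0)"
proof
  fix \<sigma>
  show "scochain_d C (Suc n) (scochain_d C n u) \<sigma> = (\<lambda>\<sigma>\<in>nerve C (Suc (Suc n)). 0) \<sigma>"
  proof (cases "\<sigma> \<in> nerve C (Suc (Suc n))")
    case True
    have "scochain_d C (Suc n) (scochain_d C n u) \<sigma> =
        dl (\<lambda>l. scochain_d C n u (face C \<sigma> l)) [0..<Suc (Suc (Suc n))]"
      by (rule scochain_d_dl[OF True])
    also have "\<dots> = dl (dl (\<lambda>l. u (face C \<sigma> l))) [0..<Suc (Suc (Suc n))]"
    proof (rule dl_cong[OF _ upt_sorted])
      fix l' assume l': "sorted_wrt (<) l'" "set l' \<subseteq> set [0..<Suc (Suc (Suc n))]"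
        "Suc (length l') = length [0..<Suc (Suc (Suc n))]"
      then show "scochain_d C n u (face C \<sigma> l') = dl (\<lambda>l. u (face C \<sigma> l)) l'"
        by (intro scochain_d_face[OF True]) (auto simp: subset_iff less_Suc_eq_le simp del: upt_Suc)
    qed
    finally show ?thesis using True by (simp add: dl_dl)
  qed (simp add: scochain_d_def)
qed

lemma scochain_d_hom: "scochain_d C n \<in> module_hom (scochains C n) (scochains C (Suc n) :: ('k::{comm_ring,comm_monoid_mult}, _) module)"
proof (rule module_homI)
  have face: "face C \<sigma> (remove1 j [0..<n + 2]) \<in> nerve C n" if "\<sigma> \<in> nerve C (Suc n)" "j \<le> n + 1" for \<sigma> j
  proof -
    have "length (remove1 j [0..<n + 2]) = Suc n" using that by (simp add: length_remove1 del: upt_Suc)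
    moreover have "sorted_wrt (<) (remove1 j [0..<n + 2])"
      using that remove1_upt[of j "n + 2"] by (auto simp: sorted_wrt_append simp del: upt_Suc)
    moreover have "\<forall>s\<in>set (remove1 j [0..<n + 2]). s \<le> Suc n"
      using notin_set_remove1 by (auto simp del: upt_Suc dest: notin_set_remove1[rotated])
    moreover have "remove1 j [0..<n + 2] \<noteq> []" using \<open>length _ = Suc n\<close> by auto
    ultimately show ?thesis using face_nerve[OF that(1)] by (metis diff_Suc_1)
  qed
  fix v w :: "('o, 'm) simplex \<Rightarrow> 'k" and c
  show "scochain_d C n v \<in> carrier (scochains C (Suc n))" by (simp add: scochain_d_def)
  show "scochain_d C n (v \<oplus>\<^bsub>scochains C n\<^esub> w) = scochain_d C n v \<oplus>\<^bsub>scochains C (Suc n)\<^esub> scochain_d C n w"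
    using face by (auto simp: scochain_d_def algebra_simps sum.distrib[symmetric] intro!: restrict_ext sum.cong
        simp del: upt_Suc sum.atMost_Suc)
  show "scochain_d C n (c \<odot>\<^bsub>scochains C n\<^esub> v) = c \<odot>\<^bsub>scochains C (Suc n)\<^esub> scochain_d C n v"
    using face by (auto simp: scochain_d_def mult_ac sum_distrib_left intro!: restrict_ext sum.cong
        simp del: upt_Suc sum.atMost_Suc)
qed

lemma cochain_complex_scochains: "cochain_complex (scochains C) (scochain_d C :: nat \<Rightarrow> (_ \<Rightarrow> 'k::{comm_ring,comm_monoid_mult}) \<Rightarrow> _)"
  by (rule cochain_complex.intro)
    (auto intro: opgroup_scochains scochain_d_hom simp: scochain_d_scochain_d)

lemma cup_cuts:
  assumes \<sigma>: "\<sigma> \<in> nerve C (p + q - i)"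
  shows "cup C i p q u v \<sigma> =
    cuts (Suc i) True (on_face C p u \<sigma>) (on_face C q v \<sigma>) [0..<Suc (p + q - i)]"
proof -
  let ?m = "p + q - i"
  let ?N = "{J. J \<subseteq> {..?m} \<and> card J = i + 1}"
  let ?P = "\<lambda>J. card (cut_fst ?m J) = p + 1 \<and> card (cut_snd ?m J) = q + 1"
  have fin: "finite ?N" by (rule finite_subset[of _ "Pow {..?m}"]) auto
  have summand: "cutterm True 0 (Suc ?m) (on_face C p u \<sigma>) (on_face C q v \<sigma>) J = (if ?P J then
       (- 1) ^ cut_inversions ?m J * u (face C \<sigma> (sorted_list_of_set (cut_fst ?m J)))
       * v (face C \<sigma> (sorted_list_of_set (cut_snd ?m J))) else 0)" if "J \<subseteq> {..?m}" for J
    using that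
    by (simp add: cutterm_def on_face_def cut_fst_cutset cut_snd_cutset cut_inversions_def cutinv_def)
  have "cuts (Suc i) True (on_face C p u \<sigma>) (on_face C q v \<sigma>) [0..<Suc ?m] =
      (\<Sum>J\<in>?N. cutterm True 0 (Suc ?m) (on_face C p u \<sigma>) (on_face C q v \<sigma>) J)"
    by (subst cuts_sum) (simp_all add: atLeast0LessThan lessThan_Suc_atMost del: upt_Suc)
  also have "\<dots> = (\<Sum>J\<in>?N. if ?P J then
       (- 1) ^ cut_inversions ?m J * u (face C \<sigma> (sorted_list_of_set (cut_fst ?m J)))
       * v (face C \<sigma> (sorted_list_of_set (cut_snd ?m J))) else 0)"
    by (rule sum.cong) (simp_all add: summand)
  also have "\<dots> = (\<Sum>J | J \<in> ?N \<and> ?P J.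
       (- 1) ^ cut_inversions ?m J * u (face C \<sigma> (sorted_list_of_set (cut_fst ?m J)))
       * v (face C \<sigma> (sorted_list_of_set (cut_snd ?m J))))"
    using fin by (rule sum.inter_filter[symmetric])
  finally show ?thesis using \<sigma> by (simp add: cup_def conj_ac)
qed

lemma on_face_face:
  assumes \<sigma>: "\<sigma> \<in> nerve C m" and l: "sorted_wrt (<) l" "\<forall>s\<in>set l. s \<le> m"
    and l': "sorted_wrt (<) l'" "\<forall>s\<in>set l'. s < length l"
  shows "on_face C p u (face C \<sigma> l) l' = on_face C p u \<sigma> (map ((!) l) l')"
  using face_face[OF assms] by (cases "l' = []") (auto simp: on_face_def)

lemma cup_face:
  assumes \<sigma>: "\<sigma> \<in> nerve C m" and l: "sorted_wrt (<) l" "\<forall>s\<in>set l. s \<le> m" "length l = Suc (p + q - i)"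
  shows "cup C i p q u v (face C \<sigma> l) = cuts (Suc i) True (on_face C p u \<sigma>) (on_face C q v \<sigma>) l"
proof -
  have "l \<noteq> []" using l by auto
  then have "face C \<sigma> l \<in> nerve C (p + q - i)" using face_nerve[OF \<sigma> _ l(1,2)] l(3) by simp
  then have "cup C i p q u v (face C \<sigma> l) =
      cuts (Suc i) True (on_face C p u (face C \<sigma> l)) (on_face C q v (face C \<sigma> l)) [0..<Suc (p + q - i)]"
    by (rule cup_cuts)
  also have "\<dots> = cuts (Suc i) True (\<lambda>l'. on_face C p u \<sigma> (map ((!) l) l'))
      (\<lambda>l'. on_face C q v \<sigma> (map ((!) l) l')) [0..<Suc (p + q - i)]"
    by (rule cuts_cong[OF _ upt_sorted])
      (use l in \<open>auto simp: on_face_face[OF \<sigma> l(1,2)] subset_iff simp del: upt_Suc\<close>)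
  also have "\<dots> = cuts (Suc i) True (on_face C p u \<sigma>) (on_face C q v \<sigma>) (map ((!) l) [0..<Suc (p + q - i)])"
    by (rule cuts_map)
  also have "map ((!) l) [0..<Suc (p + q - i)] = l" using l(3) map_nth[of l] by simp
  finally show ?thesis .
qed

lemma dl_on_face:
  assumes \<sigma>: "\<sigma> \<in> nerve C m" and l: "sorted_wrt (<) l" "\<forall>s\<in>set l. s \<le> m"
  shows "dl (on_face C p u \<sigma>) l = on_face C (Suc p) (scochain_d C p u) \<sigma> l"
proof (cases "length l = Suc (Suc p)")
  case True
  have "dl (on_face C p u \<sigma>) l = dl (\<lambda>l. u (face C \<sigma> l)) l"
    by (rule dl_cong[OF _ l(1)]) (simp add: on_face_def True)
  then show ?thesis using scochain_d_face[OF \<sigma> l True, of u] True by (simp add: on_face_def)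
next
  case False
  have "dl (on_face C p u \<sigma>) l = dl (\<lambda>l. 0) l"
    by (rule dl_cong[OF _ l(1)]) (use False in \<open>auto simp: on_face_def\<close>)
  then show ?thesis using False by (simp add: on_face_def)
qed

lemma sgnl_on_face: "sgnl (on_face C p u \<sigma>) = (\<lambda>l. (- 1) ^ Suc p * on_face C p u \<sigma> l)"
  by (auto simp: sgnl_def on_face_def fun_eq_iff)

theorem scochain_d_cup:
  fixes f g :: "('o, 'm) simplex \<Rightarrow> 'k::{comm_ring,comm_monoid_mult}"
  assumes i: "i \<le> p + q" and \<sigma>: "\<sigma> \<in> nerve C (Suc (p + q - i))"
  shows "scochain_d C (p + q - i) (cup C i p q f g) \<sigma> =
    (if i = 0 then 0 else (- 1) ^ (p + q - i) * cup C (i - 1) p q f g \<sigma>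
       + (- 1) ^ (p * q + p + q) * cup C (i - 1) q p g f \<sigma>)
    + cup C i (Suc p) q (scochain_d C p f) g \<sigma>
    + (- 1) ^ p * cup C i p (Suc q) f (scochain_d C q g) \<sigma>"
proof -
  let ?m = "p + q - i"
  let ?l = "[0..<Suc (Suc ?m)]" and ?F = "on_face C p f \<sigma>" and ?G = "on_face C q g \<sigma>"
  have le: "\<forall>s\<in>set l'. s \<le> Suc ?m" if "set l' \<subseteq> set ?l" for l'
    using that by (auto simp: subset_iff less_Suc_eq_le simp del: upt_Suc)
  have deg: "Suc p + q - i = Suc ?m" "p + Suc q - i = Suc ?m" using i by auto
  have "scochain_d C ?m (cup C i p q f g) \<sigma> = dl (\<lambda>l. cup C i p q f g (face C \<sigma> l)) ?l"
    by (rule scochain_d_dl[OF \<sigma>])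
  also have "\<dots> = dl (cuts (Suc i) True ?F ?G) ?l"
    by (rule dl_cong[OF _ upt_sorted], rule cup_face[OF \<sigma>]) (use le in \<open>auto simp del: upt_Suc\<close>)
  \<comment> \<open>The third term has the factors in the opposite order; it is turned around by \<open>cuts_swap\<close>.  For \<open>i = 0\<close> the last
    two terms vanish, because one factor would get no vertices.\<close>
  also have "\<dots> = cuts (Suc i) True (dl ?F) ?G ?l - cuts (Suc i) True (sgnl ?F) (dl ?G) ?l
      - cuts i False (sgnl ?F) ?G ?l + (- 1) ^ Suc (Suc ?m) * cuts i True ?F ?G ?l"
    unfolding dl_cuts by (simp add: cuts'_def del: upt_Suc cuts.simps)
  also have "cuts (Suc i) True (dl ?F) ?G ?l = cup C i (Suc p) q (scochain_d C p f) g \<sigma>"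
  proof -
    have n: "\<sigma> \<in> nerve C (Suc p + q - i)" using \<sigma> deg by simp
    have "cup C i (Suc p) q (scochain_d C p f) g \<sigma> =
        cuts (Suc i) True (on_face C (Suc p) (scochain_d C p f) \<sigma>) ?G ?l"
      unfolding cup_cuts[OF n] deg ..
    also have "\<dots> = cuts (Suc i) True (dl ?F) ?G ?l"
      by (rule cuts_cong[OF _ upt_sorted]) (simp add: dl_on_face[OF \<sigma> _ le] del: upt_Suc)
    finally show ?thesis ..
  qed
  also have "cuts (Suc i) True (sgnl ?F) (dl ?G) ?l =
      - ((- 1) ^ p * cup C i p (Suc q) f (scochain_d C q g) \<sigma>)"
  proof -
    have n: "\<sigma> \<in> nerve C (p + Suc q - i)" using \<sigma> deg by simp
    have "cup C i p (Suc q) f (scochain_d C q g) \<sigma> =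
        cuts (Suc i) True ?F (on_face C (Suc q) (scochain_d C q g) \<sigma>) ?l"
      unfolding cup_cuts[OF n] deg ..
    also have "\<dots> = cuts (Suc i) True ?F (dl ?G) ?l"
      by (rule cuts_cong[OF _ upt_sorted]) (simp add: dl_on_face[OF \<sigma> _ le] del: upt_Suc)
    finally show ?thesis unfolding sgnl_on_face cuts_scaleU by simp
  qed
  also have "(- 1) ^ Suc (Suc ?m) * cuts i True ?F ?G ?l =
      (if i = 0 then 0 else (- 1) ^ ?m * cup C (i - 1) p q f g \<sigma>)"
  proof (cases i)
    case 0
    then show ?thesis by (simp add: cuts_0 on_face_def del: upt_Suc cuts.simps)
  next
    case (Suc j)
    then have d: "p + q - j = Suc ?m" using i by simp
    then have "\<sigma> \<in> nerve C (p + q - j)" using \<sigma> by simp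
    from cup_cuts[OF this, of f g] show ?thesis unfolding d using Suc by (simp del: upt_Suc cuts.simps)
  qed
  also have "cuts i False (sgnl ?F) ?G ?l =
      (if i = 0 then 0 else - ((- 1) ^ (p * q + p + q) * cup C (i - 1) q p g f \<sigma>))"
  proof (cases i)
    case 0
    then show ?thesis by (simp add: cuts_0 on_face_def sgnl_def del: upt_Suc cuts.simps)
  next
    case (Suc j)
    then have d: "q + p - j = Suc ?m" using i by simp
    then have "\<sigma> \<in> nerve C (q + p - j)" using \<sigma> by simp
    from cup_cuts[OF this, of g f] have c: "cup C j q p g f \<sigma> = cuts i True ?G ?F ?l"
      unfolding d using Suc by simp
    have "cuts i False (sgnl ?F) ?G ?l = (- 1) ^ Suc p * ((- 1) ^ swap_sign (Suc p) (Suc q) i * cuts i True ?G ?F ?l)"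
      unfolding sgnl_on_face cuts_scaleU
      by (subst cuts_swap[of "Suc p" _ "Suc q"]) (auto simp: on_face_def)
    also have "\<dots> = (- 1) ^ (Suc p + swap_sign (Suc p) (Suc q) i) * cup C j q p g f \<sigma>"
      by (simp only: c power_add mult.assoc)
    also have "(- 1) ^ (Suc p + swap_sign (Suc p) (Suc q) i) = ((- 1) ^ Suc (p * q + p + q) :: 'k)"
      by (rule neg_one_power_cong) (auto simp: swap_sign_def)
    finally show ?thesis using Suc by simp
  qed
  finally show ?thesis by (cases "i = 0") (simp_all add: algebra_simps)
qed

lemma cup_0:
  assumes p: "is_path C i as" and len: "length as = p + q"
  shows "cup C 0 p q u v (i, as) = u (i, take p as) * v (path_end C i (take p as), drop p as)"
proof -
  have \<sigma>: "(i, as) \<in> nerve C (p + q - 0)" using p len by (simp add: nerve_iff)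
  have f: "face C (i, as) [0..<Suc p] = (i, take p as)" "face C (i, as) [p..<Suc (p + q)] = (path_end C i (take p as), drop p as)"
    using face_interval[OF p, of 0 p] face_interval[OF p, of p "p + q"] len vertex_path_end[of p as i]
    by (simp_all add: vertex_def del: upt_Suc)
  have "cup C 0 p q u v (i, as) = (\<Sum>s<Suc (p + q).
      on_face C p u (i, as) (take (Suc s) [0..<Suc (p + q)]) * on_face C q v (i, as) (drop s [0..<Suc (p + q)]))"
    unfolding cup_cuts[OF \<sigma>] by (simp add: cuts_1 del: upt_Suc sum.lessThan_Suc cuts.simps)
  also have "\<dots> = (\<Sum>s<Suc (p + q). if s = p then u (i, take p as) * v (path_end C i (take p as), drop p as) else 0)"
    by (rule sum.cong) (auto simp: on_face_def take_upt f simp del: upt_Suc)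
  finally show ?thesis by (simp del: sum.lessThan_Suc)
qed

end

section \<open>The autopoietic cochains\<close>

lemma opsub_image:
  assumes "opgroup M" "opgroup N" "h \<in> module_hom M N"
  shows "opsub N (h ` carrier M)"
proof -
  interpret M: opgroup M by fact
  interpret N: opgroup N by fact
  note h = module_homD[OF assms(3)] module_hom_zero[OF assms] module_hom_minus[OF assms]
  show ?thesis
  proof (rule N.opsubI)
    show "\<zero>\<^bsub>N\<^esub> \<in> h ` carrier M" using h(4) by (intro image_eqI[of _ _ "\<zero>\<^bsub>M\<^esub>"]) auto
    fix c x y assume "x \<in> h ` carrier M"
    then obtain a where a: "a \<in> carrier M" "x = h a" by auto
    show "c \<odot>\<^bsub>N\<^esub> x \<in> h ` carrier M" using a h(3)[OF a(1), of c] by (intro image_eqI[of _ _ "c \<odot>\<^bsub>M\<^esub> a"]) auto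
    assume "y \<in> h ` carrier M"
    then obtain b where b: "b \<in> carrier M" "y = h b" by auto
    show "x \<ominus>\<^bsub>N\<^esub> y \<in> h ` carrier M" using a b h(5)[OF a(1) b(1)] by (intro image_eqI[of _ _ "a \<ominus>\<^bsub>M\<^esub> b"]) auto
  qed (use h(1) in auto)
qed

lemma vmerge_append: "vmerge m (length xs + k) (xs @ ys) = xs @ vmerge m k ys"
  by (induction xs) auto

lemma (in fin_cat) bPsi_path:
  assumes "is_path C i as" "as \<noteq> []"
  shows "bPsi \<gamma> as = Poly_Mapping.single (composite C i as) (\<gamma> (i, as))"
proof -
  have "starts as = {i}" using assms is_path_start by (auto simp: starts_def)
  then show ?thesis by (simp add: bPsi_def)
qed

lemma (in fin_cat) bPsi_cong:
  assumes "\<And>i. is_path C i as \<Longrightarrow> \<gamma> (i, as) = \<delta> (i, as)"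
  shows "bPsi \<gamma> as = bPsi \<delta> as"
  unfolding bPsi_def using assms by (intro sum.cong) (auto simp: starts_def)

lemma (in fin_cat) bPsi_add: "bPsi (\<lambda>\<sigma>. \<gamma> \<sigma> + \<delta> \<sigma>) as = bPsi \<gamma> as + bPsi \<delta> as"
  and bPsi_scale: "bPsi (\<lambda>\<sigma>. c * \<gamma> \<sigma>) as = scale c (bPsi \<gamma> as)"
  by (simp_all add: bPsi_def single_add sum.distrib scale_sum)

text \<open>A nonempty list that is not a path has two neighbours that are not composable.\<close>

lemma (in fin_cat) not_path:
  assumes "set as \<subseteq> Arr C" "as \<noteq> []" "starts as = {}"
  obtains bs a b ds where "as = bs @ a # b # ds" "tgt C a \<noteq> src C b"
proof -
  have "is_path C (src C (hd as)) as \<or> (\<exists>bs a b ds. as = bs @ a # b # ds \<and> tgt C a \<noteq> src C b)"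
    using assms(1,2)
  proof (induction as)
    case (Cons a as)
    show ?case
    proof (cases as)
      case Nil
      then show ?thesis using Cons.prems src_Ob tgt_Ob by auto
    next
      case as: (Cons b bs)
      show ?thesis
      proof (cases "tgt C a = src C b")
        case False
        then show ?thesis using as by (intro disjI2 exI[of _ "[]"]) auto
      next
        case True
        from Cons.IH have "is_path C (src C (hd as)) as \<or> (\<exists>bs a b ds. as = bs @ a # b # ds \<and> tgt C a \<noteq> src C b)"
          using Cons.prems as by auto
        then show ?thesis
        proof
          assume "is_path C (src C (hd as)) as"
          then show ?thesis using True as Cons.prems src_Ob by simp
        next
          assume "\<exists>bs a b ds. as = bs @ a # b # ds \<and> tgt C a \<noteq> src C b"
          then obtain bs' c d ds where "as = bs' @ c # d # ds" "tgt C c \<noteq> src C d" by blast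
          then show ?thesis by (intro disjI2 exI[of _ "a # bs'"]) auto
        qed
      qed
    qed
  qed simp
  then show thesis using that assms(3) by (auto simp: starts_def)
qed

context cat_over
begin

lemma Psi_closed: "Psi C n \<gamma> \<in> carrier (hoch A n)"
  unfolding Psi_eq_mext by (rule hoch_mext[OF bcochain_bPsi])

lemma Psi_basis: "set as \<subseteq> Arr C \<Longrightarrow> length as = n \<Longrightarrow> Psi C n \<gamma> (map basis as) = bPsi \<gamma> as"
  by (simp add: Psi_eq_mext)

lemma Psi_hom: "Psi C n \<in> module_hom (scochains C n) (hoch A n)"
proof (rule module_homI)
  interpret opgroup "hoch A n" by (rule opgroup_hoch)
  fix \<gamma> \<delta> :: "('o, 'm) simplex \<Rightarrow> 'k" and c
  show "Psi C n \<gamma> \<in> carrier (hoch A n)" by (rule Psi_closed)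
  show "Psi C n (\<gamma> \<oplus>\<^bsub>scochains C n\<^esub> \<delta>) = Psi C n \<gamma> \<oplus>\<^bsub>hoch A n\<^esub> Psi C n \<delta>"
    unfolding Psi_eq_mext hoch_add_mext
    by (rule mext_cong) (auto simp: bPsi_add[symmetric] nerve_iff intro!: bPsi_cong)
  show "Psi C n (c \<odot>\<^bsub>scochains C n\<^esub> \<gamma>) = c \<odot>\<^bsub>hoch A n\<^esub> Psi C n \<gamma>"
    unfolding Psi_eq_mext hoch_smult_mext
    by (rule mext_cong) (auto simp: bPsi_scale[symmetric] nerve_iff intro!: bPsi_cong)
qed

lemma Psi_d: "Psi C (Suc n) (scochain_d C n \<gamma>) = hoch_d A n (Psi C n \<gamma>)"
  unfolding Psi_eq_mext hoch_d_mext[OF bcochain_bPsi]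
  by (rule mext_cong) (simp add: bdiff_bPsi)

text \<open>
  The retraction of the Hochschild complex onto the simplicial cochains, which sends a value on a path
  from \<open>i\<close> to \<open>j\<close> to the sum of its coefficients at the morphisms from \<open>i\<close> to \<open>j\<close>.
\<close>

definition retr :: "nat \<Rightarrow> (('m \<Rightarrow>\<^sub>0 'k) list \<Rightarrow> ('m \<Rightarrow>\<^sub>0 'k)) \<Rightarrow> ('o, 'm) simplex \<Rightarrow> 'k" where
  "retr n f = (\<lambda>\<sigma>\<in>nerve C n. baug (\<lambda>as. f (map basis as)) \<sigma>)"

lemma retr_path:
  "is_path C i as \<Longrightarrow> length as = n \<Longrightarrow> retr n f (i, as) = aug (Mor C i (path_end C i as)) (f (map basis as))"
  by (simp add: retr_def nerve_iff baug_def)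

lemma retr_Psi: "\<gamma> \<in> carrier (scochains C n) \<Longrightarrow> retr n (Psi C n \<gamma>) = \<gamma>"
proof
  fix \<sigma> :: "('o, 'm) simplex" assume g: "\<gamma> \<in> carrier (scochains C n)"
  obtain i as where s: "\<sigma> = (i, as)" by (cases \<sigma>)
  show "retr n (Psi C n \<gamma>) \<sigma> = \<gamma> \<sigma>"
  proof (cases "\<sigma> \<in> nerve C n")
    case True
    then have p: "is_path C i as" "length as = n" by (auto simp: s nerve_iff)
    then have "retr n (Psi C n \<gamma>) \<sigma> = baug (bPsi \<gamma>) (i, as)"
      using is_path_props[OF p(1)] by (simp add: s retr_path baug_def Psi_basis)
    then show ?thesis using baug_bPsi[OF p(1), of \<gamma>] by (simp add: s)
  next
    case False
    then show ?thesis using g extensional_arb[of \<gamma> "nerve C n" \<sigma>] by (simp add: retr_def)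
  qed
qed

lemma cochain_map_Psi: "cochain_map (scochains C) (scochain_d C) (hoch A) (hoch_d A) (Psi C)"
  by (intro cochain_map.intro cochain_map_axioms.intro cochain_complex_scochains cochain_complex_hoch)
    (simp add: chain_map_def Psi_hom Psi_d)

lemma cochain_map_retr: "cochain_map (hoch A) (hoch_d A) (scochains C) (scochain_d C) retr"
proof (intro cochain_map.intro cochain_map_axioms.intro cochain_complex_scochains cochain_complex_hoch)
  have hom: "retr n \<in> module_hom (hoch A n) (scochains C n)" for n
  proof (rule module_homI)
    fix f g :: "('m \<Rightarrow>\<^sub>0 'k) list \<Rightarrow> ('m \<Rightarrow>\<^sub>0 'k)" and c
    show "retr n f \<in> carrier (scochains C n)" by (simp add: retr_def)
    show "retr n (f \<oplus>\<^bsub>hoch A n\<^esub> g) = retr n f \<oplus>\<^bsub>scochains C n\<^esub> retr n g"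
      using is_path_props
      by (auto simp: retr_def nerve_iff baug_def hoch_basis intro!: restrict_ext)
    show "retr n (c \<odot>\<^bsub>hoch A n\<^esub> f) = c \<odot>\<^bsub>scochains C n\<^esub> retr n f"
      using is_path_props
      by (auto simp: retr_def nerve_iff baug_def hoch_basis intro!: restrict_ext)
  qed
  have comm: "retr (Suc n) (hoch_d A n f) = scochain_d C n (retr n f)" if f: "f \<in> carrier (hoch A n)" for n f
  proof
    fix \<sigma> :: "('o, 'm) simplex"
    obtain i as where s: "\<sigma> = (i, as)" by (cases \<sigma>)
    show "retr (Suc n) (hoch_d A n f) \<sigma> = scochain_d C n (retr n f) \<sigma>"
    proof (cases "\<sigma> \<in> nerve C (Suc n)")
      case True
      then have p: "is_path C i as" "length as = Suc n" by (auto simp: s nerve_iff)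
      have as: "set as \<subseteq> Arr C" "as \<noteq> []" using is_path_props[OF p(1)] p(2) by auto
      let ?F = "\<lambda>as. f (map basis as)"
      have "retr (Suc n) (hoch_d A n f) \<sigma> = baug (bdiff (cat_prod C) n ?F) (i, as)"
        using p as f by (simp add: s retr_path baug_def hoch_d_basis)
      also have "\<dots> = scochain_d C n (baug ?F) (i, as)"
        by (rule baug_bdiff[OF hoch_bcochain[OF f] p])
      also have "\<dots> = scochain_d C n (retr n f) (i, as)"
      proof -
        have "baug ?F \<tau> = retr n f \<tau>" if "\<tau> \<in> nerve C n" for \<tau> using that by (simp add: retr_def)
        moreover have "(tgt C (hd as), tl as) \<in> nerve C n" using p as by (cases as) (auto simp: nerve_iff)
        moreover have "(i, butlast as) \<in> nerve C n"
          using p as is_path_append[of i "butlast as" "[last as]"] by (simp add: nerve_iff)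
        moreover have "(i, the (bmerge (cat_prod C) k as)) \<in> nerve C n" if "k < n" for k
          using bmerge_path(1)[OF bmerge_path_eq[OF p(1), of k] as(1), of i] bmerge_path_eq[OF p(1), of k]
            p that by (simp add: nerve_iff)
        ultimately show ?thesis unfolding scochain_d_path[OF p] by simp
      qed
      finally show ?thesis by (simp add: s)
    qed (simp add: retr_def scochain_d_def)
  qed
  show "chain_map (hoch A) (hoch_d A) (scochains C) (scochain_d C) retr"
    using hom comm by (simp add: chain_map_def)
qed

subsection \<open>Autopoietic cochains are the image of the simplicial ones\<close>

lemma Psi_balanced:
  fixes \<gamma> :: "('o, 'm) simplex \<Rightarrow> 'k"
  assumes "Poly_Mapping.keys x \<subseteq> Arr C" "Poly_Mapping.keys y \<subseteq> Arr C" "Poly_Mapping.keys e \<subseteq> Id C ` Ob C"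
    and xs: "\<forall>z\<in>set xs. Poly_Mapping.keys z \<subseteq> Arr C" and ys: "\<forall>z\<in>set ys. Poly_Mapping.keys z \<subseteq> Arr C"
    and n: "length xs + length ys + 2 = n"
  shows "Psi C n \<gamma> (xs @ pmult (cat_prod C) x e # y # ys) = Psi C n \<gamma> (xs @ x # pmult (cat_prod C) e y # ys)"
proof -
  let ?m = "cat_prod C" and ?zs = "xs @ x # e # y # ys"
  have e: "Poly_Mapping.keys e \<subseteq> Arr C" using assms(3) Id by blast
  have mem: "xs @ pmult ?m x e # y # ys \<in> vtuples (Arr C) n" "xs @ x # pmult ?m e y # ys \<in> vtuples (Arr C) n"
    using assms pmult_closed[OF assms(1) e] pmult_closed[OF e assms(2)] by (auto simp: vtuples_def)
  have "ml (bPsi \<gamma>) (xs @ pmult ?m x e # y # ys) = ml (\<lambda>as. on_opt (bPsi \<gamma>) (bmerge ?m (length xs) as)) ?zs"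
    using ml_vmerge[of "length xs" ?zs "bPsi \<gamma>" ?m] vmerge_append[of ?m xs 0 "x # e # y # ys"] by simp
  also have "\<dots> = ml (\<lambda>as. on_opt (bPsi \<gamma>) (bmerge ?m (Suc (length xs)) as)) ?zs"
  proof (rule ml_cong)
    fix as assume "list_all2 (\<lambda>a x. a \<in> Poly_Mapping.keys x) as ?zs"
    then obtain bs a c b ds where as: "as = bs @ a # c # b # ds" "length bs = length xs"
      "a \<in> Poly_Mapping.keys x" "c \<in> Poly_Mapping.keys e" "b \<in> Poly_Mapping.keys y"
      by (auto simp: list_all2_append2 list_all2_Cons2 dest: list_all2_lengthD)
    obtain i where i: "i \<in> Ob C" "c = Id C i" using as assms(3) by auto
    have ab: "a \<in> Arr C" "b \<in> Arr C" using as assms by auto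
    have "bPsi \<gamma> (bs @ a # b # ds) = 0" if "tgt C a \<noteq> src C b"
    proof -
      have "starts (bs @ a # b # ds) = {}" using that by (auto simp: starts_def is_path_append)
      then show ?thesis by (simp add: bPsi_def)
    qed
    moreover have "Comp C a (Id C i) = a" if "tgt C a = i" using Comp_Id(2)[OF ab(1)] that by simp
    moreover have "Comp C (Id C i) b = b" if "src C b = i" using Comp_Id(1)[OF ab(2)] that by simp
    ultimately show "on_opt (bPsi \<gamma>) (bmerge ?m (length xs) as) = on_opt (bPsi \<gamma>) (bmerge ?m (Suc (length xs)) as)"
      using bmerge_append2[of ?m bs 0 "a # c # b # ds"] bmerge_append2[of ?m bs 1 "a # c # b # ds"] i Id as(2)
      by (auto simp: as cat_prod_def)
  qed
  also have "\<dots> = ml (bPsi \<gamma>) (xs @ x # pmult ?m e y # ys)"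
    using ml_vmerge[of "Suc (length xs)" ?zs "bPsi \<gamma>" ?m] vmerge_append[of ?m xs 1 "x # e # y # ys"] by simp
  finally show ?thesis using mem by (simp add: Psi_eq_mext mext_def)
qed

lemma Psi_autopoietic:
  fixes \<gamma> :: "('o, 'm) simplex \<Rightarrow> 'k"
  shows "Psi C n \<gamma> \<in> autopoietic C n"
proof -
  let ?f = "Psi C n \<gamma>"
  have path: "?f (map basis as) = Poly_Mapping.single (composite C i as) (\<gamma> (i, as))"
    if "(i, as) \<in> nerve C n" "n \<noteq> 0" for i as
    using that is_path_props[of i as] bPsi_path[of i as \<gamma>] by (auto simp: nerve_iff Psi_basis)
  have zero: "?f [] = bPsi \<gamma> []" if "n = 0" using Psi_basis[of "[]" 0 \<gamma>] that by simp
  have "?f \<in> rel_cochains C n"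
  proof -
    have "Poly_Mapping.keys (?f []) \<subseteq> (\<Union>i\<in>Ob C. Mor C i i)" if "n = 0"
      unfolding zero[OF that] bPsi_def
      by (intro keys_sum_subset keys_single_subset) (auto simp: starts_def Mor_def Id)
    moreover have "Poly_Mapping.keys (?f (map basis as)) \<subseteq> Mor C i (vertex C (i, as) n)"
      if "(i, as) \<in> nerve C n" "n \<noteq> 0" for i as
      unfolding path[OF that] using that is_path_props[of i as] vertex_path_end[of n as i]
      by (intro keys_single_subset) (auto simp: nerve_iff Mor_def)
    ultimately show ?thesis
      using Psi_closed[of n \<gamma>] Psi_balanced[of _ _ _ _ _ n \<gamma>]
      by (auto simp: rel_cochains_def Let_def cat_algebra_A split_def subset_iff)
  qed
  moreover have "\<exists>c. basis (Id C i) \<bullet> ?f [] \<bullet> basis (Id C i) = Poly_Mapping.single (Id C i) c"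
    if n: "n = 0" and i: "i \<in> Ob C" for i
  proof -
    have "basis (Id C i) \<bullet> ?f [] \<bullet> basis (Id C i) =
        (\<Sum>j\<in>starts []. if j = i then Poly_Mapping.single (Id C i) (\<gamma> (i, [])) else 0)"
      unfolding zero[OF n] bPsi_def pmult_sum
      by (rule sum.cong) (use i Id Comp_Id(1)[of "Id C i"] in \<open>auto simp: starts_def pmult_single_left pmult_single_right\<close>)
    then show ?thesis using i finite_Ob by (auto simp: starts_def)
  qed
  ultimately show ?thesis using path by (auto simp: autopoietic_def cat_algebra_A)
qed

lemma autopoietic_eq_Psi:
  fixes f :: "('m \<Rightarrow>\<^sub>0 'k) list \<Rightarrow> ('m \<Rightarrow>\<^sub>0 'k)"
  assumes f: "f \<in> autopoietic C n"
  shows "f = Psi C n (retr n f)"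
proof (rule hoch_eqI[of _ "Arr C" "cat_prod C" u n])
  have rel: "f \<in> rel_cochains C n" using f by (simp add: autopoietic_def)
  then show fc: "f \<in> carrier (hoch A n)" by (simp add: rel_cochains_def Let_def cat_algebra_A)
  show "Psi C n (retr n f) \<in> carrier (hoch A n)" by (rule Psi_closed)
  fix as assume as: "set as \<subseteq> Arr C" "length as = n"
  show "f (map basis as) = Psi C n (retr n f) (map basis as)"
  proof (cases "n = 0")
    case True
    let ?x = "f []"
    have keys: "Poly_Mapping.keys ?x \<subseteq> (\<Union>i\<in>Ob C. Mor C i i)"
      using rel True by (simp add: rel_cochains_def Let_def)
    obtain c where c: "\<And>i. i \<in> Ob C \<Longrightarrow> basis (Id C i) \<bullet> ?x \<bullet> basis (Id C i) = Poly_Mapping.single (Id C i) (c i)"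
      using f True unfolding autopoietic_def by (auto simp: cat_algebra_A) metis
    \<comment> \<open>the components of \<open>f []\<close> between equal identities make up all of \<open>f []\<close>\<close>
    have "?x = lext basis ?x" by (simp add: lext_basis)
    also have "\<dots> = lext (\<lambda>a. \<Sum>i\<in>Ob C. basis (Id C i) \<bullet> basis a \<bullet> basis (Id C i)) ?x"
    proof (rule lext_cong)
      fix a assume "a \<in> Poly_Mapping.keys ?x"
      then obtain j where j: "j \<in> Ob C" "a \<in> Arr C" "src C a = j" "tgt C a = j" using keys by (auto simp: Mor_def)
      have unit: "Comp C (Id C j) a = a" "Comp C a (Id C j) = a" using Comp_Id[OF j(2)] j by simp_all
      have "(\<Sum>i\<in>Ob C. basis (Id C i) \<bullet> basis a \<bullet> basis (Id C i)) =
          (\<Sum>i\<in>Ob C. if i = j then basis a else 0 :: 'm \<Rightarrow>\<^sub>0 'k)"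
        by (rule sum.cong) (use j Id unit in \<open>auto simp: pmult_single_left pmult_single_right\<close>)
      then show "basis a = (\<Sum>i\<in>Ob C. basis (Id C i) \<bullet> basis a \<bullet> basis (Id C i) :: 'm \<Rightarrow>\<^sub>0 'k)"
        using j finite_Ob by simp
    qed
    also have "\<dots> = (\<Sum>i\<in>Ob C. basis (Id C i) \<bullet> lext basis ?x \<bullet> basis (Id C i))"
      by (simp only: lext_fun_sum pmult_lext)
    also have "\<dots> = (\<Sum>i\<in>Ob C. Poly_Mapping.single (Id C i) (c i))"
      using c by (simp add: lext_basis)
    finally have x: "?x = (\<Sum>i\<in>Ob C. Poly_Mapping.single (Id C i) (c i))" .
    have "retr n f (i, []) = c i" if i: "i \<in> Ob C" for i
    proof -
      have "retr n f (i, []) = aug (Mor C i i) ?x"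
        using True i retr_path[of i "[]" 0 f] by simp
      also have "\<dots> = (\<Sum>j\<in>Ob C. if j = i then c j else 0)"
        unfolding x aug_sum by (rule sum.cong) (auto simp: Mor_def Id)
      finally have "retr n f (i, []) = (\<Sum>j\<in>Ob C. if j = i then c j else 0)" .
      then show ?thesis using i finite_Ob by simp
    qed
    then have "bPsi (retr n f) [] = ?x"
      unfolding x bPsi_def by (auto simp: starts_def intro!: sum.cong)
    then show ?thesis using as True Psi_basis[of "[]" 0 "retr 0 f"] by simp
  next
    case False
    then have ne: "as \<noteq> []" using as by auto
    have P: "Psi C n (retr n f) (map basis as) = bPsi (retr n f) as" by (rule Psi_basis[OF as])
    show ?thesis
    proof (cases "starts as = {}")
      case True
      obtain bs a b ds where *: "as = bs @ a # b # ds" "tgt C a \<noteq> src C b" by (rule not_path[OF as(1) ne True])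
      \<comment> \<open>The identity between the morphisms \<open>a\<close> and \<open>b\<close>, which are not composable, is moved from \<open>a\<close> to \<open>b\<close>, where it gives zero.\<close>
      let ?e = "basis (Id C (tgt C a)) :: 'm \<Rightarrow>\<^sub>0 'k" and ?B = "map basis bs" and ?D = "map basis ds"
      have ab: "a \<in> Arr C" "b \<in> Arr C" "set bs \<subseteq> Arr C" "set ds \<subseteq> Arr C" using as * by auto
      have "f (?B @ (basis a \<bullet> ?e) # basis b # ?D) = f (?B @ basis a # (?e \<bullet> basis b) # ?D)"
      proof -
        have "Poly_Mapping.keys ?e \<subseteq> Id C ` Ob C" using ab tgt_Ob by auto
        moreover have "set ?B \<subseteq> carrier A" "set ?D \<subseteq> carrier A" "basis a \<in> carrier A" "basis b \<in> carrier A"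
          using ab by (auto split: if_splits)
        moreover have "length ?B + length ?D + 2 = n" using as * by simp
        moreover have bal: "\<And>xs ys x y e. x \<in> carrier A \<Longrightarrow> y \<in> carrier A \<Longrightarrow>
            Poly_Mapping.keys e \<subseteq> Id C ` Ob C \<Longrightarrow> set xs \<subseteq> carrier A \<Longrightarrow> set ys \<subseteq> carrier A \<Longrightarrow>
            length xs + length ys + 2 = n \<Longrightarrow> f (xs @ (x \<bullet> e) # y # ys) = f (xs @ x # (e \<bullet> y) # ys)"
          using rel unfolding rel_cochains_def Let_def cat_algebra_A free_algebra_mult by blast
        ultimately show ?thesis by (intro bal)
      qed
      moreover have "basis a \<bullet> ?e = basis a" "?e \<bullet> basis b = 0"
        using ab * Id tgt_Ob Comp_Id by (auto simp: pmult_basis cat_prod_def)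
      moreover have "f ((?B @ [basis a]) @ scale 0 0 # ?D) = scale 0 (f ((?B @ [basis a]) @ 0 # ?D))"
        by (rule hoch_arg(2)[OF fc, where z = "basis b" and y = 0]) (use as * map_basis_vtuples[OF as] in auto)
      ultimately have "f (map basis as) = 0" using * by simp
      then show ?thesis using True P by (simp add: bPsi_def)
    next
      case False
      then obtain i where p: "is_path C i as" by (auto simp: starts_def)
      then have "(i, as) \<in> nerve C n" using as by (simp add: nerve_iff)
      then obtain c where c: "f (map basis as) = Poly_Mapping.single (composite C i as) c"
        using f \<open>n \<noteq> 0\<close> by (fastforce simp: autopoietic_def)
      have "retr n f (i, as) = c"
        unfolding retr_path[OF p as(2)] c using is_path_props[OF p] by (simp add: Mor_def)
      then show ?thesis unfolding P bPsi_path[OF p ne] using c by simp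
    qed
  qed
qed

lemma autopoietic_image: "(autopoietic C n :: (('m \<Rightarrow>\<^sub>0 'k) list \<Rightarrow> _) set) = Psi C n ` carrier (scochains C n)"
proof
  show "(autopoietic C n :: (('m \<Rightarrow>\<^sub>0 'k) list \<Rightarrow> _) set) \<subseteq> Psi C n ` carrier (scochains C n)"
  proof
    fix f :: "('m \<Rightarrow>\<^sub>0 'k) list \<Rightarrow> ('m \<Rightarrow>\<^sub>0 'k)" assume "f \<in> autopoietic C n"
    then have "f = Psi C n (retr n f)" by (rule autopoietic_eq_Psi)
    moreover have "retr n f \<in> carrier (scochains C n)" by (simp add: retr_def)
    ultimately show "f \<in> Psi C n ` carrier (scochains C n)" by blast
  qed
  show "Psi C n ` carrier (scochains C n) \<subseteq> (autopoietic C n :: (('m \<Rightarrow>\<^sub>0 'k) list \<Rightarrow> _) set)"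
    using Psi_autopoietic by blast
qed

lemma ap_cochains_A: "(ap_cochains C n :: ('k, _) module) = hoch A n\<lparr>carrier := autopoietic C n\<rparr>"
  by (simp add: ap_cochains_def cat_algebra_A)

lemma opsub_autopoietic: "opsub (hoch A n) (autopoietic C n)"
  unfolding autopoietic_image by (rule opsub_image[OF opgroup_scochains opgroup_hoch Psi_hom])

lemma Psi_inj: "inj_on (Psi C n) (carrier (scochains C n :: ('k, _) module))"
  by (rule inj_on_inverseI[where g = "retr n"]) (rule retr_Psi)

lemma Psi_iso: "Psi C n \<in> module_iso (scochains C n) (ap_cochains C n :: ('k, _) module)"
proof -
  have "Psi C n \<in> module_hom (scochains C n) (ap_cochains C n :: ('k, _) module)"
    by (rule module_homI) (use module_homD[OF Psi_hom[of n]] Psi_autopoietic in \<open>auto simp: ap_cochains_A\<close>)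
  then show ?thesis
    using Psi_inj by (simp add: module_iso_def bij_betw_def ap_cochains_A autopoietic_image)
qed

lemma Psi_cup_0: "Psi C (p + q) (cup C 0 p q \<gamma> \<delta>) = gerst A p q (Psi C p \<gamma>) (Psi C q \<delta>)"
  unfolding Psi_eq_mext gerst_mext
proof (rule mext_cong)
  fix as assume as: "set as \<subseteq> Arr C" "length as = p + q"
  let ?b = "take p as" and ?c = "drop p as"
  have s: "starts as = {i \<in> starts ?b. path_end C i ?b \<in> starts ?c}"
    using is_path_append[of _ ?b ?c] by (auto simp: starts_def)
  have "bprod (cat_prod C) p (bPsi \<gamma>) (bPsi \<delta>) as = (\<Sum>i\<in>starts ?b. \<Sum>j\<in>starts ?c.
      pmult (cat_prod C) (Poly_Mapping.single (composite C i ?b) (\<gamma> (i, ?b)))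
        (Poly_Mapping.single (composite C j ?c) (\<delta> (j, ?c))))"
    by (simp add: bprod_def bPsi_def pmult_sum) (rule sum.swap)
  also have "\<dots> = (\<Sum>i\<in>starts ?b. \<Sum>j\<in>starts ?c. if j = path_end C i ?b
      then Poly_Mapping.single (composite C i as) (\<gamma> (i, ?b) * \<delta> (j, ?c)) else 0)"
  proof (intro sum.cong refl)
    fix i j assume "i \<in> starts ?b" "j \<in> starts ?c"
    then have p: "is_path C i ?b" "is_path C j ?c" by (auto simp: starts_def)
    have "composite C i as = Comp C (composite C i ?b) (composite C j ?c)" if "j = path_end C i ?b"
      using composite_append[of i ?b ?c] that p is_path_append[of i ?b ?c] by simp
    then show "pmult (cat_prod C) (Poly_Mapping.single (composite C i ?b) (\<gamma> (i, ?b)))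
        (Poly_Mapping.single (composite C j ?c) (\<delta> (j, ?c))) = (if j = path_end C i ?b
      then Poly_Mapping.single (composite C i as) (\<gamma> (i, ?b) * \<delta> (j, ?c)) else 0)"
      using is_path_props[OF p(1)] is_path_props[OF p(2)]
      by (auto simp: pmult_def cat_prod_def)
  qed
  also have "\<dots> = (\<Sum>i\<in>starts ?b. if path_end C i ?b \<in> starts ?c
      then Poly_Mapping.single (composite C i as) (\<gamma> (i, ?b) * \<delta> (path_end C i ?b, ?c)) else 0)"
    by (rule sum.cong) (simp_all add: sum.delta')
  also have "\<dots> = (\<Sum>i\<in>starts as. Poly_Mapping.single (composite C i as) (\<gamma> (i, ?b) * \<delta> (path_end C i ?b, ?c)))"
    unfolding s by (simp add: sum.inter_filter)
  also have "\<dots> = bPsi (cup C 0 p q \<gamma> \<delta>) as"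
    unfolding bPsi_def by (rule sum.cong) (use as in \<open>auto simp: starts_def cup_0\<close>)
  finally show "bPsi (cup C 0 p q \<gamma> \<delta>) as = bprod (cat_prod C) p (bPsi \<gamma>) (bPsi \<delta>) as" ..
qed

lemma cup_extensional: "cup C i p q \<gamma> \<delta> \<in> extensional (nerve C (p + q - i))"
  by (simp add: cup_def)

lemma cup_linear:
  fixes \<gamma> \<delta> \<epsilon> :: "('o, 'm) simplex \<Rightarrow> 'k"
  shows "cup C i p q \<gamma> (\<delta> \<oplus>\<^bsub>scochains C q\<^esub> \<epsilon>) = cup C i p q \<gamma> \<delta> \<oplus>\<^bsub>scochains C (p + q - i)\<^esub> cup C i p q \<gamma> \<epsilon>"
    and "cup C i p q (\<delta> \<oplus>\<^bsub>scochains C p\<^esub> \<epsilon>) \<gamma> = cup C i p q \<delta> \<gamma> \<oplus>\<^bsub>scochains C (p + q - i)\<^esub> cup C i p q \<epsilon> \<gamma>"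
    and "cup C i p q \<gamma> (c \<odot>\<^bsub>scochains C q\<^esub> \<delta>) = c \<odot>\<^bsub>scochains C (p + q - i)\<^esub> cup C i p q \<gamma> \<delta>"
    and "cup C i p q (c \<odot>\<^bsub>scochains C p\<^esub> \<delta>) \<gamma> = c \<odot>\<^bsub>scochains C (p + q - i)\<^esub> cup C i p q \<delta> \<gamma>"
proof -
  let ?m = "p + q - i"
  have face: "face C \<sigma> l \<in> nerve C r"
    if "\<sigma> \<in> nerve C ?m" "sorted_wrt (<) l" "set l \<subseteq> set [0..<Suc ?m]" "length l = Suc r" for \<sigma> l r
  proof -
    have "l \<noteq> []" using that by auto
    moreover have "\<forall>s\<in>set l. s \<le> ?m" using that(3) by (auto simp: subset_iff less_Suc_eq_le simp del: upt_Suc)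
    ultimately show ?thesis using face_nerve[OF that(1) _ that(2)] that(4) by (metis diff_Suc_1)
  qed
  have add: "on_face C r (\<delta> \<oplus>\<^bsub>scochains C r\<^esub> \<epsilon>) \<sigma> l = on_face C r \<delta> \<sigma> l + on_face C r \<epsilon> \<sigma> l"
    and smult: "on_face C r (c \<odot>\<^bsub>scochains C r\<^esub> \<delta>) \<sigma> l = c * on_face C r \<delta> \<sigma> l"
    if "\<sigma> \<in> nerve C ?m" "sorted_wrt (<) l" "set l \<subseteq> set [0..<Suc ?m]" for \<sigma> l r
    using face[OF that, of r] by (auto simp: on_face_def)
  show "cup C i p q \<gamma> (\<delta> \<oplus>\<^bsub>scochains C q\<^esub> \<epsilon>) = cup C i p q \<gamma> \<delta> \<oplus>\<^bsub>scochains C ?m\<^esub> cup C i p q \<gamma> \<epsilon>"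
  proof (rule extensionalityI[OF cup_extensional])
    fix \<sigma> assume \<sigma>: "\<sigma> \<in> nerve C ?m"
    show "cup C i p q \<gamma> (\<delta> \<oplus>\<^bsub>scochains C q\<^esub> \<epsilon>) \<sigma> = (cup C i p q \<gamma> \<delta> \<oplus>\<^bsub>scochains C ?m\<^esub> cup C i p q \<gamma> \<epsilon>) \<sigma>"
      using \<sigma> cuts_cong[OF _ upt_sorted, of 0 "Suc ?m" "on_face C p \<gamma> \<sigma>" "on_face C p \<gamma> \<sigma>"
          "on_face C q (\<delta> \<oplus>\<^bsub>scochains C q\<^esub> \<epsilon>) \<sigma>" "\<lambda>l. on_face C q \<delta> \<sigma> l + on_face C q \<epsilon> \<sigma> l" "Suc i" True]
        add[OF \<sigma>, of _ q]
      by (simp add: cup_cuts cuts_addV del: upt_Suc cuts.simps)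
  qed simp
  show "cup C i p q (\<delta> \<oplus>\<^bsub>scochains C p\<^esub> \<epsilon>) \<gamma> = cup C i p q \<delta> \<gamma> \<oplus>\<^bsub>scochains C ?m\<^esub> cup C i p q \<epsilon> \<gamma>"
  proof (rule extensionalityI[OF cup_extensional])
    fix \<sigma> assume \<sigma>: "\<sigma> \<in> nerve C ?m"
    show "cup C i p q (\<delta> \<oplus>\<^bsub>scochains C p\<^esub> \<epsilon>) \<gamma> \<sigma> = (cup C i p q \<delta> \<gamma> \<oplus>\<^bsub>scochains C ?m\<^esub> cup C i p q \<epsilon> \<gamma>) \<sigma>"
      using \<sigma> cuts_cong[OF _ upt_sorted, of 0 "Suc ?m" "on_face C p (\<delta> \<oplus>\<^bsub>scochains C p\<^esub> \<epsilon>) \<sigma>"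
          "\<lambda>l. on_face C p \<delta> \<sigma> l + on_face C p \<epsilon> \<sigma> l" "on_face C q \<gamma> \<sigma>" "on_face C q \<gamma> \<sigma>" "Suc i" True]
        add[OF \<sigma>, of _ p]
      by (simp add: cup_cuts cuts_addU del: upt_Suc cuts.simps)
  qed simp
  show "cup C i p q \<gamma> (c \<odot>\<^bsub>scochains C q\<^esub> \<delta>) = c \<odot>\<^bsub>scochains C ?m\<^esub> cup C i p q \<gamma> \<delta>"
  proof (rule extensionalityI[OF cup_extensional])
    fix \<sigma> assume \<sigma>: "\<sigma> \<in> nerve C ?m"
    show "cup C i p q \<gamma> (c \<odot>\<^bsub>scochains C q\<^esub> \<delta>) \<sigma> = (c \<odot>\<^bsub>scochains C ?m\<^esub> cup C i p q \<gamma> \<delta>) \<sigma>"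
      using \<sigma> cuts_cong[OF _ upt_sorted, of 0 "Suc ?m" "on_face C p \<gamma> \<sigma>" "on_face C p \<gamma> \<sigma>"
          "on_face C q (c \<odot>\<^bsub>scochains C q\<^esub> \<delta>) \<sigma>" "\<lambda>l. c * on_face C q \<delta> \<sigma> l" "Suc i" True]
        smult[OF \<sigma>, of _ q]
      by (simp add: cup_cuts cuts_scaleV del: upt_Suc cuts.simps)
  qed simp
  show "cup C i p q (c \<odot>\<^bsub>scochains C p\<^esub> \<delta>) \<gamma> = c \<odot>\<^bsub>scochains C ?m\<^esub> cup C i p q \<delta> \<gamma>"
  proof (rule extensionalityI[OF cup_extensional])
    fix \<sigma> assume \<sigma>: "\<sigma> \<in> nerve C ?m"
    show "cup C i p q (c \<odot>\<^bsub>scochains C p\<^esub> \<delta>) \<gamma> \<sigma> = (c \<odot>\<^bsub>scochains C ?m\<^esub> cup C i p q \<delta> \<gamma>) \<sigma>"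
      using \<sigma> cuts_cong[OF _ upt_sorted, of 0 "Suc ?m" "on_face C p (c \<odot>\<^bsub>scochains C p\<^esub> \<delta>) \<sigma>"
          "\<lambda>l. c * on_face C p \<delta> \<sigma> l" "on_face C q \<gamma> \<sigma>" "on_face C q \<gamma> \<sigma>" "Suc i" True]
        smult[OF \<sigma>, of _ p]
      by (simp add: cup_cuts cuts_scaleU del: upt_Suc cuts.simps)
  qed simp
qed

lemma cup_hom:
  fixes \<gamma> :: "('o, 'm) simplex \<Rightarrow> 'k"
  shows "cup C i p q \<gamma> \<in> module_hom (scochains C q) (scochains C (p + q - i))"
    and "(\<lambda>\<delta>. cup C i p q \<delta> \<gamma>) \<in> module_hom (scochains C p) (scochains C (p + q - i))"
  using cup_linear cup_extensional by (auto intro!: module_homI simp del: scochains_simps(2-4))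

lemma scochain_d_cup':
  fixes \<gamma> \<delta> :: "('o, 'm) simplex \<Rightarrow> 'k"
  assumes "i \<le> p + q"
  defines "N \<equiv> scochains C (Suc (p + q - i)) :: ('k, _) module"
  shows "scochain_d C (p + q - i) (cup C i p q \<gamma> \<delta>) =
    (if i = 0 then \<zero>\<^bsub>N\<^esub>
     else ((- 1) ^ (p + q - i) \<odot>\<^bsub>N\<^esub> cup C (i - 1) p q \<gamma> \<delta>)
       \<oplus>\<^bsub>N\<^esub> ((- 1) ^ (p * q + p + q) \<odot>\<^bsub>N\<^esub> cup C (i - 1) q p \<delta> \<gamma>))
    \<oplus>\<^bsub>N\<^esub> cup C i (Suc p) q (scochain_d C p \<gamma>) \<delta>
    \<oplus>\<^bsub>N\<^esub> ((- 1) ^ p \<odot>\<^bsub>N\<^esub> cup C i p (Suc q) \<gamma> (scochain_d C q \<delta>))"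
    (is "_ = ?R")
proof (rule extensionalityI[of _ "nerve C (Suc (p + q - i))"])
  fix \<sigma> assume "\<sigma> \<in> nerve C (Suc (p + q - i))"
  then show "scochain_d C (p + q - i) (cup C i p q \<gamma> \<delta>) \<sigma> = ?R \<sigma>"
    unfolding N_def scochain_d_cup[OF assms(1) \<open>\<sigma> \<in> _\<close>] by (cases "i = 0") simp_all
qed (auto simp: scochain_d_def N_def)

lemma ap_cup_Psi:
  fixes \<gamma> \<delta> :: "('o, 'm) simplex \<Rightarrow> 'k"
  assumes "\<gamma> \<in> carrier (scochains C p)" "\<delta> \<in> carrier (scochains C q)"
  shows "ap_cup C i p q (Psi C p \<gamma>) (Psi C q \<delta>) = Psi C (p + q - i) (cup C i p q \<gamma> \<delta>)"
  using assms Psi_inj by (simp add: ap_cup_def inv_into_f_f del: scochains_simps)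

lemma autopoieticE:
  fixes f :: "('m \<Rightarrow>\<^sub>0 'k) list \<Rightarrow> ('m \<Rightarrow>\<^sub>0 'k)"
  assumes "f \<in> autopoietic C n"
  obtains \<gamma> where "\<gamma> \<in> carrier (scochains C n)" "f = Psi C n \<gamma>"
  using assms unfolding autopoietic_image by blast

lemma ap_cup_gerst:
  fixes f g :: "('m \<Rightarrow>\<^sub>0 'k) list \<Rightarrow> ('m \<Rightarrow>\<^sub>0 'k)"
  assumes "f \<in> autopoietic C p" "g \<in> autopoietic C q"
  shows "ap_cup C 0 p q f g = gerst A p q f g"
  using assms by (auto elim!: autopoieticE simp: ap_cup_Psi Psi_cup_0 simp del: scochains_simps)

lemma Psi_one: "Psi C 0 (\<lambda>\<sigma>\<in>nerve C 0. 1) = (\<lambda>xs\<in>tuples A 0. u)"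
proof -
  have "starts [] = Ob C" by (auto simp: starts_def)
  then have "bPsi (\<lambda>\<sigma>\<in>nerve C 0. 1) [] = u" by (simp add: bPsi_def u cat_unit_def nerve_iff)
  then show ?thesis
    unfolding Psi_eq_mext mext_def tuples_free_algebra by (auto simp: vtuples_def intro!: restrict_ext)
qed

lemma gerst_unit:
  assumes "f \<in> carrier (hoch A p)"
  shows "gerst A 0 p (\<lambda>xs\<in>tuples A 0. u) f = f" "gerst A p 0 f (\<lambda>xs\<in>tuples A 0. u) = f"
proof -
  have e: "(\<lambda>xs\<in>tuples A 0. u) \<in> carrier (hoch A 0)" using Psi_closed[of 0] Psi_one by metis
  have k: "Poly_Mapping.keys (f (map basis as)) \<subseteq> Arr C" if "set as \<subseteq> Arr C" "length as = p" for as
    using hoch_bcochain[OF assms] that by (simp add: bcochain_def)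
  have e0: "(\<lambda>xs\<in>tuples A 0. u) [] = u" by (simp add: vtuples_def)
  show "gerst A 0 p (\<lambda>xs\<in>tuples A 0. u) f = f"
    by (rule hoch_eqI[of _ "Arr C" "cat_prod C" u p])
      (use gerst_closed[OF e assms] assms e0 k in \<open>auto simp: gerst_basis[OF e assms] pmult_unit simp del: tuples_free_algebra\<close>)
  show "gerst A p 0 f (\<lambda>xs\<in>tuples A 0. u) = f"
    by (rule hoch_eqI[of _ "Arr C" "cat_prod C" u p])
      (use gerst_closed[OF assms e] assms e0 k in \<open>auto simp: gerst_basis[OF assms e] pmult_unit simp del: tuples_free_algebra\<close>)
qed

lemma gerst_assoc:
  assumes f: "f \<in> carrier (hoch A p)" and g: "g \<in> carrier (hoch A q)" and h: "h \<in> carrier (hoch A s)"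
  shows "gerst A (p + q) s (gerst A p q f g) h = gerst A p (q + s) f (gerst A q s g h)"
proof (rule hoch_eqI[of _ "Arr C" "cat_prod C" u "p + q + s"])
  note fg = gerst_closed[OF f g] and gh = gerst_closed[OF g h]
  show "gerst A (p + q) s (gerst A p q f g) h \<in> carrier (hoch A (p + q + s))" by (rule gerst_closed[OF fg h])
  show "gerst A p (q + s) f (gerst A q s g h) \<in> carrier (hoch A (p + q + s))"
    using gerst_closed[OF f gh] by (simp add: add.assoc)
  fix as assume as: "set as \<subseteq> Arr C" "length as = p + q + s"
  have td: "set (take j as) \<subseteq> Arr C" "set (drop j as) \<subseteq> Arr C" for j
    using as(1) by (auto dest: in_set_takeD in_set_dropD)
  have tdd: "set (take l (drop j as)) \<subseteq> Arr C" for j l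
    using td(2)[of j] by (auto dest: in_set_takeD)
  have k: "Poly_Mapping.keys (f (map basis (take p as))) \<subseteq> Arr C"
    "Poly_Mapping.keys (g (map basis (take q (drop p as)))) \<subseteq> Arr C"
    "Poly_Mapping.keys (h (map basis (drop (p + q) as))) \<subseteq> Arr C"
    using hoch_bcochain[OF f] hoch_bcochain[OF g] hoch_bcochain[OF h] td tdd as(2) by (auto simp: bcochain_def)
  have "gerst A (p + q) s (gerst A p q f g) h (map basis as) =
      (f (map basis (take p as)) \<bullet> g (map basis (take q (drop p as)))) \<bullet> h (map basis (drop (p + q) as))"
    using gerst_basis[OF fg h as(1)] gerst_basis[OF f g td(1), of "p + q"] as(2)
    by (simp add: drop_take min_def)
  also have "\<dots> = f (map basis (take p as)) \<bullet> (g (map basis (take q (drop p as))) \<bullet> h (map basis (drop (p + q) as)))"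
    by (rule pmult_assoc[OF k])
  also have "\<dots> = gerst A p (q + s) f (gerst A q s g h) (map basis as)"
    using gerst_basis[OF f gh as(1)] gerst_basis[OF g h td(2), of p] as(2)
    by (simp add: add.commute add.left_commute)
  finally show "gerst A (p + q) s (gerst A p q f g) h (map basis as) =
      gerst A p (q + s) f (gerst A q s g h) (map basis as)" .
qed

theorem cup_i_algebra_autopoietic:
  "cup_i_algebra (ap_cochains C :: nat \<Rightarrow> ('k, _) module) (hoch_d A) (ap_cup C) (\<lambda>xs\<in>tuples A 0. u)"
proof -
  let ?K = "ap_cochains C :: nat \<Rightarrow> ('k, ('m \<Rightarrow>\<^sub>0 'k) list \<Rightarrow> ('m \<Rightarrow>\<^sub>0 'k)) module"
  have K: "carrier (?K n) = autopoietic C n" "x \<oplus>\<^bsub>?K n\<^esub> y = x \<oplus>\<^bsub>hoch A n\<^esub> y"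
    "c \<odot>\<^bsub>?K n\<^esub> x = c \<odot>\<^bsub>hoch A n\<^esub> x" "\<zero>\<^bsub>?K n\<^esub> = \<zero>\<^bsub>hoch A n\<^esub>" for n x y c
    by (simp_all add: ap_cochains_A)
  have ap_hoch: "f \<in> autopoietic C n \<Longrightarrow> f \<in> carrier (hoch A n)" for f :: "('m \<Rightarrow>\<^sub>0 'k) list \<Rightarrow> ('m \<Rightarrow>\<^sub>0 'k)" and n
    using Psi_closed by (auto elim!: autopoieticE)
  note dh = module_homD[OF hoch_d_hom] and Ph = module_homD[OF Psi_hom]
  have cup: "cup C i p q \<gamma> \<delta> \<in> carrier (scochains C (p + q - i))" for i p q and \<gamma> \<delta> :: "('o, 'm) simplex \<Rightarrow> 'k"
    using cup_extensional by simp
  have e: "(\<lambda>xs\<in>tuples A 0. u) \<in> autopoietic C 0"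
    using Psi_autopoietic[of 0 "\<lambda>\<sigma>\<in>nerve C 0. 1"] unfolding Psi_one .
  have dap: "hoch_d A n f \<in> autopoietic C (Suc n)" if "f \<in> autopoietic C n" for f n
    using that Psi_autopoietic by (auto elim!: autopoieticE simp flip: Psi_d)
  have 1: "hoch_d A n \<in> module_hom (?K n) (?K (Suc n))" for n
    by (rule module_homI) (auto simp: K dap ap_hoch dh)
  have 2: "hoch_d A (Suc n) (hoch_d A n f) = \<zero>\<^bsub>?K (Suc (Suc n))\<^esub>" if "f \<in> carrier (?K n)" for f n
    using that ap_hoch hoch_d_hoch_d by (simp add: K)
  have 3: "ap_cup C i p q f \<in> module_hom (?K q) (?K (p + q - i))" if f: "f \<in> carrier (?K p)" for i p q f
  proof -
    obtain \<gamma> where \<gamma>: "\<gamma> \<in> carrier (scochains C p)" "f = Psi C p \<gamma>"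
      using f by (auto simp: K elim: autopoieticE)
    note S = opgroup_scochains[of C q, where 'k = 'k]
    interpret opgroup "scochains C q :: ('k, _) module" by (rule S)
    show ?thesis
    proof (rule module_homI)
      fix g h c assume "g \<in> carrier (?K q)"
      then obtain \<delta> where \<delta>: "\<delta> \<in> carrier (scochains C q)" "g = Psi C q \<delta>" by (auto simp: K elim: autopoieticE)
      show "ap_cup C i p q f g \<in> carrier (?K (p + q - i))"
        unfolding \<gamma>(2) \<delta>(2) ap_cup_Psi[OF \<gamma>(1) \<delta>(1)] K by (rule Psi_autopoietic)
      show "ap_cup C i p q f (c \<odot>\<^bsub>?K q\<^esub> g) = c \<odot>\<^bsub>?K (p + q - i)\<^esub> ap_cup C i p q f g"
        unfolding \<gamma>(2) \<delta>(2) K ap_cup_Psi[OF \<gamma>(1) \<delta>(1)] Ph(3)[OF \<delta>(1), symmetric]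
          ap_cup_Psi[OF \<gamma>(1) smult_closed[OF \<delta>(1)]] Ph(3)[OF cup, symmetric] cup_linear ..
      assume "h \<in> carrier (?K q)"
      then obtain \<epsilon> where \<epsilon>: "\<epsilon> \<in> carrier (scochains C q)" "h = Psi C q \<epsilon>" by (auto simp: K elim: autopoieticE)
      show "ap_cup C i p q f (g \<oplus>\<^bsub>?K q\<^esub> h) = ap_cup C i p q f g \<oplus>\<^bsub>?K (p + q - i)\<^esub> ap_cup C i p q f h"
        unfolding \<gamma>(2) \<delta>(2) \<epsilon>(2) K ap_cup_Psi[OF \<gamma>(1) \<delta>(1)] ap_cup_Psi[OF \<gamma>(1) \<epsilon>(1)] Ph(2)[OF \<delta>(1) \<epsilon>(1), symmetric]
          ap_cup_Psi[OF \<gamma>(1) a_closed[OF \<delta>(1) \<epsilon>(1)]] Ph(2)[OF cup cup, symmetric] cup_linear ..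
    qed
  qed
  have 4: "(\<lambda>f. ap_cup C i p q f g) \<in> module_hom (?K p) (?K (p + q - i))" if g: "g \<in> carrier (?K q)" for i p q g
  proof -
    obtain \<gamma> where \<gamma>: "\<gamma> \<in> carrier (scochains C q)" "g = Psi C q \<gamma>"
      using g by (auto simp: K elim: autopoieticE)
    note S = opgroup_scochains[of C p, where 'k = 'k]
    interpret opgroup "scochains C p :: ('k, _) module" by (rule S)
    show ?thesis
    proof (rule module_homI)
      fix f h c assume "f \<in> carrier (?K p)"
      then obtain \<delta> where \<delta>: "\<delta> \<in> carrier (scochains C p)" "f = Psi C p \<delta>" by (auto simp: K elim: autopoieticE)
      show "ap_cup C i p q f g \<in> carrier (?K (p + q - i))"
        unfolding \<gamma>(2) \<delta>(2) ap_cup_Psi[OF \<delta>(1) \<gamma>(1)] K by (rule Psi_autopoietic)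
      show "ap_cup C i p q (c \<odot>\<^bsub>?K p\<^esub> f) g = c \<odot>\<^bsub>?K (p + q - i)\<^esub> ap_cup C i p q f g"
        unfolding \<gamma>(2) \<delta>(2) K ap_cup_Psi[OF \<delta>(1) \<gamma>(1)] Ph(3)[OF \<delta>(1), symmetric]
          ap_cup_Psi[OF smult_closed[OF \<delta>(1)] \<gamma>(1)] Ph(3)[OF cup, symmetric] cup_linear ..
      assume "h \<in> carrier (?K p)"
      then obtain \<epsilon> where \<epsilon>: "\<epsilon> \<in> carrier (scochains C p)" "h = Psi C p \<epsilon>" by (auto simp: K elim: autopoieticE)
      show "ap_cup C i p q (f \<oplus>\<^bsub>?K p\<^esub> h) g = ap_cup C i p q f g \<oplus>\<^bsub>?K (p + q - i)\<^esub> ap_cup C i p q h g"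
        unfolding \<gamma>(2) \<delta>(2) \<epsilon>(2) K ap_cup_Psi[OF \<delta>(1) \<gamma>(1)] ap_cup_Psi[OF \<epsilon>(1) \<gamma>(1)] Ph(2)[OF \<delta>(1) \<epsilon>(1), symmetric]
          ap_cup_Psi[OF a_closed[OF \<delta>(1) \<epsilon>(1)] \<gamma>(1)] Ph(2)[OF cup cup, symmetric] cup_linear ..
    qed
  qed
  have g0: "ap_cup C 0 p q f g = gerst A p q f g" if "f \<in> carrier (?K p)" "g \<in> carrier (?K q)" for p q f g
    using that ap_cup_gerst by (simp add: K)
  have 5: "ap_cup C 0 0 p (\<lambda>xs\<in>tuples A 0. u) f = f \<and> ap_cup C 0 p 0 f (\<lambda>xs\<in>tuples A 0. u) = f"
    if "f \<in> carrier (?K p)" for p f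
    using that e ap_hoch gerst_unit[of f p] by (simp add: K g0 del: tuples_free_algebra)
  have c0: "ap_cup C 0 p q f g \<in> carrier (?K (p + q))" if "f \<in> carrier (?K p)" "g \<in> carrier (?K q)" for p q f g
    using module_homD(1)[OF 3[OF that(1), of 0 q] that(2)] by simp
  have 6: "ap_cup C 0 (p + q) s (ap_cup C 0 p q f g) h = ap_cup C 0 p (q + s) f (ap_cup C 0 q s g h)"
    if "f \<in> carrier (?K p)" "g \<in> carrier (?K q)" "h \<in> carrier (?K s)" for p q s f g h
    using that c0[OF that(1,2)] c0[OF that(2,3)] gerst_assoc[of f p g q h s] ap_hoch by (simp add: g0) (simp add: K)
  have 7: "hoch_d A (p + q - i) (ap_cup C i p q f g) =
      (if i = 0 then \<zero>\<^bsub>?K (Suc (p + q - i))\<^esub>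
       else ((- 1) ^ (p + q - i) \<odot>\<^bsub>?K (Suc (p + q - i))\<^esub> ap_cup C (i - 1) p q f g)
         \<oplus>\<^bsub>?K (Suc (p + q - i))\<^esub> ((- 1) ^ (p * q + p + q) \<odot>\<^bsub>?K (Suc (p + q - i))\<^esub> ap_cup C (i - 1) q p g f))
      \<oplus>\<^bsub>?K (Suc (p + q - i))\<^esub> ap_cup C i (Suc p) q (hoch_d A p f) g
      \<oplus>\<^bsub>?K (Suc (p + q - i))\<^esub> ((- 1) ^ p \<odot>\<^bsub>?K (Suc (p + q - i))\<^esub> ap_cup C i p (Suc q) f (hoch_d A q g))"
    if i: "i \<le> p + q" and f: "f \<in> carrier (?K p)" and g: "g \<in> carrier (?K q)" for i p q f g
  proof -
    obtain \<gamma> where \<gamma>: "\<gamma> \<in> carrier (scochains C p)" "f = Psi C p \<gamma>" using f by (auto simp: K elim: autopoieticE)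
    obtain \<delta> where \<delta>: "\<delta> \<in> carrier (scochains C q)" "g = Psi C q \<delta>" using g by (auto simp: K elim: autopoieticE)
    let ?m = "Suc (p + q - i)"
    interpret N: opgroup "scochains C ?m :: ('k, _) module" by (rule opgroup_scochains)
    have d\<gamma>: "scochain_d C p \<gamma> \<in> carrier (scochains C (Suc p))" "scochain_d C q \<delta> \<in> carrier (scochains C (Suc q))"
      by (simp_all add: scochain_d_def)
    have deg: "Suc p + q - i = ?m" "p + Suc q - i = ?m" using i by auto
    have deg': "p + q - (i - 1) = ?m" "q + p - (i - 1) = ?m" if "i \<noteq> 0" using i that by auto
    have mem: "cup C i (Suc p) q (scochain_d C p \<gamma>) \<delta> \<in> carrier (scochains C ?m)"
      "cup C i p (Suc q) \<gamma> (scochain_d C q \<delta>) \<in> carrier (scochains C ?m)"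
      using cup[of i "Suc p" q] cup[of i p "Suc q"] deg by metis+
    have mem': "cup C (i - 1) p q \<gamma> \<delta> \<in> carrier (scochains C ?m)"
      "cup C (i - 1) q p \<delta> \<gamma> \<in> carrier (scochains C ?m)" if "i \<noteq> 0"
      using cup[of "i - 1" p q] cup[of "i - 1" q p] deg'[OF that] by metis+
    have cl: "v \<oplus>\<^bsub>scochains C n\<^esub> w \<in> carrier (scochains C n)" "c \<odot>\<^bsub>scochains C n\<^esub> v \<in> carrier (scochains C n)"
      for n c and v w :: "('o, 'm) simplex \<Rightarrow> 'k" by simp_all
    have zero: "Psi C ?m \<zero>\<^bsub>scochains C ?m\<^esub> = \<zero>\<^bsub>hoch A ?m\<^esub>"
      by (rule module_hom_zero[OF opgroup_scochains opgroup_hoch Psi_hom])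
    have "hoch_d A (p + q - i) (ap_cup C i p q f g) = Psi C ?m (scochain_d C (p + q - i) (cup C i p q \<gamma> \<delta>))"
      unfolding \<gamma>(2) \<delta>(2) ap_cup_Psi[OF \<gamma>(1) \<delta>(1)] Psi_d ..
    also note scochain_d_cup'[OF i, of \<gamma> \<delta>]
    finally show ?thesis
      unfolding \<gamma>(2) \<delta>(2) Psi_d[symmetric] ap_cup_Psi[OF d\<gamma>(1) \<delta>(1)] ap_cup_Psi[OF \<gamma>(1) d\<gamma>(2)] deg
        ap_cup_Psi[OF \<gamma>(1) \<delta>(1)] ap_cup_Psi[OF \<delta>(1) \<gamma>(1)] K
      using mem mem' deg' zero N.zero_closed
      by (cases "i = 0") (simp_all add: Ph cl del: scochains_simps)
  qed
  show ?thesis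
    unfolding cup_i_algebra_def Let_def
    using 1 2 3 4 5 6 7 e by (simp add: K(1) del: tuples_free_algebra)
qed

end

section \<open>Cochain maps that are given on basis elements\<close>

text \<open>
  A linear operation \<open>T\<close> on cochains that are given on lists of basis elements is a map of Hochschild complexes
  if it commutes with the differentials.
\<close>

lemma cochain_map_mext:
  fixes u :: "'m \<Rightarrow>\<^sub>0 'k::{comm_ring,comm_monoid_mult}" and u' :: "'n \<Rightarrow>\<^sub>0 'k"
    and T :: "('m list \<Rightarrow> 'm \<Rightarrow>\<^sub>0 'k) \<Rightarrow> 'n list \<Rightarrow> 'n \<Rightarrow>\<^sub>0 'k"
  assumes A: "partial_algebra S m u" and A': "partial_algebra S' m' u'"
    and cong: "\<And>n F F' bs. (\<And>as. set as \<subseteq> S \<Longrightarrow> length as = n \<Longrightarrow> F as = F' as) \<Longrightarrow>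
      set bs \<subseteq> S' \<Longrightarrow> length bs = n \<Longrightarrow> T F bs = T F' bs"
    and closed: "\<And>n F. bcochain S n F \<Longrightarrow> bcochain S' n (T F)"
    and add: "\<And>F F' bs. T (\<lambda>as. F as + F' as) bs = T F bs + T F' bs"
    and scale: "\<And>c F bs. T (\<lambda>as. scale c (F as)) bs = scale c (T F bs)"
    and comm: "\<And>n F bs. bcochain S n F \<Longrightarrow> set bs \<subseteq> S' \<Longrightarrow> length bs = Suc n \<Longrightarrow>
      T (bdiff m n F) bs = bdiff m' n (T F) bs"
  shows "cochain_map (hoch (free_algebra S m u)) (hoch_d (free_algebra S m u))
    (hoch (free_algebra S' m' u')) (hoch_d (free_algebra S' m' u'))
    (\<lambda>n f. mext S' n (T (\<lambda>as. f (map basis as))))"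
proof -
  interpret A: partial_algebra S m u by fact
  interpret A': partial_algebra S' m' u' by fact
  let ?T = "\<lambda>n f. mext S' n (T (\<lambda>as. f (map basis as)))"
  have hom: "?T n \<in> module_hom (hoch A.A n) (hoch A'.A n)" for n
  proof (rule module_homI)
    fix f g c assume f: "f \<in> carrier (hoch A.A n)"
    show "?T n f \<in> carrier (hoch A'.A n)" by (rule hoch_mext[OF closed[OF hoch_bcochain[OF f]]])
    show "?T n (c \<odot>\<^bsub>hoch A.A n\<^esub> f) = c \<odot>\<^bsub>hoch A'.A n\<^esub> ?T n f"
      unfolding hoch_smult_mext scale[symmetric]
      by (rule mext_cong, rule cong) (auto simp: hoch_basis)
    show "?T n (f \<oplus>\<^bsub>hoch A.A n\<^esub> g) = ?T n f \<oplus>\<^bsub>hoch A'.A n\<^esub> ?T n g"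
      unfolding hoch_add_mext add[symmetric]
      by (rule mext_cong, rule cong) (auto simp: hoch_basis)
  qed
  have "?T (Suc n) (hoch_d A.A n f) = hoch_d A'.A n (?T n f)" if f: "f \<in> carrier (hoch A.A n)" for n f
  proof -
    have "T (\<lambda>as. hoch_d A.A n f (map basis as)) bs = bdiff m' n (T (\<lambda>as. f (map basis as))) bs"
      if bs: "set bs \<subseteq> S'" "length bs = Suc n" for bs
    proof -
      have "T (\<lambda>as. hoch_d A.A n f (map basis as)) bs = T (bdiff m n (\<lambda>as. f (map basis as))) bs"
        by (rule cong[OF _ bs]) (rule A.hoch_d_basis[OF f])
      then show ?thesis using comm[OF hoch_bcochain[OF f] bs] by simp
    qed
    then show ?thesis
      unfolding A'.hoch_d_mext[OF closed[OF hoch_bcochain[OF f]]] by (rule mext_cong)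
  qed
  then show ?thesis
    using hom A.cochain_complex_hoch A'.cochain_complex_hoch
    by (intro cochain_map.intro cochain_map_axioms.intro) (auto simp: chain_map_def)
qed

lemma hoch_finsum_basis:
  assumes "finite I" "\<And>i. i \<in> I \<Longrightarrow> f i \<in> carrier (hoch (free_algebra S m u) n)" "set as \<subseteq> S" "length as = n"
  shows "(\<Oplus>\<^bsub>hoch (free_algebra S m u) n\<^esub>i\<in>I. f i) (map basis as) = (\<Sum>i\<in>I. f i (map basis as))"
proof -
  interpret opgroup "hoch (free_algebra S m u) n" by (rule opgroup_hoch)
  show ?thesis
    using assms(1,2) by (induction I) (auto simp: hoch_basis[OF assms(3,4)] finsum_insert Pi_iff)
qed

lemma (in partial_algebra) bdiff_diff:
  "bdiff m n (\<lambda>as. F as - F' as) as = bdiff m n F as - bdiff m n F' as"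
  using bdiff_add[of n F "\<lambda>as. scale (- 1) (F' as)" as] bdiff_scale[of n "- 1" F' as] by simp

section \<open>Groups as categories with one object\<close>

text \<open>A group as a category whose only object is \<open>()\<close>.\<close>

definition group_cat :: "'g monoid \<Rightarrow> (unit, 'g) cat" where
  "group_cat G = \<lparr>Ob = {()}, Arr = carrier G, src = (\<lambda>_. ()), tgt = (\<lambda>_. ()), Id = (\<lambda>_. \<one>\<^bsub>G\<^esub>), Comp = (\<otimes>\<^bsub>G\<^esub>)\<rparr>"

lemma group_cat_simps [simp]:
  "Ob (group_cat G) = {()}" "Arr (group_cat G) = carrier G" "src (group_cat G) a = ()"
  "tgt (group_cat G) a = ()" "Id (group_cat G) o' = \<one>\<^bsub>G\<^esub>" "Comp (group_cat G) a b = a \<otimes>\<^bsub>G\<^esub> b"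
  by (simp_all add: group_cat_def)

lemma group_algebra_eq:
  "group_algebra G = free_algebra (Arr (group_cat G)) (cat_prod (group_cat G)) (cat_unit (group_cat G))"
  by (simp add: group_algebra_def cat_prod_def[abs_def] cat_unit_def)

lemma is_path_group [simp]: "is_path (group_cat G) i gs \<longleftrightarrow> set gs \<subseteq> carrier G"
  by (induction gs arbitrary: i) auto

lemma composite_group [simp]: "composite (group_cat G) i gs = foldr (\<otimes>\<^bsub>G\<^esub>) gs \<one>\<^bsub>G\<^esub>"
  by (induction gs arbitrary: i) auto

lemma Mor_group [simp]: "Mor (group_cat G) i j = carrier G"
  by (auto simp: Mor_def)

lemma fin_cat_group: "group G \<Longrightarrow> fin_cat (group_cat G)"
  by unfold_locales (auto simp: group.is_monoid monoid.m_closed monoid.m_assoc)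

text \<open>The part of a cochain of a group algebra that is left after its autopoietic part is removed.\<close>

definition reduced :: "'g monoid \<Rightarrow> ('g list \<Rightarrow> 'g \<Rightarrow>\<^sub>0 'k) \<Rightarrow> 'g list \<Rightarrow> 'g \<Rightarrow>\<^sub>0 'k::{comm_ring,comm_monoid_mult}" where
  "reduced G F gs = F gs - Poly_Mapping.single (foldr (\<otimes>\<^bsub>G\<^esub>) gs \<one>\<^bsub>G\<^esub>) (aug (carrier G) (F gs))"

context
  fixes G :: "'g monoid"
  assumes G: "group G"
begin

interpretation fin_cat "group_cat G" by (rule fin_cat_group[OF G])

lemma bPsi_group: "set gs \<subseteq> carrier G \<Longrightarrow>
    bPsi \<gamma> gs = Poly_Mapping.single (foldr (\<otimes>\<^bsub>G\<^esub>) gs \<one>\<^bsub>G\<^esub>) (\<gamma> ((), gs))"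
proof -
  assume "set gs \<subseteq> carrier G"
  then have "starts gs = {()}" by (auto simp: starts_def)
  then show ?thesis by (simp add: bPsi_def)
qed

lemma foldr_closed: "set gs \<subseteq> carrier G \<Longrightarrow> foldr (\<otimes>\<^bsub>G\<^esub>) gs \<one>\<^bsub>G\<^esub> \<in> carrier G"
  using is_path_props[of "()" gs] by simp

lemma aug_reduced: "set gs \<subseteq> carrier G \<Longrightarrow> aug (carrier G) (reduced G F gs) = 0"
  by (simp add: reduced_def foldr_closed)

lemma reduced_bcochain: "bcochain (carrier G) n F \<Longrightarrow> bcochain (carrier G) n (reduced G F)"
  unfolding bcochain_def reduced_def
  by (intro allI impI keys_diff_subset keys_single_subset foldr_closed) auto

lemma reduced_bdiff:
  fixes F :: "'g list \<Rightarrow> 'g \<Rightarrow>\<^sub>0 'k::{comm_ring,comm_monoid_mult}"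
  assumes F: "bcochain (carrier G) n F" and gs: "set gs \<subseteq> carrier G" "length gs = Suc n"
  shows "reduced G (bdiff (cat_prod (group_cat G)) n F) gs = bdiff (cat_prod (group_cat G)) n (reduced G F) gs"
proof -
  interpret cat_over "group_cat G" "cat_unit (group_cat G) :: 'g \<Rightarrow>\<^sub>0 'k" by unfold_locales simp
  let ?m = "cat_prod (group_cat G)"
  have red: "reduced G F' hs = F' hs - bPsi (baug F') hs" if "set hs \<subseteq> carrier G" for F' :: "'g list \<Rightarrow> 'g \<Rightarrow>\<^sub>0 'k" and hs
    using that by (simp add: bPsi_group reduced_def baug_def)
  have "bdiff ?m n (reduced G F) gs = bdiff ?m n (\<lambda>gs. F gs - bPsi (baug F) gs) gs"
    by (rule bdiff_cong_S) (use gs red in auto)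
  also have "\<dots> = bdiff ?m n F gs - bPsi (scochain_d (group_cat G) n (baug F)) gs"
    using gs by (simp add: bdiff_diff bdiff_bPsi)
  also have "bPsi (scochain_d (group_cat G) n (baug F)) gs = bPsi (baug (bdiff ?m n F)) gs"
    by (rule bPsi_cong) (use baug_bdiff[of n F _ gs] F gs in simp)
  finally show ?thesis using red gs by simp
qed

end

section \<open>The amalgam of groups and a poset\<close>

text \<open>
  The group element of a loop; \<open>emb i\<close> embeds \<open>k[G\<^sub>i]\<close>, and \<open>loop_part i\<close> is the projection onto it that omits all
  other morphisms.
\<close>

fun label :: "('i, 'g) amalgam_mor \<Rightarrow> 'g" where
  "label (Loop i g) = g"
| "label (Edge i j) = undefined"

definition emb :: "'i \<Rightarrow> ('g \<Rightarrow>\<^sub>0 'k) \<Rightarrow> (('i, 'g) amalgam_mor \<Rightarrow>\<^sub>0 'k::{comm_ring,comm_monoid_mult})" where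
  "emb i = lext (\<lambda>g. basis (Loop i g))"

definition loop_part :: "'i \<Rightarrow> (('i, 'g) amalgam_mor \<Rightarrow>\<^sub>0 'k) \<Rightarrow> ('g \<Rightarrow>\<^sub>0 'k::{comm_ring,comm_monoid_mult})" where
  "loop_part i = lext (\<lambda>a. case a of Loop j g \<Rightarrow> if j = i then basis g else 0 | Edge _ _ \<Rightarrow> 0)"

text \<open>Extension by zero from the loops at \<open>i\<close>, and restriction to them.\<close>

definition ext_loops :: "'i \<Rightarrow> ('g list \<Rightarrow> 'g \<Rightarrow>\<^sub>0 'k) \<Rightarrow> ('i, 'g) amalgam_mor list
    \<Rightarrow> (('i, 'g) amalgam_mor \<Rightarrow>\<^sub>0 'k::{comm_ring,comm_monoid_mult})" where
  "ext_loops i F as = (if set as \<subseteq> range (Loop i) then emb i (F (map label as)) else 0)"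

definition res_loops :: "'i \<Rightarrow> (('i, 'g) amalgam_mor list \<Rightarrow> (('i, 'g) amalgam_mor \<Rightarrow>\<^sub>0 'k)) \<Rightarrow> 'g list
    \<Rightarrow> ('g \<Rightarrow>\<^sub>0 'k::{comm_ring,comm_monoid_mult})" where
  "res_loops i F gs = loop_part i (F (map (Loop i) gs))"

lemma emb_simps: "emb i 0 = 0" "emb i (x + y) = emb i x + emb i y" "emb i (scale c x) = scale c (emb i x)"
  by (simp_all add: emb_def lext_add lext_scale)

lemma emb_sum: "emb i (\<Sum>j\<in>I. x j) = (\<Sum>j\<in>I. emb i (x j))"
  by (simp add: emb_def lext_sum)

lemma loop_part_simps: "loop_part i 0 = 0" "loop_part i (x + y) = loop_part i x + loop_part i y"
  "loop_part i (x - y) = loop_part i x - loop_part i y"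
  "loop_part i (scale c x) = scale c (loop_part i x)"
  "loop_part i (Poly_Mapping.single (Loop j g) b) = (if j = i then Poly_Mapping.single g b else 0)"
  by (simp_all add: loop_part_def lext_add lext_diff lext_scale)

lemma loop_part_sum: "loop_part i (\<Sum>j\<in>I. x j) = (\<Sum>j\<in>I. loop_part i (x j))"
  by (simp add: loop_part_def lext_sum)

lemma loop_part_emb: "loop_part i (emb j x) = (if j = i then x else 0)"
  by (auto simp: loop_part_def emb_def lext_lext lext_basis)

lemma set_map_Loop: "set as \<subseteq> range (Loop i) \<longleftrightarrow> (\<exists>gs. as = map (Loop i) gs)"
  by (auto simp: ex_map_conv)

lemma map_label_Loop [simp]: "map (label \<circ> Loop i) gs = gs"
  by (induction gs) auto

lemma lext_const: "lext (\<lambda>a. if a \<in> T then y else 0) x = scale (aug T x) y"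
proof -
  have "lext (\<lambda>a. if a \<in> T then y else 0) x = lext (\<lambda>_. y) (lext (\<lambda>a. if a \<in> T then basis () else 0) x)"
    unfolding lext_lext by (rule lext_cong) auto
  also have "\<dots> = scale (aug T x) y" unfolding aug_def
    by (subst lext_superset[of "{()}"]) auto
  finally show ?thesis .
qed

locale group_amalgam =
  fixes P :: "'i set" and r :: "('i \<times> 'i) set" and G :: "'i \<Rightarrow> 'g monoid"
  assumes finite_P: "finite P" and order: "partial_order_on P r" and group: "\<And>i. i \<in> P \<Longrightarrow> group (G i)"
begin

abbreviation "C \<equiv> amalgam P r G"

lemma C_simps [simp]:
  "Ob C = P" "src C = amalgam_src" "tgt C = amalgam_tgt" "Id C i = Loop i \<one>\<^bsub>G i\<^esub>" "Comp C = amalgam_comp G"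
  by (simp_all add: amalgam_def)

lemma Arr_Loop [simp]: "Loop i g \<in> Arr C \<longleftrightarrow> i \<in> P \<and> g \<in> carrier (G i)"
  and Arr_Edge [simp]: "Edge i j \<in> Arr C \<longleftrightarrow> i \<in> P \<and> j \<in> P \<and> i \<noteq> j \<and> (i, j) \<in> r"
  by (auto simp: amalgam_def)

lemma r_trans: "(i, j) \<in> r \<Longrightarrow> (j, l) \<in> r \<Longrightarrow> (i, l) \<in> r"
  using order by (auto simp: partial_order_on_def preorder_on_def elim: transE)

lemma r_antisym: "(i, j) \<in> r \<Longrightarrow> (j, i) \<in> r \<Longrightarrow> i = j"
  using order by (auto simp: partial_order_on_def elim: antisymD)

lemma r_refl: "i \<in> P \<Longrightarrow> (i, i) \<in> r"
  using order by (auto simp: partial_order_on_def preorder_on_def refl_on_def)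

lemma monoid_G: "i \<in> P \<Longrightarrow> monoid (G i)"
  using group group.is_monoid by blast

lemma fin_cat_C: "fin_cat C"
proof
  show "finite (Ob C)" using finite_P by simp
  fix a assume a: "a \<in> Arr C"
  then show "src C a \<in> Ob C" "tgt C a \<in> Ob C" by (cases a; simp)+
  show "Comp C (Id C (src C a)) a = a"
    using a monoid.l_one[OF monoid_G] by (cases a) simp_all
  show "Comp C a (Id C (tgt C a)) = a"
    using a monoid.r_one[OF monoid_G] by (cases a) simp_all
next
  fix i assume "i \<in> Ob C"
  then show "Id C i \<in> Arr C" "src C (Id C i) = i" "tgt C (Id C i) = i"
    using monoid.one_closed[OF monoid_G] by simp_all
next
  fix a b assume ab: "a \<in> Arr C" "b \<in> Arr C" "tgt C a = src C b"
  show "Comp C a b \<in> Arr C"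
  proof (cases a)
    case a: (Loop i g)
    then show ?thesis using ab monoid.m_closed[OF monoid_G] by (cases b) simp_all
  next
    case a: (Edge i j)
    show ?thesis
    proof (cases b)
      case (Loop l h)
      then show ?thesis using ab a by simp
    next
      case (Edge l q)
      then have "(i, j) \<in> r" "(j, q) \<in> r" "i \<noteq> j" using ab a by auto
      then have "i \<noteq> q" "(i, q) \<in> r" using r_antisym r_trans by blast+
      then show ?thesis using ab a Edge by simp
    qed
  qed
  show "src C (Comp C a b) = src C a" "tgt C (Comp C a b) = tgt C b"
    using ab by (cases a; cases b; simp)+
next
  fix a b c assume "a \<in> Arr C" "b \<in> Arr C" "c \<in> Arr C" "tgt C a = src C b" "tgt C b = src C c"
  then show "Comp C (Comp C a b) c = Comp C a (Comp C b c)"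
    using monoid.m_assoc[OF monoid_G] by (cases a; cases b; cases c) simp_all
qed

lemma bmerge_Loop:
  "bmerge (cat_prod C) k (map (Loop i) gs) = map_option (map (Loop i)) (bmerge (cat_prod (group_cat (G i))) k gs)"
proof (induction k arbitrary: gs)
  case 0
  show ?case
  proof (cases gs)
    case (Cons g hs)
    then show ?thesis by (cases hs) (auto simp: cat_prod_def)
  qed simp
next
  case (Suc k)
  show ?case
  proof (cases gs)
    case (Cons g hs)
    then show ?thesis using Suc[of hs] by (cases "bmerge (cat_prod (group_cat (G i))) k hs") auto
  qed simp
qed

lemma bmerge_loops:
  "bmerge (cat_prod C) k as = Some bs \<Longrightarrow> set as \<subseteq> Arr C \<Longrightarrow> set bs \<subseteq> range (Loop i) \<Longrightarrow> set as \<subseteq> range (Loop i)"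
proof (induction k arbitrary: as bs)
  case 0
  then obtain a b cs c where *: "as = a # b # cs" "cat_prod C a b = Some c" "bs = c # cs"
    by (cases "(cat_prod C, 0::nat, as)" rule: bmerge.cases) auto
  then have "c \<in> range (Loop i)" "tgt C a = src C b" "c = Comp C a b"
    using 0 by (auto simp: cat_prod_def split: if_splits)
  then have "a \<in> range (Loop i) \<and> b \<in> range (Loop i)" by (cases a; cases b; auto)
  then show ?case using 0 * by auto
next
  case (Suc k)
  then obtain a cs ds where "as = a # cs" "bmerge (cat_prod C) k cs = Some ds" "bs = a # ds"
    by (cases as) auto
  then show ?case using Suc.IH[of cs ds] Suc.prems by auto
qed

lemma emb_left:
  assumes i: "i \<in> P" and a: "a \<in> Arr C" and x: "Poly_Mapping.keys x \<subseteq> carrier (G i)" "aug (carrier (G i)) x = 0"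
  shows "pmult (cat_prod C) (basis a) (emb i x) =
    (if a \<in> range (Loop i) then emb i (pmult (cat_prod (group_cat (G i))) (basis (label a)) x) else 0)"
proof (cases "a \<in> range (Loop i)")
  case True
  then obtain g where "a = Loop i g" by auto
  then show ?thesis
    by (auto simp: emb_def pmult_lext(2) pmult_basis_left lext_lext cat_prod_def intro!: lext_cong)
next
  case False
  have "pmult (cat_prod C) (basis a) (emb i x) =
      lext (\<lambda>g. if g \<in> carrier (G i) then (if tgt C a = i then basis a else 0) else 0) x"
    unfolding emb_def pmult_lext
  proof (rule lext_cong)
    fix g assume "g \<in> Poly_Mapping.keys x"
    then show "pmult (cat_prod C) (basis a) (basis (Loop i g)) =
        (if g \<in> carrier (G i) then (if tgt C a = i then basis a else 0) else 0)"
      using x(1) False by (cases a) (auto simp: pmult_basis cat_prod_def)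
  qed
  also have "\<dots> = 0" by (simp add: lext_const x(2))
  finally show ?thesis using False by simp
qed

lemma emb_right:
  assumes i: "i \<in> P" and a: "a \<in> Arr C" and x: "Poly_Mapping.keys x \<subseteq> carrier (G i)" "aug (carrier (G i)) x = 0"
  shows "pmult (cat_prod C) (emb i x) (basis a) =
    (if a \<in> range (Loop i) then emb i (pmult (cat_prod (group_cat (G i))) x (basis (label a))) else 0)"
proof (cases "a \<in> range (Loop i)")
  case True
  then obtain g where "a = Loop i g" by auto
  then show ?thesis
    by (auto simp: emb_def pmult_lext(1) pmult_basis_right lext_lext cat_prod_def intro!: lext_cong)
next
  case False
  have "pmult (cat_prod C) (emb i x) (basis a) =
      lext (\<lambda>g. if g \<in> carrier (G i) then (if src C a = i then basis a else 0) else 0) x"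
    unfolding emb_def pmult_lext
  proof (rule lext_cong)
    fix g assume "g \<in> Poly_Mapping.keys x"
    then show "pmult (cat_prod C) (basis (Loop i g)) (basis a) =
        (if g \<in> carrier (G i) then (if src C a = i then basis a else 0) else 0)"
      using x(1) False by (cases a) (auto simp: pmult_basis cat_prod_def)
  qed
  also have "\<dots> = 0" by (simp add: lext_const x(2))
  finally show ?thesis using False by simp
qed

lemma ext_loops_map: "ext_loops i F (map (Loop i) gs) = emb i (F gs)"
  by (auto simp: ext_loops_def)

text \<open>
  A cochain whose values have coefficient sum zero can be extended by zero from the loops at \<open>i\<close>: products
  of its values with morphisms that are not loops vanish.
\<close>

lemma bdiff_ext_loops:
  assumes i: "i \<in> P" and F: "bcochain (carrier (G i)) n F"
    and aug: "\<And>gs. set gs \<subseteq> carrier (G i) \<Longrightarrow> aug (carrier (G i)) (F gs) = 0"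
    and as: "set as \<subseteq> Arr C" "length as = Suc n"
  shows "bdiff (cat_prod C) n (ext_loops i F) as = ext_loops i (bdiff (cat_prod (group_cat (G i))) n F) as"
proof -
  have ne: "as \<noteq> []" using as by auto
  have hl: "hd as \<in> Arr C" "last as \<in> Arr C" "set (tl as) \<subseteq> Arr C" "set (butlast as) \<subseteq> Arr C"
    using as ne by (auto dest: in_set_butlastD list.set_sel(2))
  have lab: "set (map label bs) \<subseteq> carrier (G i)" if "set bs \<subseteq> Arr C" "set bs \<subseteq> range (Loop i)" for bs
    using that by fastforce
  have F': "Poly_Mapping.keys (F (map label bs)) \<subseteq> carrier (G i)" "aug (carrier (G i)) (F (map label bs)) = 0"
    if "set bs \<subseteq> Arr C" "set bs \<subseteq> range (Loop i)" "length bs = n" for bs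
    using F aug lab[OF that(1,2)] that(3) by (auto simp: bcochain_def)
  have left: "pmult (cat_prod C) (basis (hd as)) (ext_loops i F (tl as)) = (if set as \<subseteq> range (Loop i)
      then emb i (pmult (cat_prod (group_cat (G i))) (basis (label (hd as))) (F (map label (tl as)))) else 0)"
  proof -
    have "set as \<subseteq> range (Loop i) \<longleftrightarrow> hd as \<in> range (Loop i) \<and> set (tl as) \<subseteq> range (Loop i)"
      using ne by (cases as) auto
    then show ?thesis
      using emb_left[OF i hl(1) F'[OF hl(3)]] as(2) by (auto simp: ext_loops_def)
  qed
  have right: "pmult (cat_prod C) (ext_loops i F (butlast as)) (basis (last as)) = (if set as \<subseteq> range (Loop i)
      then emb i (pmult (cat_prod (group_cat (G i))) (F (map label (butlast as))) (basis (label (last as)))) else 0)"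
  proof -
    have "set as \<subseteq> range (Loop i) \<longleftrightarrow> last as \<in> range (Loop i) \<and> set (butlast as) \<subseteq> range (Loop i)"
      using ne by (cases as rule: rev_cases) auto
    then show ?thesis
      using emb_right[OF i hl(2) F'[OF hl(4)]] as(2) by (auto simp: ext_loops_def)
  qed
  show ?thesis
  proof (cases "set as \<subseteq> range (Loop i)")
    case True
    then obtain gs where gs: "as = map (Loop i) gs" by (auto simp: set_map_Loop)
    have mid: "on_opt (ext_loops i F) (bmerge (cat_prod C) k as) = emb i (on_opt F (bmerge (cat_prod (group_cat (G i))) k gs))" for k
      by (cases "bmerge (cat_prod (group_cat (G i))) k gs") (auto simp: gs bmerge_Loop ext_loops_map emb_simps)
    have "gs \<noteq> []" using ne gs by auto
    then have "map label (tl as) = tl gs" "map label (butlast as) = butlast gs" "label (hd as) = hd gs" "label (last as) = last gs"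
      by (auto simp: gs map_tl[symmetric] map_butlast[symmetric] hd_map last_map)
    then have "bdiff (cat_prod C) n (ext_loops i F) as = emb i (bdiff (cat_prod (group_cat (G i))) n F gs)"
      unfolding bdiff_def left right mid using True by (simp add: emb_simps emb_sum del: power_Suc)
    then show ?thesis by (simp add: gs ext_loops_map)
  next
    case False
    have "on_opt (ext_loops i F) (bmerge (cat_prod C) k as) = 0" for k
      using bmerge_loops[of k as _ i] as(1) False
      by (cases "bmerge (cat_prod C) k as") (auto simp: ext_loops_def)
    then show ?thesis using False left right by (simp add: bdiff_def ext_loops_def[of i "bdiff _ _ _"])
  qed
qed

lemma loop_part_left:
  assumes "Poly_Mapping.keys x \<subseteq> Arr C"
  shows "loop_part i (pmult (cat_prod C) (basis (Loop i g)) x) =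
    pmult (cat_prod (group_cat (G i))) (basis g) (loop_part i x)"
  unfolding loop_part_def pmult_lext pmult_basis_left[of "cat_prod C"] lext_lext
  by (rule lext_cong) (auto simp: pmult_basis cat_prod_def split: amalgam_mor.split option.split)

lemma loop_part_right:
  assumes "Poly_Mapping.keys x \<subseteq> Arr C"
  shows "loop_part i (pmult (cat_prod C) x (basis (Loop i g))) =
    pmult (cat_prod (group_cat (G i))) (loop_part i x) (basis g)"
  unfolding loop_part_def pmult_lext pmult_basis_right[of "cat_prod C"] lext_lext
  by (rule lext_cong) (auto simp: pmult_basis cat_prod_def split: amalgam_mor.split option.split)

lemma bdiff_res_loops:
  assumes i: "i \<in> P" and F: "bcochain (Arr C) n F" and gs: "set gs \<subseteq> carrier (G i)" "length gs = Suc n"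
  shows "bdiff (cat_prod (group_cat (G i))) n (res_loops i F) gs = res_loops i (bdiff (cat_prod C) n F) gs"
proof -
  have ne: "gs \<noteq> []" using gs by auto
  have "set (map (Loop i) (tl gs)) \<subseteq> Arr C" "set (map (Loop i) (butlast gs)) \<subseteq> Arr C"
    using gs(1) i ne by (auto dest: in_set_butlastD list.set_sel(2))
  then have k: "Poly_Mapping.keys (F (map (Loop i) (tl gs))) \<subseteq> Arr C"
    "Poly_Mapping.keys (F (map (Loop i) (butlast gs))) \<subseteq> Arr C"
    using F gs(2) by (simp_all add: bcochain_def)
  have "on_opt (res_loops i F) p = loop_part i (on_opt F (map_option (map (Loop i)) p))" for p
    by (cases p) (auto simp: res_loops_def loop_part_simps)
  then show ?thesis
    using loop_part_left[OF k(1), of i "hd gs"] loop_part_right[OF k(2), of i "last gs"] ne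
    by (simp add: bdiff_def res_loops_def[of i F] res_loops_def[of i "bdiff _ _ _"] bmerge_Loop hd_map last_map
        map_tl map_butlast loop_part_simps loop_part_sum del: power_Suc)
qed

text \<open>Antisymmetry: a path that returns to its start never leaves it.\<close>

lemma path_order: "is_path C i as \<Longrightarrow> (i, path_end C i as) \<in> r \<and> (path_end C i as = i \<longrightarrow> set as \<subseteq> range (Loop i))"
proof (induction as arbitrary: i)
  case (Cons a as)
  show ?case
  proof (cases a)
    case (Loop j g)
    then show ?thesis using Cons by auto
  next
    case (Edge j l)
    then have "(i, l) \<in> r" "i \<noteq> l" "(l, path_end C l as) \<in> r" using Cons by auto
    then have "(i, path_end C l as) \<in> r" "path_end C l as \<noteq> i" using r_trans r_antisym by blast+
    then show ?thesis using Edge by simp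
  qed
qed (auto simp: r_refl)

text \<open>
  The map \<open>incl i\<close> removes the autopoietic part of a cochain of \<open>k[G\<^sub>i]\<close> and extends the rest by zero; \<open>restr i\<close>
  restricts a cochain of the category algebra to \<open>k[G\<^sub>i]\<close>.
\<close>

definition incl :: "'i \<Rightarrow> nat \<Rightarrow> (('g \<Rightarrow>\<^sub>0 'k) list \<Rightarrow> 'g \<Rightarrow>\<^sub>0 'k) \<Rightarrow> (('i, 'g) amalgam_mor \<Rightarrow>\<^sub>0 'k) list
    \<Rightarrow> ('i, 'g) amalgam_mor \<Rightarrow>\<^sub>0 'k::{comm_ring,comm_monoid_mult}" where
  "incl i n f = mext (Arr C) n (ext_loops i (reduced (G i) (\<lambda>gs. f (map basis gs))))"

definition restr :: "'i \<Rightarrow> nat \<Rightarrow> ((('i, 'g) amalgam_mor \<Rightarrow>\<^sub>0 'k) list \<Rightarrow> ('i, 'g) amalgam_mor \<Rightarrow>\<^sub>0 'k)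
    \<Rightarrow> ('g \<Rightarrow>\<^sub>0 'k) list \<Rightarrow> 'g \<Rightarrow>\<^sub>0 'k::{comm_ring,comm_monoid_mult}" where
  "restr i n f = mext (carrier (G i)) n (res_loops i (\<lambda>as. f (map basis as)))"

lemma cat_over_C: "cat_over C (cat_unit C)"
  using fin_cat_C by (simp add: cat_over_def cat_over_axioms_def)

lemma cat_over_group: "i \<in> P \<Longrightarrow> cat_over (group_cat (G i)) (cat_unit (group_cat (G i)))"
  using fin_cat_group[OF group] by (simp add: cat_over_def cat_over_axioms_def)

lemma label_Arr: "set as \<subseteq> Arr C \<Longrightarrow> set as \<subseteq> range (Loop i) \<Longrightarrow> set (map label as) \<subseteq> carrier (G i)"
  by fastforce

lemma keys_emb: "i \<in> P \<Longrightarrow> Poly_Mapping.keys x \<subseteq> carrier (G i) \<Longrightarrow> Poly_Mapping.keys (emb i x) \<subseteq> Arr C"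
  unfolding emb_def by (intro keys_lext keys_single_subset) auto

lemma keys_loop_part:
  assumes "Poly_Mapping.keys x \<subseteq> Arr C" shows "Poly_Mapping.keys (loop_part i x) \<subseteq> carrier (G i)"
  unfolding loop_part_def
proof (intro keys_lext)
  fix a assume "a \<in> Poly_Mapping.keys x"
  then have "a \<in> Arr C" using assms by auto
  then show "Poly_Mapping.keys (case a of Loop j g \<Rightarrow> if j = i then basis g else 0 | Edge _ _ \<Rightarrow> 0) \<subseteq> carrier (G i)"
    by (cases a) auto
qed

lemma cochain_map_incl:
  assumes i: "i \<in> P"
  shows "cochain_map (hoch (group_algebra (G i))) (hoch_d (group_algebra (G i)))
    (hoch (cat_algebra C :: ('k::{comm_ring,comm_monoid_mult}, _) module)) (hoch_d (cat_algebra C)) (incl i)"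
proof -
  interpret C: cat_over C "cat_unit C :: _ \<Rightarrow>\<^sub>0 'k" by (rule cat_over_C)
  interpret Gi: cat_over "group_cat (G i)" "cat_unit (group_cat (G i)) :: _ \<Rightarrow>\<^sub>0 'k" by (rule cat_over_group[OF i])
  let ?T = "\<lambda>F. ext_loops i (reduced (G i) F)"
  note red = reduced_bcochain[OF group[OF i]]
  have "cochain_map (hoch Gi.A) (hoch_d Gi.A) (hoch C.A) (hoch_d C.A)
      (\<lambda>n f. mext (Arr C) n (?T (\<lambda>as. f (map basis as))))"
  proof (rule cochain_map_mext)
    fix n and F F' :: "'g list \<Rightarrow> 'g \<Rightarrow>\<^sub>0 'k" and bs :: "('i, 'g) amalgam_mor list" and c
    show "?T F bs = ?T F' bs"
      if "\<And>as. set as \<subseteq> Arr (group_cat (G i)) \<Longrightarrow> length as = n \<Longrightarrow> F as = F' as" "set bs \<subseteq> Arr C" "length bs = n"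
      using that(1)[of "map label bs"] label_Arr[OF that(2)] that(3) by (simp add: ext_loops_def reduced_def)
    show "bcochain (Arr C) n (?T F)" if "bcochain (Arr (group_cat (G i))) n F"
      unfolding bcochain_def
    proof (intro allI impI)
      fix as assume as: "set as \<subseteq> Arr C \<and> length as = n"
      have "bcochain (carrier (G i)) n F" using that by simp
      then have "Poly_Mapping.keys (reduced (G i) F (map label as)) \<subseteq> carrier (G i)" if "set as \<subseteq> range (Loop i)"
        using red[of n F] label_Arr[of as i] as that unfolding bcochain_def by simp
      then show "Poly_Mapping.keys (?T F as) \<subseteq> Arr C"
        by (simp add: ext_loops_def keys_emb[OF i])
    qed
    show "?T (\<lambda>as. F as + F' as) bs = ?T F bs + ?T F' bs"
      by (simp add: ext_loops_def reduced_def single_add flip: emb_simps) (simp add: algebra_simps)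
    show "?T (\<lambda>as. scale c (F as)) bs = scale c (?T F bs)"
      by (simp add: ext_loops_def reduced_def scale_diff flip: emb_simps)
    show "?T (bdiff (cat_prod (group_cat (G i))) n F) bs = bdiff (cat_prod C) n (?T F) bs"
      if F: "bcochain (Arr (group_cat (G i))) n F" and bs: "set bs \<subseteq> Arr C" "length bs = Suc n"
    proof -
      have F': "bcochain (carrier (G i)) n F" using F by simp
      have "bdiff (cat_prod C) n (?T F) bs = ext_loops i (bdiff (cat_prod (group_cat (G i))) n (reduced (G i) F)) bs"
        by (rule bdiff_ext_loops[OF i red[OF F'] _ bs]) (rule aug_reduced[OF group[OF i]])
      then show ?thesis
        using reduced_bdiff[OF group[OF i] F', of "map label bs"] label_Arr[OF bs(1)] bs(2)
        by (simp add: ext_loops_def)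
    qed
  qed unfold_locales
  then show ?thesis by (simp add: incl_def[abs_def] group_algebra_eq cat_algebra_eq)
qed

lemma cochain_map_restr:
  assumes i: "i \<in> P"
  shows "cochain_map (hoch (cat_algebra C :: ('k::{comm_ring,comm_monoid_mult}, _) module)) (hoch_d (cat_algebra C))
    (hoch (group_algebra (G i))) (hoch_d (group_algebra (G i))) (restr i)"
proof -
  interpret C: cat_over C "cat_unit C :: _ \<Rightarrow>\<^sub>0 'k" by (rule cat_over_C)
  interpret Gi: cat_over "group_cat (G i)" "cat_unit (group_cat (G i)) :: _ \<Rightarrow>\<^sub>0 'k" by (rule cat_over_group[OF i])
  have "cochain_map (hoch C.A) (hoch_d C.A) (hoch Gi.A) (hoch_d Gi.A)
      (\<lambda>n f. mext (Arr (group_cat (G i))) n (res_loops i (\<lambda>as. f (map basis as))))"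
  proof (rule cochain_map_mext)
    fix n and F F' :: "('i, 'g) amalgam_mor list \<Rightarrow> ('i, 'g) amalgam_mor \<Rightarrow>\<^sub>0 'k" and gs :: "'g list" and c
    have loops: "set (map (Loop i) gs) \<subseteq> Arr C" if "set gs \<subseteq> carrier (G i)" for gs using that i by auto
    show "res_loops i F gs = res_loops i F' gs"
      if "\<And>as. set as \<subseteq> Arr C \<Longrightarrow> length as = n \<Longrightarrow> F as = F' as" "set gs \<subseteq> Arr (group_cat (G i))" "length gs = n"
      using that(1)[of "map (Loop i) gs"] loops that(2,3) by (simp add: res_loops_def)
    show "bcochain (Arr (group_cat (G i))) n (res_loops i F)" if "bcochain (Arr C) n F"
      unfolding bcochain_def res_loops_def group_cat_simps
    proof (intro allI impI keys_loop_part)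
      fix gs assume "set gs \<subseteq> carrier (G i) \<and> length gs = n"
      then have "set (map (Loop i) gs) \<subseteq> Arr C" "length (map (Loop i) gs) = n" using loops by simp_all
      then show "Poly_Mapping.keys (F (map (Loop i) gs)) \<subseteq> Arr C" using that unfolding bcochain_def by blast
    qed
    show "res_loops i (\<lambda>as. F as + F' as) gs = res_loops i F gs + res_loops i F' gs"
      "res_loops i (\<lambda>as. scale c (F as)) gs = scale c (res_loops i F gs)"
      by (simp_all add: res_loops_def loop_part_simps)
    show "res_loops i (bdiff (cat_prod C) n F) gs = bdiff (cat_prod (group_cat (G i))) n (res_loops i F) gs"
      if "bcochain (Arr C) n F" "set gs \<subseteq> Arr (group_cat (G i))" "length gs = Suc n"
      using bdiff_res_loops[OF i that(1)] that(2,3) by simp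
  qed unfold_locales
  then show ?thesis by (simp add: restr_def[abs_def] group_algebra_eq cat_algebra_eq)
qed

lemma restr_basis: "set gs \<subseteq> carrier (G i) \<Longrightarrow> length gs = n \<Longrightarrow>
    restr i n f (map basis gs) = loop_part i (f (map basis (map (Loop i) gs)))"
  by (simp add: restr_def res_loops_def)

lemma incl_basis: "set as \<subseteq> Arr C \<Longrightarrow> length as = n \<Longrightarrow>
    incl i n f (map basis as) = ext_loops i (reduced (G i) (\<lambda>gs. f (map basis gs))) as"
  by (simp add: incl_def)

end

lemma group_ap_carrier: "carrier (group_ap_cochains G n) = {f \<in> carrier (hoch (group_algebra G) n).
    \<forall>gs. set gs \<subseteq> carrier G \<and> length gs = n \<longrightarrow>
      (\<exists>c. f (map basis gs) = Poly_Mapping.single (foldr (\<otimes>\<^bsub>G\<^esub>) gs \<one>\<^bsub>G\<^esub>) c)}"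
  by (simp add: group_ap_cochains_def)

lemma opsub_group_ap:
  "opsub (hoch (group_algebra G :: ('k::{comm_ring,comm_monoid_mult}, _) module) n) (carrier (group_ap_cochains G n))"
proof -
  interpret opgroup "hoch (group_algebra G :: ('k, _) module) n" unfolding group_algebra_eq by (rule opgroup_hoch)
  have S: "set gs \<subseteq> Arr (group_cat G) \<longleftrightarrow> set gs \<subseteq> carrier G" for gs by simp
  show ?thesis
  proof (rule opsubI)
    let ?s = "\<lambda>gs. Poly_Mapping.single (foldr (\<otimes>\<^bsub>G\<^esub>) gs \<one>\<^bsub>G\<^esub>)"
    have "\<zero>\<^bsub>hoch (group_algebra G :: ('k, _) module) n\<^esub> (map basis gs) = ?s gs 0"
      if "set gs \<subseteq> carrier G" "length gs = n" for gs
      unfolding group_algebra_eq using hoch_basis(3)[OF that[folded S]] by simp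
    then show "\<zero>\<^bsub>hoch (group_algebra G :: ('k, _) module) n\<^esub> \<in> carrier (group_ap_cochains G n)"
      unfolding group_ap_carrier by blast
    fix c :: 'k and x y assume "x \<in> carrier (group_ap_cochains G n :: ('k, _) module)"
    then have x: "x \<in> carrier (hoch (group_algebra G) n)"
      "\<And>gs. set gs \<subseteq> carrier G \<Longrightarrow> length gs = n \<Longrightarrow> \<exists>c. x (map basis gs) = ?s gs c"
      unfolding group_ap_carrier by auto
    have "\<exists>b. (c \<odot>\<^bsub>hoch (group_algebra G) n\<^esub> x) (map basis gs) = ?s gs b"
      if gs: "set gs \<subseteq> carrier G" "length gs = n" for gs
    proof -
      obtain b where "x (map basis gs) = ?s gs b" using x(2)[OF gs] by blast
      then have "(c \<odot>\<^bsub>hoch (group_algebra G) n\<^esub> x) (map basis gs) = ?s gs (c * b)"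
        unfolding group_algebra_eq by (subst hoch_basis(2)[OF gs[folded S]]) simp
      then show ?thesis by blast
    qed
    then show "c \<odot>\<^bsub>hoch (group_algebra G) n\<^esub> x \<in> carrier (group_ap_cochains G n)"
      unfolding group_ap_carrier using x(1) by simp
    assume "y \<in> carrier (group_ap_cochains G n :: ('k, _) module)"
    then have y: "y \<in> carrier (hoch (group_algebra G) n)"
      "\<And>gs. set gs \<subseteq> carrier G \<Longrightarrow> length gs = n \<Longrightarrow> \<exists>c. y (map basis gs) = ?s gs c"
      unfolding group_ap_carrier by auto
    have "\<exists>b. (x \<ominus>\<^bsub>hoch (group_algebra G) n\<^esub> y) (map basis gs) = ?s gs b"
      if gs: "set gs \<subseteq> carrier G" "length gs = n" for gs
    proof -
      obtain b b' where "x (map basis gs) = ?s gs b" "y (map basis gs) = ?s gs b'"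
        using x(2)[OF gs] y(2)[OF gs] by blast
      then have "(x \<ominus>\<^bsub>hoch (group_algebra G) n\<^esub> y) (map basis gs) = ?s gs (b - b')"
        using hoch_minus_basis[OF x(1)[unfolded group_algebra_eq] y(1)[unfolded group_algebra_eq] gs[folded S]]
        unfolding group_algebra_eq by (simp add: single_diff)
      then show ?thesis by blast
    qed
    then show "x \<ominus>\<^bsub>hoch (group_algebra G) n\<^esub> y \<in> carrier (group_ap_cochains G n)"
      unfolding group_ap_carrier using x(1) y(1) by simp
  qed (auto simp: group_ap_carrier)
qed

section \<open>The splitting\<close>

text \<open>The category algebra of the amalgam.\<close>

locale amalgam_algebra = group_amalgam P r G + cat_over "amalgam P r G" u
  for P :: "'i set" and r and G :: "'i \<Rightarrow> 'g monoid"
    and u :: "('i, 'g) amalgam_mor \<Rightarrow>\<^sub>0 'k::{comm_ring,comm_monoid_mult}"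
begin

lemma aug_emb:
  fixes x :: "'g \<Rightarrow>\<^sub>0 'k"
  assumes "i \<in> P" "Poly_Mapping.keys x \<subseteq> carrier (G i)"
  shows "aug (Mor C l l') (emb i x) = (if l = i \<and> l' = i then aug (carrier (G i)) x else 0)"
proof -
  have "aug (Mor C l l') (emb i x) = aug (if l = i \<and> l' = i then carrier (G i) else {}) (lext basis x)"
    unfolding emb_def by (rule aug_lext_cong) (use assms in \<open>auto simp: Mor_def\<close>)
  also have "lext basis x = x" by (rule lext_basis)
  finally show ?thesis by (simp add: aug_def lext_def)
qed

lemma aug_loop_part:
  fixes x :: "('i, 'g) amalgam_mor \<Rightarrow>\<^sub>0 'k"
  assumes "Poly_Mapping.keys x \<subseteq> Arr C"
  shows "aug (carrier (G i)) (loop_part i x) = aug (Mor C i i) x"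
proof -
  have "aug (carrier (G i)) (loop_part i x) = aug (Mor C i i) (lext basis x)"
    unfolding loop_part_def
    by (rule aug_lext_cong) (use assms in \<open>auto simp: Mor_def split: amalgam_mor.split\<close>)
  then show ?thesis by (simp add: lext_basis)
qed

lemma composite_loops:
  "is_path C i (map (Loop i) gs) \<Longrightarrow> composite C i (map (Loop i) gs) = Loop i (foldr (\<otimes>\<^bsub>G i\<^esub>) gs \<one>\<^bsub>G i\<^esub>)"
  by (induction gs) auto

lemma loops_path: "i \<in> P \<Longrightarrow> set gs \<subseteq> carrier (G i) \<Longrightarrow> is_path C i (map (Loop i) gs)"
  by (induction gs) auto

lemma path_end_loops: "set as \<subseteq> range (Loop l) \<Longrightarrow> is_path C i as \<Longrightarrow> path_end C i as = i"
  by (induction as arbitrary: i) auto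

lemma loop_part_bPsi:
  fixes \<gamma> :: "('i, ('i, 'g) amalgam_mor) simplex \<Rightarrow> 'k"
  assumes i: "i \<in> P" and gs: "set gs \<subseteq> carrier (G i)"
  shows "loop_part i (bPsi \<gamma> (map (Loop i) gs)) =
    Poly_Mapping.single (foldr (\<otimes>\<^bsub>G i\<^esub>) gs \<one>\<^bsub>G i\<^esub>) (\<gamma> (i, map (Loop i) gs))"
proof -
  let ?as = "map (Loop i) gs"
  note p = loops_path[OF i gs]
  have "loop_part i (Poly_Mapping.single (composite C l ?as) (\<gamma> (l, ?as))) =
      (if l = i then Poly_Mapping.single (foldr (\<otimes>\<^bsub>G i\<^esub>) gs \<one>\<^bsub>G i\<^esub>) (\<gamma> (i, ?as)) else 0)"
    if "l \<in> starts ?as" for l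
  proof (cases gs)
    case Nil
    then show ?thesis by (simp add: loop_part_simps)
  next
    case (Cons g hs)
    then have "l = i" using that by (simp add: starts_def)
    then show ?thesis by (simp add: composite_loops[OF p] loop_part_simps)
  qed
  then have "loop_part i (bPsi \<gamma> ?as) = (\<Sum>l\<in>starts ?as.
      if l = i then Poly_Mapping.single (foldr (\<otimes>\<^bsub>G i\<^esub>) gs \<one>\<^bsub>G i\<^esub>) (\<gamma> (i, ?as)) else 0)"
    unfolding bPsi_def loop_part_sum by (rule sum.cong[OF refl])
  moreover have "i \<in> starts ?as" using p by (simp add: starts_def)
  ultimately show ?thesis by simp
qed

lemma loop_part_ext_loops:
  "loop_part j (ext_loops i F (map (Loop j) gs)) = (if i = j then F gs else 0)"
  by (auto simp: ext_loops_def loop_part_emb loop_part_simps)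

text \<open>
  The part of an element of the category algebra between the identities of \<open>i\<close> and \<open>j\<close>: for \<open>i = j\<close> it is the
  component in \<open>k[G\<^sub>i]\<close>, for \<open>i \<noteq> j\<close> it is determined by its coefficient sum.
\<close>

lemma corner_loops:
  fixes x :: "('i, 'g) amalgam_mor \<Rightarrow>\<^sub>0 'k"
  assumes i: "i \<in> P" and x: "Poly_Mapping.keys x \<subseteq> Arr C"
  shows "pmult (cat_prod C) (pmult (cat_prod C) (basis (Id C i)) x) (basis (Id C i)) = emb i (loop_part i x)"
  unfolding pmult_basis_left pmult_lext emb_def loop_part_def lext_lext
proof (rule lext_cong)
  fix a assume "a \<in> Poly_Mapping.keys x"
  then have "a \<in> Arr C" using x by auto
  then show "pmult (cat_prod C) (case cat_prod C (Id C i) a of None \<Rightarrow> 0 | Some c \<Rightarrow> basis c) (basis (Id C i)) =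
      lext (\<lambda>g. basis (Loop i g)) (case a of Loop j g \<Rightarrow> if j = i then basis g else 0 | Edge _ _ \<Rightarrow> 0)"
    using monoid.l_one[OF monoid_G] monoid.r_one[OF monoid_G]
    by (cases a) (auto simp: cat_prod_def pmult_basis)
qed

lemma corner_edge:
  fixes x :: "('i, 'g) amalgam_mor \<Rightarrow>\<^sub>0 'k"
  assumes ij: "i \<noteq> j" and x: "Poly_Mapping.keys x \<subseteq> Arr C"
  shows "pmult (cat_prod C) (pmult (cat_prod C) (basis (Id C i)) x) (basis (Id C j)) =
    scale (aug (Mor C i j) x) (basis (Edge i j))"
  unfolding pmult_basis_left pmult_lext lext_const[symmetric]
proof (rule lext_cong)
  fix a assume "a \<in> Poly_Mapping.keys x"
  then have "a \<in> Arr C" using x by auto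
  then show "pmult (cat_prod C) (case cat_prod C (Id C i) a of None \<Rightarrow> 0 | Some c \<Rightarrow> basis c) (basis (Id C j)) =
      (if a \<in> Mor C i j then basis (Edge i j) else 0)"
    using ij by (cases a) (auto simp: cat_prod_def pmult_basis Mor_def)
qed

lemma incl_restr_basis:
  fixes f :: "(('i, 'g) amalgam_mor \<Rightarrow>\<^sub>0 'k) list \<Rightarrow> ('i, 'g) amalgam_mor \<Rightarrow>\<^sub>0 'k"
  assumes "set as \<subseteq> Arr C" "length as = n"
  shows "incl i n (restr i n f) (map basis as) = ext_loops i (reduced (G i) (res_loops i (\<lambda>as. f (map basis as)))) as"
proof (cases "set as \<subseteq> range (Loop i)")
  case True
  then have "set (map label as) \<subseteq> carrier (G i)" using assms(1) label_Arr by blast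
  then have "restr i n f (map basis (map label as)) = res_loops i (\<lambda>as. f (map basis as)) (map label as)"
    using assms(2) unfolding restr_def by (intro mext_basis) simp_all
  then show ?thesis unfolding incl_basis[OF assms] ext_loops_def reduced_def by simp
next
  case False
  then show ?thesis unfolding incl_basis[OF assms] ext_loops_def by simp
qed

text \<open>
  The difference \<open>W\<close> between a cochain and the sum of its parts vanishes on paths, between the identities of
  the end points.
\<close>

lemma parts_corner:
  fixes z :: "(('i, 'g) amalgam_mor \<Rightarrow>\<^sub>0 'k) list \<Rightarrow> ('i, 'g) amalgam_mor \<Rightarrow>\<^sub>0 'k"
  assumes z: "z \<in> carrier (hoch A n)" and p: "is_path C i as" and n: "length as = n"
    and Wk: "Poly_Mapping.keys W \<subseteq> Arr C"
    and W: "W = bPsi (retr n z) as + (\<Sum>j\<in>P. incl j n (restr j n z) (map basis as)) - z (map basis as)"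
  shows "pmult (cat_prod C) (pmult (cat_prod C) (basis (Id C i)) W) (basis (Id C (path_end C i as))) = 0"
proof -
  let ?F = "\<lambda>as. z (map basis as)"
  have i: "i \<in> P" and as: "set as \<subseteq> Arr C" using is_path_props[OF p] by auto
  have Fk: "Poly_Mapping.keys (?F as) \<subseteq> Arr C" using hoch_bcochain[OF z] as n by (simp add: bcochain_def)
  have W': "W = bPsi (retr n z) as + (\<Sum>j\<in>P. ext_loops j (reduced (G j) (res_loops j ?F)) as) - ?F as"
    unfolding W by (simp add: incl_restr_basis[OF as n])
  show ?thesis
  proof (cases "path_end C i as = i")
    case True
    then have "set as \<subseteq> range (Loop i)" using path_order[OF p] by simp
    then obtain gs where gs: "as = map (Loop i) gs" by (auto simp: set_map_Loop)
    then have gsG: "set gs \<subseteq> carrier (G i)" using as by auto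
    have "(\<Sum>j\<in>P. loop_part i (ext_loops j (reduced (G j) (res_loops j ?F)) as)) =
        (\<Sum>j\<in>P. if j = i then reduced (G i) (res_loops i ?F) gs else 0)"
      unfolding gs by (rule sum.cong) (auto simp: loop_part_ext_loops)
    also have "\<dots> = reduced (G i) (res_loops i ?F) gs" using i finite_P by simp
    also have "\<dots> = loop_part i (?F as) - Poly_Mapping.single (foldr (\<otimes>\<^bsub>G i\<^esub>) gs \<one>\<^bsub>G i\<^esub>) (retr n z (i, as))"
      by (simp add: reduced_def res_loops_def aug_loop_part[OF Fk] retr_path[OF p n] True flip: gs)
    finally have "loop_part i W = 0"
      using loop_part_bPsi[OF i gsG, of "retr n z"] by (simp add: W' loop_part_simps loop_part_sum flip: gs)
    then show ?thesis using corner_loops[OF i Wk] True by (simp add: emb_simps)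
  next
    case False
    have "ext_loops j F as = 0" for j and F :: "'g list \<Rightarrow> 'g \<Rightarrow>\<^sub>0 'k"
      using path_end_loops[OF _ p] False by (auto simp: ext_loops_def)
    then have "W = bPsi (retr n z) as - ?F as" using W' by simp
    then have "aug (Mor C i (path_end C i as)) W = 0"
      using baug_bPsi[OF p, of "retr n z"] retr_path[OF p n, of z] by (simp add: baug_def)
    then show ?thesis using corner_edge[OF False[symmetric] Wk] by simp
  qed
qed

lemma sum_of_parts:
  fixes z :: "(('i, 'g) amalgam_mor \<Rightarrow>\<^sub>0 'k) list \<Rightarrow> ('i, 'g) amalgam_mor \<Rightarrow>\<^sub>0 'k"
  assumes z: "z \<in> cocycles (hoch A) (hoch_d A) n"
  shows "(Psi C n (retr n z) \<oplus>\<^bsub>hoch A n\<^esub> (\<Oplus>\<^bsub>hoch A n\<^esub>i\<in>P. incl i n (restr i n z))) \<ominus>\<^bsub>hoch A n\<^esub> z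
    \<in> coboundaries (hoch A) (hoch_d A) n"
proof (rule cocycle_coboundary)
  interpret H: opgroup "hoch A n" by (rule opgroup_hoch)
  interpret X: cochain_complex "hoch A" "hoch_d A" by (rule cochain_complex_hoch)
  note Z = H.opsub_props[OF X.cocycles_opsub]
  note \<psi> = cochain_map.cocycle[OF cochain_map_Psi] and \<rho> = cochain_map.cocycle[OF cochain_map_retr]
  have t: "incl i n (restr i n z) \<in> cocycles (hoch A) (hoch_d A) n" if i: "i \<in> P" for i
    using cochain_map.cocycle[OF cochain_map_incl[OF i, where ?'k = 'k]]
      cochain_map.cocycle[OF cochain_map_restr[OF i, where ?'k = 'k]] z
    by (simp add: cat_algebra_A)
  let ?S = "\<Oplus>\<^bsub>hoch A n\<^esub>i\<in>P. incl i n (restr i n z)" and ?p = "Psi C n (retr n z)"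
  have S: "?S \<in> cocycles (hoch A) (hoch_d A) n"
    by (rule H.opsub_finsum[OF X.cocycles_opsub]) (use t finite_P in auto)
  have p: "?p \<in> cocycles (hoch A) (hoch_d A) n" using \<psi> \<rho> z by blast
  show w: "(?p \<oplus>\<^bsub>hoch A n\<^esub> ?S) \<ominus>\<^bsub>hoch A n\<^esub> z \<in> cocycles (hoch A) (hoch_d A) n"
    by (intro Z(3,4) S p z)
  fix i as assume path: "is_path C i as" and n: "length as = n"
  have as: "set as \<subseteq> Arr C" using is_path_props[OF path] by auto
  have c: "?p \<oplus>\<^bsub>hoch A n\<^esub> ?S \<in> carrier (hoch A n)" "z \<in> carrier (hoch A n)"
    using Z(1) Z(3)[OF p S] z by auto
  have tc: "incl i n (restr i n z) \<in> carrier (hoch A n)" if "i \<in> P" for i using t[OF that] Z(1) by blast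
  show "pmult (cat_prod C) (pmult (cat_prod C) (basis (Id C i))
      (((?p \<oplus>\<^bsub>hoch A n\<^esub> ?S) \<ominus>\<^bsub>hoch A n\<^esub> z) (map basis as))) (basis (Id C (path_end C i as))) = 0"
  proof (rule parts_corner[OF c(2) path n])
    show "Poly_Mapping.keys (((?p \<oplus>\<^bsub>hoch A n\<^esub> ?S) \<ominus>\<^bsub>hoch A n\<^esub> z) (map basis as)) \<subseteq> Arr C"
      using hoch_bcochain[OF subsetD[OF Z(1) w]] as n by (simp add: bcochain_def)
    show "((?p \<oplus>\<^bsub>hoch A n\<^esub> ?S) \<ominus>\<^bsub>hoch A n\<^esub> z) (map basis as) =
        bPsi (retr n z) as + (\<Sum>j\<in>P. incl j n (restr j n z) (map basis as)) - z (map basis as)"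
      unfolding hoch_minus_basis[OF c as n] hoch_basis(1)[OF as n] Psi_basis[OF as n]
        hoch_finsum_basis[of P "\<lambda>i. incl i n (restr i n z)", OF finite_P tc as n, simplified] ..
  qed
qed

lemma incl_closed:
  assumes "i \<in> P" "y \<in> carrier (hoch (group_algebra (G i)) n)"
  shows "incl i n y \<in> carrier (hoch A n)"
  using module_homD(1)[OF cochain_map.hom[OF cochain_map_incl[OF assms(1), where ?'k = 'k]]] assms(2)
  by (simp add: cat_algebra_A)

lemma restr_closed:
  assumes "i \<in> P" "y \<in> carrier (hoch A n)"
  shows "restr i n y \<in> carrier (hoch (group_algebra (G i)) n)"
  using module_homD(1)[OF cochain_map.hom[OF cochain_map_restr[OF assms(1), where ?'k = 'k]]] assms(2)
  by (simp add: cat_algebra_A)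

lemma group_value_keys:
  fixes y :: "('g \<Rightarrow>\<^sub>0 'k) list \<Rightarrow> 'g \<Rightarrow>\<^sub>0 'k"
  assumes "y \<in> carrier (hoch (group_algebra (G i)) n)"
  shows "bcochain (carrier (G i)) n (\<lambda>gs. y (map basis gs))"
  using hoch_bcochain[OF assms[unfolded group_algebra_eq]] by simp

lemma retr_incl:
  fixes y :: "('g \<Rightarrow>\<^sub>0 'k) list \<Rightarrow> 'g \<Rightarrow>\<^sub>0 'k"
  assumes i: "i \<in> P" and y: "y \<in> carrier (hoch (group_algebra (G i)) n)"
  shows "retr n (incl i n y) = \<zero>\<^bsub>scochains C n\<^esub>"
proof
  fix \<sigma> :: "('i, ('i, 'g) amalgam_mor) simplex"
  obtain l as where s: "\<sigma> = (l, as)" by (cases \<sigma>)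
  show "retr n (incl i n y) \<sigma> = \<zero>\<^bsub>scochains C n\<^esub> \<sigma>"
  proof (cases "\<sigma> \<in> nerve C n")
    case True
    then have p: "is_path C l as" "length as = n" by (auto simp: s nerve_iff)
    have as: "set as \<subseteq> Arr C" using is_path_props[OF p(1)] by auto
    let ?R = "reduced (G i) (\<lambda>gs. y (map basis gs))"
    have "aug (Mor C l (path_end C l as)) (ext_loops i ?R as) = 0"
    proof (cases "set as \<subseteq> range (Loop i)")
      case loops: True
      have gs: "set (map label as) \<subseteq> carrier (G i)" "length (map label as) = n"
        using label_Arr[OF as loops] p(2) by auto
      have "Poly_Mapping.keys (?R (map label as)) \<subseteq> carrier (G i)"
        using reduced_bcochain[OF group[OF i] group_value_keys[OF y]] gs unfolding bcochain_def by blast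
      then show ?thesis
        using loops by (simp add: ext_loops_def aug_emb[OF i] aug_reduced[OF group[OF i] gs(1)])
    qed (simp add: ext_loops_def)
    then show ?thesis using True p by (simp add: s retr_path incl_basis[OF as p(2)] scochains_simps)
  qed (simp add: retr_def scochains_simps)
qed

lemma restr_Psi:
  fixes \<gamma> :: "('i, ('i, 'g) amalgam_mor) simplex \<Rightarrow> 'k"
  assumes i: "i \<in> P"
  shows "restr i n (Psi C n \<gamma>) \<in> carrier (group_ap_cochains (G i) n)"
proof -
  have "restr i n (Psi C n \<gamma>) (map basis gs) =
      Poly_Mapping.single (foldr (\<otimes>\<^bsub>G i\<^esub>) gs \<one>\<^bsub>G i\<^esub>) (\<gamma> (i, map (Loop i) gs))"
    if gs: "set gs \<subseteq> carrier (G i)" "length gs = n" for gs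
  proof -
    have "set (map (Loop i) gs) \<subseteq> Arr C" "length (map (Loop i) gs) = n" using gs i by auto
    then show ?thesis unfolding restr_basis[OF gs] by (simp only: Psi_basis loop_part_bPsi[OF i gs(1)])
  qed
  then show ?thesis unfolding group_ap_carrier using restr_closed[OF i Psi_closed[of n \<gamma>]] by blast
qed

lemma restr_incl:
  fixes y :: "('g \<Rightarrow>\<^sub>0 'k) list \<Rightarrow> 'g \<Rightarrow>\<^sub>0 'k"
  assumes j: "j \<in> P" and gs: "set gs \<subseteq> carrier (G j)" "length gs = n"
  shows "restr j n (incl i n y) (map basis gs) = (if i = j then reduced (G i) (\<lambda>gs. y (map basis gs)) gs else 0)"
proof -
  have "set (map (Loop j) gs) \<subseteq> Arr C" "length (map (Loop j) gs) = n" using gs j by auto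
  then show ?thesis unfolding restr_basis[OF gs] by (simp only: incl_basis loop_part_ext_loops)
qed

lemma restr_incl_same:
  fixes y :: "('g \<Rightarrow>\<^sub>0 'k) list \<Rightarrow> 'g \<Rightarrow>\<^sub>0 'k"
  assumes i: "i \<in> P" and y: "y \<in> carrier (hoch (group_algebra (G i)) n)"
  shows "y \<ominus>\<^bsub>hoch (group_algebra (G i)) n\<^esub> restr i n (incl i n y) \<in> carrier (group_ap_cochains (G i) n)"
proof -
  interpret opgroup "hoch (group_algebra (G i) :: ('k, _) module) n" unfolding group_algebra_eq by (rule opgroup_hoch)
  note c = restr_closed[OF i incl_closed[OF i y]]
  have S: "set gs \<subseteq> Arr (group_cat (G i)) \<longleftrightarrow> set gs \<subseteq> carrier (G i)" for gs by simp
  have "(y \<ominus>\<^bsub>hoch (group_algebra (G i)) n\<^esub> restr i n (incl i n y)) (map basis gs) =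
      Poly_Mapping.single (foldr (\<otimes>\<^bsub>G i\<^esub>) gs \<one>\<^bsub>G i\<^esub>) (aug (carrier (G i)) (y (map basis gs)))"
    if gs: "set gs \<subseteq> carrier (G i)" "length gs = n" for gs
    using hoch_minus_basis[OF y[unfolded group_algebra_eq] c[unfolded group_algebra_eq] gs[folded S]]
    unfolding group_algebra_eq restr_incl[OF i gs] by (simp add: reduced_def)
  then show ?thesis unfolding group_ap_carrier using y c by blast
qed

lemma restr_incl_distinct:
  fixes y :: "('g \<Rightarrow>\<^sub>0 'k) list \<Rightarrow> 'g \<Rightarrow>\<^sub>0 'k"
  assumes i: "i \<in> P" and j: "j \<in> P" and ij: "i \<noteq> j" and y: "y \<in> carrier (hoch (group_algebra (G i)) n)"
  shows "restr j n (incl i n y) = \<zero>\<^bsub>hoch (group_algebra (G j)) n\<^esub>"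
proof -
  interpret opgroup "hoch (group_algebra (G j) :: ('k, _) module) n" unfolding group_algebra_eq by (rule opgroup_hoch)
  show ?thesis
    unfolding group_algebra_eq
  proof (rule hoch_eqI)
    show "restr j n (incl i n y) \<in> carrier (hoch (free_algebra (Arr (group_cat (G j))) (cat_prod (group_cat (G j))) (cat_unit (group_cat (G j)))) n)"
      using restr_closed[OF j incl_closed[OF i y]] unfolding group_algebra_eq .
    show "\<zero>\<^bsub>hoch (free_algebra (Arr (group_cat (G j))) (cat_prod (group_cat (G j))) (cat_unit (group_cat (G j)))) n\<^esub> \<in>
        carrier (hoch (free_algebra (Arr (group_cat (G j))) (cat_prod (group_cat (G j))) (cat_unit (group_cat (G j))) :: ('k, _) module) n)"
      using zero_closed unfolding group_algebra_eq .
    fix gs assume gs: "set gs \<subseteq> Arr (group_cat (G j))" "length gs = n"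
    then show "restr j n (incl i n y) (map basis gs) =
        \<zero>\<^bsub>hoch (free_algebra (Arr (group_cat (G j))) (cat_prod (group_cat (G j))) (cat_unit (group_cat (G j)))) n\<^esub> (map basis gs)"
      by (subst hoch_basis(3)[OF gs], subst restr_incl[OF j]) (use ij in auto)
  qed
qed

lemma incl_group_ap:
  fixes y :: "('g \<Rightarrow>\<^sub>0 'k) list \<Rightarrow> 'g \<Rightarrow>\<^sub>0 'k"
  assumes i: "i \<in> P" and y: "y \<in> carrier (group_ap_cochains (G i) n)"
  shows "incl i n y = \<zero>\<^bsub>hoch A n\<^esub>"
proof -
  interpret H: opgroup "hoch A n" by (rule opgroup_hoch)
  have yc: "y \<in> carrier (hoch (group_algebra (G i)) n)"
    and ys: "\<And>gs. set gs \<subseteq> carrier (G i) \<Longrightarrow> length gs = n \<Longrightarrow>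
      \<exists>c. y (map basis gs) = Poly_Mapping.single (foldr (\<otimes>\<^bsub>G i\<^esub>) gs \<one>\<^bsub>G i\<^esub>) c"
    using y unfolding group_ap_carrier by auto
  show ?thesis
  proof (rule hoch_eqI[OF incl_closed[OF i yc] H.zero_closed])
    fix as assume as: "set as \<subseteq> Arr C" "length as = n"
    have "reduced (G i) (\<lambda>gs. y (map basis gs)) (map label as) = 0" if "set as \<subseteq> range (Loop i)"
    proof -
      have gs: "set (map label as) \<subseteq> carrier (G i)" "length (map label as) = n"
        using label_Arr[OF as(1) that] as(2) by auto
      show ?thesis
        using ys[OF gs] foldr_closed[OF group[OF i] gs(1)] by (auto simp: reduced_def)
    qed
    then show "incl i n y (map basis as) = \<zero>\<^bsub>hoch A n\<^esub> (map basis as)"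
      by (simp add: incl_basis[OF as] hoch_basis(3)[OF as] ext_loops_def emb_simps)
  qed
qed

lemma HH_mod_HB_eq:
  "HH_mod_HB (G i) n = quot_module (HH (group_algebra (G i) :: ('k, _) module) n)
     (coh_map (hoch (group_algebra (G i))) (hoch_d (group_algebra (G i))) n (\<lambda>f. f) `
       carrier (cohomology (\<lambda>n. hoch (group_algebra (G i)) n\<lparr>carrier := carrier (group_ap_cochains (G i) n)\<rparr>)
         (hoch_d (group_algebra (G i))) n))"
proof -
  have "(\<lambda>n. hoch (group_algebra (G i) :: ('k, _) module) n\<lparr>carrier := carrier (group_ap_cochains (G i) n)\<rparr>) =
      group_ap_cochains (G i)"
    by (simp add: group_ap_cochains_def fun_eq_iff)
  then show ?thesis by (simp add: HH_mod_HB_def Let_def)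
qed

theorem HH_splitting:
  "\<exists>\<Phi> \<in> module_iso (prod_module (HB C n) (direct_sum P (\<lambda>i. HH_mod_HB (G i) n))) (HH A n).
    \<forall>x\<in>carrier (HB C n). \<Phi> (x, \<zero>\<^bsub>direct_sum P (\<lambda>i. HH_mod_HB (G i) n)\<^esub>) =
      coh_map (hoch A) (hoch_d A) n (Psi C n) x"
  unfolding HH_mod_HB_eq
proof (rule cohomology_splitting[where p = retr and t = incl and q = restr])
  show "finite P" by (rule finite_P)
  show "cochain_map (scochains C) (scochain_d C) (hoch A) (hoch_d A) (Psi C)" by (rule cochain_map_Psi)
  show "cochain_map (hoch A) (hoch_d A) (scochains C) (scochain_d C) retr" by (rule cochain_map_retr)
  show "cochain_map (hoch (group_algebra (G i))) (hoch_d (group_algebra (G i))) (hoch A) (hoch_d A) (incl i)"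
    if "i \<in> P" for i using cochain_map_incl[OF that, where ?'k = 'k] by (simp only: cat_algebra_A)
  show "cochain_map (hoch A) (hoch_d A) (hoch (group_algebra (G i))) (hoch_d (group_algebra (G i))) (restr i)"
    if "i \<in> P" for i using cochain_map_restr[OF that, where ?'k = 'k] by (simp only: cat_algebra_A)
qed (rule opsub_group_ap retr_Psi retr_incl restr_Psi restr_incl_same restr_incl_distinct incl_group_ap sum_of_parts;
    assumption)+

end

section \<open>The subalgebra of autopoietic classes\<close>

context cat_over
begin

text \<open>The map that \<open>\<Psi>\<close> induces in cohomology.\<close>

abbreviation Psi_coh where "Psi_coh n \<equiv> coh_map (hoch A) (hoch_d A) n (Psi C n)"

lemma Psi_coh_class:
  "\<gamma> \<in> carrier (scochains C n) \<Longrightarrow>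
    Psi_coh n (coh_class (scochains C) (scochain_d C) n \<gamma>) = coh_class (hoch A) (hoch_d A) n (Psi C n \<gamma>)"
  by (rule cochain_map.coh_map_cl[OF cochain_map_Psi])

lemma HB_cases:
  assumes "x \<in> carrier (HB C n :: ('k, _) module)"
  obtains \<gamma> :: "('o, 'm) simplex \<Rightarrow> 'k"
  where "x = coh_class (scochains C) (scochain_d C) n \<gamma>" "\<gamma> \<in> cocycles (scochains C) (scochain_d C) n"
  using assms unfolding cochain_complex.H_carrier[OF cochain_complex_scochains] by blast

lemma Psi_coh_inj: "inj_on (Psi_coh n) (carrier (HB C n))"
proof (rule inj_on_inverseI)
  interpret S: cochain_complex "scochains C :: nat \<Rightarrow> ('k, _) module" "scochain_d C" by (rule cochain_complex_scochains)
  fix x :: "(('o, 'm) simplex \<Rightarrow> 'k) set" assume "x \<in> carrier (HB C n)"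
  then obtain \<gamma> where x: "x = S.cl n \<gamma>" "\<gamma> \<in> cocycles (scochains C) (scochain_d C) n" by (rule HB_cases)
  then have \<gamma>: "\<gamma> \<in> carrier (scochains C n)" using S.cocyclesD by blast
  show "coh_map (scochains C) (scochain_d C) n (retr n) (Psi_coh n x) = x"
    unfolding x(1) Psi_coh_class[OF \<gamma>] cochain_map.coh_map_cl[OF cochain_map_retr Psi_closed] retr_Psi[OF \<gamma>] ..
qed

lemma Psi_coh_hom: "Psi_coh n \<in> module_hom (HB C n) (HH A n)"
  by (rule cochain_map.coh_map_hom[OF cochain_map_Psi])

lemma Psi_coh_prod:
  assumes x: "x \<in> carrier (HB C p :: ('k, _) module)" and y: "y \<in> carrier (HB C q :: ('k, _) module)"
  shows "Psi_coh (p + q) (coh_prod (scochains C) (scochain_d C) (p + q) (cup C 0 p q) x y) =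
    coh_prod (hoch A) (hoch_d A) (p + q) (gerst A p q) (Psi_coh p x) (Psi_coh q y)"
proof -
  let ?S = "scochains C :: nat \<Rightarrow> ('k, _) module"
  interpret S: cochain_complex ?S "scochain_d C" by (rule cochain_complex_scochains)
  interpret X: cochain_complex "hoch A" "hoch_d A" by (rule cochain_complex_hoch)
  obtain \<gamma> where \<gamma>: "x = S.cl p \<gamma>" "\<gamma> \<in> cocycles ?S (scochain_d C) p" using x by (rule HB_cases)
  obtain \<delta> where \<delta>: "y = S.cl q \<delta>" "\<delta> \<in> cocycles ?S (scochain_d C) q" using y by (rule HB_cases)
  note c = S.cocyclesD[OF \<gamma>(2)] S.cocyclesD[OF \<delta>(2)]
  note z = cochain_map.cocycle[OF cochain_map_Psi]
  have "coh_prod ?S (scochain_d C) (p + q) (cup C 0 p q) x y = S.cl (p + q) (cup C 0 p q \<gamma> \<delta>)"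
    unfolding \<gamma>(1) \<delta>(1)
  proof (rule S.coh_prod_cl[where sg = "\<lambda>p. (- 1) ^ p"])
    fix p q n and a b :: "('o, 'm) simplex \<Rightarrow> 'k"
    show "cup C 0 p q a \<in> module_hom (?S q) (?S (p + q))" using cup_hom(1)[of 0 p q a] by simp
    show "(\<lambda>a. cup C 0 p q a b) \<in> module_hom (?S p) (?S (p + q))" using cup_hom(2)[of 0 p q b] by simp
    show "scochain_d C (p + q) (cup C 0 p q a b) = cup C 0 (Suc p) q (scochain_d C p a) b
        \<oplus>\<^bsub>?S (Suc (p + q))\<^esub> ((- 1) ^ p \<odot>\<^bsub>?S (Suc (p + q))\<^esub> cup C 0 p (Suc q) a (scochain_d C q b))"
    proof -
      have "cup C 0 (Suc p) q (scochain_d C p a) b \<in> carrier (?S (Suc (p + q)))"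
        using cup_extensional[of 0 "Suc p" q] by simp
      from S.deg.l_zero[OF this] scochain_d_cup'[of 0 p q a b] show ?thesis by (simp del: scochains_simps)
    qed
    show "(- 1) ^ p \<odot>\<^bsub>?S n\<^esub> ((- 1) ^ p \<odot>\<^bsub>?S n\<^esub> a) = a" if "a \<in> carrier (?S n)"
      using that by (auto simp: fun_eq_iff neg_one_mult_self extensional_def simp flip: mult.assoc)
  qed (fact \<gamma>(2) \<delta>(2))+
  then have "Psi_coh (p + q) (coh_prod ?S (scochain_d C) (p + q) (cup C 0 p q) x y) =
      X.cl (p + q) (gerst A p q (Psi C p \<gamma>) (Psi C q \<delta>))"
    using Psi_coh_class[of "cup C 0 p q \<gamma> \<delta>" "p + q"] cup_extensional[of 0 p q \<gamma> \<delta>] by (simp add: Psi_cup_0)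
  also have "\<dots> = coh_prod (hoch A) (hoch_d A) (p + q) (gerst A p q) (X.cl p (Psi C p \<gamma>)) (X.cl q (Psi C q \<delta>))"
  proof (rule X.coh_prod_cl[where sg = "\<lambda>p. (- 1) ^ p", symmetric])
    fix p q n and f :: "('m \<Rightarrow>\<^sub>0 'k) list \<Rightarrow> 'm \<Rightarrow>\<^sub>0 'k" assume f: "f \<in> carrier (hoch A n)"
    interpret n: opgroup "hoch A n" by (rule opgroup_hoch)
    show "(- 1) ^ p \<odot>\<^bsub>hoch A n\<^esub> ((- 1) ^ p \<odot>\<^bsub>hoch A n\<^esub> f) = f"
      by (rule hoch_eqI[of _ "Arr C" "cat_prod C" u n])
        (use f in \<open>auto simp: hoch_basis neg_one_mult_self\<close>)
  qed (fact gerst_bilinear hoch_d_gerst z[OF \<gamma>(2)] z[OF \<delta>(2)] | (rule gerst_bilinear hoch_d_gerst; assumption))+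
  finally show ?thesis by (simp only: \<gamma>(1) \<delta>(1) Psi_coh_class[OF c(1)] Psi_coh_class[OF c(2)])
qed

lemma Psi_coh_one:
  "Psi_coh 0 (coh_class (scochains C) (scochain_d C) 0 (\<lambda>\<sigma>\<in>nerve C 0. 1)) =
    coh_class (hoch A) (hoch_d A) 0 (\<lambda>xs\<in>tuples A 0. u)"
  by (subst Psi_coh_class) (simp_all add: Psi_one)

lemma Psi_coh_image:
  "Psi_coh n ` carrier (HB C n :: ('k, _) module) =
    coh_map (hoch A) (hoch_d A) n (\<lambda>f. f) ` carrier (cohomology (ap_cochains C) (hoch_d A) n)"
proof -
  interpret S: cochain_complex "scochains C :: nat \<Rightarrow> ('k, _) module" "scochain_d C" by (rule cochain_complex_scochains)
  interpret X: cochain_complex "hoch A" "hoch_d A" by (rule cochain_complex_hoch)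
  have "coh_map (hoch A) (hoch_d A) n (\<lambda>f. f) ` carrier (cohomology (ap_cochains C) (hoch_d A) n) =
      X.cl n ` (autopoietic C n \<inter> cocycles (hoch A) (hoch_d A) n)"
    using X.sub_cohomology_image[of "autopoietic C" n, OF opsub_autopoietic] unfolding ap_cochains_A[symmetric] .
  also have "autopoietic C n \<inter> cocycles (hoch A) (hoch_d A) n = Psi C n ` cocycles (scochains C) (scochain_d C) n"
  proof
    show "autopoietic C n \<inter> cocycles (hoch A) (hoch_d A) n \<subseteq> Psi C n ` cocycles (scochains C) (scochain_d C) n"
      using autopoietic_eq_Psi cochain_map.cocycle[OF cochain_map_retr] by blast
    show "Psi C n ` cocycles (scochains C) (scochain_d C) n \<subseteq> autopoietic C n \<inter> cocycles (hoch A) (hoch_d A) n"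
      using Psi_autopoietic cochain_map.cocycle[OF cochain_map_Psi] by blast
  qed
  also have "X.cl n ` Psi C n ` cocycles (scochains C) (scochain_d C) n = Psi_coh n ` carrier (HB C n :: ('k, _) module)"
    unfolding S.H_carrier image_image
    by (rule image_cong[OF refl]) (rule Psi_coh_class[symmetric, OF S.cocyclesD])
  finally show ?thesis ..
qed

end

theorem theorem4p3:
  fixes P :: "'i set" and r :: "('i \<times> 'i) set" and G :: "'i \<Rightarrow> 'g monoid"
    and C :: "('i, ('i, 'g) amalgam_mor) cat"
    and A :: "('k::{comm_ring,comm_monoid_mult}, ('i, 'g) amalgam_mor \<Rightarrow>\<^sub>0 'k) module"
    and h :: "nat \<Rightarrow> (('i, ('i, 'g) amalgam_mor) simplex \<Rightarrow> 'k) set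
                  \<Rightarrow> ((('i, 'g) amalgam_mor \<Rightarrow>\<^sub>0 'k) list \<Rightarrow> ('i, 'g) amalgam_mor \<Rightarrow>\<^sub>0 'k) set"
  assumes "finite P" and "partial_order_on P r" and "\<And>i. i \<in> P \<Longrightarrow> group (G i)"
  defines "C \<equiv> amalgam P r G"
    and "A \<equiv> cat_algebra C"
    and "h \<equiv> (\<lambda>n. coh_map (hoch A) (hoch_d A) n (Psi C n))"
  shows
    \<comment> \<open>the decomposition of \<open>HH\<^sup>*\<close>, in which the summand \<open>H\<^sup>*(BC)\<close> is embedded by \<open>h\<close>\<close>
    "(\<forall>n. \<exists>\<Phi> \<in> module_iso (prod_module (HB C n) (direct_sum P (\<lambda>i. HH_mod_HB (G i) n))) (HH A n).
        \<forall>x\<in>carrier (HB C n). \<Phi> (x, \<zero>\<^bsub>direct_sum P (\<lambda>i. HH_mod_HB (G i) n)\<^esub>) = h n x)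
    \<comment> \<open>\<open>h\<close> makes \<open>H\<^sup>*(BC)\<close> with the cup product a subalgebra\<close>
    \<and> (\<forall>n. h n \<in> module_hom (HB C n) (HH A n) \<and> inj_on (h n) (carrier (HB C n)))
    \<and> (\<forall>p q. \<forall>x\<in>carrier (HB C p). \<forall>y\<in>carrier (HB C q).
        h (p + q) (coh_prod (scochains C) (scochain_d C) (p + q) (cup C 0 p q) x y)
          = coh_prod (hoch A) (hoch_d A) (p + q) (gerst A p q) (h p x) (h q y))
    \<and> h 0 (coh_class (scochains C) (scochain_d C) 0 (\<lambda>\<sigma>\<in>nerve C 0. 1))
          = coh_class (hoch A) (hoch_d A) 0 (\<lambda>xs\<in>tuples A 0. \<one>\<^bsub>A\<^esub>)
    \<comment> \<open>its classes are those of the autopoietic cocycles\<close>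
    \<and> (\<forall>n. h n ` carrier (HB C n)
          = coh_map (hoch A) (hoch_d A) n (\<lambda>f. f) ` carrier (cohomology (ap_cochains C) (hoch_d A) n))
    \<comment> \<open>the autopoietic cochains are isomorphic to the simplicial ones, and with the transported cup-\<open>i\<close>
        products they form a subalgebra of the Hochschild cochains\<close>
    \<and> (\<forall>n. Psi C n \<in> module_iso (scochains C n) (ap_cochains C n :: ('k, _) module))
    \<and> (\<forall>n. \<forall>\<gamma>\<in>carrier (scochains C n). Psi C (Suc n) (scochain_d C n \<gamma>) = hoch_d A n (Psi C n \<gamma>))
    \<and> cup_i_algebra (ap_cochains C) (hoch_d A) (ap_cup C) (\<lambda>xs\<in>tuples A 0. \<one>\<^bsub>A\<^esub>)
    \<and> (\<forall>p q. \<forall>f\<in>autopoietic C p. \<forall>g\<in>autopoietic C q. ap_cup C 0 p q f g = gerst A p q f g)"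
proof -
  interpret L: group_amalgam P r G by (rule group_amalgam.intro) (fact assms)+
  let ?u = "cat_unit C :: ('i, 'g) amalgam_mor \<Rightarrow>\<^sub>0 'k"
  have "amalgam_algebra P r G ?u"
    unfolding amalgam_algebra_def C_def using L.group_amalgam_axioms L.cat_over_C by blast
  then interpret amalgam_algebra P r G ?u .
  have A: "A = free_algebra (Arr C) (cat_prod C) ?u" unfolding A_def C_def by (rule cat_algebra_A[unfolded C_def])
  have one: "\<one>\<^bsub>A\<^esub> = ?u" by (simp add: A free_algebra_simps)
  show ?thesis
    unfolding h_def one unfolding A C_def
    using HH_splitting Psi_coh_hom Psi_coh_inj Psi_coh_prod Psi_coh_one Psi_coh_image Psi_iso Psi_d
      cup_i_algebra_autopoietic ap_cup_gerst
    unfolding C_def by (intro conjI allI ballI)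
qed

end
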